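(* Let $\mathfrak k\subset S^3$ be a hyperbolic $2$-bridge knot with knot exterior $M$. Then $\pi_1(M)$ has infinitely many Nielsen classes of generating pairs.
   Context: Nielsen equivalence: for a group $G$, two $k$-tuples $(g_1,\ldots,g_k)$ and $(h_1,\ldots,h_k)$ of elements of $G$ are elementarily equivalent if one of the following holds: (1) $h_i=g_{\sigma(i)}$ for all $i$ and some permutation $\sigma\in S_k$; (2) $h_i=g_i^{-1}$ for some $i$ and $h_j=g_j$ for all $j\ne i$; (3) $h_i=g_ig_j^{\varepsilon}$ for some $i\ne j$ and $\varepsilon\in\{-1,1\}$, and $h_l=g_l$ for all $l\neq i$. Two tuples are Nielsen equivalent if one can be transformed into the other by a finite sequence of elementary equivalences. A generating pair of $G$ is a pair $(x,y)$ of elements with $G=\langle x,y\rangle$; a Nielsen class of generating pairs is a Nielsen equivalence class of generating pairs. A knot in $S^3$ is hyperbolic if its complement admits a complete hyperbolic structure of finite volume. *)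

theory Defs
  imports "HOL-Analysis.Analysis" "HOL-Algebra.Generated_Groups" "HOL-Combinatorics.Permutations"
begin

section \<open>Nielsen equivalence\<close>

definition tuples :: "('a, 'b) monoid_scheme \<Rightarrow> nat \<Rightarrow> 'a list set" where
  "tuples G k = {g. length g = k \<and> set g \<subseteq> carrier G}"

inductive elementarily_equivalent :: "('a, 'b) monoid_scheme \<Rightarrow> 'a list \<Rightarrow> 'a list \<Rightarrow> bool"
  for G (structure) where
  perm: "\<sigma> permutes {..<length g} \<Longrightarrow> elementarily_equivalent G g (permute_list \<sigma> g)"
| inverse: "i < length g \<Longrightarrow> elementarily_equivalent G g (g[i := inv (g ! i)])"
| mult: "i < length g \<Longrightarrow> j < length g \<Longrightarrow> i \<noteq> j \<Longrightarrow>
    elementarily_equivalent G g (g[i := g ! i \<otimes> g ! j])"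
| mult_inverse: "i < length g \<Longrightarrow> j < length g \<Longrightarrow> i \<noteq> j \<Longrightarrow>
    elementarily_equivalent G g (g[i := g ! i \<otimes> inv (g ! j)])"

definition nielsen_equivalent :: "('a, 'b) monoid_scheme \<Rightarrow> 'a list \<Rightarrow> 'a list \<Rightarrow> bool" where
  "nielsen_equivalent G = (elementarily_equivalent G)\<^sup>*\<^sup>*"

definition generating_tuples :: "('a, 'b) monoid_scheme \<Rightarrow> nat \<Rightarrow> 'a list set" where
  "generating_tuples G k = {g \<in> tuples G k. generate G (set g) = carrier G}"

abbreviation generating_pairs :: "('a, 'b) monoid_scheme \<Rightarrow> 'a list set" where
  "generating_pairs G \<equiv> generating_tuples G 2"

definition nielsen_classes_of_generating_pairs :: "('a, 'b) monoid_scheme \<Rightarrow> 'a list set set" where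
  "nielsen_classes_of_generating_pairs G =
    generating_pairs G // {(g, h). g \<in> tuples G 2 \<and> h \<in> tuples G 2 \<and> nielsen_equivalent G g h}"


section \<open>The fundamental group\<close>

definition loops :: "'a::topological_space set \<Rightarrow> 'a \<Rightarrow> (real \<Rightarrow> 'a) set" where
  "loops X x = {p. path p \<and> path_image p \<subseteq> X \<and> pathstart p = x \<and> pathfinish p = x}"

text \<open>Homotopy is relative to the end points; paths are functions on all of the reals, of which
  only the restriction to the unit interval matters for \<^const>\<open>homotopic_paths\<close>.\<close>

definition loop_homotopy :: "'a::topological_space set \<Rightarrow> 'a \<Rightarrow> ((real \<Rightarrow> 'a) \<times> (real \<Rightarrow> 'a)) set" where
  "loop_homotopy X x = {(p, q). p \<in> loops X x \<and> q \<in> loops X x \<and> homotopic_paths X p q}"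

definition fundamental_group ::
    "'a::topological_space set \<Rightarrow> 'a \<Rightarrow> (real \<Rightarrow> 'a) set monoid" where
  "fundamental_group X x =
    \<lparr>carrier = loops X x // loop_homotopy X x,
     mult = (\<lambda>A B. \<Union>p\<in>A. \<Union>q\<in>B. loop_homotopy X x `` {p +++ q}),
     one = loop_homotopy X x `` {\<lambda>_. x}\<rparr>"


section \<open>Hyperbolic structures on 3-manifolds\<close>

text \<open>The upper half-space model of hyperbolic 3-space, of constant curvature \<open>-1\<close>.\<close>

definition H3 :: "(complex \<times> real) set" where
  "H3 = {p. snd p > 0}"

definition H3_dist :: "complex \<times> real \<Rightarrow> complex \<times> real \<Rightarrow> real" where
  "H3_dist p q = arcosh (1 + (dist p q)\<^sup>2 / (2 * snd p * snd q))"

text \<open>The volume form is Lebesgue measure divided by the cube of the height.\<close>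

definition H3_volume :: "(complex \<times> real) measure" where
  "H3_volume = density lborel (\<lambda>p. ennreal (indicator H3 p / snd p ^ 3))"

definition curve_length :: "('a \<Rightarrow> 'a \<Rightarrow> real) \<Rightarrow> (real \<Rightarrow> 'a) \<Rightarrow> ennreal" where
  "curve_length d p =
    (SUP ts \<in> {ts. sorted ts \<and> set ts \<subseteq> {0..1}}.
      \<Sum>i<length ts - 1. ennreal (d (p (ts ! i)) (p (ts ! Suc i))))"

definition hyperbolic_chart ::
    "'a::topological_space set \<Rightarrow> ('a \<Rightarrow> 'a \<Rightarrow> real) \<Rightarrow> 'a set \<Rightarrow> ('a \<Rightarrow> complex \<times> real) \<Rightarrow> bool" where
  "hyperbolic_chart X d U \<phi> \<longleftrightarrow>
    openin (top_of_set X) U \<and> \<phi> ` U \<subseteq> H3 \<and> open (\<phi> ` U) \<and>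
    (\<forall>a\<in>U. \<forall>b\<in>U. H3_dist (\<phi> a) (\<phi> b) = d a b)"

text \<open>A hyperbolic structure is recorded by its Riemannian distance function: a metric inducing
  the given topology, locally isometric to hyperbolic space, in which the distance of two points
  is the infimum of the lengths of the curves joining them.\<close>

definition hyperbolic_structure :: "'a::topological_space set \<Rightarrow> ('a \<Rightarrow> 'a \<Rightarrow> real) \<Rightarrow> bool" where
  "hyperbolic_structure X d \<longleftrightarrow>
    Metric_space X d \<and>
    Metric_space.mtopology X d = top_of_set X \<and>
    (\<forall>x\<in>X. \<exists>U \<phi>. x \<in> U \<and> hyperbolic_chart X d U \<phi>) \<and>
    (\<forall>a\<in>X. \<forall>b\<in>X. ennreal (d a b) =
      (INF p \<in> {p. path p \<and> path_image p \<subseteq> X \<and> pathstart p = a \<and> pathfinish p = b}.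
        curve_length d p))"

text \<open>The Riemannian volume is the Borel measure that agrees with hyperbolic volume in every chart.
  If \<open>X\<close> is second countable, such a measure is unique.\<close>

definition hyperbolic_volume_measure ::
    "'a::topological_space set \<Rightarrow> ('a \<Rightarrow> 'a \<Rightarrow> real) \<Rightarrow> 'a measure \<Rightarrow> bool" where
  "hyperbolic_volume_measure X d \<mu> \<longleftrightarrow>
    sets \<mu> = sets (restrict_space borel X) \<and>
    (\<forall>U \<phi> B. hyperbolic_chart X d U \<phi> \<longrightarrow> B \<in> sets \<mu> \<longrightarrow> B \<subseteq> U \<longrightarrow>
      emeasure \<mu> B = emeasure H3_volume (\<phi> ` B))"

definition has_complete_finite_volume_hyperbolic_structure :: "'a::topological_space set \<Rightarrow> bool" where
  "has_complete_finite_volume_hyperbolic_structure X \<longleftrightarrow>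
    (\<exists>d. hyperbolic_structure X d \<and> Metric_space.mcomplete X d \<and>
      (\<exists>\<mu>. hyperbolic_volume_measure X d \<mu> \<and> emeasure \<mu> X < \<infinity>))"


section \<open>Knots in the 3-sphere\<close>

abbreviation S3 :: "(real ^ 4) set" where
  "S3 \<equiv> sphere 0 1"

abbreviation unit_circle :: "complex set" where
  "unit_circle \<equiv> sphere 0 1"

text \<open>Knots are tame; tameness is expressed as local flatness: near each of its points the knot
  looks like a straight line in 3-space.\<close>

definition knot :: "(real ^ 4) set \<Rightarrow> bool" where
  "knot K \<longleftrightarrow>
    K \<subseteq> S3 \<and> K homeomorphic unit_circle \<and>
    (\<forall>x\<in>K. \<exists>U f g. x \<in> U \<and> openin (top_of_set S3) U \<and>
      homeomorphism U (UNIV :: (complex \<times> real) set) f g \<and> f ` (U \<inter> K) = {0} \<times> UNIV)"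

definition hyperbolic_knot :: "(real ^ 4) set \<Rightarrow> bool" where
  "hyperbolic_knot K \<longleftrightarrow> knot K \<and> has_complete_finite_volume_hyperbolic_structure (S3 - K)"

text \<open>The strands of a trivial tangle are straightened simultaneously by a homeomorphism of
  the ball with a cylinder.\<close>

definition trivial_tangle :: "nat \<Rightarrow> (real ^ 4) set \<Rightarrow> (real ^ 4) set \<Rightarrow> bool" where
  "trivial_tangle n B T \<longleftrightarrow>
    (\<exists>P f g. P \<subseteq> ball (0::complex) 1 \<and> finite P \<and> card P = n \<and>
      homeomorphism (cball 0 1 \<times> {0..1::real}) B f g \<and> f ` (P \<times> {0..1}) = T)"

definition has_bridge_presentation :: "nat \<Rightarrow> (real ^ 4) set \<Rightarrow> bool" where
  "has_bridge_presentation n K \<longleftrightarrow>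
    (\<exists>h h'. homeomorphism S3 S3 h h' \<and>
      trivial_tangle n (S3 \<inter> {x. x $ 1 \<ge> 0}) (h ` K \<inter> {x. x $ 1 \<ge> 0}) \<and>
      trivial_tangle n (S3 \<inter> {x. x $ 1 \<le> 0}) (h ` K \<inter> {x. x $ 1 \<le> 0}))"

text \<open>The bridge number is the minimal number of strands in such a presentation; in particular the
  unknot, which has bridge number 1, is not a 2-bridge knot.\<close>

definition bridge_knot :: "nat \<Rightarrow> (real ^ 4) set \<Rightarrow> bool" where
  "bridge_knot n K \<longleftrightarrow>
    knot K \<and> has_bridge_presentation n K \<and> (\<forall>m<n. \<not> has_bridge_presentation m K)"

text \<open>The exterior is the complement of an open tubular neighbourhood whose closure is contained
  in a larger one, so that its boundary is a collared torus.\<close>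

definition knot_exterior :: "(real ^ 4) set \<Rightarrow> (real ^ 4) set \<Rightarrow> bool" where
  "knot_exterior K M \<longleftrightarrow>
    (\<exists>N f g. N \<subseteq> S3 \<and> homeomorphism (unit_circle \<times> ball (0::complex) 2) N f g \<and>
      f ` (unit_circle \<times> {0}) = K \<and> M = S3 - f ` (unit_circle \<times> ball 0 1))"


section \<open>The constructions are well defined\<close>

lemma equiv_loop_homotopy: "equiv (loops X x) (loop_homotopy X x)"
  by (rule equivI)
    (auto simp: loop_homotopy_def loops_def refl_on_def sym_def trans_def
      intro: homotopic_paths_sym homotopic_paths_trans)

lemma fundamental_group_mult:
  assumes "p \<in> loops X x" "q \<in> loops X x"
  shows "mult (fundamental_group X x) (loop_homotopy X x `` {p}) (loop_homotopy X x `` {q}) =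
    loop_homotopy X x `` {p +++ q}"
proof -
  have "loop_homotopy X x `` {p' +++ q'} = loop_homotopy X x `` {p +++ q}"
    if "(p, p') \<in> loop_homotopy X x" "(q, q') \<in> loop_homotopy X x" for p' q'
  proof (rule equiv_class_eq [OF equiv_loop_homotopy])
    show "(p' +++ q', p +++ q) \<in> loop_homotopy X x"
      using that unfolding loop_homotopy_def loops_def
      by (auto simp: path_image_join homotopic_paths_sym_eq [of X "p' +++ q'"]
          intro!: homotopic_paths_join)
  qed
  moreover have "p \<in> loop_homotopy X x `` {p}" "q \<in> loop_homotopy X x `` {q}"
    using equiv_class_self [OF equiv_loop_homotopy] assms by blast+
  ultimately show ?thesis
    unfolding fundamental_group_def monoid.simps by (intro equalityI UN_least) blast+
qed

lemma group_fundamental_group: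
  fixes x :: "'a::real_normed_vector"
  assumes "x \<in> X"
  shows "group (fundamental_group X x)"
proof -
  let ?G = "fundamental_group X x" and ?c = "\<lambda>p. loop_homotopy X x `` {p}"
  have carr: "carrier ?G = ?c ` loops X x"
    by (auto simp: fundamental_group_def quotient_def)
  have one: "one ?G = ?c (linepath x x)"
    by (simp add: fundamental_group_def linepath_refl)
  have lx: "linepath x x \<in> loops X x"
    using assms by (auto simp: loops_def)
  have join: "p +++ q \<in> loops X x" if "p \<in> loops X x" "q \<in> loops X x" for p q
    using that by (simp add: loops_def path_image_join)
  have rev: "reversepath p \<in> loops X x" if "p \<in> loops X x" for p
    using that by (simp add: loops_def)
  have eq: "?c p = ?c q" if "p \<in> loops X x" "q \<in> loops X x" "homotopic_paths X p q" for p q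
    using that by (intro equiv_class_eq [OF equiv_loop_homotopy]) (simp add: loop_homotopy_def)
  show ?thesis
  proof (rule groupI)
    show "a \<otimes>\<^bsub>?G\<^esub> b \<in> carrier ?G" if "a \<in> carrier ?G" "b \<in> carrier ?G" for a b
      using that join by (auto simp: carr fundamental_group_mult)
    show "\<one>\<^bsub>?G\<^esub> \<in> carrier ?G"
      using lx by (simp add: carr one)
    show "a \<otimes>\<^bsub>?G\<^esub> b \<otimes>\<^bsub>?G\<^esub> c = a \<otimes>\<^bsub>?G\<^esub> (b \<otimes>\<^bsub>?G\<^esub> c)"
      if abc: "a \<in> carrier ?G" "b \<in> carrier ?G" "c \<in> carrier ?G" for a b c
    proof -
      obtain p q r where pqr: "p \<in> loops X x" "q \<in> loops X x" "r \<in> loops X x"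
        and [simp]: "a = ?c p" "b = ?c q" "c = ?c r"
        using abc by (auto simp: carr)
      have "homotopic_paths X (p +++ (q +++ r)) ((p +++ q) +++ r)"
        using pqr by (intro homotopic_paths_assoc) (auto simp: loops_def)
      then have "?c ((p +++ q) +++ r) = ?c (p +++ (q +++ r))"
        using pqr join by (metis eq)
      with pqr join show ?thesis
        by (simp add: fundamental_group_mult)
    qed
    show "\<one>\<^bsub>?G\<^esub> \<otimes>\<^bsub>?G\<^esub> a = a" if a: "a \<in> carrier ?G" for a
    proof -
      obtain p where p: "p \<in> loops X x" and [simp]: "a = ?c p"
        using a by (auto simp: carr)
      have "homotopic_paths X (linepath x x +++ p) p"
        using p by (intro homotopic_paths_lid') (auto simp: loops_def)
      then have "?c (linepath x x +++ p) = ?c p"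
        using p lx join by (metis eq)
      with p lx show ?thesis
        by (simp add: one fundamental_group_mult)
    qed
    show "\<exists>b\<in>carrier ?G. b \<otimes>\<^bsub>?G\<^esub> a = \<one>\<^bsub>?G\<^esub>" if a: "a \<in> carrier ?G" for a
    proof -
      obtain p where p: "p \<in> loops X x" and [simp]: "a = ?c p"
        using a by (auto simp: carr)
      have "homotopic_paths X (reversepath p +++ p) (linepath x x)"
        using p homotopic_paths_linv [of p X] by (auto simp: loops_def)
      then have "?c (reversepath p +++ p) = ?c (linepath x x)"
        using p rev [OF p] lx join by (metis eq)
      then have "?c (reversepath p) \<otimes>\<^bsub>?G\<^esub> a = \<one>\<^bsub>?G\<^esub>"
        using p rev [OF p] by (simp add: one fundamental_group_mult)
      with rev [OF p] show ?thesis
        by (auto simp: carr)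
    qed
  qed
qed


lemma (in group) elementarily_equivalent_sym:
  assumes "elementarily_equivalent G g h" "set g \<subseteq> carrier G"
  shows "elementarily_equivalent G h g \<and> set h \<subseteq> carrier G"
  using assms
proof cases
  case (perm \<sigma>)
  let ?\<tau> = "Hilbert_Choice.inv \<sigma>"
  have "permute_list ?\<tau> (permute_list \<sigma> g) = permute_list (\<sigma> \<circ> ?\<tau>) g"
    using perm by (simp add: permute_list_compose permutes_inv)
  also have "\<dots> = g"
    using perm permutes_inv_o(1) by (metis permute_list_id)
  finally show ?thesis
    using perm assms elementarily_equivalent.perm [of ?\<tau> h G]
    by (simp add: permutes_inv)
next
  case (inverse i)
  have gi: "g ! i \<in> carrier G"
    using inverse assms(2) nth_mem by blast
  have "h[i := inv (h ! i)] = g"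
    using inverse gi by simp
  moreover have "set h \<subseteq> carrier G"
    using inverse gi assms(2) set_update_subset_insert [of g i] by blast
  ultimately show ?thesis
    using inverse elementarily_equivalent.inverse [of i h G] by simp
next
  case (mult i j)
  have gi: "g ! i \<in> carrier G" "g ! j \<in> carrier G"
    using mult assms(2) nth_mem by blast+
  have "h[i := h ! i \<otimes> inv (h ! j)] = g"
    using mult gi by (simp add: m_assoc)
  moreover have "set h \<subseteq> carrier G"
    using mult gi assms(2) set_update_subset_insert [of g i] by blast
  ultimately show ?thesis
    using mult elementarily_equivalent.mult_inverse [of i h j G] by simp
next
  case (mult_inverse i j)
  have gi: "g ! i \<in> carrier G" "g ! j \<in> carrier G"
    using mult_inverse assms(2) nth_mem by blast+
  have "h[i := h ! i \<otimes> h ! j] = g"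
    using mult_inverse gi by (simp add: m_assoc)
  moreover have "set h \<subseteq> carrier G"
    using mult_inverse gi assms(2) set_update_subset_insert [of g i] by blast
  ultimately show ?thesis
    using mult_inverse elementarily_equivalent.mult [of i h j G] by simp
qed

lemma (in group) equiv_nielsen_equivalent:
  "equiv (tuples G k) {(g, h). g \<in> tuples G k \<and> h \<in> tuples G k \<and> nielsen_equivalent G g h}"
proof -
  have sym: "nielsen_equivalent G h g \<and> set h \<subseteq> carrier G"
    if "nielsen_equivalent G g h" "set g \<subseteq> carrier G" for g h
    using that unfolding nielsen_equivalent_def
  proof (induction rule: rtranclp_induct)
    case (step h h')
    then have "elementarily_equivalent G h' h" "set h' \<subseteq> carrier G"
      using elementarily_equivalent_sym by blast+
    with step show ?case
      by (meson converse_rtranclp_into_rtranclp)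
  qed auto
  show ?thesis
  proof (rule equivI)
    show "sym {(g, h). g \<in> tuples G k \<and> h \<in> tuples G k \<and> nielsen_equivalent G g h}"
      using sym unfolding tuples_def by (intro symI) blast
    show "trans {(g, h). g \<in> tuples G k \<and> h \<in> tuples G k \<and> nielsen_equivalent G g h}"
      by (intro transI) (auto simp: nielsen_equivalent_def elim: rtranclp_trans)
  qed (auto simp: refl_on_def nielsen_equivalent_def)
qed

end

(*
  Write X for the complete hyperbolic manifold S3 - K. Its developing map identifies the universal
  covering with H3, so pi1(M) is a discrete group of isometries. Finite volume forces the meridian m
  and the longitude l to be parabolic: after conjugation they are the translations by 1 and by some
  tau with Im tau \<noteq> 0. A 2-bridge presentation shows that the group is generated by two meridians
  m and w m w^-1. Since l commutes with m, the element w l^n conjugates m to the same second meridian,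
  so (m, w l^n) is a generating pair for every n. In SL2(C) the trace triple of this pair is
  (2, y_n, y_n + c) with y_n = y_0 + n tau c and c \<noteq> 0. Nielsen moves act on trace triples by sign
  changes and Markov moves (a, b, d) -> (a, b, ab - d); if all entries on the base line (2, y + kc,
  y + (k+1)c) are large, every move leaving that line strictly increases the largest entry, so a Nielsen
  class determines y_n up to sign and up to integral multiples of c. As Im tau \<noteq> 0, this makes the pairs
  for infinitely many n pairwise inequivalent.
*)

theory Submission
  imports Defs
begin

section \<open>Isometries of hyperbolic space\<close>

text \<open>Charts carry no orientation, so at first the deck group may contain reversing
  isometries; that it contains none comes out only at the end, because two conjugates of a
  translation generate it. Isometries have matrices only up to sign, hence representations are
  relations and traces are followed up to sign. Parabolicity of the periphery rests on one
  dichotomy. A lift of the boundary torus stays within bounded distance of a peripheral orbit. If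
  the peripheral group were trivial, contained a loxodromic element, or moved points only along one
  direction, this lift would sit in a box, a cone or a slab whose complement in \<open>H3\<close> is
  connected. That complement would then belong to the lifted end, and with it a box of infinite
  volume reaching down to height 0. An elliptic element would have a fixed point. Generation by two
  meridians is proved in \<open>H3\<close> itself: path components over the pieces of the bridge
  decomposition are followed from one orbit. The tube defining the exterior and the bridge
  decomposition are unrelated homeomorphisms; they are compared only on small loops around the
  strands.\<close>

type_synonym mat = "complex \<times> complex \<times> complex \<times> complex"

fun mmul :: "mat \<Rightarrow> mat \<Rightarrow> mat" where
  "mmul (a, b, c, d) (a', b', c', d') =
    (a * a' + b * c', a * b' + b * d', c * a' + d * c', c * b' + d * d')"

fun mdet :: "mat \<Rightarrow> complex" where "mdet (a, b, c, d) = a * d - b * c"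
fun mtr :: "mat \<Rightarrow> complex" where "mtr (a, b, c, d) = a + d"
fun mctrans :: "mat \<Rightarrow> mat" where "mctrans (a, b, c, d) = (cnj a, cnj c, cnj b, cnj d)"
fun mcof :: "mat \<Rightarrow> mat" where "mcof (a, b, c, d) = (d, - b, - c, a)"
fun mneg :: "mat \<Rightarrow> mat" where "mneg (a, b, c, d) = (- a, - b, - c, - d)"
definition mone :: mat where "mone = (1, 0, 0, 1)"

definition SL2 :: "mat set" where "SL2 = {A. mdet A = 1}"

lemma mmul_assoc: "mmul (mmul A B) C = mmul A (mmul B C)"
  by (cases A; cases B; cases C) (simp add: algebra_simps)

lemma mdet_mmul: "mdet (mmul A B) = mdet A * mdet B"
  by (cases A; cases B) (simp add: algebra_simps)

lemma mctrans_mmul: "mctrans (mmul A B) = mmul (mctrans B) (mctrans A)"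
  by (cases A; cases B) (simp add: algebra_simps)

lemma mcof_mmul: "mcof (mmul A B) = mmul (mcof B) (mcof A)"
  by (cases A; cases B) (simp add: algebra_simps)

lemma mtr_mmul_commute: "mtr (mmul A B) = mtr (mmul B A)"
  by (cases A; cases B) (simp add: algebra_simps)

lemma mone_mmul [simp]: "mmul mone A = A" "mmul A mone = A"
  by (cases A; simp add: mone_def)+

lemma mmul_mcof: "mdet A = 1 \<Longrightarrow> mmul A (mcof A) = mone" "mdet A = 1 \<Longrightarrow> mmul (mcof A) A = mone"
  by (cases A; simp add: mone_def algebra_simps)+

lemma mdet_simps [simp]: "mdet (mcof A) = mdet A" "mdet mone = 1" "mdet (mneg A) = mdet A"
  "mdet (mctrans A) = cnj (mdet A)"
  by (cases A; simp add: mone_def mult.commute)+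

lemma mneg_mmul [simp]: "mmul (mneg A) B = mneg (mmul A B)" "mmul A (mneg B) = mneg (mmul A B)"
  by (cases A; cases B; simp)+

lemma mneg_simps [simp]: "mneg (mneg A) = A" "mtr (mneg A) = - mtr A" "mcof (mneg A) = mneg (mcof A)"
  by (cases A; simp)+

lemma SL2_closed [simp]: "A \<in> SL2 \<Longrightarrow> B \<in> SL2 \<Longrightarrow> mmul A B \<in> SL2" "A \<in> SL2 \<Longrightarrow> mcof A \<in> SL2"
  "mone \<in> SL2" "A \<in> SL2 \<Longrightarrow> mneg A \<in> SL2"
  by (auto simp: SL2_def mdet_mmul)

lemma mmul_mcof_SL2 [simp]: "A \<in> SL2 \<Longrightarrow> mmul A (mcof A) = mone" "A \<in> SL2 \<Longrightarrow> mmul (mcof A) A = mone"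
  by (simp_all add: SL2_def mmul_mcof)

text \<open>Points of hyperbolic space correspond to positive definite Hermitian matrices of
  determinant 1, on which \<open>SL2\<close> acts by \<open>Q \<mapsto> A Q A\<^sup>*\<close>; this makes the action visibly
  multiplicative.\<close>

definition herm :: "complex \<times> real \<Rightarrow> mat" where
  "herm p = (of_real (((cmod (fst p))\<^sup>2 + (snd p)\<^sup>2) / snd p), fst p / of_real (snd p),
    cnj (fst p) / of_real (snd p), 1 / of_real (snd p))"

text \<open>With the point written as the quaternion q = z + t j, this is the squared norm of c q +
  d.\<close>

definition mob_denom :: "mat \<Rightarrow> complex \<times> real \<Rightarrow> real" where
  "mob_denom A p = (case A of (a, b, c, d) \<Rightarrow>
    (cmod (c * fst p + d))\<^sup>2 + (cmod c)\<^sup>2 * (snd p)\<^sup>2)"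

text \<open>Poincare extension of a Moebius transformation. Outside \<open>H3\<close> it is the
  identity, so that isometries of \<open>H3\<close> are bijections of the whole type and can be
  compared, composed and inverted as functions.\<close>

definition mob :: "mat \<Rightarrow> complex \<times> real \<Rightarrow> complex \<times> real" where
  "mob A p = (if p \<in> H3 then (case A of (a, b, c, d) \<Rightarrow>
    (((a * fst p + b) * cnj (c * fst p + d) + a * cnj c * of_real ((snd p)\<^sup>2)) / of_real (mob_denom A p),
     snd p / mob_denom A p)) else p)"

definition hconj :: "complex \<times> real \<Rightarrow> complex \<times> real" where
  "hconj p = (if p \<in> H3 then (cnj (fst p), snd p) else p)"

text \<open>The hyperbolic cosine of the distance. It is rational in the coordinates, which turns
  statements about isometries into algebra.\<close>

definition ch :: "complex \<times> real \<Rightarrow> complex \<times> real \<Rightarrow> real" where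
  "ch p q = ((cmod (fst p - fst q))\<^sup>2 + (snd p)\<^sup>2 + (snd q)\<^sup>2) / (2 * snd p * snd q)"

lemma of_real_cmod_squared: "(complex_of_real (cmod w))\<^sup>2 = w * cnj w"
  by (metis complex_norm_square of_real_power)

lemma mob_denom_pos:
  assumes "A \<in> SL2" "p \<in> H3" shows "mob_denom A p > 0"
proof -
  obtain a b c d where A: "A = (a, b, c, d)" by (cases A)
  have t: "snd p > 0" using assms by (simp add: H3_def)
  show ?thesis
  proof (cases "c = 0")
    case True
    then have "d \<noteq> 0" using assms by (auto simp: A SL2_def)
    then show ?thesis using True by (simp add: mob_denom_def A)
  next
    case False
    then show ?thesis using t by (simp add: mob_denom_def A add_nonneg_pos)
  qed
qed

lemma mob_in_H3: "A \<in> SL2 \<Longrightarrow> p \<in> H3 \<Longrightarrow> mob A p \<in> H3"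
  using mob_denom_pos[of A p] by (cases A) (auto simp: mob_def H3_def)

lemma hconj_in_H3: "p \<in> H3 \<Longrightarrow> hconj p \<in> H3"
  by (simp add: hconj_def H3_def)

lemma herm_inj: "p \<in> H3 \<Longrightarrow> q \<in> H3 \<Longrightarrow> herm p = herm q \<Longrightarrow> p = q"
  by (cases p; cases q) (auto simp: herm_def H3_def)

text \<open>Multiplicativity of the determinant in the Hermitian model, written out: the image
  matrix again has determinant 1. Primed letters replace complex conjugates and \<open>t\<close> the
  squared height, so that the identity becomes purely polynomial.\<close>

lemma mob_identity:
  fixes a a' c c' x x' y y' t :: complex
  assumes "a * y - c * x = 1" "a' * y' - c' * x' = 1"
  shows "(x * y' + a * c' * t) * (x' * y + a' * c * t) + t =
    (y * y' + c * c' * t) * (x * x' + a * a' * t)"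
  using assms by algebra

lemma herm_mob:
  assumes "A \<in> SL2" "p \<in> H3"
  shows "herm (mob A p) = mmul A (mmul (herm p) (mctrans A))"
proof -
  obtain a b c d where A: "A = (a, b, c, d)" by (cases A)
  obtain z t where p: "p = (z, t)" by (cases p)
  have t: "t > 0" using assms by (simp add: H3_def p)
  define N where "N = mob_denom A p"
  have N: "N > 0" using mob_denom_pos[OF assms] by (simp add: N_def)
  define x y where "x = a * z + b" and "y = c * z + d"
  have NE: "of_real N = y * cnj y + c * cnj c * (of_real t)\<^sup>2"
    by (simp add: N_def mob_denom_def A p y_def of_real_cmod_squared)
  have det: "a * d - b * c = 1" using assms by (simp add: A SL2_def)
  have e: "a * y - c * x = 1" using det by (simp add: x_def y_def algebra_simps)
  then have e': "cnj a * cnj y - cnj c * cnj x = 1"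
    by (metis complex_cnj_diff complex_cnj_mult complex_cnj_one)
  have m: "mob A p = ((x * cnj y + a * cnj c * (of_real t)\<^sup>2) / of_real N, t / N)"
    using assms by (simp add: mob_def A p N_def x_def y_def)
  define n where "n = x * cnj y + a * cnj c * (of_real t)\<^sup>2"
  have cn: "cnj n = cnj x * y + cnj a * c * (of_real t)\<^sup>2" by (simp add: n_def)
  have key: "n * cnj n + (of_real t)\<^sup>2 = of_real N * (x * cnj x + a * cnj a * (of_real t)\<^sup>2)"
    unfolding cn NE unfolding n_def by (rule mob_identity[OF e e'])
  have "of_real (((cmod (fst (mob A p)))\<^sup>2 + (snd (mob A p))\<^sup>2) / snd (mob A p))
     = (n * cnj n + (of_real t)\<^sup>2) / (of_real N * of_real t)"
    using N t unfolding m n_def[symmetric]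
    by (simp add: norm_divide power_divide of_real_cmod_squared)
      (simp add: field_simps power2_eq_square)
  also have "\<dots> = (x * cnj x + a * cnj a * (of_real t)\<^sup>2) / of_real t"
    unfolding key using N by simp
  finally have 1: "of_real (((cmod (fst (mob A p)))\<^sup>2 + (snd (mob A p))\<^sup>2) / snd (mob A p)) = \<dots>" .
  have h: "herm (mob A p) = ((x * cnj x + a * cnj a * (of_real t)\<^sup>2) / of_real t, n / of_real t,
      cnj n / of_real t, of_real N / of_real t)"
    unfolding herm_def 1 using N t by (simp add: m n_def)
  have hp: "herm p = ((z * cnj z + (of_real t)\<^sup>2) / of_real t, z / of_real t, cnj z / of_real t, 1 / of_real t)"
    by (simp add: herm_def p of_real_cmod_squared)
  show ?thesis
    unfolding h hp unfolding A using t
    by (simp add: n_def x_def y_def NE field_simps power2_eq_square)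
qed

lemma mob_mob:
  assumes "A \<in> SL2" "B \<in> SL2"
  shows "mob A (mob B p) = mob (mmul A B) p"
proof (cases "p \<in> H3")
  case True
  then show ?thesis
    using assms by (intro herm_inj) (simp_all add: mob_in_H3 herm_mob mctrans_mmul mmul_assoc)
next
  case False then show ?thesis by (cases A; cases B; simp add: mob_def)
qed

lemma mob_mone [simp]: "mob mone p = p"
  by (cases p) (auto simp: mob_def mone_def mob_denom_def)

lemma mob_mneg [simp]: "mob (mneg A) = mob A"
proof
  fix p
  obtain a b c d where A: "A = (a, b, c, d)" by (cases A)
  have 1: "cmod (- d - c * z) = cmod (c * z + d)" for z
    by (metis add.commute minus_add_distrib norm_minus_cancel uminus_add_conv_diff diff_conv_add_uminus)
  have "mob_denom (mneg A) p = mob_denom A p"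
    by (simp add: A mob_denom_def 1 add.commute)
  then show "mob (mneg A) p = mob A p"
    by (simp add: mob_def A) (simp add: algebra_simps)
qed

text \<open>Since tr (P adj P) = 2 det P, the right-hand side is the polarised determinant, that is,
  the Lorentz product of the Hermitian model.\<close>

lemma ch_herm:
  assumes "p \<in> H3" "q \<in> H3"
  shows "of_real (2 * ch p q) = mtr (mmul (herm p) (mcof (herm q)))"
proof -
  obtain z t where p: "p = (z, t)" by (cases p)
  obtain w s where q: "q = (w, s)" by (cases q)
  have ts: "t > 0" "s > 0" using assms by (auto simp: H3_def p q)
  have "2 * ch p q = ((cmod (z - w))\<^sup>2 + t\<^sup>2 + s\<^sup>2) / (t * s)"
    using ts by (simp add: ch_def p q field_simps)
  then have "of_real (2 * ch p q) = ((z - w) * cnj (z - w) + (of_real t)\<^sup>2 + (of_real s)\<^sup>2) / (of_real t * of_real s)"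
    by (simp only: of_real_cmod_squared of_real_divide of_real_add of_real_mult of_real_power)
  moreover
  have "herm p = ((z * cnj z + (of_real t)\<^sup>2) / of_real t, z / of_real t, cnj z / of_real t, 1 / of_real t)"
    "herm q = ((w * cnj w + (of_real s)\<^sup>2) / of_real s, w / of_real s, cnj w / of_real s, 1 / of_real s)"
    by (simp_all add: herm_def p q of_real_cmod_squared)
  then have "mtr (mmul (herm p) (mcof (herm q))) =
      ((z - w) * cnj (z - w) + (of_real t)\<^sup>2 + (of_real s)\<^sup>2) / (of_real t * of_real s)"
    using ts by (simp add: field_simps)
  ultimately show ?thesis by simp
qed

text \<open>In the trace of \<open>ch_herm\<close> the conjugate transposes of \<open>A\<close>
  cancel in the middle, and the outer \<open>A\<close> and its inverse cancel by cyclicity of the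
  trace.\<close>

lemma ch_mob:
  assumes "A \<in> SL2" "p \<in> H3" "q \<in> H3"
  shows "ch (mob A p) (mob A q) = ch p q"
proof -
  have A': "mctrans A \<in> SL2" using assms by (simp add: SL2_def)
  let ?P = "herm p" and ?Q = "herm q" and ?A = "mctrans A"
  have "mmul (mmul A (mmul ?P ?A)) (mcof (mmul A (mmul ?Q ?A)))
     = mmul A (mmul ?P (mmul (mmul ?A (mcof ?A)) (mmul (mcof ?Q) (mcof A))))"
    by (simp add: mcof_mmul mmul_assoc)
  also have "\<dots> = mmul A (mmul (mmul ?P (mcof ?Q)) (mcof A))"
    using A' by (simp add: mmul_assoc)
  finally have "mtr (mmul (mmul A (mmul ?P ?A)) (mcof (mmul A (mmul ?Q ?A))))
      = mtr (mmul ?P (mcof ?Q))"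
    using assms by (simp add: mtr_mmul_commute[of A] mmul_assoc)
  then have "complex_of_real (2 * ch (mob A p) (mob A q)) = of_real (2 * ch p q)"
    using assms by (simp add: ch_herm mob_in_H3 herm_mob del: of_real_mult)
  then show ?thesis by (simp only: of_real_eq_iff)
qed

lemma ch_hconj: "p \<in> H3 \<Longrightarrow> q \<in> H3 \<Longrightarrow> ch (hconj p) (hconj q) = ch p q"
  by (simp add: ch_def hconj_def) (metis complex_cnj_diff complex_mod_cnj)

lemma ch_ge_1:
  assumes "p \<in> H3" "q \<in> H3" shows "ch p q \<ge> 1"
proof -
  have "snd p > 0" "snd q > 0" using assms by (auto simp: H3_def)
  moreover have "(snd p - snd q)\<^sup>2 \<ge> 0" by simp
  moreover have "(cmod (fst p - fst q))\<^sup>2 \<ge> 0" by simp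
  ultimately have "2 * snd p * snd q \<le> (cmod (fst p - fst q))\<^sup>2 + (snd p)\<^sup>2 + (snd q)\<^sup>2"
    unfolding power2_diff by linarith
  then show ?thesis
    using \<open>snd p > 0\<close> \<open>snd q > 0\<close> by (simp add: ch_def)
qed

lemma H3_dist_ch:
  assumes "p \<in> H3" "q \<in> H3" shows "H3_dist p q = arcosh (ch p q)"
proof -
  have "snd p > 0" "snd q > 0" using assms by (auto simp: H3_def)
  moreover have "(dist p q)\<^sup>2 = (cmod (fst p - fst q))\<^sup>2 + (snd p - snd q)\<^sup>2"
    by (cases p; cases q) (simp add: dist_Pair_Pair dist_norm[where x="_::complex"] dist_real_def)
  ultimately show ?thesis
    unfolding H3_dist_def ch_def by (intro arg_cong[of _ _ arcosh]) (simp add: field_simps power2_diff)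
qed

lemma H3_dist_eq_iff:
  assumes "p \<in> H3" "q \<in> H3" "p' \<in> H3" "q' \<in> H3"
  shows "H3_dist p q = H3_dist p' q' \<longleftrightarrow> ch p q = ch p' q'"
  using assms ch_ge_1 by (metis H3_dist_ch cosh_arcosh_real)

lemma cosh_H3_dist: "p \<in> H3 \<Longrightarrow> q \<in> H3 \<Longrightarrow> cosh (H3_dist p q) = ch p q"
  by (simp add: H3_dist_ch ch_ge_1)

lemma H3_dist_nonneg: "p \<in> H3 \<Longrightarrow> q \<in> H3 \<Longrightarrow> H3_dist p q \<ge> 0"
  by (simp add: H3_dist_ch ch_ge_1)

lemma ch_eq_1:
  assumes "p \<in> H3" "q \<in> H3" shows "ch p q = 1 \<longleftrightarrow> p = q"
proof
  assume "ch p q = 1"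
  moreover have "snd p > 0" "snd q > 0" using assms by (auto simp: H3_def)
  ultimately have "(cmod (fst p - fst q))\<^sup>2 + (snd p - snd q)\<^sup>2 = 0"
    by (simp add: ch_def field_simps power2_diff)
  then show "p = q" by (simp add: prod_eq_iff sum_power2_eq_zero_iff)
next
  assume "p = q" then show "ch p q = 1"
    using assms by (auto simp: ch_def H3_def power2_eq_square)
qed

lemma H3_dist_0: "p \<in> H3 \<Longrightarrow> q \<in> H3 \<Longrightarrow> H3_dist p q = 0 \<longleftrightarrow> p = q"
  by (simp add: H3_dist_ch ch_ge_1 ch_eq_1)

lemma H3_dist_less_iff:
  assumes "p \<in> H3" "q \<in> H3" "r \<ge> 0" shows "H3_dist p q < r \<longleftrightarrow> ch p q < cosh r"
  using assms H3_dist_nonneg[OF assms(1,2)] cosh_H3_dist[OF assms(1,2)]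
  by (metis cosh_real_nonneg_less_iff)

section \<open>Normal forms for pairs of points\<close>

lemma mob_to_base:
  assumes "p \<in> H3" obtains A where "A \<in> SL2" "mob A p = (0, 1)"
proof -
  obtain z t where p: "p = (z, t)" by (cases p)
  have t: "t > 0" using assms by (simp add: H3_def p)
  define r where "r = sqrt t"
  have r: "r > 0" "r * r = t" using t by (auto simp: r_def)
  let ?A = "(1 / of_real r, - z / of_real r, 0, of_real r) :: mat"
  have 1: "?A \<in> SL2" using r by (simp add: SL2_def)
  have "mob_denom ?A p = t" using r by (simp add: mob_denom_def power2_eq_square)
  then have "mob ?A p = (0, 1)" using assms t r by (simp add: mob_def p field_simps)
  with 1 show ?thesis by (rule that)
qed

text \<open>Diagonalisation of the Hermitian matrix of \<open>q\<close>, with entries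
  \<open>al\<close>, \<open>be * e\<close> and \<open>ga\<close>, by a special unitary matrix. Such
  matrices fix the base point, whose Hermitian matrix is the identity, and the height of the image
  of \<open>q\<close> is the larger eigenvalue.\<close>

lemma mob_to_axis:
  assumes "q \<in> H3" "q \<noteq> (0, 1)"
  obtains A s where "A \<in> SL2" "mob A (0, 1) = (0, 1)" "s > 1" "mob A q = (0, s)"
proof -
  obtain z t where q: "q = (z, t)" by (cases q)
  have t: "t > 0" using assms by (simp add: H3_def q)
  define al ga be where "al = ((cmod z)\<^sup>2 + t\<^sup>2) / t" and "ga = 1 / t" and "be = cmod z / t"
  have pos: "al > 0" "ga > 0" "be \<ge> 0" using t by (auto simp: al_def ga_def be_def add_nonneg_pos)
  have ag: "al * ga = 1 + be\<^sup>2"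
    using t by (simp add: al_def ga_def be_def field_simps power2_eq_square)
  define x where "x = (al - ga) / 2"
  define r where "r = sqrt (x\<^sup>2 + be\<^sup>2)"
  have r2: "r\<^sup>2 = x\<^sup>2 + be\<^sup>2" by (simp add: r_def)
  have r: "r > 0"
  proof (rule ccontr)
    assume "\<not> r > 0"
    then have "x\<^sup>2 + be\<^sup>2 = 0" using r_def
      by (metis not_less order_antisym real_sqrt_ge_0_iff real_sqrt_eq_zero_cancel_iff sum_power2_ge_zero)
    then have "x = 0" "be = 0" by (auto simp: sum_power2_eq_zero_iff)
    then have "z = 0" "al = ga" "al * ga = 1" using ag t by (auto simp: be_def x_def)
    then have "t\<^sup>2 = 1" using t by (simp add: al_def ga_def power2_eq_square)
    then have "t = 1" using t by (simp add: power2_eq_1_iff)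
    then show False using \<open>z = 0\<close> assms(2) q by simp
  qed
  have xr: "\<bar>x\<bar> \<le> r" using r2 r by (intro abs_le_square_iff[THEN iffD2, of x r, simplified abs_of_pos[OF r]]) auto
  \<comment> \<open>Half-angle formulas: the rotation is by half the angle whose cosine is
    \<open>x / r\<close>, where \<open>r\<close> is half the difference of the eigenvalues.\<close>
  define c s where "c = sqrt ((1 + x / r) / 2)" and "s = sqrt ((1 - x / r) / 2)"
  have "-1 \<le> x / r" "x / r \<le> 1" using xr r by (auto simp: field_simps abs_le_iff)
  then have cs: "c\<^sup>2 = (1 + x / r) / 2" "s\<^sup>2 = (1 - x / r) / 2" "c \<ge> 0" "s \<ge> 0"
    by (auto simp: c_def s_def)
  have "(c * s)\<^sup>2 = (be / (2 * r))\<^sup>2"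
  proof -
    have b: "be\<^sup>2 = r\<^sup>2 - x\<^sup>2" using r2 by simp
    show ?thesis
      using r unfolding power_mult_distrib cs power_divide b by (simp add: field_simps power2_eq_square)
  qed
  then have cs1: "c * s = be / (2 * r)"
    by (rule power2_eq_imp_eq) (use cs(3,4) r pos in simp_all)
  obtain e where e: "cmod e = 1" "z = of_real (cmod z) * e"
  proof (cases "z = 0")
    case True then show ?thesis by (intro that[of 1]) auto
  next
    case False then show ?thesis by (intro that[of "z / of_real (cmod z)"]) (auto simp: norm_divide)
  qed
  have ee: "e * cnj e = 1" using e(1) by (metis of_real_cmod_squared of_real_1 power_one)
  define A :: mat where "A = (of_real c, e * of_real s, - cnj e * of_real s, of_real c)"
  have c1: "(of_real c)\<^sup>2 + (of_real s)\<^sup>2 = (1::complex)"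
    unfolding of_real_power[symmetric] of_real_add[symmetric] cs by (simp add: field_simps)
  have c2: "of_real c * of_real c + e * cnj e * (of_real s * of_real s) = (1::complex)"
    using c1 ee by (simp add: power2_eq_square)
  have A: "A \<in> SL2"
    using c2 by (simp add: A_def SL2_def algebra_simps)
  have AA: "mmul A (mctrans A) = mone"
    using c2 by (simp add: A_def mone_def algebra_simps)
  have h01: "herm (0, 1) = mone" by (simp add: herm_def mone_def)
  have i01: "(0, 1) \<in> H3" by (simp add: H3_def)
  have A01: "mob A (0, 1) = (0, 1)"
    by (rule herm_inj) (simp_all add: mob_in_H3 A i01 herm_mob h01 AA)
  define s' where "s' = (al + ga) / 2 + r"
  have "((al + ga) / 2)\<^sup>2 = al * ga + x\<^sup>2" by (simp add: x_def power2_eq_square field_simps)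
  then have "((al + ga) / 2)\<^sup>2 = 1 + r\<^sup>2" using ag r2 by linarith
  then have "((al + ga) / 2)\<^sup>2 > 1\<^sup>2" using r by simp
  then have "(al + ga) / 2 > 1" using pos by (intro power2_less_imp_less[of 1]) auto
  then have s'1: "s' > 1" using r unfolding s'_def by linarith
  have hq: "herm q = (of_real al, of_real be * e, of_real be * cnj e, of_real ga)"
  proof -
    have 1: "z / of_real t = of_real be * e" by (subst e(2)) (simp add: be_def)
    have "cnj z / of_real t = cnj (z / of_real t)" by simp
    also have "\<dots> = of_real be * cnj e" unfolding 1 by simp
    finally show ?thesis using 1 by (simp add: herm_def q al_def ga_def)
  qed
  have 1: "of_real be * (of_real c)\<^sup>2 - of_real be * (of_real s)\<^sup>2 - (of_real al - of_real ga) * (of_real c * of_real s) = (0::complex)"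
  proof -
    have "be * c\<^sup>2 - be * s\<^sup>2 - (al - ga) * (c * s) = 0"
      unfolding cs cs1 using r by (simp add: x_def field_simps)
    then show ?thesis by (metis of_real_0 of_real_diff of_real_mult of_real_power)
  qed
  have 2: "of_real al * (of_real c)\<^sup>2 + of_real ga * (of_real s)\<^sup>2 + 2 * of_real be * (of_real c * of_real s) = (of_real s'::complex)"
  proof -
    have "al * c\<^sup>2 + ga * s\<^sup>2 + 2 * be * (c * s) = (al + ga) / 2 + (x * (al - ga) / 2 + be\<^sup>2) / r"
      unfolding cs cs1 using r by (simp add: field_simps power2_eq_square)
    also have "x * (al - ga) / 2 + be\<^sup>2 = r\<^sup>2" unfolding r2 by (simp add: x_def power2_eq_square)
    finally have "al * c\<^sup>2 + ga * s\<^sup>2 + 2 * be * (c * s) = s'" using r by (simp add: s'_def power2_eq_square)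
    then show ?thesis by (metis of_real_add of_real_mult of_real_power of_real_numeral)
  qed
  obtain w u where wu: "mob A q = (w, u)" by (cases "mob A q")
  have H: "(w, u) \<in> H3" using mob_in_H3[OF A assms(1)] wu by simp
  have u: "u > 0" using H by (simp add: H3_def)
  have hw: "herm (w, u) = mmul A (mmul (herm q) (mctrans A))"
    using herm_mob[OF A assms(1)] wu by simp
  have "w / of_real u = fst (snd (herm (w, u)))" by (simp add: herm_def)
  also have "\<dots> = e * (of_real be * (of_real c)\<^sup>2 - of_real be * (of_real s)\<^sup>2 * (e * cnj e) - (of_real al - of_real ga) * (of_real c * of_real s))"
    unfolding hw by (simp add: hq A_def algebra_simps power2_eq_square)
  finally have w: "w = 0" using 1 ee u by simp
  have "of_real u = fst (herm (w, u))" using w u by (simp add: herm_def power2_eq_square)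
  also have "\<dots> = of_real al * (of_real c)\<^sup>2 + of_real ga * (of_real s)\<^sup>2 * (e * cnj e)  + 2 * of_real be * (of_real c * of_real s) * (e * cnj e)"
    unfolding hw by (simp add: hq A_def algebra_simps power2_eq_square)
  finally have "of_real u = of_real al * (of_real c)\<^sup>2 + of_real ga * (of_real s)\<^sup>2 * (e * cnj e)  + 2 * of_real be * (of_real c * of_real s) * (e * cnj e)" .
  then have "u = s'" using 2 ee by simp
  then show ?thesis using that[OF A A01 s'1] wu w by simp
qed

lemma base_in_H3 [simp]: "(0, 1) \<in> H3" by (simp add: H3_def)

lemma mob_normal_form:
  assumes "p \<in> H3" "q \<in> H3" "p \<noteq> q"
  obtains A s where "A \<in> SL2" "mob A p = (0, 1)" "s > 1" "mob A q = (0, s)"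
proof -
  obtain A where A: "A \<in> SL2" "mob A p = (0, 1)" using mob_to_base[OF assms(1)] .
  have "mob A q \<noteq> (0, 1)"
  proof
    assume "mob A q = (0, 1)"
    then have "mob (mcof A) (mob A p) = mob (mcof A) (mob A q)" using A by simp
    moreover have "mob (mcof A) (mob A u) = u" for u using A by (simp add: mob_mob)
    ultimately show False using assms(3) by metis
  qed
  then obtain B s where B: "B \<in> SL2" "mob B (0, 1) = (0, 1)" "s > 1" "mob B (mob A q) = (0, s)"
    using mob_to_axis[of "mob A q"] mob_in_H3[OF A(1) assms(2)] by metis
  then show ?thesis using that[of "mmul B A" s] A by (simp add: mob_mob[symmetric])
qed

lemma continuous_on_mob: "A \<in> SL2 \<Longrightarrow> continuous_on H3 (mob A)"
proof -
  assume A: "A \<in> SL2"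
  obtain a b c d where e: "A = (a, b, c, d)" by (cases A)
  have "continuous_on H3 (\<lambda>p. (((a * fst p + b) * cnj (c * fst p + d) + a * cnj c * of_real ((snd p)\<^sup>2)) / of_real (mob_denom A p),
     snd p / mob_denom A p))"
    using mob_denom_pos[OF A] unfolding mob_denom_def e
    by (auto intro!: continuous_intros simp: less_le simp del: of_real_add of_real_power of_real_mult)
  then show ?thesis
    by (rule continuous_on_eq) (auto simp: mob_def e)
qed

lemma continuous_on_hconj: "continuous_on H3 hconj"
proof -
  have "continuous_on H3 (\<lambda>p. (cnj (fst p), snd p))" by (intro continuous_intros)
  then show ?thesis by (rule continuous_on_eq) (auto simp: hconj_def)
qed

lemma open_H3: "open H3"
proof -
  have "H3 = UNIV \<times> {0<..}" by (auto simp: H3_def)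
  moreover have "open (UNIV \<times> {0<..} :: (complex \<times> real) set)"
    by (intro open_Times open_UNIV open_greaterThan)
  ultimately show ?thesis by metis
qed

definition mcnj :: "mat \<Rightarrow> mat" where "mcnj = (\<lambda>(a, b, c, d). (cnj a, cnj b, cnj c, cnj d))"

lemma mcnj_SL2 [simp]: "A \<in> SL2 \<Longrightarrow> mcnj A \<in> SL2"
  by (cases A) (auto simp: SL2_def mcnj_def complex_eq_iff)

lemma hconj_mob: "hconj (mob A p) = mob (mcnj A) (hconj p)" if "A \<in> SL2"
proof (cases "p \<in> H3")
  case True
  obtain a b c d where A: "A = (a, b, c, d)" by (cases A)
  have m: "cmod (cnj c * cnj (fst p) + cnj d) = cmod (c * fst p + d)"
    by (metis complex_cnj_add complex_cnj_mult complex_mod_cnj)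
  have "mob_denom (mcnj A) (hconj p) = mob_denom A p"
    using True m by (simp add: mob_denom_def mcnj_def hconj_def A)
  then show ?thesis using True hconj_in_H3[OF True] mob_in_H3[OF that True]
    by (simp add: hconj_def mob_def mcnj_def A)
next
  case False
  then show ?thesis by (cases A) (simp add: hconj_def mob_def mcnj_def)
qed

lemma hconj_hconj [simp]: "hconj (hconj p) = p"
  by (cases p) (auto simp: hconj_def H3_def)

section \<open>Rigidity of local isometries\<close>

lemma ch_eq_iff:
  assumes "u \<in> H3" "v \<in> H3" "w \<in> H3"
  shows "ch u w = ch v w \<longleftrightarrow> snd v * ((cmod (fst u - fst w))\<^sup>2 + (snd u)\<^sup>2 + (snd w)\<^sup>2) =
    snd u * ((cmod (fst v - fst w))\<^sup>2 + (snd v)\<^sup>2 + (snd w)\<^sup>2)" (is "_ \<longleftrightarrow> snd v * ?U = snd u * ?V")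
proof -
  have t: "snd u > 0" "snd v > 0" "snd w > 0" using assms by (auto simp: H3_def)
  have "ch u w = ch v w \<longleftrightarrow> (2 * snd w) * (snd v * ?U) = (2 * snd w) * (snd u * ?V)"
    using t by (simp add: ch_def frac_eq_eq ac_simps)
  then show ?thesis using t by simp
qed

text \<open>The equations for one point of \<open>V\<close> and for its small translates in the
  three coordinate directions differ by linear equations. The vertical translate gives equal
  heights, the horizontal ones then give equal real and imaginary parts.\<close>

lemma ch_determines_point:
  assumes "open V" "V \<noteq> {}" "V \<subseteq> H3" "u \<in> H3" "v \<in> H3" and eq: "\<And>w. w \<in> V \<Longrightarrow> ch u w = ch v w"
  shows "u = v"
proof -
  obtain w s where ws: "(w, s) \<in> V" using assms(2) by auto
  then obtain e where e: "e > 0" "ball (w, s) e \<subseteq> V" using assms(1) open_contains_ball by blast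
  define h where "h = e / 2"
  have h: "h > 0" "h < e" using e by (auto simp: h_def)
  have tu: "snd u > 0" "snd v > 0" using assms by (auto simp: H3_def)
  have *: "snd v * ((cmod (fst u - w'))\<^sup>2 + (snd u)\<^sup>2 + s'\<^sup>2) = snd u * ((cmod (fst v - w'))\<^sup>2 + (snd v)\<^sup>2 + s'\<^sup>2)"
    if "(w', s') \<in> V" for w' s'
  proof -
    have "(w', s') \<in> H3" using that assms(3) by auto
    then show ?thesis using eq[OF that] assms by (simp add: ch_eq_iff)
  qed
  have V: "(w, s + h) \<in> V" "(w + of_real h, s) \<in> V" "(w + \<i> * of_real h, s) \<in> V"
    using h e(2) by (auto simp: subset_iff dist_Pair_Pair dist_norm norm_mult)
  have "snd v * ((s + h)\<^sup>2 - s\<^sup>2) = snd u * ((s + h)\<^sup>2 - s\<^sup>2)"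
    using *[OF ws] *[OF V(1)] by (simp add: algebra_simps)
  moreover have "(s + h)\<^sup>2 - s\<^sup>2 > 0"
    using h ws assms(3) by (auto simp: H3_def power2_eq_square algebra_simps add_pos_pos)
  ultimately have st: "snd u = snd v" by simp
  then have **: "(cmod (fst u - w'))\<^sup>2 = (cmod (fst v - w'))\<^sup>2" if "(w', s) \<in> V" for w'
    using *[OF that] tu by simp
  define a a' b b' where "a = Re (fst u) - Re w" and "a' = Re (fst v) - Re w"
    and "b = Im (fst u) - Im w" and "b' = Im (fst v) - Im w"
  have 1: "a\<^sup>2 + b\<^sup>2 = a'\<^sup>2 + b'\<^sup>2" "(a - h)\<^sup>2 + b\<^sup>2 = (a' - h)\<^sup>2 + b'\<^sup>2" "a\<^sup>2 + (b - h)\<^sup>2 = a'\<^sup>2 + (b' - h)\<^sup>2"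
    using **[OF ws] **[OF V(2)] **[OF V(3)] unfolding cmod_power2 a_def b_def a'_def b'_def
    by (simp_all add: diff_diff_eq)
  then have "h * (a - a') = 0" "h * (b - b') = 0" unfolding power2_diff by argo+
  then have "Re (fst u) = Re (fst v)" "Im (fst u) = Im (fst v)" using h by (simp_all add: a_def b_def a'_def b'_def)
  then show ?thesis using st by (simp add: prod_eq_iff complex_eq_iff)
qed

lemma ch_axis_inj:
  assumes "s > 1" "s' > 1" "ch (0, 1) (0, s) = ch (0, 1) (0, s')" shows "s = s'"
proof -
  have "(s - s') * (s * s' - 1) = 0"
    using assms by (simp add: ch_def field_simps power2_eq_square)
  moreover have "s * s' > 1" using assms by (simp add: less_1_mult)
  ultimately show ?thesis by simp
qed

text \<open>Two points and their images are moved to the same pair on the vertical axis, so that the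
  transported map fixes both. A rotation about the axis makes it fix a third point as well, and what
  remains is the identity or the reflection \<open>hconj\<close>.\<close>

lemma isometric_imp_mob:
  assumes "open V" "V \<noteq> {}" "V \<subseteq> H3" "f ` V \<subseteq> H3"
    and iso: "\<And>u v. u \<in> V \<Longrightarrow> v \<in> V \<Longrightarrow> ch (f u) (f v) = ch u v"
  shows "\<exists>A\<in>SL2. (\<forall>u\<in>V. f u = mob A u) \<or> (\<forall>u\<in>V. f u = mob A (hconj u))"
proof -
  obtain p where p: "p \<in> V" using assms by auto
  obtain e0 where e0: "e0 > 0" "ball p e0 \<subseteq> V" using open_contains_ball assms(1) p by blast
  define q where "q = (fst p, snd p + e0 / 2)"
  have q: "q \<in> V" "q \<noteq> p"
    using e0 by (auto simp: q_def subset_iff dist_prod_def dist_real_def prod_eq_iff)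
  have pq: "p \<in> H3" "q \<in> H3" "f p \<in> H3" "f q \<in> H3" using p q assms by auto
  obtain A s where A: "A \<in> SL2" "mob A p = (0, 1)" "s > 1" "mob A q = (0, s)"
    using mob_normal_form[OF pq(1,2)] q(2) by metis
  have "f p \<noteq> f q" using iso[OF p q(1)] pq ch_eq_1 q(2) by metis
  then obtain B s' where B: "B \<in> SL2" "mob B (f p) = (0, 1)" "s' > 1" "mob B (f q) = (0, s')"
    using mob_normal_form[OF pq(3,4)] by metis
  have "ch (0, 1) (0, s) = ch (0, 1) (0, s')"
    using ch_mob[OF A(1) pq(1,2)] ch_mob[OF B(1) pq(3,4)] iso[OF p q(1)] A B by simp
  then have ss: "s' = s" using ch_axis_inj A B by metis
  define A' where "A' = mcof A"
  have A': "A' \<in> SL2" using A by (simp add: A'_def)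
  have AA: "mob A' (mob A u) = u" "mob A (mob A' u) = u" for u
    using A by (simp_all add: A'_def mob_mob)
  define V' where "V' = {u \<in> H3. mob A' u \<in> V}"
  have "open V'"
    using continuous_open_preimage[OF continuous_on_mob[OF A'] open_H3 assms(1)]
    by (simp add: V'_def vimage_def Int_def)
  have V'1: "(0, 1) \<in> V'" using A p AA by (metis (mono_tags, lifting) V'_def base_in_H3 mem_Collect_eq)
  have V's: "(0, s) \<in> V'" using A q AA pq mob_in_H3 by (metis (mono_tags, lifting) V'_def mem_Collect_eq)
  have V'H: "V' \<subseteq> H3" by (auto simp: V'_def)
  obtain e where e: "e > 0" "ball (0, 1) e \<subseteq> V'" using \<open>open V'\<close> V'1 open_contains_ball by blast
  define r where "r = e / 2"
  have r: "r > 0" "r < e" using e by (auto simp: r_def)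
  have V'r: "(of_real r, 1) \<in> V'" "(\<i> * of_real r, 1) \<in> V'"
    using r e(2) by (auto simp: subset_iff dist_Pair_Pair dist_norm norm_mult)
  define g where "g u = mob B (f (mob A' u))" for u
  have gH: "g u \<in> H3" if "u \<in> V'" for u
    using that B(1) assms(4) unfolding g_def V'_def by (auto intro!: mob_in_H3)
  have giso: "ch (g u) (g v) = ch u v" if "u \<in> V'" "v \<in> V'" for u v
  proof -
    have "mob A' u \<in> V" "mob A' v \<in> V" "u \<in> H3" "v \<in> H3" using that by (auto simp: V'_def)
    then show ?thesis unfolding g_def using assms(4) A' B(1)
      by (metis ch_mob image_subset_iff iso)
  qed
  have g1: "g (0, 1) = (0, 1)" "g (0, s) = (0, s)"
    using A B AA ss by (metis g_def)+
  \<comment> \<open>The distances to two points of the axis determine the height and the distance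
    from the axis.\<close>
  have g: "snd (g u) = snd u \<and> cmod (fst (g u)) = cmod (fst u)" if "u \<in> V'" for u
  proof -
    have t: "snd u > 0" "snd (g u) > 0" using gH[OF that] that V'H by (auto simp: H3_def)
    have "ch (g u) (0, 1) = ch u (0, 1)" "ch (g u) (0, s) = ch u (0, s)"
      using giso[OF that V'1] giso[OF that V's] g1 by auto
    then have e: "snd u * ((cmod (fst (g u)))\<^sup>2 + (snd (g u))\<^sup>2 + 1) = snd (g u) * ((cmod (fst u))\<^sup>2 + (snd u)\<^sup>2 + 1)"
      "snd u * ((cmod (fst (g u)))\<^sup>2 + (snd (g u))\<^sup>2 + s\<^sup>2) = snd (g u) * ((cmod (fst u))\<^sup>2 + (snd u)\<^sup>2 + s\<^sup>2)"
      using ch_eq_iff[OF gH[OF that], of u "(0, 1)"] ch_eq_iff[OF gH[OF that], of u "(0, s)"]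
        that V'H V'1 V's by (auto simp: mult.commute)
    then have "(s\<^sup>2 - 1) * snd u = (s\<^sup>2 - 1) * snd (g u)" by (simp add: algebra_simps)
    moreover have "s\<^sup>2 > 1" using A(3) by (simp add: power2_eq_square less_1_mult)
    ultimately have "snd u = snd (g u)" by simp
    then show ?thesis using e t by simp
  qed
  define w where "w = fst (g (of_real r, 1))"
  have w: "cmod w = r" "g (of_real r, 1) = (w, 1)"
    using g[OF V'r(1)] r by (auto simp: w_def prod_eq_iff)
  \<comment> \<open>A diagonal matrix with entries \<open>om\<close> and \<open>cnj om\<close>
    rotates by the square of \<open>om\<close>, hence the square root.\<close>
  define om where "om = csqrt (of_real r / w)"
  have om: "om\<^sup>2 = of_real r / w" by (simp add: om_def)
  have "cmod (om\<^sup>2) = 1" using w(1) r unfolding om by (simp add: norm_divide)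
  then have om2: "(cmod om)\<^sup>2 = 1" by (simp add: norm_power)
  then have om1: "om * cnj om = 1" by (metis of_real_cmod_squared of_real_power of_real_1 om2)
  have w0: "w \<noteq> 0" using w r by auto
  define R :: mat where "R = (om, 0, 0, cnj om)"
  have R: "R \<in> SL2" using om1 by (simp add: R_def SL2_def)
  have mR: "mob R (z, t) = (om\<^sup>2 * z, t)" if "t > 0" for z t
  proof -
    have "mob_denom R (z, t) = 1" using om2 by (simp add: mob_denom_def R_def)
    then show ?thesis
      using that by (simp add: mob_def R_def H3_def power2_eq_square)
  qed
  define B' where "B' = mmul R B"
  define k where "k u = mob R (g u)" for u
  have kH: "k u \<in> H3" if "u \<in> V'" for u using gH[OF that] R by (simp add: k_def mob_in_H3)
  have kiso: "ch (k u) (k v) = ch u v" if "u \<in> V'" "v \<in> V'" for u v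
    using that giso gH R by (simp add: k_def ch_mob)
  have k: "snd (k u) = snd u \<and> cmod (fst (k u)) = cmod (fst u)" if "u \<in> V'" for u
  proof -
    have "snd (g u) > 0" using gH[OF that] by (simp add: H3_def)
    then have "k u = (om\<^sup>2 * fst (g u), snd (g u))" using mR by (metis k_def prod.collapse)
    moreover have "cmod (om\<^sup>2) = 1" using om2 by (simp add: norm_power)
    ultimately show ?thesis using g[OF that] by (simp add: norm_mult)
  qed
  have kr: "k (of_real r, 1) = (of_real r, 1)" by (simp add: k_def w mR om w0)
  have k2: "Re (fst (k u)) = Re (fst u) \<and> (Im (fst (k u)))\<^sup>2 = (Im (fst u))\<^sup>2" if "u \<in> V'" for u
  proof -
    have t: "snd u > 0" "snd (k u) > 0" using kH[OF that] that V'H by (auto simp: H3_def)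
    have "ch (k u) (of_real r, 1) = ch u (of_real r, 1)" using kiso[OF that V'r(1)] kr by simp
    then have "(cmod (fst (k u) - of_real r))\<^sup>2 = (cmod (fst u - of_real r))\<^sup>2"
      using t k[OF that] by (simp add: ch_def)
    moreover have "(cmod (fst (k u)))\<^sup>2 = (cmod (fst u))\<^sup>2" using k[OF that] by simp
    ultimately show ?thesis using r unfolding cmod_power2 by (simp add: power2_eq_square algebra_simps)
  qed
  \<comment> \<open>Only the sign of the imaginary part is still free for each point. The image of
    the single point over \<open>\<i> * r\<close> fixes this sign for all points at once.\<close>
  have dich: "(\<forall>u\<in>V'. k u = u) \<or> (\<forall>u\<in>V'. k u = hconj u)"
  proof -
    define y where "y = Im (fst (k (\<i> * of_real r, 1)))"
    have y: "fst (k (\<i> * of_real r, 1)) = \<i> * of_real y" "y = r \<or> y = - r"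
      using k2[OF V'r(2)] by (auto simp: y_def complex_eq_iff power2_eq_iff)
    have **: "Im (fst (k u)) * y = Im (fst u) * r" if "u \<in> V'" for u
    proof -
      have t: "snd u > 0" "snd (k u) > 0" using kH[OF that] that V'H by (auto simp: H3_def)
      have "ch (k u) (k (\<i> * of_real r, 1)) = ch u (\<i> * of_real r, 1)" using kiso[OF that V'r(2)] .
      moreover have "k (\<i> * of_real r, 1) = (\<i> * of_real y, 1)" using y k[OF V'r(2)] by (simp add: prod_eq_iff)
      ultimately have "(cmod (fst (k u) - \<i> * of_real y))\<^sup>2 = (cmod (fst u - \<i> * of_real r))\<^sup>2"
        using t k[OF that] by (simp add: ch_def)
      moreover have "y\<^sup>2 = r\<^sup>2" using y by auto
      ultimately show ?thesis using k2[OF that] unfolding cmod_power2 by (simp add: power2_eq_square algebra_simps)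
    qed
    from y(2) show ?thesis
    proof
      assume "y = r"
      then have "k u = u" if "u \<in> V'" for u
        using k2[OF that] k[OF that] **[OF that] r by (simp add: prod_eq_iff complex_eq_iff)
      then show ?thesis by blast
    next
      assume "y = - r"
      then have "k u = hconj u" if "u \<in> V'" for u
        using k2[OF that] k[OF that] **[OF that] r that V'H
        by (auto simp: prod_eq_iff complex_eq_iff hconj_def)
          (metis minus_mult_right mult_minus_left mult_right_cancel less_irrefl minus_minus)
      then show ?thesis by blast
    qed
  qed
  have RB: "mob (mcof B') (mob B' u) = u" "B' \<in> SL2" for u using R B by (simp_all add: B'_def mob_mob)
  have fk: "f u = mob (mcof B') (k (mob A u))" "mob A u \<in> V'" if "u \<in> V" for u
  proof -
    show "mob A u \<in> V'" using that A AA assms(3) by (auto simp: V'_def mob_in_H3)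
    have "k (mob A u) = mob B' (f u)" using R B by (simp add: k_def g_def AA B'_def mob_mob)
    then show "f u = mob (mcof B') (k (mob A u))" using RB by simp
  qed
  from dich show ?thesis
  proof
    assume *: "\<forall>u\<in>V'. k u = u"
    have "f u = mob (mmul (mcof B') A) u" if "u \<in> V" for u
      using fk[OF that] * RB A by (simp add: mob_mob)
    then show ?thesis using RB A by (intro bexI[of _ "mmul (mcof B') A"]) auto
  next
    assume *: "\<forall>u\<in>V'. k u = hconj u"
    have "f u = mob (mmul (mcof B') (mcnj A)) (hconj u)" if "u \<in> V" for u
      using fk[OF that] * RB A by (simp add: mob_mob hconj_mob)
    then show ?thesis using RB A by (intro bexI[of _ "mmul (mcof B') (mcnj A)"]) auto
  qed
qed

definition hisom :: "(complex \<times> real \<Rightarrow> complex \<times> real) set" where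
  "hisom = {g. \<exists>A\<in>SL2. g = mob A \<or> g = mob A \<circ> hconj}"

lemma mob_hisom [simp]: "A \<in> SL2 \<Longrightarrow> mob A \<in> hisom"
  by (auto simp: hisom_def)

lemma hconj_hisom [simp]: "hconj \<in> hisom"
proof -
  have "hconj = mob mone \<circ> hconj" by (simp add: fun_eq_iff)
  then show ?thesis unfolding hisom_def using SL2_closed(3) by blast
qed

lemma id_hisom [simp]: "id \<in> hisom"
proof -
  have "mob mone = id" by (simp add: fun_eq_iff)
  then show ?thesis by (metis mob_hisom SL2_closed(3))
qed

lemma hisom_comp [simp]:
  assumes "g \<in> hisom" "h \<in> hisom" shows "g \<circ> h \<in> hisom"
proof -
  obtain A B where A: "A \<in> SL2" "g = mob A \<or> g = mob A \<circ> hconj"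
    and B: "B \<in> SL2" "h = mob B \<or> h = mob B \<circ> hconj"
    using assms by (auto simp: hisom_def)
  have 1: "mob A \<circ> mob B = mob (mmul A B)" "mob A \<circ> (mob B \<circ> hconj) = mob (mmul A B) \<circ> hconj"
    "(mob A \<circ> hconj) \<circ> mob B = mob (mmul A (mcnj B)) \<circ> hconj"
    "(mob A \<circ> hconj) \<circ> (mob B \<circ> hconj) = mob (mmul A (mcnj B))"
    using A(1) B(1) by (auto simp: fun_eq_iff mob_mob hconj_mob)
  have 2: "mmul A B \<in> SL2" "mmul A (mcnj B) \<in> SL2" using A B by auto
  show ?thesis using A(2) B(2) unfolding hisom_def using 1 2 by auto
qed

lemma hisom_inverse:
  assumes "g \<in> hisom"
  obtains h where "h \<in> hisom" "\<And>u. h (g u) = u" "\<And>u. g (h u) = u"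
proof -
  obtain A where A: "A \<in> SL2" "g = mob A \<or> g = mob A \<circ> hconj"
    using assms by (auto simp: hisom_def)
  from A(2) show ?thesis
  proof
    assume "g = mob A"
    then show ?thesis using A(1) by (intro that[of "mob (mcof A)"]) (auto simp: mob_mob)
  next
    assume "g = mob A \<circ> hconj"
    then show ?thesis using A(1) by (intro that[of "hconj \<circ> mob (mcof A)"]) (auto simp: mob_mob)
  qed
qed

lemma hisom_H3 [simp]: "g \<in> hisom \<Longrightarrow> u \<in> H3 \<Longrightarrow> g u \<in> H3"
  by (auto simp: hisom_def mob_in_H3 hconj_in_H3)

lemma hisom_outside: "g \<in> hisom \<Longrightarrow> u \<notin> H3 \<Longrightarrow> g u = u"
  by (auto simp: hisom_def mob_def hconj_def)

lemma hisom_H3_iff [simp]: "g \<in> hisom \<Longrightarrow> g u \<in> H3 \<longleftrightarrow> u \<in> H3"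
  using hisom_H3 hisom_outside by metis

abbreviation hinv :: "('a \<Rightarrow> 'a) \<Rightarrow> 'a \<Rightarrow> 'a" where "hinv g \<equiv> inv_into UNIV g"

lemma bij_hisom: "g \<in> hisom \<Longrightarrow> bij g"
  using hisom_inverse[of g] by (metis bijI')

lemma inv_hisom [simp]: "g \<in> hisom \<Longrightarrow> hinv g \<in> hisom"
  by (metis bij_hisom bij_inv_eq_iff hisom_inverse ext)

lemma hisom_inv_apply [simp]: "g \<in> hisom \<Longrightarrow> hinv g (g u) = u" "g \<in> hisom \<Longrightarrow> g (hinv g u) = u"
  using bij_hisom[of g] by (simp_all add: bij_is_inj bij_is_surj surj_f_inv_f)

lemma hisom_image_H3: "g \<in> hisom \<Longrightarrow> g ` H3 = H3"
proof (intro equalityI subsetI)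
  fix u assume "g \<in> hisom" "u \<in> H3"
  then have "hinv g u \<in> H3" "u = g (hinv g u)" by simp_all
  then show "u \<in> g ` H3" by blast
qed auto

lemma hisom_ch: "g \<in> hisom \<Longrightarrow> u \<in> H3 \<Longrightarrow> v \<in> H3 \<Longrightarrow> ch (g u) (g v) = ch u v"
  by (auto simp: hisom_def ch_mob ch_hconj hconj_in_H3)

lemma hisom_dist: "g \<in> hisom \<Longrightarrow> u \<in> H3 \<Longrightarrow> v \<in> H3 \<Longrightarrow> H3_dist (g u) (g v) = H3_dist u v"
  by (simp add: H3_dist_eq_iff hisom_ch)

lemma continuous_on_hisom: "g \<in> hisom \<Longrightarrow> continuous_on H3 g"
proof -
  assume "g \<in> hisom"
  then obtain A where A: "A \<in> SL2" "g = mob A \<or> g = mob A \<circ> hconj" by (auto simp: hisom_def)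
  have "continuous_on H3 (mob A \<circ> hconj)"
    by (rule continuous_on_compose[OF continuous_on_hconj continuous_on_subset[OF continuous_on_mob[OF A(1)]]])
      (auto simp: hconj_in_H3)
  then show ?thesis using A(2) continuous_on_mob[OF A(1)] by (elim disjE) simp_all
qed

lemma open_hisom_image:
  assumes "g \<in> hisom" "open V" "V \<subseteq> H3" shows "open (g ` V)"
proof -
  have "g ` V = H3 \<inter> hinv g -` V"
  proof (intro equalityI subsetI)
    fix u assume "u \<in> H3 \<inter> hinv g -` V"
    then have "hinv g u \<in> V" "u = g (hinv g u)" using assms by simp_all
    then show "u \<in> g ` V" by blast
  qed (use assms in auto)
  then show ?thesis
    using continuous_open_preimage[OF continuous_on_hisom[OF inv_hisom[OF assms(1)]] open_H3 assms(2)] by simp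
qed

lemma hisom_eqI:
  assumes "g \<in> hisom" "h \<in> hisom" "open V" "V \<noteq> {}" "V \<subseteq> H3" "\<And>u. u \<in> V \<Longrightarrow> g u = h u"
  shows "g = h"
proof
  fix u
  show "g u = h u"
  proof (cases "u \<in> H3")
    case True
    show ?thesis
    proof (rule ch_determines_point)
      show "open (g ` V)" using open_hisom_image assms by blast
      fix w assume "w \<in> g ` V"
      then obtain v where v: "v \<in> V" "w = g v" by auto
      then have "v \<in> H3" using assms by auto
      then show "ch (g u) w = ch (h u) w"
        using v True assms by (metis hisom_ch)
    qed (use assms True in auto)
  qed (simp add: hisom_outside assms(1,2))
qed

lemma isometric_extension:
  assumes "open V" "V \<noteq> {}" "V \<subseteq> H3" "f ` V \<subseteq> H3"
    and iso: "\<And>u v. u \<in> V \<Longrightarrow> v \<in> V \<Longrightarrow> H3_dist (f u) (f v) = H3_dist u v"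
  obtains g where "g \<in> hisom" "\<And>u. u \<in> V \<Longrightarrow> f u = g u"
proof -
  have "ch (f u) (f v) = ch u v" if "u \<in> V" "v \<in> V" for u v
  proof -
    have "u \<in> H3" "v \<in> H3" "f u \<in> H3" "f v \<in> H3" using that assms(3,4) by blast+
    then show ?thesis using iso[OF that] H3_dist_eq_iff by blast
  qed
  then obtain A where A: "A \<in> SL2" "(\<forall>u\<in>V. f u = mob A u) \<or> (\<forall>u\<in>V. f u = mob A (hconj u))"
    using isometric_imp_mob[OF assms(1-4)] by blast
  from A(2) show ?thesis
  proof
    assume "\<forall>u\<in>V. f u = mob A u"
    then show ?thesis using that[of "mob A"] A by auto
  next
    assume "\<forall>u\<in>V. f u = mob A (hconj u)"
    then show ?thesis using that[of "mob A \<circ> hconj"] A by auto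
  qed
qed

section \<open>Geodesics, the triangle inequality and hyperbolic balls\<close>

lemma H3_dist_self [simp]: "p \<in> H3 \<Longrightarrow> H3_dist p p = 0"
  by (simp add: H3_dist_0)

lemma H3_dist_axis:
  "H3_dist (0, exp a) (0, exp b) = \<bar>a - b\<bar>"
proof -
  have "ch (0, exp a) (0, exp b) = cosh (a - b)"
    by (simp add: ch_def cosh_def exp_diff exp_minus field_simps power2_eq_square)
  then have "ch (0, exp a) (0, exp b) = cosh \<bar>a - b\<bar>" by simp
  then show ?thesis by (simp add: H3_dist_ch H3_def arcosh_cosh_real del: cosh_real_abs)
qed

lemma H3_geodesic:
  assumes "p \<in> H3" "q \<in> H3"
  obtains c where "c 0 = p" "c (H3_dist p q) = q" "\<And>s. c s \<in> H3"
    "\<And>s t. H3_dist (c s) (c t) = \<bar>s - t\<bar>" "continuous_on UNIV c"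
proof (cases "p = q")
  case True
  obtain A where A: "A \<in> SL2" "mob A p = (0, 1)" using mob_to_base[OF assms(1)] .
  let ?c = "\<lambda>t. mob (mcof A) (0, exp t)"
  have H: "(0, exp t) \<in> H3" for t by (simp add: H3_def)
  have "mob (mcof A) (mob A p) = p" by (simp only: mob_mob SL2_closed mmul_mcof_SL2 mob_mone A(1))
  then have "?c 0 = p" by (simp only: A(2) exp_zero)
  moreover have "H3_dist (?c s) (?c t) = \<bar>s - t\<bar>" for s t
    using A H by (simp add: hisom_dist H3_dist_axis)
  moreover have "continuous_on UNIV ?c"
    by (intro continuous_on_compose2[OF continuous_on_mob]) (use A H in \<open>auto intro!: continuous_intros\<close>)
  moreover have "H3_dist p q = 0" using True assms by (simp add: H3_dist_0)
  ultimately show ?thesis using True A H by (intro that[of ?c]) (auto simp: mob_in_H3)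
next
  case False
  obtain A s where A: "A \<in> SL2" "mob A p = (0, 1)" "s > 1" "mob A q = (0, s)"
    using mob_normal_form[OF assms False] .
  let ?c = "\<lambda>t. mob (mcof A) (0, exp t)"
  have H: "(0, exp t) \<in> H3" for t by (simp add: H3_def)
  have unA: "mob (mcof A) (mob A u) = u" for u using A by (simp add: mob_mob)
  have "H3_dist p q = H3_dist (mob A p) (mob A q)" using hisom_dist[of "mob A" p q] A assms by simp
  also have "\<dots> = H3_dist (0, exp 0) (0, exp (ln s))" using A by simp
  also have "\<dots> = ln s" unfolding H3_dist_axis using A(3) by simp
  finally have "?c (H3_dist p q) = q" using A(3,4) unA[of q] by simp
  moreover have "?c 0 = p" using A unA[of p] by simp
  moreover have "H3_dist (?c s) (?c t) = \<bar>s - t\<bar>" for s t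
    using A H by (simp add: hisom_dist H3_dist_axis)
  moreover have "continuous_on UNIV ?c"
    by (intro continuous_on_compose2[OF continuous_on_mob]) (use A H in \<open>auto intro!: continuous_intros\<close>)
  ultimately show ?thesis using A H by (intro that[of ?c]) (auto simp: mob_in_H3)
qed

text \<open>The middle point is at (0, 1) and the first point on the axis above it. For a fixed
  distance \<open>b\<close> from (0, 1) to \<open>q\<close>, the hyperbolic cosine of the distance
  from the first point decreases in the height of \<open>q\<close>. That height is at least
  \<open>exp (- b)\<close>, where the value is \<open>cosh (a + b)\<close>.\<close>

lemma H3_triangle_normalized:
  assumes "s > 1" "q \<in> H3"
  shows "H3_dist (0, s) q \<le> H3_dist (0, s) (0, 1) + H3_dist (0, 1) q"
proof -
  obtain z t where q: "q = (z, t)" by (cases q)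
  have t: "t > 0" using assms by (simp add: H3_def q)
  define a b where "a = ln s" and "b = H3_dist (0, 1) q"
  have sH: "(0, s) \<in> H3" using assms by (simp add: H3_def)
  have a: "exp a = s" "a > 0" "H3_dist (0, s) (0, 1) = a"
    using assms H3_dist_axis[of a 0] by (auto simp: a_def)
  have b: "b \<ge> 0" "cosh b = ((cmod z)\<^sup>2 + t\<^sup>2 + 1) / (2 * t)"
    using assms by (auto simp: b_def H3_dist_nonneg cosh_H3_dist ch_def q algebra_simps)
  have tc: "(cmod z)\<^sup>2 = 2 * t * cosh b - t\<^sup>2 - 1" using b t by (simp add: field_simps)
  then have "t\<^sup>2 + 1 \<le> 2 * t * cosh b" by (smt (verit) zero_le_power2)
  then have "t\<^sup>2 + 1 \<le> t * (exp b + exp (- b))" by (simp add: cosh_def)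
  moreover have "exp b * exp (- b) = 1" by (simp add: exp_minus)
  ultimately have "(t - exp b) * (t - exp (- b)) \<le> 0" by (simp add: algebra_simps power2_eq_square)
  moreover have "exp (- b) \<le> exp b" using b by simp
  ultimately have "t \<ge> exp (- b)"
    by (smt (verit) mult_pos_pos mult_neg_neg)
  then have t1: "1 / t \<le> exp b" using t by (simp add: exp_minus field_simps)
  have "ch (0, s) q = ((cmod z)\<^sup>2 + s\<^sup>2 + t\<^sup>2) / (2 * s * t)"
    by (simp add: ch_def q)
  also have "\<dots> = cosh b / s + (s - 1 / s) / 2 * (1 / t)"
    unfolding tc using t assms by (simp add: field_simps power2_eq_square)
  also have "\<dots> \<le> cosh b / s + (s - 1 / s) / 2 * exp b"
    using t1 assms by (intro add_left_mono mult_left_mono) (auto simp: field_simps less_1_mult[THEN less_imp_le])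
  also have "\<dots> = cosh (a + b)"
    unfolding a(1)[symmetric] by (simp add: cosh_def exp_add exp_minus exp_diff field_simps)
  finally have "H3_dist (0, s) q \<le> arcosh (cosh (a + b))"
    using ch_ge_1[OF sH assms(2)] arcosh_less_iff_real[of "cosh (a + b)" "ch (0, s) q"]
    by (auto simp: H3_dist_ch sH assms not_less[symmetric] simp del: arcosh_less_iff_real)
  then show ?thesis using a b by (simp add: arcosh_cosh_real b_def[symmetric])
qed

lemma H3_triangle:
  assumes "p \<in> H3" "o' \<in> H3" "q \<in> H3"
  shows "H3_dist p q \<le> H3_dist p o' + H3_dist o' q"
proof (cases "p = o'")
  case True then show ?thesis using assms by (simp add: H3_dist_0 H3_dist_nonneg)
next
  case False
  then obtain A s where A: "A \<in> SL2" "mob A o' = (0, 1)" "s > 1" "mob A p = (0, s)"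
    using mob_normal_form[OF assms(2,1)] by metis
  then show ?thesis
    using H3_triangle_normalized[OF A(3), of "mob A q"] assms
    by (metis hisom_dist mob_hisom mob_in_H3)
qed

definition hball :: "complex \<times> real \<Rightarrow> real \<Rightarrow> (complex \<times> real) set" where
  "hball p r = {q \<in> H3. H3_dist p q < r}"

text \<open>Completing the square with cosh^2 = 1 + sinh^2. Euclidean roundness matters later:
  hyperbolic balls and their intersections are convex subsets of a vector space, hence
  connected.\<close>

lemma hball_eq_ball:
  assumes "p \<in> H3" "r > 0"
  shows "hball p r = ball (fst p, snd p * cosh r) (snd p * sinh r)"
proof -
  obtain z t where p: "p = (z, t)" by (cases p)
  have t: "t > 0" using assms by (simp add: H3_def p)
  have sh: "sinh r > 0" "sinh r < cosh r" "(cosh r)\<^sup>2 = 1 + (sinh r)\<^sup>2"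
    using assms by (auto simp: sinh_less_cosh_real cosh_square_eq)
  have "(w, s) \<in> hball p r \<longleftrightarrow> (w, s) \<in> ball (z, t * cosh r) (t * sinh r)" for w s
  proof -
    have "(w, s) \<in> ball (z, t * cosh r) (t * sinh r) \<longleftrightarrow> (dist (z, t * cosh r) (w, s))\<^sup>2 < (t * sinh r)\<^sup>2"
      using t sh by (auto intro: power2_less_imp_less power_strict_mono)
    also have "\<dots> \<longleftrightarrow> (cmod (z - w))\<^sup>2 + (t * cosh r - s)\<^sup>2 < (t * sinh r)\<^sup>2"
      by (simp add: dist_Pair_Pair dist_norm[where x="_::complex"] dist_real_def)
    also have "\<dots> \<longleftrightarrow> (cmod (z - w))\<^sup>2 + t\<^sup>2 + s\<^sup>2 < 2 * t * s * cosh r"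
      unfolding power_mult_distrib power2_diff sh(3) by (simp add: algebra_simps)
    finally have *: "(w, s) \<in> ball (z, t * cosh r) (t * sinh r) \<longleftrightarrow> (cmod (z - w))\<^sup>2 + t\<^sup>2 + s\<^sup>2 < 2 * t * s * cosh r" .
    show ?thesis
    proof (cases "s > 0")
      case True
      then have "(w, s) \<in> H3" by (simp add: H3_def)
      then have "(w, s) \<in> hball p r \<longleftrightarrow> ch (z, t) (w, s) < cosh r"
        using assms by (simp add: hball_def H3_dist_less_iff p)
      also have "\<dots> \<longleftrightarrow> (cmod (z - w))\<^sup>2 + t\<^sup>2 + s\<^sup>2 < 2 * t * s * cosh r"
        using True t by (simp add: ch_def divide_less_eq ac_simps)
      finally show ?thesis using * by simp
    next
      case False
      then have "2 * t * s * cosh r \<le> 0" using t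
        by (intro mult_nonpos_nonneg mult_nonneg_nonpos) auto
      moreover have "(cmod (z - w))\<^sup>2 + t\<^sup>2 + s\<^sup>2 > 0" using t by (simp add: add_nonneg_pos add_pos_nonneg)
      ultimately have "\<not> (cmod (z - w))\<^sup>2 + t\<^sup>2 + s\<^sup>2 < 2 * t * s * cosh r" by linarith
      then show ?thesis using * False by (simp add: hball_def H3_def)
    qed
  qed
  then show ?thesis unfolding p by auto
qed

lemma hball_empty: "p \<in> H3 \<Longrightarrow> r \<le> 0 \<Longrightarrow> hball p r = {}"
  using H3_dist_nonneg[of p] by (fastforce simp: hball_def)

lemma open_hball [simp]: "p \<in> H3 \<Longrightarrow> open (hball p r)"
  by (cases "r > 0") (auto simp: hball_eq_ball hball_empty)

lemma convex_hball: "p \<in> H3 \<Longrightarrow> convex (hball p r)"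
  by (cases "r > 0") (auto simp: hball_eq_ball hball_empty)

lemma convex_H3: "convex H3"
proof -
  have "H3 = {w. inner (0, 1) w > (0::real)}" by (auto simp: H3_def inner_prod_def)
  then show ?thesis using convex_halfspace_gt by metis
qed

lemma hball_H3: "hball p r \<subseteq> H3" by (auto simp: hball_def)

lemma centre_hball [simp]: "p \<in> H3 \<Longrightarrow> r > 0 \<Longrightarrow> p \<in> hball p r"
  by (simp add: hball_def H3_dist_0)

lemma hball_subset_open:
  assumes "open V" "q \<in> V" "q \<in> H3"
  obtains e where "e > 0" "hball q e \<subseteq> V"
proof -
  obtain d where d: "d > 0" "ball q d \<subseteq> V" using assms open_contains_ball by blast
  obtain z t where q: "q = (z, t)" by (cases q)
  have t: "t > 0" using assms by (simp add: H3_def q)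
  \<comment> \<open>The point of the sphere of radius \<open>e\<close> that is farthest from
    \<open>q\<close> in the Euclidean sense is the topmost one, at height \<open>t * exp e\<close>,
    so at distance exactly \<open>d\<close>.\<close>
  define e where "e = ln (1 + d / t)"
  have e: "e > 0" "exp e = 1 + d / t" using d t by (auto simp: e_def add_pos_pos)
  have "hball q e \<subseteq> ball q d"
  proof
    fix u assume "u \<in> hball q e"
    then have u: "dist (z, t * cosh e) u < t * sinh e"
      using hball_eq_ball[OF assms(3) e(1)] q by simp
    have "t * cosh e \<ge> t" using t cosh_real_ge_1[of e] by simp
    then have d1: "dist q (z, t * cosh e) = t * cosh e - t"
      using t by (simp add: q dist_Pair_Pair dist_real_def)
    have "dist q u \<le> dist q (z, t * cosh e) + dist (z, t * cosh e) u" by (rule dist_triangle)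
    also have "dist q (z, t * cosh e) + dist (z, t * cosh e) u < t * (cosh e + sinh e) - t"
      using u d1 by (simp add: algebra_simps)
    also have "\<dots> = d" unfolding cosh_plus_sinh e(2) using t by (simp add: field_simps)
    finally show "u \<in> ball q d" by simp
  qed
  then show ?thesis using d that e by blast
qed

lemma hisom_hball: "g \<in> hisom \<Longrightarrow> p \<in> H3 \<Longrightarrow> g ` hball p r = hball (g p) r"
proof (intro equalityI subsetI)
  fix u assume g: "g \<in> hisom" "p \<in> H3" "u \<in> hball (g p) r"
  then have "hinv g u \<in> hball p r"
    using hisom_dist[of "hinv g" "g p" u] by (simp add: hball_def)
  moreover have "u = g (hinv g u)" using g by simp
  ultimately show "u \<in> g ` hball p r" by blast
qed (auto simp: hball_def hisom_dist)

section \<open>Developing maps of complete hyperbolic manifolds\<close>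

lemma hball_mono: "r \<le> r' \<Longrightarrow> hball p r \<subseteq> hball p r'"
  by (auto simp: hball_def)

locale hyperbolic_manifold = Metric_space X d for X :: "'a::euclidean_space set" and d +
  assumes mtopology_eq: "mtopology = top_of_set X"
    and charts: "\<And>x. x \<in> X \<Longrightarrow> \<exists>U \<phi>. x \<in> U \<and> hyperbolic_chart X d U \<phi>"
    and complete: "mcomplete"
begin

text \<open>The inverse of a chart centred at \<open>y\<close>, cut down so that its image is a
  whole metric ball; concentric balls of \<open>H3\<close> and of the manifold then correspond
  radius by radius.\<close>

definition isometric_ball :: "'a \<Rightarrow> real \<Rightarrow> complex \<times> real \<Rightarrow> (complex \<times> real \<Rightarrow> 'a) \<Rightarrow> bool" where
  "isometric_ball y r c s \<longleftrightarrow> y \<in> X \<and> c \<in> H3 \<and> r > 0 \<and> s c = y \<and> s ` hball c r = mball y r \<and>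
    (\<forall>u\<in>hball c r. \<forall>v\<in>hball c r. d (s u) (s v) = H3_dist u v)"

lemma ex_isometric_ball:
  assumes "y \<in> X" obtains r c s where "isometric_ball y r c s"
proof -
  obtain U \<phi> where y: "y \<in> U" and U: "openin (top_of_set X) U" "\<phi> ` U \<subseteq> H3" "open (\<phi> ` U)"
    and iso: "\<And>a b. a \<in> U \<Longrightarrow> b \<in> U \<Longrightarrow> H3_dist (\<phi> a) (\<phi> b) = d a b"
    using charts[OF assms] unfolding hyperbolic_chart_def by blast
  have UX: "U \<subseteq> X" using U(1) openin_imp_subset by blast
  have yH: "\<phi> y \<in> H3" using U(2) y by blast
  obtain e1 where e1: "e1 > 0" "hball (\<phi> y) e1 \<subseteq> \<phi> ` U"
    using hball_subset_open[OF U(3)] y yH by blast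
  obtain e2 where e2: "e2 > 0" "mball y e2 \<subseteq> U"
    using U(1) y unfolding mtopology_eq[symmetric] openin_mtopology by blast
  define r where "r = min e1 e2"
  have inj: "inj_on \<phi> U"
  proof (rule inj_onI)
    fix a b assume ab: "a \<in> U" "b \<in> U" "\<phi> a = \<phi> b"
    then have "d a b = 0" using iso[OF ab(1,2)] U(2) by auto
    then show "a = b" using ab UX zero[of a b] by blast
  qed
  define s where "s = inv_into U \<phi>"
  have s: "s u \<in> U" "\<phi> (s u) = u" if "u \<in> hball (\<phi> y) r" for u
  proof -
    have "u \<in> \<phi> ` U" using that e1 by (auto simp: hball_def r_def)
    then show "s u \<in> U" "\<phi> (s u) = u" by (simp_all add: s_def inv_into_into f_inv_into_f)
  qed
  have s': "s (\<phi> w) = w" if "w \<in> U" for w using that inj by (simp add: s_def)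
  have "isometric_ball y r (\<phi> y) s"
    unfolding isometric_ball_def
  proof (intro conjI ballI)
    show "s ` hball (\<phi> y) r = mball y r"
    proof (intro equalityI subsetI)
      fix w assume "w \<in> s ` hball (\<phi> y) r"
      then obtain u where u: "u \<in> hball (\<phi> y) r" "w = s u" by blast
      then have "d y w = H3_dist (\<phi> y) u" using iso[of y "s u"] s[of u] y by simp
      then show "w \<in> mball y r" using u s[of u] UX assms by (auto simp: hball_def)
    next
      fix w assume w: "w \<in> mball y r"
      then have "w \<in> U" using e2 by (auto simp: r_def)
      moreover from this have "\<phi> w \<in> hball (\<phi> y) r"
        using w iso[OF y \<open>w \<in> U\<close>] U(2) by (auto simp: hball_def)
      ultimately show "w \<in> s ` hball (\<phi> y) r" using s' by (metis image_eqI)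
    qed
    fix u v assume "u \<in> hball (\<phi> y) r" "v \<in> hball (\<phi> y) r"
    then show "d (s u) (s v) = H3_dist u v" using iso[of "s u" "s v"] s by simp
  qed (use assms yH e1 e2 s'[OF y] in \<open>auto simp: r_def\<close>)
  then show ?thesis by (rule that)
qed

lemma isometric_ball_inj:
  assumes "isometric_ball y r c s" shows "inj_on s (hball c r)"
proof (rule inj_onI)
  fix u v assume uv: "u \<in> hball c r" "v \<in> hball c r" "s u = s v"
  have "s u \<in> mball y r" using uv assms unfolding isometric_ball_def by blast
  then have "d (s u) (s v) = 0" using uv(3) by simp
  then have "H3_dist u v = 0" using uv(1,2) assms unfolding isometric_ball_def by metis
  then show "u = v" using uv by (simp add: hball_def H3_dist_0)
qed

section \<open>Local isometries and their unique continuation\<close>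

definition liso :: "(complex \<times> real) set \<Rightarrow> (complex \<times> real \<Rightarrow> 'a) \<Rightarrow> bool" where
  "liso C F \<longleftrightarrow> open C \<and> C \<subseteq> H3 \<and> F ` C \<subseteq> X \<and>
    (\<forall>q\<in>C. \<exists>e>0. hball q e \<subseteq> C \<and> (\<forall>u\<in>hball q e. \<forall>v\<in>hball q e. d (F u) (F v) = H3_dist u v))"

lemma liso_X: "liso C F \<Longrightarrow> u \<in> C \<Longrightarrow> F u \<in> X"
  and liso_H3: "liso C F \<Longrightarrow> C \<subseteq> H3"
  and liso_open: "liso C F \<Longrightarrow> open C"
  unfolding liso_def by blast+

lemma lisoE:
  assumes "liso C F" "q \<in> C"
  obtains e where "e > 0" "hball q e \<subseteq> C"
    "\<And>u v. u \<in> hball q e \<Longrightarrow> v \<in> hball q e \<Longrightarrow> d (F u) (F v) = H3_dist u v"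
proof -
  have "\<exists>e>0. hball q e \<subseteq> C \<and> (\<forall>u\<in>hball q e. \<forall>v\<in>hball q e. d (F u) (F v) = H3_dist u v)"
    using assms by (simp add: liso_def)
  then obtain e where e: "e > 0" "hball q e \<subseteq> C"
    "\<forall>u\<in>hball q e. \<forall>v\<in>hball q e. d (F u) (F v) = H3_dist u v"
    by (elim exE conjE)
  show ?thesis by (rule that[OF e(1,2)]) (simp add: e(3))
qed

lemma liso_subset:
  assumes "liso C F" "open C'" "C' \<subseteq> C" "\<And>u. u \<in> C' \<Longrightarrow> F' u = F u" shows "liso C' F'"
  unfolding liso_def
proof (intro conjI ballI)
  show "C' \<subseteq> H3" using liso_H3[OF assms(1)] assms(3) by blast
  show "F' ` C' \<subseteq> X" using liso_X[OF assms(1)] assms(3,4) by auto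
  fix q assume q: "q \<in> C'"
  then have qC: "q \<in> C" "q \<in> H3" using assms(3) liso_H3[OF assms(1)] by blast+
  obtain e where e: "e > 0" "\<And>u v. u \<in> hball q e \<Longrightarrow> v \<in> hball q e \<Longrightarrow> d (F u) (F v) = H3_dist u v"
    using lisoE[OF assms(1) qC(1)] by metis
  obtain e' where e': "e' > 0" "hball q e' \<subseteq> C'" using hball_subset_open[OF assms(2) q qC(2)] .
  show "\<exists>e>0. hball q e \<subseteq> C' \<and> (\<forall>u\<in>hball q e. \<forall>v\<in>hball q e. d (F' u) (F' v) = H3_dist u v)"
  proof (intro exI[of _ "min e e'"] conjI ballI)
    have sub: "hball q (min e e') \<subseteq> hball q e" "hball q (min e e') \<subseteq> hball q e'"
      by (intro hball_mono; simp)+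
    show "hball q (min e e') \<subseteq> C'" using e'(2) sub by blast
    fix u v assume uv: "u \<in> hball q (min e e')" "v \<in> hball q (min e e')"
    then have "u \<in> C'" "v \<in> C'" using e' sub by blast+
    moreover have "d (F u) (F v) = H3_dist u v" using e(2)[of u v] uv sub by blast
    ultimately show "d (F' u) (F' v) = H3_dist u v" using assms(4) by simp
  qed (use e e' in auto)
qed (fact assms(2))

lemma liso_local:
  assumes "open C" "\<And>q. q \<in> C \<Longrightarrow> \<exists>C'. q \<in> C' \<and> C' \<subseteq> C \<and> liso C' F"
  shows "liso C F"
  unfolding liso_def
proof (intro conjI ballI)
  show "C \<subseteq> H3" "F ` C \<subseteq> X" using assms(2) unfolding liso_def by blast+
  fix q assume "q \<in> C"
  then obtain C' where C': "q \<in> C'" "C' \<subseteq> C" "liso C' F" using assms(2) by blast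
  then show "\<exists>e>0. hball q e \<subseteq> C \<and> (\<forall>u\<in>hball q e. \<forall>v\<in>hball q e. d (F u) (F v) = H3_dist u v)"
    unfolding liso_def by (meson order_trans)
qed (fact assms(1))

lemma liso_isometric_ball:
  assumes "isometric_ball y r c s" shows "liso (hball c r) s"
  unfolding liso_def
proof (intro conjI ballI)
  have c: "c \<in> H3" using assms by (simp add: isometric_ball_def)
  then show o: "open (hball c r)" by simp
  show "hball c r \<subseteq> H3" by (rule hball_H3)
  show "s ` hball c r \<subseteq> X" using assms by (auto simp: isometric_ball_def)
  fix q assume q: "q \<in> hball c r"
  then have "q \<in> H3" by (simp add: hball_def)
  then obtain e where e: "e > 0" "hball q e \<subseteq> hball c r" using hball_subset_open[OF o q] by blast
  then show "\<exists>e>0. hball q e \<subseteq> hball c r \<and> (\<forall>u\<in>hball q e. \<forall>v\<in>hball q e. d (s u) (s v) = H3_dist u v)"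
    using assms unfolding isometric_ball_def by (meson subsetD)
qed

lemma liso_hisom:
  assumes "liso C F" "g \<in> hisom" shows "liso (hinv g ` C) (F \<circ> g)"
  unfolding liso_def
proof (intro conjI ballI)
  have C: "open C" "C \<subseteq> H3" "F ` C \<subseteq> X" using assms(1) unfolding liso_def by blast+
  show "open (hinv g ` C)" using open_hisom_image[OF inv_hisom] assms C by blast
  show "hinv g ` C \<subseteq> H3" using C assms by auto
  show "(F \<circ> g) ` hinv g ` C \<subseteq> X" using C assms by auto
  fix q assume "q \<in> hinv g ` C"
  then have q: "g q \<in> C" "g q \<in> H3" "q \<in> H3" using assms C by auto
  then obtain e where e: "e > 0" "hball (g q) e \<subseteq> C"
    "\<And>u v. u \<in> hball (g q) e \<Longrightarrow> v \<in> hball (g q) e \<Longrightarrow> d (F u) (F v) = H3_dist u v"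
    using lisoE[OF assms(1) q(1)] by metis
  have gb: "g ` hball q e = hball (g q) e" using hisom_hball assms q by blast
  show "\<exists>e>0. hball q e \<subseteq> hinv g ` C \<and> (\<forall>u\<in>hball q e. \<forall>v\<in>hball q e. d ((F \<circ> g) u) ((F \<circ> g) v) = H3_dist u v)"
  proof (intro exI[of _ e] conjI ballI)
    show "hball q e \<subseteq> hinv g ` C"
    proof
      fix u assume "u \<in> hball q e"
      then have "g u \<in> C" using gb e by blast
      moreover have "u = hinv g (g u)" using assms by simp
      ultimately show "u \<in> hinv g ` C" by blast
    qed
    fix u v assume uv: "u \<in> hball q e" "v \<in> hball q e"
    then have "g u \<in> hball (g q) e" "g v \<in> hball (g q) e" "u \<in> H3" "v \<in> H3" using gb by (auto simp: hball_def)
    then show "d ((F \<circ> g) u) ((F \<circ> g) v) = H3_dist u v"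
      using e(3)[of "g u" "g v"] hisom_dist[OF assms(2), of u v] by simp
  qed (fact e)
qed

text \<open>Read in the chart, \<open>F\<close> preserves distances near \<open>q\<close>, and by
  rigidity such a map on an open set is the restriction of one isometry \<open>g\<close> of all of
  \<open>H3\<close>. This global \<open>g\<close> is what lets local information spread.\<close>

lemma liso_chart:
  assumes F: "liso C F" "q \<in> C" and s: "isometric_ball y r c s" "F q \<in> mball y r"
  obtains e g where "e > 0" "g \<in> hisom" "hball q e \<subseteq> C"
    "\<And>u. u \<in> hball q e \<Longrightarrow> g u \<in> hball c r \<and> F u = s (g u)"
proof -
  have qH: "q \<in> H3" using liso_H3[OF F(1)] F(2) by blast
  obtain e1 where e1: "e1 > 0" "hball q e1 \<subseteq> C"
    "\<And>u v. u \<in> hball q e1 \<Longrightarrow> v \<in> hball q e1 \<Longrightarrow> d (F u) (F v) = H3_dist u v"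
    using lisoE[OF F] by metis
  define e where "e = min e1 (r - d y (F q))"
  have e: "e > 0" using e1 s by (simp add: e_def)
  have sub: "hball q e \<subseteq> hball q e1" unfolding e_def by (intro hball_mono) simp
  have FX: "F ` C \<subseteq> X" using liso_X[OF F(1)] by blast
  have Fb: "F u \<in> mball y r" if u: "u \<in> hball q e" for u
  proof -
    have "u \<in> hball q e1" "q \<in> hball q e1" using u sub e1 qH by auto
    then have "d (F q) (F u) = H3_dist q u" using e1(3) by blast
    then have "d (F q) (F u) < e" using u by (simp add: hball_def)
    moreover have "F u \<in> X" using e1(2) u sub liso_X[OF F(1)] by blast
    ultimately show ?thesis using s(2) triangle[of y "F q" "F u"] by (auto simp: e_def)
  qed
  define h where "h u = inv_into (hball c r) s (F u)" for u
  have h: "h u \<in> hball c r" "s (h u) = F u" if "u \<in> hball q e" for u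
  proof -
    have "F u \<in> s ` hball c r" using Fb[OF that] s by (simp add: isometric_ball_def)
    then show "h u \<in> hball c r" "s (h u) = F u" by (simp_all add: h_def inv_into_into f_inv_into_f)
  qed
  have "H3_dist (h u) (h v) = H3_dist u v" if "u \<in> hball q e" "v \<in> hball q e" for u v
    using h[OF that(1)] h[OF that(2)] e1(3)[of u v] that sub s(1) unfolding isometric_ball_def
    by (metis subsetD)
  moreover have "h ` hball q e \<subseteq> H3" using h hball_H3 by blast
  moreover have "open (hball q e)" "hball q e \<noteq> {}" "hball q e \<subseteq> H3" using open_hball[OF qH] centre_hball[OF qH e] hball_H3 by blast+
  ultimately obtain g where "g \<in> hisom" "\<And>u. u \<in> hball q e \<Longrightarrow> h u = g u"
    using isometric_extension[of "hball q e" h] by blast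
  then show ?thesis using that[OF e, of g] h sub e1(2) by force
qed

text \<open>Near \<open>q\<close> both maps are the same inverse chart preceded by isometries of
  \<open>H3\<close>, and these isometries coincide once they agree on some nonempty open set. This
  is the local step of \<open>liso_identity\<close>.\<close>

lemma liso_eq_nbhd:
  assumes F: "liso C F" "liso C F'" and q: "q \<in> C" "F q = F' q"
  obtains e where "e > 0" "hball q e \<subseteq> C"
    "\<And>V. open V \<Longrightarrow> V \<noteq> {} \<Longrightarrow> V \<subseteq> hball q e \<Longrightarrow> (\<And>u. u \<in> V \<Longrightarrow> F u = F' u) \<Longrightarrow>
      (\<And>u. u \<in> hball q e \<Longrightarrow> F u = F' u)"
proof -
  have FX: "F q \<in> X" using liso_X[OF F(1)] q by blast
  obtain r c s where s: "isometric_ball (F q) r c s" using ex_isometric_ball[OF FX] .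
  then have b: "F q \<in> mball (F q) r" "F' q \<in> mball (F q) r" using q by (auto simp: isometric_ball_def)
  obtain e1 g where 1: "e1 > 0" "g \<in> hisom" "hball q e1 \<subseteq> C"
    "\<And>u. u \<in> hball q e1 \<Longrightarrow> g u \<in> hball c r \<and> F u = s (g u)"
    using liso_chart[OF F(1) q(1) s b(1)] by metis
  obtain e2 g' where 2: "e2 > 0" "g' \<in> hisom" "hball q e2 \<subseteq> C"
    "\<And>u. u \<in> hball q e2 \<Longrightarrow> g' u \<in> hball c r \<and> F' u = s (g' u)"
    using liso_chart[OF F(2) q(1) s b(2)] by metis
  define e where "e = min e1 e2"
  have sub: "hball q e \<subseteq> hball q e1" "hball q e \<subseteq> hball q e2" unfolding e_def by (intro hball_mono; simp)+
  show ?thesis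
  proof (rule that[of e])
    show "e > 0" using 1 2 by (simp add: e_def)
    show "hball q e \<subseteq> C" using sub 1 by blast
    fix V u assume V: "open V" "V \<noteq> {}" "V \<subseteq> hball q e" "\<And>u. u \<in> V \<Longrightarrow> F u = F' u" and u: "u \<in> hball q e"
    have "g = g'"
    proof (rule hisom_eqI[OF 1(2) 2(2) V(1,2)])
      show "V \<subseteq> H3" using V hball_H3 by blast
      fix v assume v: "v \<in> V"
      then have v': "v \<in> hball q e1" "v \<in> hball q e2" using V sub by blast+
      then have "s (g v) = s (g' v)" using 1(4) 2(4) V(4)[OF v] by metis
      then show "g v = g' v" using isometric_ball_inj[OF s] 1(4)[OF v'(1)] 2(4)[OF v'(2)]
        by (meson inj_onD)
    qed
    moreover have "u \<in> hball q e1" "u \<in> hball q e2" using u sub by blast+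
    ultimately show "F u = F' u" using 1(4)[of u] 2(4)[of u] by simp
  qed
qed

lemma liso_continuous_at:
  assumes "liso C F" "q \<in> C" "\<eta> > 0"
  obtains e where "e > 0" "hball q e \<subseteq> C" "\<And>u. u \<in> hball q e \<Longrightarrow> d (F q) (F u) < \<eta>"
proof -
  obtain e where e: "e > 0" "hball q e \<subseteq> C"
    "\<And>u v. u \<in> hball q e \<Longrightarrow> v \<in> hball q e \<Longrightarrow> d (F u) (F v) = H3_dist u v"
    using lisoE[OF assms(1,2)] by metis
  have "q \<in> H3" using liso_H3[OF assms(1)] assms(2) by blast
  then have qe: "q \<in> hball q e" using e by simp
  show ?thesis
  proof (rule that[of "min e \<eta>"])
    fix u assume "u \<in> hball q (min e \<eta>)"
    then have "u \<in> hball q e" "H3_dist q u < \<eta>" by (auto simp: hball_def)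
    then show "d (F q) (F u) < \<eta>" using e(3)[OF qe] by simp
  qed (use e(1,2) assms(3) hball_mono[of "min e \<eta>" e q] in auto)
qed

text \<open>Continuation by connectedness of the property of agreeing near a point. Where the two
  values are equal, \<open>liso_eq_nbhd\<close> makes this property locally constant; where they
  differ, continuity keeps them different nearby.\<close>

lemma liso_identity:
  assumes F: "liso C F" "liso C F'" and "connected C"
    and V: "open V" "V \<noteq> {}" "V \<subseteq> C" "\<And>u. u \<in> V \<Longrightarrow> F u = F' u"
    and u: "u \<in> C"
  shows "F u = F' u"
proof -
  define P where "P a \<longleftrightarrow> (\<exists>V. open V \<and> a \<in> V \<and> V \<subseteq> C \<and> (\<forall>u\<in>V. F u = F' u))" for a
  obtain v where v: "v \<in> V" using V by blast
  have CH: "C \<subseteq> H3" "open C" using liso_H3[OF F(1)] liso_open[OF F(1)] by blast+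
  have "P u"
  proof (rule connected_induction_simple[OF \<open>connected C\<close>, of v u P])
    show "v \<in> C" "P v" using v V by (auto simp: P_def)
    fix a assume a: "a \<in> C"
    then have aH: "a \<in> H3" using CH by blast
    show "\<exists>T. openin (top_of_set C) T \<and> a \<in> T \<and> (\<forall>x\<in>T. \<forall>y\<in>T. P x \<longrightarrow> P y)"
    proof (cases "F a = F' a")
      case True
      obtain e where e: "e > 0" "hball a e \<subseteq> C"
        "\<And>V u. open V \<Longrightarrow> V \<noteq> {} \<Longrightarrow> V \<subseteq> hball a e \<Longrightarrow> (\<And>u. u \<in> V \<Longrightarrow> F u = F' u) \<Longrightarrow>
          u \<in> hball a e \<Longrightarrow> F u = F' u"
        using liso_eq_nbhd[OF F a True] by metis
      have "P y" if xy: "x \<in> hball a e" "y \<in> hball a e" "P x" for x y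
      proof -
        obtain V where "open V" "x \<in> V" "V \<subseteq> C" "\<forall>u\<in>V. F u = F' u" using xy(3) by (auto simp: P_def)
        then have V: "open (V \<inter> hball a e)" "V \<inter> hball a e \<noteq> {}" "V \<inter> hball a e \<subseteq> hball a e"
          "\<And>u. u \<in> V \<inter> hball a e \<Longrightarrow> F u = F' u" using xy(1) aH by (blast intro: open_Int open_hball)+
        have "F u = F' u" if "u \<in> hball a e" for u
          using e(3)[OF V that] .
        then show "P y" unfolding P_def using xy(2) aH e(2) by (intro exI[of _ "hball a e"]) auto
      qed
      moreover have "openin (top_of_set C) (hball a e)" using e(2) open_hball[OF aH] by (rule open_subset)
      ultimately show ?thesis using centre_hball[OF aH e(1)] by blast
    next
      case False
      have FX: "F a \<in> X" "F' a \<in> X" using liso_X F a by blast+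
      define \<eta> where "\<eta> = d (F a) (F' a) / 2"
      have \<eta>: "\<eta> > 0" using False FX by (simp add: \<eta>_def)
      obtain e1 where e1: "e1 > 0" "hball a e1 \<subseteq> C" "\<And>u. u \<in> hball a e1 \<Longrightarrow> d (F a) (F u) < \<eta>"
        using liso_continuous_at[OF F(1) a \<eta>] by metis
      obtain e2 where e2: "e2 > 0" "hball a e2 \<subseteq> C" "\<And>u. u \<in> hball a e2 \<Longrightarrow> d (F' a) (F' u) < \<eta>"
        using liso_continuous_at[OF F(2) a \<eta>] by metis
      define e where "e = min e1 e2"
      have sub: "hball a e \<subseteq> hball a e1" "hball a e \<subseteq> hball a e2" unfolding e_def by (intro hball_mono; simp)+
      have "\<not> P x" if x: "x \<in> hball a e" for x
      proof
        assume "P x"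
        then have eq: "F x = F' x" by (auto simp: P_def)
        have "x \<in> C" using x sub e1 by blast
        then have "F x \<in> X" using liso_X[OF F(1)] by blast
        then have "d (F a) (F' a) < \<eta> + \<eta>"
          using triangle[OF FX(1) _ FX(2), of "F x"] e1(3)[of x] e2(3)[of x] x sub eq commute[of "F' a" "F' x"]
          by (smt (verit) subsetD)
        then show False by (simp add: \<eta>_def)
      qed
      moreover have "e > 0" using e1(1) e2(1) by (simp add: e_def)
      moreover have "hball a e \<subseteq> C" using sub e1(2) by blast
      then have "openin (top_of_set C) (hball a e)" using open_hball[OF aH] by (rule open_subset)
      ultimately show ?thesis using centre_hball[OF aH \<open>e > 0\<close>] by blast
    qed
  qed (fact u)
  then show ?thesis by (auto simp: P_def)
qed

text \<open>On short pieces of the geodesic the map is isometric, and the triangle inequality adds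
  the pieces up. It yields the Cauchy property of images along a geodesic that runs to the boundary
  of the domain.\<close>

lemma liso_geodesic_lipschitz:
  assumes F: "liso C F" and c: "\<And>s t. H3_dist (c s) (c t) = \<bar>s - t\<bar>" "\<And>s. c s \<in> H3"
    and ab: "a \<le> b" "\<And>t. a \<le> t \<Longrightarrow> t \<le> b \<Longrightarrow> c t \<in> C"
  shows "d (F (c a)) (F (c b)) \<le> b - a"
proof -
  have X: "F (c t) \<in> X" if "a \<le> t" "t \<le> b" for t using liso_X[OF F] ab(2)[OF that] by blast
  define P where "P s t \<longleftrightarrow> (a \<le> s \<and> s \<le> t \<and> t \<le> b \<longrightarrow> d (F (c s)) (F (c t)) \<le> t - s)" for s t
  have "P a b" using ab(1)
  proof (induction rule: Bolzano)
    case (trans s t u)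
    then show ?case using triangle[of "F (c s)" "F (c t)" "F (c u)"] X[of s] X[of t] X[of u]
      unfolding P_def by auto
  next
    case (local x)
    then obtain e where e: "e > 0"
      "\<And>u v. u \<in> hball (c x) e \<Longrightarrow> v \<in> hball (c x) e \<Longrightarrow> d (F u) (F v) = H3_dist u v"
      using lisoE[OF F ab(2)[OF local]] by metis
    show ?case
    proof (intro exI[of _ e] conjI allI impI)
      fix s t assume st: "s \<le> x \<and> x \<le> t \<and> t - s < e"
      then have "c s \<in> hball (c x) e" "c t \<in> hball (c x) e" using c by (auto simp: hball_def)
      then show "P s t" unfolding P_def using e(2) c st by auto
    qed (fact e)
  qed
  then show ?thesis using ab by (simp add: P_def)
qed

text \<open>The closed Euclidean ball is contained in every hyperbolic ball of larger radius about
  the same point: cosh - sinh = exp (- R) is decreasing, so the room gained by the radius exceeds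
  the displacement of the Euclidean centre.\<close>

lemma hcball_limit:
  assumes "o' \<in> H3" "R > 0" "q \<in> cball (fst o', snd o' * cosh R) (snd o' * sinh R)"
  shows "q \<in> H3" "H3_dist o' q \<le> R"
proof -
  have t: "snd o' > 0" using assms by (simp add: H3_def)
  have *: "q \<in> hball o' r" if "r > R" for r
  proof -
    have r: "r > 0" using that assms by simp
    have cs: "cosh R \<le> cosh r" using that assms by (simp add: cosh_real_nonneg_le_iff)
    have "cosh r - sinh r < cosh R - sinh R" using that unfolding cosh_minus_sinh by simp
    then have lt: "snd o' * (cosh r - cosh R) + snd o' * sinh R < snd o' * sinh r"
      using t by (simp add: distrib_left[symmetric])
    have "dist (fst o', snd o' * cosh r) (fst o', snd o' * cosh R) = snd o' * (cosh r - cosh R)"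
      using t cs by (simp add: dist_Pair_Pair dist_real_def right_diff_distrib[symmetric] abs_mult)
    moreover have "dist (fst o', snd o' * cosh r) q \<le> dist (fst o', snd o' * cosh r) (fst o', snd o' * cosh R)
        + dist (fst o', snd o' * cosh R) q" by (rule dist_triangle)
    moreover have "dist (fst o', snd o' * cosh R) q \<le> snd o' * sinh R" using assms(3) by simp
    ultimately have "dist (fst o', snd o' * cosh r) q < snd o' * sinh r" using lt by linarith
    then show ?thesis using hball_eq_ball[OF assms(1) r] by simp
  qed
  show "q \<in> H3" using *[of "R + 1"] by (simp add: hball_def)
  show "H3_dist o' q \<le> R"
  proof (rule ccontr)
    assume "\<not> H3_dist o' q \<le> R"
    then show False using *[of "H3_dist o' q"] by (simp add: hball_def)
  qed
qed

text \<open>Along the geodesic from the centre to the boundary point \<open>q\<close> the images form a Cauchy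
  sequence; completeness provides a limit, and a chart around that limit provides the extension.\<close>

lemma extend_at_boundary:
  assumes F: "liso (hball o' R) F" and o: "o' \<in> H3" and R: "R > 0"
    and q: "q \<in> cball (fst o', snd o' * cosh R) (snd o' * sinh R)"
  obtains \<delta> G where "\<delta> > 0" "liso (ball q \<delta>) G" "\<And>u. u \<in> ball q \<delta> \<inter> hball o' R \<Longrightarrow> G u = F u"
proof -
  have qH: "q \<in> H3" and qR: "H3_dist o' q \<le> R" using hcball_limit[OF o R q] by auto
  define l where "l = H3_dist o' q"
  consider "l < R" | "l = R" using qR l_def by linarith
  then show ?thesis
  proof cases
    case 1
    then have "q \<in> hball o' R" using qH by (simp add: hball_def l_def)
    then obtain \<delta> where "\<delta> > 0" "ball q \<delta> \<subseteq> hball o' R"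
      using open_hball[OF o, of R] open_contains_ball by blast
    then show ?thesis using that[of \<delta> F] liso_subset[OF F, of "ball q \<delta>" F] by auto
  next
    case 2
    obtain c where c: "c 0 = o'" "c R = q" "\<And>s. c s \<in> H3" "\<And>s t. H3_dist (c s) (c t) = \<bar>s - t\<bar>"
      using H3_geodesic[OF o qH] 2 unfolding l_def by metis
    have cb: "c t \<in> hball o' R" if "0 \<le> t" "t < R" for t
      using c(3)[of t] c(4)[of 0 t] that by (simp add: c(1) hball_def)
    have lip: "d (F (c s)) (F (c t)) \<le> \<bar>s - t\<bar>" if "0 \<le> s" "s < R" "0 \<le> t" "t < R" for s t
    proof -
      have "d (F (c s)) (F (c t)) \<le> t - s" if "0 \<le> s" "s \<le> t" "t < R" for s t
        using liso_geodesic_lipschitz[OF F c(4) c(3) that(2)] cb that by force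
      from this[of s t] this[of t s] that show ?thesis
        by (cases "s \<le> t") (auto simp: commute)
    qed
    define \<sigma> where "\<sigma> n = F (c (R - R / real (Suc n)))" for n :: nat
    have tn: "0 \<le> R - R / real (Suc n)" "R - R / real (Suc n) < R" for n
      using R by (auto simp: field_simps)
    have "MCauchy \<sigma>" unfolding MCauchy_def
    proof (intro conjI allI impI)
      show "range \<sigma> \<subseteq> X" using liso_X[OF F cb[OF tn]] by (auto simp: \<sigma>_def)
      fix \<epsilon> :: real assume e: "\<epsilon> > 0"
      obtain N :: nat where N: "real N > R / \<epsilon>" using reals_Archimedean2 by blast
      have small: "R / real (Suc n) < \<epsilon>" if "n \<ge> N" for n
      proof -
        have "R / \<epsilon> < real (Suc n)" using N that by linarith
        then show ?thesis using e by (simp add: field_simps)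
      qed
      show "\<exists>N. \<forall>n n'. N \<le> n \<longrightarrow> N \<le> n' \<longrightarrow> d (\<sigma> n) (\<sigma> n') < \<epsilon>"
      proof (intro exI[of _ N] allI impI)
        fix n m assume nm: "N \<le> n" "N \<le> m"
        have "d (\<sigma> n) (\<sigma> m) \<le> \<bar>(R - R / real (Suc n)) - (R - R / real (Suc m))\<bar>"
          unfolding \<sigma>_def using tn by (intro lip) auto
        moreover have "R / real (Suc n) > 0" "R / real (Suc m) > 0" using R by auto
        ultimately show "d (\<sigma> n) (\<sigma> m) < \<epsilon>" using small[OF nm(1)] small[OF nm(2)] by linarith
      qed
    qed
    then obtain y where y: "limitin mtopology \<sigma> y sequentially" using complete unfolding mcomplete_def by blast
    have yX: "y \<in> X" using y limitin_mspace by blast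
    obtain r cc s where s: "isometric_ball y r cc s" using ex_isometric_ball[OF yX] .
    have r: "r > 0" "cc \<in> H3" "s cc = y" using s by (auto simp: isometric_ball_def)
    obtain N1 where N1: "\<And>n. n \<ge> N1 \<Longrightarrow> \<sigma> n \<in> X \<and> d (\<sigma> n) y < r / 3"
      using y r unfolding limit_metric_sequentially by (meson divide_pos_pos zero_less_numeral)
    obtain N2 :: nat where N2: "real N2 > R / (r / 3)" using reals_Archimedean2 by blast
    define n where "n = max N1 N2"
    define t where "t = R - R / real (Suc n)"
    have t: "0 \<le> t" "t < R" using tn[of n] by (auto simp: t_def)
    have Rt: "R - t < r / 3"
    proof -
      have "R / (r / 3) < real (Suc n)" using N2 unfolding n_def by linarith
      then show ?thesis using r by (simp add: t_def field_simps)
    qed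
    have "\<sigma> n = F (c t)" "n \<ge> N1" by (simp_all add: \<sigma>_def t_def n_def)
    then have Ft: "F (c t) \<in> X" "d y (F (c t)) < r / 3"
      using N1[of n] commute[of y "F (c t)"] by simp_all
    then have Fm: "F (c t) \<in> mball y r" using yX r by simp
    obtain e g where e: "e > 0" and g: "g \<in> hisom" and eb: "hball (c t) e \<subseteq> hball o' R"
      and gs: "\<And>u. u \<in> hball (c t) e \<Longrightarrow> g u \<in> hball cc r \<and> F u = s (g u)"
      using liso_chart[OF F cb[OF t] s Fm] by metis
    \<comment> \<open>The ball of radius \<open>r\<close> that lies over the chart ball around the
      limit \<open>y\<close>. Its centre and \<open>q\<close> are both within \<open>r / 3\<close>
      of \<open>c t\<close>, so it contains \<open>q\<close>.\<close>
    define B where "B = hinv g ` hball cc r"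
    have B: "B = hball (hinv g cc) r" unfolding B_def using hisom_hball g r by simp
    have gc: "hinv g cc \<in> H3" using g r by simp
    have lG: "liso B (s \<circ> g)" unfolding B_def using liso_hisom[OF liso_isometric_ball[OF s] g] .
    have ct: "c t \<in> hball (c t) e" using e c(3) by simp
    have "H3_dist (hinv g cc) (c t) = H3_dist cc (g (c t))"
      using hisom_dist[OF g gc c(3)[of t]] g by simp
    also have "\<dots> = d (s cc) (s (g (c t)))"
      using s gs[OF ct] centre_hball[OF r(2,1)] unfolding isometric_ball_def by metis
    also have "\<dots> < r / 3" using gs[OF ct] Ft r by simp
    finally have d1: "H3_dist (hinv g cc) (c t) < r / 3" .
    have d2: "H3_dist (c t) q < r / 3" using c(4)[of t R] c(2) t Rt by simp
    have "H3_dist (hinv g cc) q < r"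
      using H3_triangle[OF gc c(3)[of t] qH] d1 d2 r(1) by linarith
    then have qB: "q \<in> B" using qH by (simp add: B hball_def)
    have oB: "open B" unfolding B using gc by simp
    obtain \<delta> where \<delta>: "\<delta> > 0" "ball q \<delta> \<subseteq> B" using oB qB open_contains_ball by blast
    have eq: "s (g u) = F u" if u: "u \<in> B \<inter> hball o' R" for u
    proof -
      have op: "open (B \<inter> hball o' R)" using oB o by (intro open_Int open_hball)
      have 1: "liso (B \<inter> hball o' R) (s \<circ> g)" using liso_subset[OF lG op] by simp
      have 2: "liso (B \<inter> hball o' R) F" using liso_subset[OF F op] by simp
      have con: "connected (B \<inter> hball o' R)"
        unfolding B using gc o by (intro convex_connected convex_Int convex_hball)
      have ctB: "c t \<in> B" using d1 c(3) r by (simp add: B hball_def)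
      have "(s \<circ> g) u = F u"
      proof (rule liso_identity[OF 1 2 con, of "hball (c t) e \<inter> B"])
        show "open (hball (c t) e \<inter> B)" using oB c(3) by (intro open_Int open_hball)
        show "hball (c t) e \<inter> B \<noteq> {}" using ct ctB by blast
        show "hball (c t) e \<inter> B \<subseteq> B \<inter> hball o' R" using eb by blast
        show "(s \<circ> g) v = F v" if "v \<in> hball (c t) e \<inter> B" for v using gs[of v] that by simp
      qed (fact u)
      then show ?thesis by simp
    qed
    show ?thesis
    proof (rule that[OF \<delta>(1)])
      show "liso (ball q \<delta>) (s \<circ> g)" using liso_subset[OF lG] \<delta> by simp
      fix u assume "u \<in> ball q \<delta> \<inter> hball o' R"
      then have "u \<in> B \<inter> hball o' R" using \<delta>(2) by blast
      then show "(s \<circ> g) u = F u" using eq by simp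
    qed
  qed
qed

end

context hyperbolic_manifold
begin

lemma liso_restrict: "liso C F \<Longrightarrow> open C' \<Longrightarrow> C' \<subseteq> C \<Longrightarrow> liso C' F"
  by (rule liso_subset) simp_all

text \<open>Hyperbolic balls are Euclidean balls, and two Euclidean balls meet in a convex set, so the local
  extensions at the boundary points agree on overlaps and can be glued.\<close>

lemma extend_ball:
  assumes F: "liso (hball o' R) F" and o: "o' \<in> H3" and R: "R > 0"
  obtains R' F' where "R' > R" "liso (hball o' R') F'" "\<And>u. u \<in> hball o' R \<Longrightarrow> F' u = F u"
proof -
  define c \<rho> where "c = (fst o', snd o' * cosh R)" and "\<rho> = snd o' * sinh R"
  have t: "snd o' > 0" using o by (simp add: H3_def)
  have \<rho>: "\<rho> > 0" using t R by (simp add: \<rho>_def)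
  have hb: "hball o' R = ball c \<rho>" unfolding c_def \<rho>_def using hball_eq_ball[OF o R] .
  define D where "D = cball c \<rho>"
  have "\<forall>q\<in>D. \<exists>\<delta> G. \<delta> > 0 \<and> liso (ball q \<delta>) G \<and> (\<forall>u \<in> ball q \<delta> \<inter> hball o' R. G u = F u)"
    using extend_at_boundary[OF F o R] unfolding D_def c_def \<rho>_def by metis
  then obtain \<delta> G where \<delta>: "\<And>q. q \<in> D \<Longrightarrow> \<delta> q > 0" and G: "\<And>q. q \<in> D \<Longrightarrow> liso (ball q (\<delta> q)) (G q)"
    and GF: "\<And>q u. q \<in> D \<Longrightarrow> u \<in> ball q (\<delta> q) \<Longrightarrow> u \<in> hball o' R \<Longrightarrow> G q u = F u"
    by (metis IntI)
  have agree: "G q u = G q' u" if q: "q \<in> D" "q' \<in> D" and u: "u \<in> ball q (\<delta> q)" "u \<in> ball q' (\<delta> q')" for q q' u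
  proof -
    define N where "N = ball q (\<delta> q) \<inter> ball q' (\<delta> q')"
    have oN: "open N" by (simp add: N_def open_Int)
    define a b where "a = \<delta> q" and "b = \<delta> q'"
    have ab: "a > 0" "b > 0" using \<delta> q by (auto simp: a_def b_def)
    have dq: "dist q q' < a + b"
      using dist_triangle[of q q' u] u by (simp add: a_def b_def dist_commute)
    \<comment> \<open>\<open>m\<close> divides the segment in the ratio of the two radii. It lies in
      both balls and, by convexity, in the closed ball \<open>D\<close>; therefore the overlap meets
      \<open>hball o' R\<close>, where both extensions equal \<open>F\<close>.\<close>
    define m where "m = (1 - a / (a + b)) *\<^sub>R q + (a / (a + b)) *\<^sub>R q'"
    have "m - q = (a / (a + b)) *\<^sub>R (q' - q)" by (simp add: m_def algebra_simps)
    then have "dist q m = a / (a + b) * dist q q'"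
      using ab by (simp add: dist_norm norm_minus_commute)
    also have "\<dots> < a / (a + b) * (a + b)" using ab dq by (intro mult_strict_left_mono) auto
    finally have mq: "dist q m < a" using ab by simp
    have ab1: "1 - a / (a + b) = b / (a + b)" using ab by (simp add: field_simps)
    have "m - q' = (1 - a / (a + b)) *\<^sub>R (q - q')" by (simp add: m_def algebra_simps)
    then have "m - q' = (b / (a + b)) *\<^sub>R (q - q')" unfolding ab1 .
    then have "dist q' m = b / (a + b) * dist q q'"
      using ab by (simp add: dist_norm norm_minus_commute)
    also have "\<dots> < b / (a + b) * (a + b)" using ab dq by (intro mult_strict_left_mono) auto
    finally have mq': "dist q' m < b" using ab by simp
    have mN: "m \<in> N" using mq mq' by (simp add: N_def a_def b_def)
    have "m \<in> D" unfolding m_def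
      by (rule convexD_alt[of D q q']) (use q ab in \<open>auto simp: D_def\<close>)
    then have "m \<in> closure (hball o' R)" using \<rho> by (simp add: hb D_def closure_ball)
    then have ne: "N \<inter> hball o' R \<noteq> {}"
      using mN open_Int_closure_eq_empty[OF oN, of "hball o' R"] by blast
    have 1: "liso N (G q)" using liso_subset[OF G[OF q(1)] oN] by (simp add: N_def)
    have 2: "liso N (G q')" using liso_subset[OF G[OF q(2)] oN] by (simp add: N_def)
    have con: "connected N" unfolding N_def by (intro convex_connected convex_Int convex_ball)
    show ?thesis
    proof (rule liso_identity[OF 1 2 con, of "N \<inter> hball o' R"])
      show "open (N \<inter> hball o' R)" using oN o by (intro open_Int open_hball)
      show "G q v = G q' v" if "v \<in> N \<inter> hball o' R" for v
        using GF[OF q(1), of v] GF[OF q(2), of v] that by (simp add: N_def)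
      show "u \<in> N" using u by (simp add: N_def)
    qed (use ne in auto)
  qed
  define W where "W = (\<Union>q\<in>D. ball q (\<delta> q))"
  define F' where "F' u = G (SOME q. q \<in> D \<and> u \<in> ball q (\<delta> q)) u" for u
  have F': "F' u = G q u" if "q \<in> D" "u \<in> ball q (\<delta> q)" for q u
  proof -
    have "(SOME q. q \<in> D \<and> u \<in> ball q (\<delta> q)) \<in> D \<and> u \<in> ball (SOME q. q \<in> D \<and> u \<in> ball q (\<delta> q)) (\<delta> (SOME q. q \<in> D \<and> u \<in> ball q (\<delta> q)))"
      by (rule someI_ex) (use that in blast)
    then show ?thesis unfolding F'_def using agree that by blast
  qed
  have oW: "open W" unfolding W_def by (intro open_UN ballI open_ball)
  have lW: "liso W F'"
  proof (rule liso_local[OF oW])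
    fix u assume "u \<in> W"
    then obtain q where q: "q \<in> D" "u \<in> ball q (\<delta> q)" by (auto simp: W_def)
    have "liso (ball q (\<delta> q)) F'" using liso_subset[OF G[OF q(1)], of "ball q (\<delta> q)" F'] F'[OF q(1)] by auto
    then show "\<exists>C'. u \<in> C' \<and> C' \<subseteq> W \<and> liso C' F'" using q by (intro exI[of _ "ball q (\<delta> q)"]) (auto simp: W_def)
  qed
  have DW: "D \<subseteq> W"
  proof
    fix q assume "q \<in> D" then show "q \<in> W" using \<delta>[of q] unfolding W_def by (intro UN_I[of q]) auto
  qed
  obtain \<epsilon> where \<epsilon>: "\<epsilon> > 0" "(\<Union>x\<in>D. ball x \<epsilon>) \<subseteq> W"
    using compact_subset_open_imp_ball_epsilon_subset[OF _ oW DW] by (auto simp: D_def)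
  \<comment> \<open>The topmost point of a ball of radius R around \<open>o'\<close> has height
    \<open>snd o' * exp R\<close>; the new radius raises it by exactly
    \<open>\<epsilon>\<close>.\<close>
  define R' where "R' = ln (exp R + \<epsilon> / snd o')"
  have eR': "exp R' = exp R + \<epsilon> / snd o'" unfolding R'_def using \<epsilon> t by (simp add: add_pos_pos)
  have RR: "R < R'" using eR' \<epsilon> t by (metis exp_less_cancel_iff less_add_same_cancel1 divide_pos_pos)
  have "hball o' R' \<subseteq> W"
  proof
    fix u assume "u \<in> hball o' R'"
    then have u: "dist (fst o', snd o' * cosh R') u < snd o' * sinh R'"
      using hball_eq_ball[OF o, of R'] RR R by simp
    have "cosh R \<le> cosh R'" using RR R by (simp add: cosh_real_nonneg_le_iff)
    then have "dist c (fst o', snd o' * cosh R') = snd o' * (cosh R' - cosh R)"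
      using t by (simp add: c_def dist_Pair_Pair dist_real_def right_diff_distrib[symmetric] abs_mult)
    then have "dist c u < snd o' * (cosh R' - cosh R) + snd o' * sinh R'"
      using u dist_triangle[of c u "(fst o', snd o' * cosh R')"] by linarith
    also have "\<dots> = snd o' * ((cosh R' + sinh R') - (cosh R + sinh R)) + \<rho>"
      by (simp add: \<rho>_def algebra_simps)
    also have "\<dots> = \<epsilon> + \<rho>" unfolding cosh_plus_sinh eR' using t by simp
    finally have cu: "dist c u < \<epsilon> + \<rho>" .
    have "\<exists>x\<in>D. dist x u < \<epsilon>"
    proof (cases "dist c u \<le> \<rho>")
      case True then show ?thesis using \<epsilon> by (intro bexI[of _ u]) (auto simp: D_def)
    next
      case False
      obtain L where L: "dist c u = L" by blast
      then have L\<rho>: "L > \<rho>" using False by simp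
      define k where "k = \<rho> / L"
      have k: "0 < k" "k < 1" "k * L = \<rho>" using \<rho> L\<rho> by (simp_all add: k_def)
      define x where "x = c + k *\<^sub>R (u - c)"
      have "c - x = - (k *\<^sub>R (u - c))" "x - u = - ((1 - k) *\<^sub>R (u - c))" by (simp_all add: x_def algebra_simps)
      then have "dist c x = k * dist c u" "dist x u = (1 - k) * dist c u"
        using k by (simp_all add: dist_norm norm_minus_commute)
      then have "dist c x = \<rho>" "dist x u < \<epsilon>" using k cu L by (simp_all add: algebra_simps)
      then show ?thesis by (intro bexI[of _ x]) (auto simp: D_def)
    qed
    then obtain x where "x \<in> D" "u \<in> ball x \<epsilon>" by auto
    then show "u \<in> W" using \<epsilon>(2) by blast
  qed
  then have "liso (hball o' R') F'" using liso_subset[OF lW] o by simp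
  moreover have "F' u = F u" if u: "u \<in> hball o' R" for u
  proof -
    have "u \<in> D" using u by (simp add: hb D_def)
    then show ?thesis using F'[of u u] GF[of u u] \<delta>[of u] u by simp
  qed
  ultimately show ?thesis using that RR by blast
qed

text \<open>An inverse chart is continued over growing concentric balls. Continuations of a given
  germ are unique, so they glue up to the supremum of the possible radii, and
  \<open>extend_ball\<close>, through which completeness enters, passes beyond any finite
  supremum.\<close>

theorem ex_developing_map:
  assumes "x0 \<in> X" obtains p where "liso H3 p" "x0 \<in> p ` H3"
proof -
  obtain r0 o' s0 where s0: "isometric_ball x0 r0 o' s0" using ex_isometric_ball[OF assms] .
  have o: "o' \<in> H3" and r0: "r0 > 0" and so: "s0 o' = x0" using s0 by (auto simp: isometric_ball_def)
  define good where "good r F \<longleftrightarrow> liso (hball o' r) F \<and> (\<forall>u\<in>hball o' r0. F u = s0 u)" for r F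
  have uniq: "F u = F' u" if "good r F" "good r' F'" "r0 \<le> r" "r \<le> r'" "u \<in> hball o' r" for r r' F F' u
  proof (rule liso_identity[of "hball o' r" F F' "hball o' r0"])
    show "liso (hball o' r) F" using that by (simp add: good_def)
    show "liso (hball o' r) F'"
    proof (rule liso_restrict)
      show "liso (hball o' r') F'" using that(2) by (simp add: good_def)
    qed (use that(4) o in \<open>simp_all add: hball_mono\<close>)
    show "connected (hball o' r)" using o by (intro convex_connected convex_hball)
    show "open (hball o' r0)" using o by simp
    show "hball o' r0 \<noteq> {}" using o r0 centre_hball by blast
    show "hball o' r0 \<subseteq> hball o' r" using that by (intro hball_mono)
    show "F v = F' v" if "v \<in> hball o' r0" for v
      using that \<open>good r F\<close> \<open>good r' F'\<close> by (simp add: good_def)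
  qed (use that in auto)
  have restr: "good r F" if "good r' F" "r \<le> r'" for r r' F
    using that(1) liso_restrict[of "hball o' r'" F "hball o' r"] o hball_mono[OF that(2), of o']
    by (simp add: good_def)
  have glue: "\<exists>F. liso C F \<and> (\<forall>u\<in>hball o' r0. F u = s0 u)"
    if C: "open C" "\<And>u. u \<in> C \<Longrightarrow> \<exists>r\<ge>r0. u \<in> hball o' r \<and> hball o' r \<subseteq> C \<and> (\<exists>F. good r F)" for C
  proof -
    define F where "F u = (SOME v. \<exists>r F. r0 \<le> r \<and> u \<in> hball o' r \<and> good r F \<and> v = F u)" for u
    have F: "F u = G u" if "r0 \<le> r" "good r G" "u \<in> hball o' r" for r G u
      unfolding F_def
    proof (rule some_equality)
      show "\<exists>r F. r0 \<le> r \<and> u \<in> hball o' r \<and> good r F \<and> G u = F u" using that by blast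
      fix v assume "\<exists>r F. r0 \<le> r \<and> u \<in> hball o' r \<and> good r F \<and> v = F u"
      then obtain r' F' where "r0 \<le> r'" "u \<in> hball o' r'" "good r' F'" "v = F' u" by blast
      then show "v = G u" using uniq[of r G r' F' u] uniq[of r' F' r G u] that by (cases "r \<le> r'") auto
    qed
    have "liso C F"
    proof (rule liso_local[OF C(1)])
      fix q assume "q \<in> C"
      then obtain r G where r: "r0 \<le> r" "q \<in> hball o' r" "hball o' r \<subseteq> C" "good r G" using C(2) by blast
      then have "liso (hball o' r) F"
        using F[OF r(1,4)] o r(4) liso_subset[of "hball o' r" G "hball o' r" F] by (simp add: good_def)
      then show "\<exists>C'. q \<in> C' \<and> C' \<subseteq> C \<and> liso C' F" using r by blast
    qed
    moreover have "good r0 s0" using liso_isometric_ball[OF s0] by (simp add: good_def)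
    then have "\<forall>u\<in>hball o' r0. F u = s0 u" using F[of r0 s0] by simp
    ultimately show ?thesis by blast
  qed
  have base: "good r0 s0" using liso_isometric_ball[OF s0] by (simp add: good_def)
  define S where "S = {r. r0 \<le> r \<and> (\<exists>F. good r F)}"
  have r0S: "r0 \<in> S" using base unfolding S_def by blast
  have all: "r \<in> S" if "r0 \<le> r" for r
  proof (rule ccontr)
    assume nr: "r \<notin> S"
    have bdd: "r' \<le> r" if r'S: "r' \<in> S" for r'
    proof (rule ccontr)
      assume "\<not> r' \<le> r"
      then have le: "r \<le> r'" by simp
      from r'S have "\<exists>F. good r' F" by (simp only: S_def mem_Collect_eq)
      then obtain F where F: "good r' F" ..
      have "good r F" using F le by (rule restr)
      then have "r0 \<le> r \<and> (\<exists>F. good r F)" using \<open>r0 \<le> r\<close> by (intro conjI exI)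
      then have "r \<in> S" by (simp only: S_def mem_Collect_eq)
      with nr show False ..
    qed
    then have bd: "bdd_above S" by (auto simp: bdd_above_def)
    define R where "R = Sup S"
    have R0: "r0 \<le> R" using cSup_upper[OF r0S bd] by (simp add: R_def)
    have "\<exists>F. liso (hball o' R) F \<and> (\<forall>u\<in>hball o' r0. F u = s0 u)"
    proof (cases "R = r0")
      case True then show ?thesis using base by (auto simp: good_def)
    next
      case False
      show ?thesis
      proof (rule glue)
        show "open (hball o' R)" using o by simp
        fix u assume u: "u \<in> hball o' R"
        then have "max r0 (H3_dist o' u) < R" using False R0 by (auto simp: hball_def)
        then obtain r' where r': "r' \<in> S" "max r0 (H3_dist o' u) < r'"
          using less_cSup_iff[of S] r0S bd unfolding R_def by blast
        then have "r' \<le> R" using cSup_upper[OF _ bd] by (simp add: R_def)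
        then show "\<exists>r\<ge>r0. u \<in> hball o' r \<and> hball o' r \<subseteq> hball o' R \<and> (\<exists>F. good r F)"
          using r' u hball_mono[of r' R o'] by (intro exI[of _ r']) (auto simp: S_def hball_def)
      qed
    qed
    then obtain F where F: "liso (hball o' R) F" "\<forall>u\<in>hball o' r0. F u = s0 u" by blast
    have Rp: "R > 0" using R0 r0 by simp
    obtain R' F' where R': "R' > R" "liso (hball o' R') F'" "\<And>u. u \<in> hball o' R \<Longrightarrow> F' u = F u"
      using extend_ball[OF F(1) o Rp] by metis
    have "good R' F'" unfolding good_def using R'(2,3) F(2) hball_mono[OF R0, of o'] by auto
    then have "R' \<in> S" using R' R0 by (auto simp: S_def)
    then have "R' \<le> R" using cSup_upper[OF _ bd] by (simp add: R_def)
    then show False using R' by simp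
  qed
  have "\<exists>F. liso H3 F \<and> (\<forall>u\<in>hball o' r0. F u = s0 u)"
  proof (rule glue)
    fix u assume u: "u \<in> H3"
    define r where "r = max r0 (H3_dist o' u + 1)"
    have "r0 \<le> r" "u \<in> hball o' r" using u by (auto simp: r_def hball_def)
    then show "\<exists>r\<ge>r0. u \<in> hball o' r \<and> hball o' r \<subseteq> H3 \<and> (\<exists>F. good r F)"
      using all[of r] hball_H3 by (auto simp: S_def)
  qed (rule open_H3)
  then obtain F where F: "liso H3 F" "\<forall>u\<in>hball o' r0. F u = s0 u" by blast
  then have "F o' = x0" using so o r0 by simp
  then show ?thesis using that F o by blast
qed

end

section \<open>The universal covering and its deck transformations\<close>

lemma hisom_inj_iff: "g \<in> hisom \<Longrightarrow> g u = g v \<longleftrightarrow> u = v"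
  using bij_hisom bij_is_inj by (metis inj_eq)

lemma hisom_mem_image_inv:
  assumes "g \<in> hisom" shows "u \<in> hinv g ` S \<longleftrightarrow> g u \<in> S"
proof
  assume "g u \<in> S"
  moreover have "u = hinv g (g u)" using assms by simp
  ultimately show "u \<in> hinv g ` S" by blast
qed (use assms in auto)

locale hyperbolic_covering = hyperbolic_manifold +
  fixes p :: "complex \<times> real \<Rightarrow> 'a"
  assumes liso_p: "liso H3 p" and connected_X: "connected X"
begin

lemma p_in_X [simp]: "u \<in> H3 \<Longrightarrow> p u \<in> X"
  using liso_X[OF liso_p] .

text \<open>The factorisation through one isometry \<open>g\<close> holds near \<open>q\<close> and
  spreads by \<open>liso_identity\<close> to the whole ball over the chart. The radius depends only
  on the chart and not on \<open>q\<close>, which is what makes chart balls evenly covered.\<close>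

lemma sheet:
  assumes s: "isometric_ball y r c s" and q: "q \<in> H3" "p q \<in> mball y r"
  obtains g where "g \<in> hisom" "g q \<in> hball c r" "\<And>u. u \<in> H3 \<Longrightarrow> g u \<in> hball c r \<Longrightarrow> p u = s (g u)"
proof -
  have c: "c \<in> H3" using s by (simp add: isometric_ball_def)
  obtain e g where e: "e > 0" and g: "g \<in> hisom"
    and gs: "\<And>u. u \<in> hball q e \<Longrightarrow> g u \<in> hball c r \<and> p u = s (g u)"
    using liso_chart[OF liso_p q(1) s q(2)] by metis
  define B where "B = hinv g ` hball c r"
  have B: "B = hball (hinv g c) r" unfolding B_def using hisom_hball g c by simp
  have gc: "hinv g c \<in> H3" using g c by simp
  have 1: "liso B (s \<circ> g)" unfolding B_def using liso_hisom[OF liso_isometric_ball[OF s] g] .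
  have oB: "open B" unfolding B using gc by simp
  have 2: "liso B p" using liso_restrict[OF liso_p oB] hball_H3 B by simp
  have con: "connected B" unfolding B using gc by (intro convex_connected convex_hball)
  have memB: "u \<in> B \<longleftrightarrow> g u \<in> hball c r" for u
    unfolding B_def using hisom_mem_image_inv[OF g] .
  have eq: "p u = s (g u)" if "u \<in> B" for u
  proof -
    have "(s \<circ> g) u = p u"
    proof (rule liso_identity[OF 1 2 con, of "hball q e"])
      show "hball q e \<noteq> {}" using centre_hball[OF q(1) e] by blast
      show "hball q e \<subseteq> B" using gs memB by blast
      show "(s \<circ> g) v = p v" if "v \<in> hball q e" for v using gs[OF that] by simp
    qed (use q that in simp_all)
    then show ?thesis by simp
  qed
  show ?thesis
    by (rule that[OF g]) (use gs[of q] centre_hball[OF q(1) e] eq memB in auto)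
qed

lemma isometric_ball_sub:
  assumes s: "isometric_ball y r c s" and e: "e \<le> r" shows "s ` hball c e = mball y e"
proof (intro equalityI subsetI)
  have cc: "c \<in> hball c r" using s by (simp add: isometric_ball_def)
  have y: "s c = y" "y \<in> X" using s by (auto simp: isometric_ball_def)
  fix w
  { assume "w \<in> s ` hball c e"
    then obtain u where u: "u \<in> hball c e" "w = s u" by blast
    then have ur: "u \<in> hball c r" using hball_mono[OF e] by blast
    then have "w \<in> mball y r" using s u unfolding isometric_ball_def by blast
    moreover have "d y w = H3_dist c u" using s cc ur u y unfolding isometric_ball_def by metis
    ultimately show "w \<in> mball y e" using u by (simp add: hball_def) }
  { assume w: "w \<in> mball y e"
    then have "w \<in> mball y r" using e by auto
    then obtain u where u: "u \<in> hball c r" "w = s u" using s unfolding isometric_ball_def by blast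
    then have "d y w = H3_dist c u" using s cc y unfolding isometric_ball_def by metis
    then have "u \<in> hball c e" using w u by (simp add: hball_def)
    then show "w \<in> s ` hball c e" using u by blast }
qed

lemma openin_X_iff: "openin (top_of_set X) U \<longleftrightarrow> U \<subseteq> X \<and> (\<forall>x\<in>U. \<exists>r>0. mball x r \<subseteq> U)"
  unfolding mtopology_eq[symmetric] openin_mtopology by blast

lemma p_image_hball:
  assumes "q \<in> H3" obtains r where "r > 0" "\<And>e. e \<le> r \<Longrightarrow> p ` hball q e = mball (p q) e" "inj_on p (hball q r)"
proof -
  obtain r c s where s: "isometric_ball (p q) r c s" using ex_isometric_ball[OF p_in_X[OF assms]] .
  have r: "r > 0" "c \<in> H3" "s c = p q" using s by (auto simp: isometric_ball_def)
  obtain g where g: "g \<in> hisom" "g q \<in> hball c r" and eq: "\<And>u. u \<in> H3 \<Longrightarrow> g u \<in> hball c r \<Longrightarrow> p u = s (g u)"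
    using sheet[OF s assms] r assms by auto
  have "s (g q) = s c" using eq[OF assms g(2)] r by simp
  then have gq: "g q = c" using inj_onD[OF isometric_ball_inj[OF s]] g(2) centre_hball[OF r(2,1)] by blast
  have gb: "g ` hball q e = hball c e" for e using hisom_hball[OF g(1) assms] gq by simp
  have pe: "p u = s (g u) \<and> g u \<in> hball c r" if "u \<in> hball q r" for u
    using eq[of u] gb[of r] that hball_H3 by blast
  show ?thesis
  proof (rule that[OF r(1)])
    fix e assume e: "e \<le> r"
    have "p ` hball q e = s ` g ` hball q e"
      unfolding image_image
    proof (rule image_cong)
      show "p u = s (g u)" if "u \<in> hball q e" for u using pe[of u] hball_mono[OF e, of q] that by blast
    qed simp
    then show "p ` hball q e = mball (p q) e" using gb isometric_ball_sub[OF s e] by simp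
  next
    show "inj_on p (hball q r)"
    proof (rule inj_onI)
      fix u v assume uv: "u \<in> hball q r" "v \<in> hball q r" "p u = p v"
      then have "g u = g v" using pe[OF uv(1)] pe[OF uv(2)] isometric_ball_inj[OF s] by (metis inj_onD)
      then show "u = v" using g(1) by (simp add: hisom_inj_iff)
    qed
  qed
qed

lemma continuous_on_p: "continuous_on H3 p"
  unfolding continuous_on_open_vimage[OF open_H3]
proof (intro allI impI)
  fix B :: "'a set" assume "open B"
  then have B: "openin (top_of_set X) (X \<inter> B)" by (rule openin_open_Int)
  show "open (p -` B \<inter> H3)" unfolding open_subopen[of "p -` B \<inter> H3"]
  proof
    fix q assume q: "q \<in> p -` B \<inter> H3"
    then have "p q \<in> X \<inter> B" by simp
    then obtain \<eta> where \<eta>: "\<eta> > 0" "mball (p q) \<eta> \<subseteq> X \<inter> B" using B unfolding openin_X_iff by blast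
    have qH: "q \<in> H3" using q by blast
    obtain r where r: "r > 0" "\<And>e. e \<le> r \<Longrightarrow> p ` hball q e = mball (p q) e" using p_image_hball[OF qH] by metis
    define e where "e = min r \<eta>"
    have e: "e > 0" "e \<le> r" "e \<le> \<eta>" using r \<eta> by (auto simp: e_def)
    have "p ` hball q e \<subseteq> B" using r(2)[OF e(2)] \<eta>(2) mball_subset_concentric[OF e(3)] by blast
    then have "hball q e \<subseteq> p -` B \<inter> H3" using hball_H3 by blast
    then show "\<exists>T. open T \<and> q \<in> T \<and> T \<subseteq> p -` B \<inter> H3"
      using open_hball[OF qH] centre_hball[OF qH e(1)] by blast
  qed
qed

lemma p_open_map:
  assumes "open U" "U \<subseteq> H3" shows "openin (top_of_set X) (p ` U)"
  unfolding openin_X_iff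
proof (intro conjI ballI)
  show "p ` U \<subseteq> X" using assms by auto
  fix x assume "x \<in> p ` U"
  then obtain q where q: "q \<in> U" "x = p q" by blast
  then have qH: "q \<in> H3" using assms by blast
  obtain e where e: "e > 0" "hball q e \<subseteq> U" using hball_subset_open[OF assms(1) q(1) qH] .
  obtain r where r: "r > 0" "\<And>e. e \<le> r \<Longrightarrow> p ` hball q e = mball (p q) e" using p_image_hball[OF qH] by metis
  have "mball x (min e r) \<subseteq> p ` U"
  proof -
    have "mball x (min e r) = p ` hball q (min e r)" using r(2)[of "min e r"] unfolding q(2) by simp
    moreover have "hball q (min e r) \<subseteq> U" using e(2) hball_mono[of "min e r" e q] by simp
    ultimately show ?thesis by blast
  qed
  then show "\<exists>r>0. mball x r \<subseteq> p ` U" using e r by (intro exI[of _ "min e r"]) auto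
qed

text \<open>The image is closed because sheets have full size: if the image meets a chart ball, then
  the sheet through that point also covers the centre.\<close>

lemma p_surj: "p ` H3 = X"
proof -
  have 1: "openin (top_of_set X) (p ` H3)" using p_open_map[OF open_H3] by simp
  have "openin (top_of_set X) (X - p ` H3)"
    unfolding openin_X_iff
  proof (intro conjI ballI)
    fix y assume y: "y \<in> X - p ` H3"
    then obtain r c s where s: "isometric_ball y r c s" using ex_isometric_ball[of y] by blast
    have r: "r > 0" "c \<in> H3" "s c = y" using s by (auto simp: isometric_ball_def)
    have "p q \<notin> mball y r" if q: "q \<in> H3" for q
    proof
      assume "p q \<in> mball y r"
      then obtain g where g: "g \<in> hisom" and eq: "\<And>u. u \<in> H3 \<Longrightarrow> g u \<in> hball c r \<Longrightarrow> p u = s (g u)"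
        using sheet[OF s q] by metis
      have "hinv g c \<in> H3" "g (hinv g c) = c" using g r by auto
      then have "p (hinv g c) = y" using eq[of "hinv g c"] r by simp
      then show False using y \<open>hinv g c \<in> H3\<close> by blast
    qed
    then show "\<exists>r>0. mball y r \<subseteq> X - p ` H3" using r by (intro exI[of _ r]) auto
  qed auto
  then have "p ` H3 = {} \<or> p ` H3 = X"
    using 1 connected_X unfolding connected_clopen by (auto simp: closedin_def Diff_Diff_Int Int_absorb1)
  then show ?thesis using base_in_H3 by blast
qed

text \<open>The sheets over a chart ball are its preimages under isometries \<open>g\<close> with p
  = s o g there. Two sheets that meet have the same \<open>g\<close>, since \<open>s\<close> is
  injective and isometries equal on an open set are equal.\<close>

lemma covering_space_p: "covering_space H3 p X"
proof (rule covering_spaceI[OF continuous_on_p p_surj])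
  fix x assume "x \<in> X"
  then obtain r c s where s: "isometric_ball x r c s" using ex_isometric_ball by blast
  have r: "r > 0" "c \<in> H3" "s c = x" "s ` hball c r = mball x r" using s by (auto simp: isometric_ball_def)
  define T where "T = mball x r"
  define GG where "GG = {g \<in> hisom. \<forall>u\<in>H3. g u \<in> hball c r \<longrightarrow> p u = s (g u)}"
  define V where "V g = {u \<in> H3. g u \<in> hball c r}" for g
  have Vh: "V g = hball (hinv g c) r" if g: "g \<in> GG" for g
  proof -
    have h: "g \<in> hisom" using g by (simp add: GG_def)
    then have "g (hinv g c) = c" "hinv g c \<in> H3" using r by simp_all
    then have "g ` hball (hinv g c) r = hball c r" using hisom_hball[OF h, of "hinv g c" r] by simp
    then have *: "g u \<in> hball c r \<longleftrightarrow> u \<in> hball (hinv g c) r" for u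
      using bij_is_inj[OF bij_hisom[OF h]] by (metis inj_image_mem_iff)
    show ?thesis unfolding V_def * using hball_H3 by blast
  qed
  have Vo: "open (V g)" "V g \<subseteq> H3" if "g \<in> GG" for g
    using Vh[OF that] that r hball_H3 by (auto simp: GG_def)
  have Vp: "p u = s (g u)" "g u \<in> hball c r" if "g \<in> GG" "u \<in> V g" for g u
    using that by (auto simp: GG_def V_def)
  have sinj: "inj_on s (hball c r)" by (rule isometric_ball_inj[OF s])
  show "\<exists>T. x \<in> T \<and> openin (top_of_set X) T \<and>
      (\<exists>v. \<Union>v = H3 \<inter> p -` T \<and> (\<forall>u\<in>v. openin (top_of_set H3) u) \<and> pairwise disjnt v \<and>
        (\<forall>u\<in>v. \<exists>q. homeomorphism u T p q))"
  proof (intro exI[of _ T] conjI exI[of _ "V ` GG"] ballI)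
    show "x \<in> T" using \<open>x \<in> X\<close> r by (simp add: T_def)
    show "openin (top_of_set X) T" using openin_mball[of x r] by (simp add: T_def mtopology_eq)
    show "\<Union> (V ` GG) = H3 \<inter> p -` T"
    proof (intro equalityI subsetI)
      fix q assume "q \<in> \<Union> (V ` GG)"
      then obtain g where "g \<in> GG" "q \<in> V g" by blast
      then show "q \<in> H3 \<inter> p -` T" using Vp[of g q] Vo[of g] r by (auto simp: T_def)
    next
      fix q assume q: "q \<in> H3 \<inter> p -` T"
      then have qH: "q \<in> H3" "p q \<in> mball x r" by (auto simp: T_def)
      obtain g where "g \<in> hisom" "g q \<in> hball c r" "\<And>u. u \<in> H3 \<Longrightarrow> g u \<in> hball c r \<Longrightarrow> p u = s (g u)"
        using sheet[OF s qH] by metis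
      then have "g \<in> GG" "q \<in> V g" using qH by (auto simp: GG_def V_def)
      then show "q \<in> \<Union> (V ` GG)" by blast
    qed
    show "openin (top_of_set H3) u" if "u \<in> V ` GG" for u
      using that Vo by (auto intro: open_subset)
    show "pairwise disjnt (V ` GG)"
    proof (rule pairwise_imageI)
      fix g h assume gh: "g \<in> GG" "h \<in> GG" "V g \<noteq> V h"
      show "disjnt (V g) (V h)"
      proof (rule ccontr)
        assume "\<not> disjnt (V g) (V h)"
        then have "V g \<inter> V h \<noteq> {}" by (simp add: disjnt_def)
        moreover have "open (V g \<inter> V h)" "V g \<inter> V h \<subseteq> H3" using Vo gh by blast+
        moreover have "g u = h u" if "u \<in> V g \<inter> V h" for u
          using Vp[of g u] Vp[of h u] gh that sinj by (metis IntE inj_onD)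
        ultimately have "g = h" using gh by (intro hisom_eqI[of g h "V g \<inter> V h"]) (auto simp: GG_def)
        then show False using gh by simp
      qed
    qed
    show "\<exists>q. homeomorphism u T p q" if uV: "u \<in> V ` GG" for u
    proof -
      obtain g where g: "g \<in> GG" "u = V g" using uV by blast
      have gh: "g \<in> hisom" using g by (simp add: GG_def)
      have gV: "g ` V g = hball c r"
        using hisom_hball[OF gh, of "hinv g c" r] gh r by (simp add: Vh[OF g(1)])
      have "continuous_on (V g) p" using continuous_on_subset[OF continuous_on_p Vo(2)[OF g(1)]] .
      moreover have "p ` V g = s ` g ` V g" unfolding image_image by (rule image_cong) (use Vp g in auto)
      then have "p ` V g = T" using gV r by (simp add: T_def)
      moreover have "inj_on p (V g)"
      proof (rule inj_onI)
        fix a b assume ab: "a \<in> V g" "b \<in> V g" "p a = p b"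
        then have "g a = g b" using Vp[OF g(1) ab(1)] Vp[OF g(1) ab(2)] sinj by (metis inj_onD)
        then show "a = b" using gh by (simp add: hisom_inj_iff)
      qed
      moreover have "openin (top_of_set T) (p ` O')" if "openin (top_of_set (V g)) O'" for O'
      proof -
        have "open O'" "O' \<subseteq> V g" using that Vo[OF g(1)] by (auto simp: openin_open_eq)
        then have "openin (top_of_set X) (p ` O')" using Vo[OF g(1)] by (intro p_open_map) auto
        moreover have "p ` O' \<subseteq> T" using \<open>p ` V g = T\<close> \<open>O' \<subseteq> V g\<close> by blast
        moreover have "T \<subseteq> X" by (auto simp: T_def)
        ultimately show ?thesis by (meson openin_subset_trans)
      qed
      ultimately show ?thesis unfolding g(2) by (metis homeomorphism_injective_open_map)
    qed
  qed
qed

section \<open>The deck group: transitivity on fibres, freeness, discreteness\<close>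

definition deck :: "(complex \<times> real \<Rightarrow> complex \<times> real) set" where
  "deck = {g \<in> hisom. \<forall>w\<in>H3. p (g w) = p w}"

lemma deck_hisom [simp]: "g \<in> deck \<Longrightarrow> g \<in> hisom"
  and deck_p: "g \<in> deck \<Longrightarrow> w \<in> H3 \<Longrightarrow> p (g w) = p w"
  by (auto simp: deck_def)

lemma deck_comp [simp]: "g \<in> deck \<Longrightarrow> h \<in> deck \<Longrightarrow> g \<circ> h \<in> deck"
  unfolding deck_def by simp

lemma deck_id [simp]: "id \<in> deck"
  unfolding deck_def by simp

lemma deck_inv [simp]:
  assumes "g \<in> deck" shows "hinv g \<in> deck"
proof -
  have "p (hinv g w) = p w" if "w \<in> H3" for w
  proof -
    have "p (g (hinv g w)) = p (hinv g w)" using assms that by (intro deck_p) auto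
    then show ?thesis using assms by simp
  qed
  moreover have "hinv g \<in> hisom" using assms by simp
  ultimately show ?thesis unfolding deck_def by blast
qed

text \<open>Neighbourhoods of \<open>u\<close> and \<open>v\<close> are identified with the same
  chart ball by two isometries of \<open>H3\<close>. Their quotient preserves \<open>p\<close> on a
  ball, hence everywhere by \<open>liso_identity\<close>.\<close>

lemma deck_transitive:
  assumes "u \<in> H3" "v \<in> H3" "p u = p v"
  obtains g where "g \<in> deck" "g u = v"
proof -
  obtain r c s where s: "isometric_ball (p u) r c s" using ex_isometric_ball[OF p_in_X[OF assms(1)]] .
  have r: "r > 0" "c \<in> H3" "s c = p u" using s by (auto simp: isometric_ball_def)
  have sinj: "inj_on s (hball c r)" by (rule isometric_ball_inj[OF s])
  have *: "\<exists>g\<in>hisom. g w = c \<and> (\<forall>z\<in>H3. g z \<in> hball c r \<longrightarrow> p z = s (g z))" if w: "w \<in> H3" "p w = p u" for w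
  proof -
    have "p w \<in> mball (p u) r" using centre_in_mball_iff[of "p u" r] p_in_X[OF assms(1)] w r by metis
    then obtain g where g: "g \<in> hisom" "g w \<in> hball c r" and eq: "\<And>u. u \<in> H3 \<Longrightarrow> g u \<in> hball c r \<Longrightarrow> p u = s (g u)"
      using sheet[OF s w(1)] by metis
    have "s (g w) = s c" using eq[OF w(1) g(2)] w r by simp
    then have "g w = c" using inj_onD[OF sinj] g(2) centre_hball[OF r(2,1)] by blast
    then show ?thesis using g eq by blast
  qed
  obtain g1 where g1: "g1 \<in> hisom" "g1 u = c" "\<forall>w\<in>H3. g1 w \<in> hball c r \<longrightarrow> p w = s (g1 w)"
    using *[of u] assms by blast
  obtain g2 where g2: "g2 \<in> hisom" "g2 v = c" "\<forall>w\<in>H3. g2 w \<in> hball c r \<longrightarrow> p w = s (g2 w)"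
    using *[of v] assms by auto
  define g where "g = hinv g2 \<circ> g1"
  have g: "g \<in> hisom" unfolding g_def using g1 g2 by (intro hisom_comp inv_hisom)
  have "g2 (g u) = g2 v" using g1 g2 by (simp add: g_def)
  then have "g u = v" using hisom_inj_iff[OF g2(1)] by blast
  have "p (g w) = p w" if w: "w \<in> H3" for w
  proof -
    have 1: "liso H3 (p \<circ> g)"
      using liso_hisom[OF liso_p g] hisom_image_H3[OF inv_hisom[OF g]] by simp
    have conH: "connected H3" by (rule convex_connected[OF convex_H3])
    have "(p \<circ> g) w = p w"
    proof (rule liso_identity[OF 1 liso_p conH, of "hball u r"])
      show "hball u r \<noteq> {}" using centre_hball[OF assms(1) r(1)] by blast
      fix z assume z: "z \<in> hball u r"
      have zH: "z \<in> H3" using z hball_H3 by blast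
      have "g1 z \<in> hball c r" using hisom_hball[OF g1(1) assms(1), of r] g1(2) z by blast
      moreover have "g2 (g z) = g1 z" using g2 by (simp add: g_def)
      moreover have "g z \<in> H3" using g zH by simp
      ultimately show "(p \<circ> g) z = p z" using g1(3) g2(3) zH by simp
    qed (use assms w hball_H3 in auto)
    then show ?thesis by simp
  qed
  then have "g \<in> deck" using g unfolding deck_def by blast
  then show ?thesis using that \<open>g u = v\<close> by blast
qed

lemma deck_free:
  assumes g: "g \<in> deck" and u: "u \<in> H3" "g u = u" shows "g = id"
proof -
  obtain r where r: "r > 0" "inj_on p (hball u r)" using p_image_hball[OF u(1)] by metis
  have gh: "g \<in> hisom" using g by simp
  show ?thesis
  proof (rule hisom_eqI[of g id "hball u r"])
    show "hball u r \<noteq> {}" using centre_hball[OF u(1) r(1)] by blast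
    fix w assume w: "w \<in> hball u r"
    then have "g w \<in> hball u r" using hisom_hball[OF gh u(1), of r] u by auto
    moreover have "w \<in> H3" using w hball_H3 by blast
    then have "p (g w) = p w" using g by (simp add: deck_p[OF g])
    ultimately show "g w = id w" using r(2) w by (simp add: inj_onD)
  qed (use g u hball_H3 in auto)
qed

lemma deck_eqI:
  assumes "g \<in> deck" "h \<in> deck" "u \<in> H3" "g u = h u" shows "g = h"
proof -
  have hh: "h \<in> hisom" using assms by simp
  have "hinv h \<circ> g = id"
    by (rule deck_free[of _ u]) (use assms hh in simp_all)
  then have "h \<circ> (hinv h \<circ> g) = h \<circ> id" by simp
  then show ?thesis using hh by (simp add: fun_eq_iff)
qed

text \<open>An accumulation point of the fibre inside \<open>C\<close> would contradict the
  injectivity of \<open>p\<close> on a ball around it.\<close>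

lemma fibre_finite:
  assumes C: "compact C" "C \<subseteq> H3" shows "finite {v \<in> C. p v = y}"
proof (rule ccontr)
  assume inf: "infinite {v \<in> C. p v = y}"
  then obtain v0 where v0: "v0 \<in> C" "v0 islimpt {v \<in> C. p v = y}"
    using C(1) unfolding compact_eq_Bolzano_Weierstrass by (metis (no_types, lifting) mem_Collect_eq subsetI)
  have vH: "v0 \<in> H3" using v0 C by blast
  obtain r where r: "r > 0" "inj_on p (hball v0 r)" using p_image_hball[OF vH] by metis
  have "infinite ({v \<in> C. p v = y} \<inter> hball v0 r)"
    using v0(2) open_hball[OF vH, of r] centre_hball[OF vH r(1)]
    unfolding islimpt_eq_acc_point by (metis inf_commute)
  moreover have "a = b" if "a \<in> {v \<in> C. p v = y} \<inter> hball v0 r" "b \<in> {v \<in> C. p v = y} \<inter> hball v0 r" for a b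
    using inj_onD[OF r(2), of a b] that by simp
  then have "\<exists>a. {v \<in> C. p v = y} \<inter> hball v0 r \<subseteq> {a}" by blast
  then have "finite ({v \<in> C. p v = y} \<inter> hball v0 r)"
    using finite_subset by blast
  ultimately show False by blast
qed

text \<open>Proper discontinuity in the form used for counting: by freeness an element is determined
  by the image of one point, and that image lies in a finite part of a fibre.\<close>

lemma deck_finite:
  assumes C: "compact C" "C \<subseteq> H3" and u: "u \<in> H3" shows "finite {g \<in> deck. g u \<in> C}"
proof (rule finite_imageD)
  show "finite ((\<lambda>g. g u) ` {g \<in> deck. g u \<in> C})"
    by (rule finite_subset[OF _ fibre_finite[OF C, of "p u"]]) (use deck_p[OF _ u] in blast)
  show "inj_on (\<lambda>g. g u) {g \<in> deck. g u \<in> C}"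
    by (rule inj_onI) (use deck_eqI u in blast)
qed

end

section \<open>The peripheral subgroup of a torus end\<close>

text \<open>Logarithmic coordinates on a solid torus without its core: the two components of \<open>fst v\<close> are the
  longitudinal and the meridional angle, and \<open>snd v\<close> is the radius.\<close>

definition polar :: "complex \<times> real \<Rightarrow> complex \<times> complex" where
  "polar v = (cis (Re (fst v)), of_real (snd v) * cis (Im (fst v)))"

definition halfcyl :: "(complex \<times> real) set" where
  "halfcyl = UNIV \<times> {0<..1}"

definition shift :: "complex \<Rightarrow> complex \<times> real \<Rightarrow> complex \<times> real" where
  "shift c v = (fst v + c, snd v)"

definition period :: "int \<Rightarrow> int \<Rightarrow> complex" where
  "period i j = of_real (2 * pi) * (of_int i + of_int j * \<i>)"

lemma halfcyl_iff: "v \<in> halfcyl \<longleftrightarrow> 0 < snd v \<and> snd v \<le> 1"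
  by (cases v) (auto simp: halfcyl_def)

lemma shift_halfcyl [simp]: "shift c v \<in> halfcyl \<longleftrightarrow> v \<in> halfcyl"
  by (simp add: halfcyl_iff shift_def)

lemma shift_shift: "shift a (shift b v) = shift (a + b) v"
  by (simp add: shift_def add_ac)

lemma shift_0 [simp]: "shift 0 v = v" by (simp add: shift_def)

lemma continuous_on_shift: "continuous_on S (shift c)"
  unfolding shift_def by (intro continuous_intros)

lemma convex_halfcyl: "convex halfcyl"
  unfolding halfcyl_def by (intro convex_Times) auto

lemma continuous_on_polar: "continuous_on S polar"
  unfolding polar_def by (intro continuous_intros)

lemma period_add: "period i j + period i' j' = period (i + i') (j + j')"
  by (simp add: period_def algebra_simps)

lemma period_0 [simp]: "period 0 0 = 0" by (simp add: period_def)

lemma cis_add_int: "cis (x + 2 * pi * of_int n) = cis x"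
  by (simp add: cis_mult[symmetric] cis_multiple_2pi)

lemma polar_period: "polar (shift (period i j) v) = polar v"
  using cis_add_int[of "Re (fst v)" i] cis_add_int[of "Im (fst v)" j]
  by (simp add: polar_def shift_def period_def)

lemma cis_eq_iff: "cis x = cis y \<longleftrightarrow> (\<exists>n::int. y = x + 2 * pi * of_int n)"
proof
  assume "cis x = cis y"
  then have "exp (\<i> * of_real y) = exp (\<i> * of_real x)" by (simp add: cis_conv_exp)
  from exp_eq[THEN iffD1, OF this]
  obtain n :: int where "\<i> * of_real y = \<i> * of_real x + of_int (2 * n) * of_real pi * \<i>" by auto
  from arg_cong[OF this, of Im] have "y = x + 2 * pi * of_int n" by simp
  then show "\<exists>n::int. y = x + 2 * pi * of_int n"..
qed (auto simp: cis_add_int)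

lemma polar_eq_imp:
  assumes "polar v = polar v'" "v \<in> halfcyl" "v' \<in> halfcyl"
  obtains i j where "v' = shift (period i j) v"
proof -
  have r: "snd v > 0" "snd v' > 0" using assms by (auto simp: halfcyl_iff)
  have e: "cis (Re (fst v)) = cis (Re (fst v'))"
    "of_real (snd v) * cis (Im (fst v)) = of_real (snd v') * cis (Im (fst v'))"
    using assms(1) by (auto simp: polar_def)
  from arg_cong[OF e(2), of cmod] have s: "snd v = snd v'" using r by (simp add: norm_mult)
  then have "cis (Im (fst v)) = cis (Im (fst v'))" using e r by simp
  then obtain i j :: int where "Re (fst v') = Re (fst v) + 2 * pi * of_int i"
    "Im (fst v') = Im (fst v) + 2 * pi * of_int j"
    using e(1) unfolding cis_eq_iff by blast
  then have "v' = shift (period i j) v"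
    using s by (simp add: shift_def period_def prod_eq_iff complex_eq_iff)
  then show ?thesis by (rule that)
qed

lemma polar_in: "v \<in> halfcyl \<Longrightarrow> polar v \<in> sphere 0 1 \<times> (cball 0 1 - {0})"
proof -
  assume v: "v \<in> halfcyl"
  have "cmod (of_real (snd v) * cis (Im (fst v))) = snd v" using v by (simp add: norm_mult halfcyl_iff)
  then have "of_real (snd v) * cis (Im (fst v)) \<in> cball 0 1 - {0}" using v by (auto simp: halfcyl_iff)
  then show ?thesis unfolding polar_def by (intro SigmaI) auto
qed

lemma polar_in': "v \<in> halfcyl \<Longrightarrow> polar v \<in> sphere 0 1 \<times> cball 0 1"
  by (rule subsetD[OF Sigma_mono polar_in]) auto

lemma polar_surj:
  assumes "a \<in> sphere 0 1" "z \<in> cball 0 1" "z \<noteq> (0::complex)"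
  obtains v where "v \<in> halfcyl" "polar v = (a, z)" "snd v = cmod z"
proof -
  define v where "v = (Complex (Arg a) (Arg z), cmod z)"
  have "cmod z * cis (Arg z) = z" "cis (Arg a) = a"
    using rcis_cmod_Arg[of z] rcis_cmod_Arg[of a] assms(1) by (simp_all add: rcis_def)
  then have "polar v = (a, z)" unfolding polar_def v_def by simp
  moreover have "v \<in> halfcyl" "snd v = cmod z" unfolding halfcyl_iff v_def using assms(2,3) by simp_all
  ultimately show ?thesis using that by blast
qed

text \<open>The punctured closed tube of radius 1 is the end; its boundary torus is shared with the
  exterior, and its core is the knot.\<close>

locale torus_end = hyperbolic_covering X d p for X :: "'a::euclidean_space set" and d p +
  fixes f :: "complex \<times> complex \<Rightarrow> 'a"
  assumes contf: "continuous_on (sphere 0 1 \<times> cball 0 1) f"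
    and injf: "inj_on f (sphere 0 1 \<times> cball 0 1)"
    and f_in_X: "\<And>a z. a \<in> sphere 0 1 \<Longrightarrow> z \<in> cball 0 1 \<Longrightarrow> f (a, z) \<in> X \<longleftrightarrow> z \<noteq> 0"
begin

lemma continuous_on_f_polar: "continuous_on halfcyl (f \<circ> polar)"
proof (rule continuous_on_compose[OF continuous_on_polar])
  show "continuous_on (polar ` halfcyl) f"
    by (rule continuous_on_subset[OF contf]) (intro image_subsetI polar_in')
qed

lemma f_polar_in_X: assumes "v \<in> halfcyl" shows "f (polar v) \<in> X"
proof -
  obtain a z where az: "polar v = (a, z)" by (cases "polar v")
  show ?thesis using polar_in[OF assms] f_in_X[of a z] unfolding az by simp
qed

lemma ex_lift: "\<exists>Q. continuous_on halfcyl Q \<and> Q ` halfcyl \<subseteq> H3 \<and> (\<forall>v\<in>halfcyl. p (Q v) = f (polar v))"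
proof -
  have "f \<circ> polar \<in> halfcyl \<rightarrow> X" using f_polar_in_X by auto
  then obtain g where "continuous_on halfcyl g" "g \<in> halfcyl \<rightarrow> H3" "\<And>y. y \<in> halfcyl \<Longrightarrow> p (g y) = (f \<circ> polar) y"
    using covering_space_lift[OF covering_space_p _ _ continuous_on_f_polar]
      convex_imp_simply_connected[OF convex_halfcyl] convex_imp_locally_path_connected[OF convex_halfcyl] by metis
  then show ?thesis by (intro exI[of _ g]) auto
qed

definition Q :: "complex \<times> real \<Rightarrow> complex \<times> real" where
  "Q = (SOME Q. continuous_on halfcyl Q \<and> Q ` halfcyl \<subseteq> H3 \<and> (\<forall>v\<in>halfcyl. p (Q v) = f (polar v)))"

lemma Q: "continuous_on halfcyl Q" "v \<in> halfcyl \<Longrightarrow> Q v \<in> H3" "v \<in> halfcyl \<Longrightarrow> p (Q v) = f (polar v)"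
  using someI_ex[OF ex_lift] unfolding Q_def[symmetric] by blast+

lemma lift_unique:
  assumes "continuous_on halfcyl g1" "\<And>v. v \<in> halfcyl \<Longrightarrow> g1 v \<in> H3" "\<And>v. v \<in> halfcyl \<Longrightarrow> p (g1 v) = f (polar v)"
    "continuous_on halfcyl g2" "\<And>v. v \<in> halfcyl \<Longrightarrow> g2 v \<in> H3" "\<And>v. v \<in> halfcyl \<Longrightarrow> p (g2 v) = f (polar v)"
    "a \<in> halfcyl" "g1 a = g2 a" "x \<in> halfcyl"
  shows "g1 x = g2 x"
  by (rule covering_space_lift_unique[OF covering_space_p, of g1 a g2 halfcyl "f \<circ> polar"])
    (use assms continuous_on_f_polar f_polar_in_X convex_connected[OF convex_halfcyl] in auto)

text \<open>The lift \<open>Q\<close> of the end to hyperbolic space turns translations by periods into deck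
  transformations: \<open>periph 0 1\<close> is the meridian and \<open>periph 1 0\<close> is a longitude.\<close>

definition periph :: "int \<Rightarrow> int \<Rightarrow> (complex \<times> real \<Rightarrow> complex \<times> real)" where
  "periph i j = (SOME g. g \<in> deck \<and> (\<forall>v\<in>halfcyl. Q (shift (period i j) v) = g (Q v)))"

lemma periph: "periph i j \<in> deck" "v \<in> halfcyl \<Longrightarrow> Q (shift (period i j) v) = periph i j (Q v)"
proof -
  define b :: "complex \<times> real" where "b = (0, 1)"
  have b: "b \<in> halfcyl" by (simp add: b_def halfcyl_iff)
  let ?s = "shift (period i j)"
  have "p (Q b) = p (Q (?s b))" using Q(3) b by (simp add: polar_period)
  then obtain g where g: "g \<in> deck" "g (Q b) = Q (?s b)"
    using deck_transitive[of "Q b" "Q (?s b)"] Q(2) b by auto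
  have gh: "g \<in> hisom" using g by simp
  have "Q (?s v) = g (Q v)" if "v \<in> halfcyl" for v
  proof (rule lift_unique[of "\<lambda>v. Q (?s v)" "\<lambda>v. g (Q v)" b])
    show "continuous_on halfcyl (\<lambda>v. Q (?s v))"
      by (rule continuous_on_compose2[OF Q(1) continuous_on_shift]) auto
    show "continuous_on halfcyl (\<lambda>v. g (Q v))"
      by (rule continuous_on_compose2[OF continuous_on_hisom[OF gh] Q(1)]) (use Q(2) in blast)
    show "p (Q (?s v)) = f (polar v)" if "v \<in> halfcyl" for v
      using Q(3)[of "?s v"] that by (simp add: polar_period)
    show "p (g (Q v)) = f (polar v)" if "v \<in> halfcyl" for v
      using Q(2,3)[OF that] deck_p[OF g(1)] by simp
  qed (use that b g Q(2) gh in auto)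
  then have "\<exists>g. g \<in> deck \<and> (\<forall>v\<in>halfcyl. Q (?s v) = g (Q v))" using g by blast
  from someI_ex[OF this] show "periph i j \<in> deck" "v \<in> halfcyl \<Longrightarrow> Q (?s v) = periph i j (Q v)"
    unfolding periph_def by blast+
qed

lemma base_halfcyl [simp]: "(0, 1) \<in> halfcyl" by (simp add: halfcyl_iff)

lemma periph_comp: "periph i j \<circ> periph i' j' = periph (i + i') (j + j')"
proof (rule deck_eqI[of _ _ "Q (0, 1)"])
  let ?b = "(0, 1) :: complex \<times> real"
  have "periph i j (periph i' j' (Q ?b)) = Q (shift (period i j) (shift (period i' j') ?b))"
    by (simp add: periph(2)[symmetric])
  also have "\<dots> = periph (i + i') (j + j') (Q ?b)"
    by (simp add: periph(2)[symmetric] shift_shift period_add)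
  finally show "(periph i j \<circ> periph i' j') (Q ?b) = periph (i + i') (j + j') (Q ?b)" by simp
qed (use periph(1) Q(2) in auto)

lemma periph_0: "periph 0 0 = id"
proof (rule deck_free[of _ "Q (0, 1)"])
  show "periph 0 0 (Q (0, 1)) = Q (0, 1)" using periph(2)[of "(0, 1)" 0 0] by simp
qed (use periph(1) Q(2) in auto)

section \<open>The lifted end and its boundary\<close>

definition Et :: "(complex \<times> real) set" where "Et = Q ` halfcyl"

definition Tt :: "(complex \<times> real) set" where "Tt = Q ` (UNIV \<times> {1})"

lemma Et_H3: "Et \<subseteq> H3" using Q(2) by (auto simp: Et_def)

lemma Et_fibre:
  assumes "u \<in> Et" "v \<in> Et" "p u = p v"
  obtains i j where "v = periph i j u"
proof -
  obtain a b where ab: "a \<in> halfcyl" "b \<in> halfcyl" "u = Q a" "v = Q b" using assms by (auto simp: Et_def)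
  then have "f (polar a) = f (polar b)" using assms(3) Q(3) by simp
  then have "polar a = polar b" by (rule inj_onD[OF injf _ polar_in'[OF ab(1)] polar_in'[OF ab(2)]])
  then obtain i j where "b = shift (period i j) a" using polar_eq_imp ab by metis
  then show ?thesis using that ab periph(2) by blast
qed

lemma p_Et: "p ` Et = X \<inter> f ` (sphere 0 1 \<times> cball 0 1)"
proof (intro equalityI subsetI)
  fix y assume "y \<in> p ` Et"
  then obtain v where v: "v \<in> halfcyl" "y = p (Q v)" by (auto simp: Et_def)
  then have "y = f (polar v)" "y \<in> X" using Q(3)[OF v(1)] f_polar_in_X[OF v(1)] by simp_all
  moreover have "f (polar v) \<in> f ` (sphere 0 1 \<times> cball 0 1)" by (intro imageI polar_in'[OF v(1)])
  ultimately show "y \<in> X \<inter> f ` (sphere 0 1 \<times> cball 0 1)" by (metis IntI)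
next
  fix y assume "y \<in> X \<inter> f ` (sphere 0 1 \<times> cball 0 1)"
  then obtain a z where az: "a \<in> sphere 0 1" "z \<in> cball 0 1" "y = f (a, z)" "y \<in> X" by auto
  then have "z \<noteq> 0" using f_in_X[OF az(1,2)] by simp
  then obtain v where v: "v \<in> halfcyl" "polar v = (a, z)" using polar_surj[OF az(1,2)] by metis
  then have "y = p (Q v)" using Q(3)[OF v(1)] az(3) by simp
  then show "y \<in> p ` Et" using v(1) unfolding Et_def by blast
qed

text \<open>Nonzero periods have length at least 2 pi, so \<open>Q\<close> is injective on pieces of
  diameter below 2, and invariance of domain applies to these pieces.\<close>

lemma Q_open_map:
  assumes "open V" "V \<subseteq> UNIV \<times> {0<..<1}" shows "open (Q ` V)"
  unfolding open_subopen[of "Q ` V"]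
proof
  fix u assume "u \<in> Q ` V"
  then obtain v where v: "v \<in> V" "u = Q v" by blast
  have Vh: "V \<subseteq> halfcyl" using assms(2) by (auto simp: halfcyl_def)
  define B where "B = V \<inter> ball v 1"
  have oB: "open B" using assms by (simp add: B_def open_Int)
  have "inj_on Q B"
  proof (rule inj_onI)
    fix a b assume ab: "a \<in> B" "b \<in> B" "Q a = Q b"
    have h: "a \<in> halfcyl" "b \<in> halfcyl" using ab Vh by (auto simp: B_def)
    have "f (polar a) = f (polar b)" using Q(3)[OF h(1)] Q(3)[OF h(2)] ab by simp
    then have "polar a = polar b" by (rule inj_onD[OF injf _ polar_in'[OF h(1)] polar_in'[OF h(2)]])
    then obtain i j where s: "b = shift (period i j) a" using polar_eq_imp h by metis
    have "dist a b < 2" using ab dist_triangle[of a b v] by (simp add: B_def dist_commute)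
    then have "dist (fst a) (fst b) < 2" using dist_fst_le[of a b] by linarith
    then have "cmod (period i j) < 2" by (simp add: s shift_def dist_norm)
    then have "\<bar>Re (period i j)\<bar> < 2" "\<bar>Im (period i j)\<bar> < 2"
      using abs_Re_le_cmod[of "period i j"] abs_Im_le_cmod[of "period i j"] by linarith+
    then have *: "2 * pi * \<bar>of_int i\<bar> < 2 * 1" "2 * pi * \<bar>of_int j\<bar> < 2 * 1"
      by (simp_all add: period_def abs_mult)
    have "\<bar>of_int n :: real\<bar> < 1" if "2 * pi * \<bar>of_int n\<bar> < 2 * 1" for n :: int
    proof (rule ccontr)
      assume "\<not> \<bar>of_int n :: real\<bar> < 1"
      then have "2 * pi * 1 \<le> 2 * pi * \<bar>of_int n\<bar>" by (intro mult_left_mono) auto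
      then show False using that pi_gt3 by linarith
    qed
    then have "i = 0" "j = 0" using * by (metis abs_less_iff of_int_abs of_int_less_1_iff zabs_less_one_iff)+
    then show "a = b" using s by simp
  qed
  moreover have "continuous_on B Q" using Q(1) Vh continuous_on_subset by (metis B_def inf.coboundedI1)
  ultimately have "open (Q ` B)" using oB by (intro invariance_of_domain)
  then show "\<exists>T. open T \<and> u \<in> T \<and> T \<subseteq> Q ` V" using v by (intro exI[of _ "Q ` B"]) (auto simp: B_def)
qed

lemma Tt_fundamental: "Tt \<subseteq> (\<Union>i j. periph i j ` Q ` (cbox 0 (Complex (2*pi) (2*pi)) \<times> {1}))"
proof
  fix u assume "u \<in> Tt"
  then obtain w where u: "u = Q (w, 1)" by (auto simp: Tt_def)
  define i j where "i = \<lfloor>Re w / (2 * pi)\<rfloor>" and "j = \<lfloor>Im w / (2 * pi)\<rfloor>"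
  have fl: "0 \<le> x - 2 * pi * of_int \<lfloor>x / (2 * pi)\<rfloor>" "x - 2 * pi * of_int \<lfloor>x / (2 * pi)\<rfloor> \<le> 2 * pi" for x :: real
  proof -
    have "of_int \<lfloor>x / (2 * pi)\<rfloor> \<le> x / (2 * pi)" "x / (2 * pi) \<le> of_int \<lfloor>x / (2 * pi)\<rfloor> + 1" by linarith+
    then have "2 * pi * of_int \<lfloor>x / (2 * pi)\<rfloor> \<le> 2 * pi * (x / (2 * pi))"
      "2 * pi * (x / (2 * pi)) \<le> 2 * pi * (of_int \<lfloor>x / (2 * pi)\<rfloor> + 1)"
      by (intro mult_left_mono; simp)+
    moreover have "2 * pi * (x / (2 * pi)) = x" by simp
    ultimately show "0 \<le> x - 2 * pi * of_int \<lfloor>x / (2 * pi)\<rfloor>" "x - 2 * pi * of_int \<lfloor>x / (2 * pi)\<rfloor> \<le> 2 * pi"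
      unfolding distrib_left by linarith+
  qed
  define w' where "w' = w - period i j"
  have "w' \<in> cbox 0 (Complex (2*pi) (2*pi))"
    using fl[of "Re w"] fl[of "Im w"] by (simp add: in_cbox_complex_iff w'_def period_def i_def j_def)
  moreover have "(w, 1) = shift (period i j) (w', 1)" by (simp add: shift_def w'_def)
  then have "u = periph i j (Q (w', 1))" using periph(2)[of "(w', 1)" i j] u by (simp add: halfcyl_iff)
  ultimately show "u \<in> (\<Union>i j. periph i j ` Q ` (cbox 0 (Complex (2*pi) (2*pi)) \<times> {1}))" by blast
qed

lemma compact_Q_cell: "compact (Q ` (cbox 0 (Complex (2*pi) (2*pi)) \<times> {1}))"
proof (rule compact_continuous_image)
  show "continuous_on (cbox 0 (Complex (2*pi) (2*pi)) \<times> {1}) Q"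
    by (rule continuous_on_subset[OF Q(1)]) (auto simp: halfcyl_def)
  show "compact (cbox 0 (Complex (2*pi) (2*pi)) \<times> {1::real})" by (intro compact_Times compact_cbox) auto
qed

end

context torus_end
begin

text \<open>A continuous branch of the tube coordinates near \<open>u\<close>, followed by
  \<open>Q\<close>, produces a point of \<open>Et\<close> over each nearby point of the end. Since
  \<open>p\<close> is injective near \<open>u\<close>, this point is the given one.\<close>

lemma Et_local:
  assumes "u \<in> Et"
  obtains e where "e > 0" "\<And>u'. u' \<in> hball u e \<Longrightarrow> p u' \<in> p ` Et \<Longrightarrow> u' \<in> Et"
proof -
  obtain v where v: "v \<in> halfcyl" "u = Q v" using assms by (auto simp: Et_def)
  have uH: "u \<in> H3" using assms Et_H3 by blast
  obtain r where r: "r > 0" "inj_on p (hball u r)" using p_image_hball[OF uH] by metis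
  let ?K = "sphere 0 1 \<times> cball 0 1 :: (complex \<times> complex) set"
  have "compact ?K" by (intro compact_Times) auto
  then obtain f' where f': "homeomorphism ?K (f ` ?K) f f'"
    using homeomorphism_compact[OF _ contf _ injf] by metis
  have cf': "continuous_on (f ` ?K) f'" and ff': "\<And>x. x \<in> ?K \<Longrightarrow> f' (f x) = x"
    using f' by (auto simp: homeomorphism_def)
  define A where "A = {w \<in> H3. p w \<in> p ` Et}"
  define F where "F w = f' (p w)" for w
  have cF: "continuous_on A F" unfolding F_def
  proof (rule continuous_on_compose2[OF cf'])
    show "continuous_on A p" using continuous_on_subset[OF continuous_on_p] by (simp add: A_def)
    show "p ` A \<subseteq> f ` ?K" unfolding A_def p_Et by blast
  qed
  have uA: "u \<in> A" using uH assms by (simp add: A_def)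
  have Fu: "F u = polar v" using Q(3)[OF v(1)] ff'[OF polar_in'[OF v(1)]] v by (simp add: F_def)
  define a b where "a = Re (fst v)" and "b = Im (fst v)"
  \<comment> \<open>The inverse branch of \<open>polar\<close> through \<open>v\<close>: dividing by
    \<open>cis a\<close> and \<open>cis b\<close> brings the arguments at \<open>u\<close> to 0,
    away from the cut of \<open>Arg\<close>.\<close>
  define sg where "sg y = (Complex (a + Arg (fst y / cis a)) (b + Arg (snd y / cis b)), cmod (snd y))" for y
  have polar_sg: "polar (sg y) = y" if y: "y \<in> sphere 0 1 \<times> (cball 0 1 - {0})" for y
  proof -
    obtain c z where cz: "y = (c, z)" by (cases y)
    have "cmod c = 1" "z \<noteq> 0" using y cz by auto
    have 1: "of_real (cmod w) * cis (Arg w) = w" for w using rcis_cmod_Arg[of w] by (simp add: rcis_def)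
    have "cmod (c / cis a) = 1" "cmod (z / cis b) = cmod z" using \<open>cmod c = 1\<close> by (simp_all add: norm_divide)
    then have "cis (Arg (c / cis a)) = c / cis a" "of_real (cmod z) * cis (Arg (z / cis b)) = z / cis b"
      using 1[of "c / cis a"] 1[of "z / cis b"] by simp_all
    then have "cis (a + Arg (c / cis a)) = c" "of_real (cmod z) * cis (b + Arg (z / cis b)) = z"
      by (simp_all add: cis_mult[symmetric] mult.left_commute)
    then show ?thesis by (simp add: polar_def sg_def cz)
  qed
  have sgu: "sg (polar v) = v"
  proof -
    have v0: "snd v > 0" using v(1) by (simp add: halfcyl_iff)
    have "fst (polar v) / cis a = 1" "snd (polar v) / cis b = of_real (snd v)"
      by (simp_all add: polar_def a_def b_def cis_neq_zero)
    moreover have "cmod (snd (polar v)) = snd v" using v0 by (simp add: polar_def norm_mult)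
    moreover have "Arg (of_real (snd v)) = 0" using v0 by (simp add: Arg_of_real)
    ultimately have "sg (polar v) = (Complex (a + Arg 1) (b + 0), snd v)" unfolding sg_def by simp
    then show ?thesis by (simp add: a_def b_def)
  qed
  have Ahalf: "sg (F w) \<in> halfcyl" "Q (sg (F w)) \<in> H3" "p (Q (sg (F w))) = p w" if w: "w \<in> A" for w
  proof -
    obtain x where x: "x \<in> halfcyl" "p w = p (Q x)" using w by (auto simp: A_def Et_def)
    then have Fw: "F w = polar x" using Q(3)[OF x(1)] ff'[OF polar_in'[OF x(1)]] by (simp add: F_def)
    have ps: "polar (sg (F w)) = polar x" using polar_sg[OF polar_in[OF x(1)]] Fw by simp
    have "snd (sg (F w)) = snd x" using x(1) by (simp add: Fw sg_def polar_def norm_mult halfcyl_iff)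
    then show h: "sg (F w) \<in> halfcyl" using x(1) by (simp add: halfcyl_iff)
    show "Q (sg (F w)) \<in> H3" by (rule Q(2)[OF h])
    show "p (Q (sg (F w))) = p w" using Q(3)[OF h] Q(3)[OF x(1)] ps x(2) by simp
  qed
  have F0: "fst (F u) / cis a = 1" "snd (F u) / cis b = of_real (snd v)"
    by (simp_all add: Fu polar_def a_def b_def cis_neq_zero)
  have cF0: "continuous (at u within A) F" using cF uA by (simp add: continuous_on_eq_continuous_within)
  then have cF1: "continuous (at u within A) (\<lambda>w. fst (F w) / cis a)" "continuous (at u within A) (\<lambda>w. snd (F w) / cis b)"
    "continuous (at u within A) (\<lambda>w. cmod (snd (F w)))"
    using cF0 by (intro continuous_intros; simp add: cis_neq_zero)+
  have "continuous (at u within A) (\<lambda>w. Arg (fst (F w) / cis a))"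
    by (rule continuous_within_compose3[OF _ cF1(1)]) (simp add: F0 continuous_at_Arg)
  moreover have "continuous (at u within A) (\<lambda>w. Arg (snd (F w) / cis b))"
    by (rule continuous_within_compose3[OF _ cF1(2)])
      (use v(1) in \<open>simp add: F0 continuous_at_Arg halfcyl_iff complex_nonpos_Reals_iff\<close>)
  ultimately have csg: "continuous (at u within A) (\<lambda>w. sg (F w))"
    unfolding sg_def Complex_eq using cF1(3) cF0 by (intro continuous_intros)
  have sgF: "sg (F u) = v" by (simp add: Fu sgu)
  have t1: "((\<lambda>w. sg (F w)) \<longlongrightarrow> v) (at u within A)" using csg sgF by (simp add: continuous_within)
  have "((\<lambda>w. Q (sg (F w))) \<longlongrightarrow> Q v) (at u within A)"
    by (rule continuous_on_tendsto_compose[OF Q(1) t1 v(1)]) (auto simp: eventually_at_filter Ahalf(1))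
  then have "((\<lambda>w. Q (sg (F w))) \<longlongrightarrow> u) (at u within A)" by (simp add: v(2))
  then have "eventually (\<lambda>w. Q (sg (F w)) \<in> hball u r) (at u within A)"
    using open_hball[OF uH] centre_hball[OF uH r(1)] by (rule topological_tendstoD)
  then obtain S where S: "open S" "u \<in> S" "\<And>w. w \<in> S \<Longrightarrow> w \<noteq> u \<Longrightarrow> w \<in> A \<Longrightarrow> Q (sg (F w)) \<in> hball u r"
    unfolding eventually_at_topological by blast
  obtain e where e: "e > 0" "hball u e \<subseteq> S \<inter> hball u r"
    using hball_subset_open[of "S \<inter> hball u r" u] S(1,2) uH centre_hball[OF uH r(1)] by (auto simp: open_Int)
  show ?thesis
  proof (rule that[OF e(1)])
    fix w assume w: "w \<in> hball u e" "p w \<in> p ` Et"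
    then have "w \<in> H3" using hball_H3 by blast
    then have wA: "w \<in> A" using w(2) by (simp add: A_def)
    show "w \<in> Et"
    proof (cases "w = u")
      case False
      have "Q (sg (F w)) \<in> hball u r" "w \<in> hball u r" using S(3)[of w] False wA w(1) e(2) by blast+
      then have "Q (sg (F w)) = w" using inj_onD[OF r(2)] Ahalf(3)[OF wA] by blast
      then show ?thesis using Ahalf(1)[OF wA] unfolding Et_def by (metis imageI)
    qed (use assms in simp)
  qed
qed

lemma closed_f_image: "closed (f ` (sphere 0 1 \<times> cball 0 1))"
  by (intro compact_imp_closed compact_continuous_image contf compact_Times) auto

text \<open>A limit point \<open>v\<close> projects into the closed tube, so v = g u for a deck
  transformation g and some u in \<open>Et\<close>. A point of \<open>Et\<close> near
  \<open>v\<close> pulls back under g to a point of \<open>Et\<close> near u, which forces g to be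
  peripheral.\<close>

lemma Et_closed:
  assumes "v \<in> H3" "v \<in> closure Et" shows "v \<in> Et"
proof -
  have "p v \<in> f ` (sphere 0 1 \<times> cball 0 1)"
  proof (rule ccontr)
    assume n: "p v \<notin> f ` (sphere 0 1 \<times> cball 0 1)"
    define V where "V = H3 \<inter> p -` (- f ` (sphere 0 1 \<times> cball 0 1))"
    have "open V" unfolding V_def
      using continuous_open_preimage[OF continuous_on_p open_H3] closed_f_image by (simp add: open_Compl)
    moreover have "v \<in> V" using n assms by (simp add: V_def)
    ultimately have "V \<inter> Et \<noteq> {}" using assms(2) open_Int_closure_eq_empty by blast
    then obtain w where "w \<in> Et" "p w \<notin> f ` (sphere 0 1 \<times> cball 0 1)" unfolding V_def by blast
    then show False using p_Et by blast
  qed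
  then have "p v \<in> p ` Et" unfolding p_Et using assms by simp
  then obtain u where u: "u \<in> Et" "p u = p v" by force
  have uH: "u \<in> H3" using u Et_H3 by blast
  obtain g where g: "g \<in> deck" "g u = v" using deck_transitive[OF uH assms(1) u(2)] .
  have gh: "g \<in> hisom" using g by simp
  obtain e where e: "e > 0" "\<And>u'. u' \<in> hball u e \<Longrightarrow> p u' \<in> p ` Et \<Longrightarrow> u' \<in> Et" using Et_local[OF u(1)] by metis
  have gb: "g ` hball u e = hball v e" using hisom_hball[OF gh uH] g by simp
  have "hball v e \<inter> Et \<noteq> {}"
    using open_hball[OF assms(1), of e] centre_hball[OF assms(1) e(1)] assms(2) open_Int_closure_eq_empty by blast
  then obtain v' where v': "v' \<in> hball v e" "v' \<in> Et" by blast
  then obtain u' where u': "u' \<in> hball u e" "v' = g u'" using gb by blast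
  have u'H: "u' \<in> H3" using u' hball_H3 by blast
  have pe: "p u' = p v'" using deck_p[OF g(1) u'H] u' by simp
  then have "u' \<in> Et" using e(2)[OF u'(1)] v' by auto
  then obtain i j where "v' = periph i j u'" using Et_fibre v'(2) pe by metis
  then have "g = periph i j" using deck_eqI[OF g(1) periph(1) u'H] u' by metis
  moreover obtain x where "x \<in> halfcyl" "u = Q x" using u by (auto simp: Et_def)
  ultimately have "v = Q (shift (period i j) x)" "shift (period i j) x \<in> halfcyl" using periph(2) g by auto
  then show ?thesis by (auto simp: Et_def)
qed

text \<open>\<open>Et\<close> is closed in \<open>H3\<close>, and without \<open>Tt\<close> it is
  open; on a connected set that avoids \<open>Tt\<close> it is therefore everything or
  nothing.\<close>

lemma Et_absorbs:
  assumes Y: "connected Y" "Y \<subseteq> H3" "Y \<inter> Tt = {}" "Y \<inter> Et \<noteq> {}"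
  shows "Y \<subseteq> Et"
proof -
  define O' where "O' = Q ` (UNIV \<times> {0<..<1})"
  have "open O'" unfolding O'_def by (rule Q_open_map) (auto intro: open_Times)
  have EO: "Et = O' \<union> Tt"
  proof -
    have eq: "halfcyl = UNIV \<times> {0<..<1} \<union> UNIV \<times> {1}" by (auto simp: halfcyl_def)
    show ?thesis unfolding Et_def O'_def Tt_def eq by (rule image_Un)
  qed
  have 1: "openin (top_of_set Y) (Y \<inter> Et)"
  proof -
    have "Y \<inter> Et = Y \<inter> O'" using EO Y(3) by blast
    then show ?thesis using \<open>open O'\<close> by (simp add: openin_open_Int)
  qed
  have "closedin (top_of_set Y) (Y \<inter> Et)"
  proof -
    have "Y \<inter> Et = Y \<inter> closure Et" using Et_closed Y(2) closure_subset[of Et] by blast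
    then show ?thesis by (simp add: closedin_closed_Int)
  qed
  then show ?thesis using Y(1,4) 1 connected_clopen by blast
qed

text \<open>Points of the tube that tend to its core would have their limit in the compact set, but
  the core lies outside \<open>X\<close>.\<close>

lemma Et_not_compact_image:
  assumes "compact C" "C \<subseteq> X" shows "\<not> p ` Et \<subseteq> C"
proof
  assume sub: "p ` Et \<subseteq> C"
  let ?K = "sphere 0 1 \<times> cball 0 1 :: (complex \<times> complex) set"
  have "p ` Et = C \<inter> f ` ?K" using sub assms(2) unfolding p_Et by blast
  then have cl: "closed (p ` Et)" using closed_f_image assms(1) by (simp add: compact_imp_closed closed_Int)
  have K: "(1, complex_of_real x) \<in> ?K" if "0 \<le> x" "x \<le> 1" for x using that by simp
  have s: "(\<lambda>n. f (1, of_real (1 / real (Suc n)))) \<longlonglongrightarrow> f (1, 0)"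
  proof (rule continuous_on_tendsto_compose[OF contf])
    have "(\<lambda>n. 1 / real (Suc n)) \<longlonglongrightarrow> 0" using LIMSEQ_inverse_real_of_nat by (simp add: inverse_eq_divide)
    then have "(\<lambda>n. complex_of_real (1 / real (Suc n))) \<longlonglongrightarrow> of_real 0" by (intro tendsto_of_real)
    then show "(\<lambda>n. (1::complex, complex_of_real (1 / real (Suc n)))) \<longlonglongrightarrow> (1, 0)" by (intro tendsto_intros) simp
    show "\<forall>\<^sub>F n in sequentially. (1, complex_of_real (1 / real (Suc n))) \<in> ?K"
      by (intro always_eventually allI K) (auto simp: field_simps)
  qed auto
  have "f (1, of_real (1 / real (Suc n))) \<in> p ` Et" for n
  proof -
    have "(1, complex_of_real (1 / real (Suc n))) \<in> ?K" by (intro K) (auto simp: field_simps)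
    moreover have "complex_of_real (1 / real (Suc n)) \<noteq> 0" unfolding of_real_eq_0_iff by simp
    ultimately show ?thesis unfolding p_Et using f_in_X[of 1 "of_real (1 / real (Suc n))"] by auto
  qed
  then have "f (1, 0) \<in> p ` Et" using closed_sequentially[OF cl _ s] by blast
  then have "f (1, 0) \<in> X" unfolding p_Et by blast
  then show False using f_in_X[of 1 0] by simp
qed

end

section \<open>Finite volume forces parabolic peripheral elements\<close>

text \<open>On the slab between heights \<open>\<delta> / 2\<close> and \<open>\<delta>\<close> the
  density is at least \<open>1 / \<delta> ^ 3\<close>, so its volume is at least the base area
  divided by 2 \<open>\<delta>\<close>^2, which is unbounded as \<open>\<delta>\<close> tends to
  0.\<close>

lemma H3_volume_cusp_box:
  assumes "measure lborel (cbox a b) > 0" "\<epsilon> > 0"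
  shows "emeasure H3_volume (cbox a b \<times> {0<..<\<epsilon>}) = \<infinity>"
proof (rule ccontr)
  let ?B = "cbox a b \<times> {0<..<\<epsilon>} :: (complex \<times> real) set"
  assume fin: "emeasure H3_volume ?B \<noteq> \<infinity>"
  have B: "?B \<in> sets borel" by (intro borel_Times) auto
  have meas: "(\<lambda>p. ennreal (indicator H3 p / snd p ^ 3)) \<in> borel_measurable lborel"
  proof -
    have [measurable]: "(\<lambda>p::complex \<times> real. snd p) \<in> borel_measurable borel"
      by (intro borel_measurable_continuous_onI continuous_intros)
    have [measurable]: "H3 \<in> sets borel" using open_H3 by simp
    have "(\<lambda>p. ennreal (indicator H3 p / snd p ^ 3)) \<in> borel_measurable borel" by measurable
    then show ?thesis by simp
  qed
  have low: "ennreal (measure lborel (cbox a b) / (2 * \<delta>\<^sup>2)) \<le> emeasure H3_volume ?B" if \<delta>: "0 < \<delta>" "\<delta> < \<epsilon>" for \<delta>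
  proof -
    let ?D = "cbox (a, \<delta> / 2) (b, \<delta>) :: (complex \<times> real) set"
    have D: "?D \<subseteq> ?B" using \<delta> by (auto simp: cbox_Pair_eq)
    have "ennreal (measure lborel (cbox a b) / (2 * \<delta>\<^sup>2)) = ennreal (1 / \<delta> ^ 3) * ennreal (measure lborel (cbox a b) * (\<delta> / 2))"
      using \<delta> by (simp add: ennreal_mult[symmetric] power2_eq_square power3_eq_cube)
    also have "measure lborel (cbox a b) * (\<delta> / 2) = measure lborel ?D"
      using \<delta> unfolding content_Pair by simp
    also have "ennreal (measure lborel ?D) = emeasure lborel ?D"
      using emeasure_lborel_cbox_finite[of "(a, \<delta> / 2)" "(b, \<delta>)"]
      by (metis emeasure_eq_ennreal_measure less_irrefl infinity_ennreal_def)
    also have "ennreal (1 / \<delta> ^ 3) * emeasure lborel ?D = (\<integral>\<^sup>+ x. ennreal (1 / \<delta> ^ 3) * indicator ?D x \<partial>lborel)"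
      by (simp add: nn_integral_cmult_indicator)
    also have "\<dots> \<le> (\<integral>\<^sup>+ x. ennreal (indicator H3 x / snd x ^ 3) * indicator ?B x \<partial>lborel)"
    proof (rule nn_integral_mono)
      fix x :: "complex \<times> real"
      show "ennreal (1 / \<delta> ^ 3) * indicator ?D x \<le> ennreal (indicator H3 x / snd x ^ 3) * indicator ?B x"
      proof (cases "x \<in> ?D")
        case True
        then have x: "snd x \<le> \<delta>" "snd x > 0" "x \<in> ?B" "x \<in> H3"
          using \<delta> D by (auto simp: cbox_Pair_eq H3_def)
        have "1 / \<delta> ^ 3 \<le> 1 / snd x ^ 3"
          using x \<delta> by (intro divide_left_mono power_mono) auto
        then show ?thesis using True x by (simp add: ennreal_leI)
      qed simp
    qed
    also have "\<dots> = emeasure H3_volume ?B"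
      unfolding H3_volume_def using B by (subst emeasure_density) (use meas in auto)
    finally show ?thesis .
  qed
  obtain m where m: "emeasure H3_volume ?B = ennreal m" "m \<ge> 0" using fin by (metis ennreal_cases infinity_ennreal_def)
  define c where "c = measure lborel (cbox a b)"
  \<comment> \<open>So small that the lower bound exceeds the supposed volume \<open>m\<close>: it
    would give \<open>c \<le> c / 2\<close>.\<close>
  define \<delta> where "\<delta> = min (\<epsilon> / 2) (min 1 (c / (4 * (m + 1))))"
  have \<delta>: "0 < \<delta>" "\<delta> < \<epsilon>" "\<delta> \<le> 1" "\<delta> \<le> c / (4 * (m + 1))"
    using assms m(2) by (auto simp: \<delta>_def c_def)
  have "ennreal (c / (2 * \<delta>\<^sup>2)) \<le> ennreal m" using low[OF \<delta>(1,2)] m c_def by simp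
  then have "c / (2 * \<delta>\<^sup>2) \<le> m" using m(2) by simp
  then have 1: "c \<le> m * (2 * \<delta>\<^sup>2)" using \<delta> by (simp add: field_simps)
  have "\<delta>\<^sup>2 \<le> \<delta>" using \<delta> by (simp add: power2_eq_square mult_left_le)
  then have "m * (2 * \<delta>\<^sup>2) \<le> m * (2 * \<delta>)" using m(2) by (intro mult_left_mono) auto
  also have "\<dots> \<le> (m + 1) * (2 * \<delta>)" using \<delta> m by (intro mult_right_mono) auto
  also have "\<dots> \<le> (m + 1) * (2 * (c / (4 * (m + 1))))" using \<delta> m by (intro mult_left_mono) auto
  also have "\<dots> = c / 2" using m(2) by (simp add: field_simps)
  finally have "c \<le> c / 2" using 1 by linarith
  then show False using assms(1) c_def by simp
qed

section \<open>Comparison of volumes under the covering map\<close>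

context hyperbolic_covering
begin

lemma chart_hball:
  assumes "q \<in> H3"
  obtains r g where "r > 0" "hyperbolic_chart X d (p ` hball q r) g" "homeomorphism (hball q r) (p ` hball q r) p g"
proof -
  obtain r where r: "r > 0" "\<And>u v. u \<in> hball q r \<Longrightarrow> v \<in> hball q r \<Longrightarrow> d (p u) (p v) = H3_dist u v"
    using lisoE[OF liso_p assms] by metis
  have H: "hball q r \<subseteq> H3" by (rule hball_H3)
  have inj: "inj_on p (hball q r)"
  proof (rule inj_onI)
    fix u v assume uv: "u \<in> hball q r" "v \<in> hball q r" "p u = p v"
    then have "u \<in> H3" "v \<in> H3" using H by blast+
    then show "u = v" using r(2)[OF uv(1,2)] uv(3) by (simp add: H3_dist_0)
  qed
  obtain g where g: "homeomorphism (hball q r) (p ` hball q r) p g"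
  proof (rule homeomorphism_injective_open_map[OF _ refl inj])
    show "continuous_on (hball q r) p" by (rule continuous_on_subset[OF continuous_on_p H])
    fix U assume "openin (top_of_set (hball q r)) U"
    then have U: "open U" "U \<subseteq> hball q r" using open_hball[OF assms] by (auto simp: openin_open_eq)
    then have "openin (top_of_set X) (p ` U)" using H by (intro p_open_map) blast+
    then show "openin (top_of_set (p ` hball q r)) (p ` U)"
    proof (rule openin_subset_trans)
      show "p ` U \<subseteq> p ` hball q r" using U by blast
      show "p ` hball q r \<subseteq> X" using H by (auto intro: p_in_X)
    qed
  qed
  have gim: "g ` p ` hball q r = hball q r" using g by (simp add: homeomorphism_def)
  have gp: "g (p u) = u" if "u \<in> hball q r" for u using g that by (simp add: homeomorphism_def)
  have "hyperbolic_chart X d (p ` hball q r) g"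
    unfolding hyperbolic_chart_def gim
    using H open_hball[OF assms] p_open_map[OF open_hball[OF assms] H] r(2) gp by auto
  then show ?thesis using that r(1) g by blast
qed

text \<open>Countably many disjoint Borel pieces of \<open>Y\<close> are cut out on which
  \<open>p\<close> is an inverse chart, so each has the same volume as its image. The images cover
  every point of \<open>X\<close> at most \<open>N\<close> times, whence the bound by
  \<open>N\<close> times the volume of \<open>X\<close>.\<close>

lemma volume_finite_to_one:
  assumes \<mu>: "hyperbolic_volume_measure X d \<mu>" "emeasure \<mu> X < \<infinity>"
    and Y: "Y \<in> sets borel" "Y \<subseteq> H3"
    and N: "\<And>u. u \<in> Y \<Longrightarrow> finite {v \<in> Y. p v = p u} \<and> card {v \<in> Y. p v = p u} \<le> N"
  shows "emeasure H3_volume Y < \<infinity>"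
proof -
  have s\<mu>: "sets \<mu> = sets (restrict_space borel X)"
    and e\<mu>: "\<And>U \<phi> B. hyperbolic_chart X d U \<phi> \<Longrightarrow> B \<in> sets \<mu> \<Longrightarrow> B \<subseteq> U \<Longrightarrow> emeasure \<mu> B = emeasure H3_volume (\<phi> ` B)"
    using \<mu>(1) by (auto simp: hyperbolic_volume_measure_def)
  have sp: "space \<mu> = X" using sets_eq_imp_space_eq[OF s\<mu>] by (simp add: space_restrict_space)
  define F where "F = {V. \<exists>q r g. q \<in> H3 \<and> V = hball q r \<and> hyperbolic_chart X d (p ` V) g \<and> homeomorphism V (p ` V) p g}"
  have Fo: "open V" if "V \<in> F" for V using that by (auto simp: F_def)
  have cov: "H3 \<subseteq> \<Union>F"
  proof
    fix q assume q: "q \<in> H3"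
    obtain r g where r: "r > 0" "hyperbolic_chart X d (p ` hball q r) g" "homeomorphism (hball q r) (p ` hball q r) p g"
      using chart_hball[OF q] .
    have "hball q r \<in> F" using q r(2,3) unfolding F_def by blast
    moreover have "q \<in> hball q r" using q r(1) by simp
    ultimately show "q \<in> \<Union>F" by blast
  qed
  obtain F' where F': "F' \<subseteq> F" "countable F'" "\<Union>F' = \<Union>F" using Lindelof[of F] Fo by metis
  have ne: "F' \<noteq> {}" using F'(3) cov base_in_H3 by blast
  define V where "V = from_nat_into F'"
  have VF: "V n \<in> F" for n using from_nat_into[OF ne] F'(1) by (auto simp: V_def)
  have UV: "H3 \<subseteq> (\<Union>n. V n)" using range_from_nat_into[OF ne F'(2)] cov F'(3) by (simp add: V_def)
  have "\<forall>n. \<exists>g. hyperbolic_chart X d (p ` V n) g \<and> homeomorphism (V n) (p ` V n) p g"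
    using VF unfolding F_def by blast
  then obtain g where g: "\<And>n. hyperbolic_chart X d (p ` V n) (g n)" "\<And>n. homeomorphism (V n) (p ` V n) p (g n)"
    by metis
  have VH: "V n \<subseteq> H3" for n using VF[of n] hball_H3 unfolding F_def by blast
  define W where "W n = Y \<inter> disjointed V n" for n
  have Wb: "W n \<in> sets borel" for n
  proof -
    have "disjointed V n \<in> sets borel" unfolding disjointed_def
      by (intro sets.Diff sets.finite_UN) (use Fo VF in \<open>auto intro: borel_open\<close>)
    then show ?thesis using Y(1) by (simp add: W_def)
  qed
  have WV: "W n \<subseteq> V n" for n using disjointed_subset[of V n] by (auto simp: W_def)
  have disj: "disjoint_family W" using disjoint_family_disjointed[of V] unfolding W_def disjoint_family_on_def by blast
  have UW: "(\<Union>n. W n) = Y" using UV Y(2) UN_disjointed_eq[of V] by (auto simp: W_def)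
  have pW: "p ` W n \<in> sets \<mu>" "emeasure \<mu> (p ` W n) = emeasure H3_volume (W n)" for n
  proof -
    have gp: "g n (p u) = u" if "u \<in> V n" for u using g(2)[of n] that by (simp add: homeomorphism_def)
    have eq: "p ` W n = g n -` W n \<inter> p ` V n"
    proof (intro equalityI subsetI)
      fix x assume "x \<in> p ` W n" then show "x \<in> g n -` W n \<inter> p ` V n" using gp WV[of n] by auto
    next
      fix x assume "x \<in> g n -` W n \<inter> p ` V n"
      then obtain u where "u \<in> V n" "x = p u" "g n x \<in> W n" by blast
      then show "x \<in> p ` W n" using gp by auto
    qed
    have "continuous_on (p ` V n) (g n)" using g(2)[of n] by (simp add: homeomorphism_def)
    then have "g n \<in> borel_measurable (restrict_space borel (p ` V n))" by (rule borel_measurable_continuous_on_restrict)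
    then have "g n -` W n \<inter> space (restrict_space borel (p ` V n)) \<in> sets (restrict_space borel (p ` V n))"
      using Wb by (rule measurable_sets)
    then have "p ` W n \<in> sets (restrict_space borel (p ` V n))" by (simp add: space_restrict_space eq)
    then obtain S where S: "S \<in> sets borel" "p ` W n = p ` V n \<inter> S"
      unfolding sets_restrict_space by blast
    obtain T where T: "open T" "p ` V n = X \<inter> T"
      using p_open_map[OF Fo[OF VF] VH, of n] unfolding openin_open by blast
    have "p ` W n = X \<inter> (S \<inter> T)" using S T by blast
    moreover have "S \<inter> T \<in> sets borel" using S T by auto
    ultimately show m: "p ` W n \<in> sets \<mu>" unfolding s\<mu> sets_restrict_space by blast
    have "g n ` p ` W n = W n" using gp WV[of n] by (force simp: image_image)
    then show "emeasure \<mu> (p ` W n) = emeasure H3_volume (W n)"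
      using e\<mu>[OF g(1)[of n] m image_mono[OF WV[of n]]] by simp
  qed
  have "sets H3_volume = sets borel" by (simp add: H3_volume_def)
  then have "emeasure H3_volume Y = (\<Sum>n. emeasure H3_volume (W n))"
    using suminf_emeasure[of W H3_volume] Wb disj UW by (simp add: image_subset_iff)
  also have "\<dots> = (\<Sum>n. \<integral>\<^sup>+ x. indicator (p ` W n) x \<partial>\<mu>)"
    using pW by (simp add: nn_integral_indicator)
  also have "\<dots> = (\<integral>\<^sup>+ x. (\<Sum>n. indicator (p ` W n) x) \<partial>\<mu>)"
    by (rule nn_integral_suminf[symmetric]) (use pW in measurable)
  also have "\<dots> \<le> (\<integral>\<^sup>+ x. of_nat N * indicator X x \<partial>\<mu>)"
  proof (rule nn_integral_mono)
    fix x assume x: "x \<in> space \<mu>"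
    \<comment> \<open>The pieces are disjoint, so their number over \<open>x\<close> is at most the
      number of points of \<open>Y\<close> in the fibre.\<close>
    define I where "I = {n. x \<in> p ` W n}"
    have "\<exists>v. \<forall>n\<in>I. v n \<in> W n \<and> p (v n) = x" unfolding I_def by (intro bchoice) auto
    then obtain v where v: "\<And>n. n \<in> I \<Longrightarrow> v n \<in> W n \<and> p (v n) = x" by blast
    have inj: "inj_on v I"
      using v disj unfolding disjoint_family_on_def by (intro inj_onI) (metis IntI UNIV_I empty_iff)
    have fI: "finite I \<and> card I \<le> N"
    proof (cases "I = {}")
      case False
      then obtain n where n: "n \<in> I" by blast
      have vY: "v n \<in> Y" using v[OF n] by (simp add: W_def)
      have sub: "v ` I \<subseteq> {w \<in> Y. p w = p (v n)}" using v n by (auto simp: W_def)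
      then have "finite (v ` I)" using N[OF vY] finite_subset by blast
      moreover have "card (v ` I) \<le> N" using card_mono[OF _ sub] N[OF vY] by linarith
      ultimately show ?thesis using inj by (simp add: finite_image_iff card_image)
    qed simp
    have "(\<Sum>n. indicator (p ` W n) x) = (\<Sum>n\<in>I. indicator (p ` W n) x :: ennreal)"
      using fI by (intro suminf_finite) (auto simp: I_def)
    also have "\<dots> = (\<Sum>n\<in>I. 1)" by (intro sum.cong) (auto simp: I_def)
    also have "\<dots> = of_nat (card I)" by simp
    also have "\<dots> \<le> of_nat N" using fI by simp
    finally show "(\<Sum>n. indicator (p ` W n) x) \<le> of_nat N * (indicator X x :: ennreal)" using x sp by simp
  qed
  also have "\<dots> = of_nat N * emeasure \<mu> X"
    using sets.top[of \<mu>] sp by (simp add: nn_integral_cmult_indicator)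
  also have "\<dots> < \<infinity>" using \<mu>(2) by (simp add: ennreal_mult_less_top of_nat_less_top)
  finally show ?thesis .
qed

end

section \<open>Conjugacy normal forms and centralisers\<close>

lemma mob_id_imp:
  assumes "C \<in> SL2" "\<And>v. v \<in> H3 \<Longrightarrow> mob C v = v" shows "C = mone \<or> C = mneg mone"
proof -
  obtain a b c d where C: "C = (a, b, c, d)" by (cases C)
  have det: "a * d - b * c = 1" using assms(1) by (simp add: SL2_def C)
  have H: "(0, t) \<in> H3" if "t > 0" for t using that by (simp add: H3_def)
  have N: "(cmod d)\<^sup>2 + (cmod c)\<^sup>2 * t\<^sup>2 = 1" if t: "t > 0" for t
  proof -
    have "snd (mob C (0, t)) = t" using assms(2)[OF H[OF t]] by simp
    then have "t / mob_denom C (0, t) = t" using H[OF t] by (simp add: mob_def C)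
    moreover have "mob_denom C (0, t) > 0" using mob_denom_pos[OF assms(1) H[OF t]] .
    ultimately have "mob_denom C (0, t) = 1" using t by (simp add: divide_eq_eq)
    then show ?thesis by (simp add: mob_denom_def C)
  qed
  have "(cmod d)\<^sup>2 + (cmod c)\<^sup>2 = 1" "(cmod d)\<^sup>2 + (cmod c)\<^sup>2 * 4 = 1" using N[of 1] N[of 2] by simp_all
  then have "(cmod c)\<^sup>2 = 0" "(cmod d)\<^sup>2 = 1" by linarith+
  then have c: "c = 0" and d: "cmod d = 1" using power2_eq_imp_eq[of "cmod d" 1] by simp_all
  then have d0: "d \<noteq> 0" and ad: "a * d = 1" using det by auto
  have b: "b = 0"
  proof -
    have "fst (mob C (0, 1)) = 0" using assms(2)[of "(0, 1)"] by simp
    then show ?thesis using d0 d by (simp add: mob_def C c mob_denom_def)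
  qed
  have "(1, 1) \<in> H3" by (simp add: H3_def)
  then have "fst (mob C (1, 1)) = 1" using assms(2)[of "(1, 1)"] by simp
  then have "a * cnj d = 1" using d \<open>(1, 1) \<in> H3\<close> by (simp add: mob_def C c b mob_denom_def)
  then have "cnj d = d" using ad d0 by (metis mult_left_cancel mult_zero_left zero_neq_one)
  then have "d * d = 1" using d of_real_cmod_squared[of d] by simp
  then have "d = 1 \<or> d = - 1" by (metis square_eq_1_iff)
  then show ?thesis using ad by (auto simp: C c b mone_def minus_equation_iff[of a])
qed

lemma mob_eq_imp:
  assumes "A \<in> SL2" "B \<in> SL2" "\<And>v. v \<in> H3 \<Longrightarrow> mob A v = mob B v" shows "A = B \<or> A = mneg B"
proof -
  have "mob (mmul (mcof B) A) v = v" if "v \<in> H3" for v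
    using assms that by (simp add: mob_mob[symmetric]) (simp add: mob_mob)
  then have "mmul (mcof B) A = mone \<or> mmul (mcof B) A = mneg mone"
    using assms by (intro mob_id_imp) auto
  then have "mmul B (mmul (mcof B) A) = B \<or> mmul B (mmul (mcof B) A) = mneg B" by auto
  then show ?thesis using assms by (simp add: mmul_assoc[symmetric])
qed

lemma mob_shift: "v \<in> H3 \<Longrightarrow> mob (1, b, 0, 1) v = shift b v"
  by (cases v) (simp add: mob_def mob_denom_def shift_def)

lemma shift_H3 [simp]: "shift b v \<in> H3 \<longleftrightarrow> v \<in> H3"
  by (simp add: shift_def H3_def)

lemma shift_SL2 [simp]: "(1, b, 0, 1) \<in> SL2" by (simp add: SL2_def)

lemma mob_diag:
  assumes "v \<in> H3" "a * d = 1"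
  shows "mob (a, 0, 0, d) v = (a\<^sup>2 * fst v, (cmod a)\<^sup>2 * snd v)"
proof -
  have "a \<noteq> 0" using assms(2) by auto
  then have d: "d = 1 / a" "a \<noteq> 0" using assms(2) by (auto simp: eq_divide_eq mult.commute)
  have "of_real ((cmod d)\<^sup>2) = d * cnj d" by (simp add: of_real_cmod_squared)
  then have "a * fst v * cnj d / of_real ((cmod d)\<^sup>2) = a\<^sup>2 * fst v"
    unfolding d(1) using d(2) by (simp add: power2_eq_square)
  moreover have "snd v / (cmod d)\<^sup>2 = (cmod a)\<^sup>2 * snd v"
    unfolding d(1) by (simp add: norm_divide power_divide)
  ultimately show ?thesis using assms(1) by (simp add: mob_def mob_denom_def)
qed

text \<open>\<open>z\<close> solves the fixed point equation of the Moebius transformation, and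
  conjugation by a matrix that sends \<open>z\<close> to infinity removes the lower left
  entry.\<close>

lemma triangularize:
  assumes "A \<in> SL2"
  obtains B a b d where "B \<in> SL2" "mmul B (mmul A (mcof B)) = (a, b, 0, d)" "a * d = 1"
proof -
  obtain a b c d where A: "A = (a, b, c, d)" by (cases A)
  have det: "a * d - b * c = 1" using assms by (simp add: A SL2_def)
  show ?thesis
  proof (cases "c = 0")
    case True
    then show ?thesis using that[of mone a b d] det by (simp add: A mone_def)
  next
    case False
    define s where "s = csqrt ((a - d)\<^sup>2 + 4 * b * c)"
    have s: "s\<^sup>2 = (a - d)\<^sup>2 + 4 * b * c" by (simp add: s_def)
    define z where "z = (a - d + s) / (2 * c)"
    have z: "2 * c * z = a - d + s" using False by (simp add: z_def)
    have "4 * c * (c * z\<^sup>2 + (d - a) * z - b) = (2 * c * z)\<^sup>2 + 2 * (d - a) * (2 * c * z) - 4 * b * c"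
      by (simp add: algebra_simps power2_eq_square)
    also have "\<dots> = 0" unfolding z using s by (simp add: algebra_simps power2_eq_square)
    finally have root: "c * z\<^sup>2 + (d - a) * z - b = 0" using False by simp
    let ?B = "(0, - 1, 1, - z) :: mat"
    have B: "?B \<in> SL2" by (simp add: SL2_def)
    have "mmul ?B (mmul A (mcof ?B)) = (c * z + d, - c, c * z\<^sup>2 + (d - a) * z - b, a - c * z)"
      by (simp add: A power2_eq_square algebra_simps)
    then have e: "mmul ?B (mmul A (mcof ?B)) = (c * z + d, - c, 0, a - c * z)" using root by simp
    have "mmul ?B (mmul A (mcof ?B)) \<in> SL2" by (intro SL2_closed B assms)
    then have "(c * z + d) * (a - c * z) = 1" unfolding e SL2_def by simp
    then show ?thesis using that[OF B e] by simp
  qed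
qed

lemma mob_conj_normal:
  assumes "A \<in> SL2" "mob A \<noteq> id"
  obtains (par) B where "B \<in> SL2" "\<And>v. v \<in> H3 \<Longrightarrow> mob B (mob A (mob (mcof B) v)) = shift 1 v"
    | (dia) B a d where "B \<in> SL2" "a * d = 1" "\<And>v. mob B (mob A (mob (mcof B) v)) = mob (a, 0, 0, d) v" "a \<noteq> d"
proof -
  obtain B a b d where B: "B \<in> SL2" "mmul B (mmul A (mcof B)) = (a, b, 0, d)" "a * d = 1"
    using triangularize[OF assms(1)] .
  have BA: "mob B (mob A (mob (mcof B) v)) = mob (a, b, 0, d) v" for v
    using B(1) assms(1) by (simp add: mob_mob flip: B(2))
  have S: "(a, b, 0, d) \<in> SL2" using B(3) by (simp add: SL2_def)
  show ?thesis
  proof (cases "a = d")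
    case False
    \<comment> \<open>Translation by \<open>s\<close> moves the finite fixed point
      \<open>- s\<close> to 0.\<close>
    define s where "s = b / (a - d)"
    define C where "C = mmul (1, s, 0, 1) B"
    have C: "C \<in> SL2" unfolding C_def using B(1) by (intro SL2_closed) auto
    have "mcof C = mmul (mcof B) (1, - s, 0, 1)" by (simp add: C_def mcof_mmul)
    then have "mob C (mob A (mob (mcof C) v)) = mob (1, s, 0, 1) (mob (a, b, 0, d) (mob (1, - s, 0, 1) v))" for v
      using B(1) by (simp add: C_def mob_mob[symmetric] BA)
    also have "\<dots> v = mob (a, 0, 0, d) v" for v
    proof -
      have "s * (a - d) = b" using False by (simp add: s_def)
      then have "s * d - a * s + b = 0" by (simp add: algebra_simps)
      then have eq: "mmul (1, s, 0, 1) (mmul (a, b, 0, d) (1, - s, 0, 1)) = (a, 0, 0, d)"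
        by (simp add: algebra_simps)
      have "mob (1, s, 0, 1) (mob (a, b, 0, d) (mob (1, - s, 0, 1) v)) =
          mob (mmul (1, s, 0, 1) (mmul (a, b, 0, d) (1, - s, 0, 1))) v"
        by (simp only: mob_mob S shift_SL2 SL2_closed)
      then show ?thesis unfolding eq .
    qed
    finally show ?thesis using dia[OF C B(3) _ False] by blast
  next
    case True
    then have "a = 1 \<or> a = -1" using B(3) by (metis square_eq_1_iff)
    define b' where "b' = a * b"
    have eq: "mob (a, b, 0, d) = mob (1, b', 0, 1)"
      using \<open>a = 1 \<or> a = -1\<close> True mob_mneg[of "(1, b', 0, 1)"] by (auto simp: b'_def)
    have b': "b' \<noteq> 0"
    proof
      assume "b' = 0"
      then have "mob B (mob A (mob (mcof B) v)) = v" for v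
        using BA eq mob_mone by (simp add: mone_def)
      then have "mob A v = v" for v
        using B(1) by (metis SL2_closed(2) mmul_mcof_SL2 mob_mob mob_mone)
      then show False using assms(2) by (auto simp: fun_eq_iff)
    qed
    \<comment> \<open>Conjugation by a diagonal matrix scales translations by the square of its
      upper entry, so a square root of \<open>b'\<close> normalises the translation to 1.\<close>
    define x where "x = csqrt b'"
    have x: "x \<noteq> 0" "x * x = b'" using b' by (auto simp: x_def simp flip: power2_eq_square)
    let ?D = "(1 / x, 0, 0, x) :: mat"
    have D: "?D \<in> SL2" using x by (simp add: SL2_def)
    define C where "C = mmul ?D B"
    have C: "C \<in> SL2" unfolding C_def using B(1) D by (intro SL2_closed)
    have "mcof C = mmul (mcof B) (mcof ?D)" by (simp add: C_def mcof_mmul)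
    then have 1: "mob C (mob A (mob (mcof C) v)) = mob ?D (mob (1, b', 0, 1) (mob (mcof ?D) v))" for v
      using B(1) D SL2_closed(2)[OF D] by (simp only: C_def mob_mob[symmetric] BA eq SL2_closed)
    have 2: "mob ?D (mob (1, b', 0, 1) (mob (mcof ?D) v)) = mob (mmul ?D (mmul (1, b', 0, 1) (mcof ?D))) v" for v
      using D SL2_closed(2)[OF D] by (simp only: mob_mob SL2_closed shift_SL2)
    have 3: "mmul ?D (mmul (1, b', 0, 1) (mcof ?D)) = (1, 1, 0, 1)"
      using x b' by (simp add: field_simps)
    show ?thesis using par[OF C] unfolding 1 2 3 by (simp add: mob_shift)
  qed
qed

text \<open>Commuting isometries have matrices that commute up to sign. The minus sign would make
  the matrix singular; the plus sign makes it plus or minus a translation, preceded by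
  \<open>hconj\<close> if orientation is reversed.\<close>

lemma commute_shift:
  assumes h: "h \<in> hisom" and comm: "\<And>v. v \<in> H3 \<Longrightarrow> h (shift 1 v) = shift 1 (h v)"
  obtains \<beta> where "(\<forall>v\<in>H3. h v = shift \<beta> v) \<or> (\<forall>v\<in>H3. h v = shift \<beta> (hconj v))"
proof -
  let ?T = "(1, 1, 0, 1) :: mat"
  obtain M where M: "M \<in> SL2" "h = mob M \<or> h = mob M \<circ> hconj" using h by (auto simp: hisom_def)
  have "mob (mmul M ?T) v = mob (mmul ?T M) v" if v: "v \<in> H3" for v
  proof -
    from M(2) show ?thesis
    proof
      assume "h = mob M"
      then have "mob M (mob ?T v) = mob ?T (mob M v)"
        using comm[OF v] v M(1) by (simp add: mob_shift mob_in_H3)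
      then show ?thesis using M(1) by (simp add: mob_mob del: mmul.simps)
    next
      assume "h = mob M \<circ> hconj"
      moreover have "hconj (shift 1 (hconj v)) = shift 1 v" using v by (simp add: hconj_def shift_def H3_def)
      ultimately have "mob M (mob ?T v) = mob ?T (mob M v)"
        using comm[OF hconj_in_H3[OF v]] v M(1) by (simp add: mob_shift mob_in_H3)
      then show ?thesis using M(1) by (simp add: mob_mob del: mmul.simps)
    qed
  qed
  then have e: "mmul M ?T = mmul ?T M \<or> mmul M ?T = mneg (mmul ?T M)"
    using M(1) by (intro mob_eq_imp SL2_closed) auto
  obtain a b c d where abcd: "M = (a, b, c, d)" by (cases M)
  have det: "a * d - b * c = 1" using M(1) by (simp add: abcd SL2_def)
  have "c = 0 \<and> a = d"
    using e
  proof
    assume "mmul M ?T = mmul ?T M"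
    then show ?thesis by (auto simp: abcd)
  next
    assume "mmul M ?T = mneg (mmul ?T M)"
    then have "a = - (a + c)" "c = - c" "a + b = - (b + d)" by (auto simp: abcd)
    then have "c = 0" "a = 0" by auto
    then show ?thesis using det by simp
  qed
  then have c: "c = 0" "d = a" and "a * a = 1" using det by auto
  then have "a = 1 \<or> a = -1" by (metis square_eq_1_iff)
  then have eq: "mob M = mob (1, a * b, 0, 1)"
    using mob_mneg[of "(1, a * b, 0, 1)"] by (auto simp: abcd c)
  from M(2) show ?thesis
  proof
    assume "h = mob M"
    then show ?thesis using that[of "a * b"] by (simp add: eq mob_shift)
  next
    assume "h = mob M \<circ> hconj"
    then show ?thesis using that[of "a * b"] by (simp add: eq mob_shift hconj_in_H3)
  qed
qed

text \<open>The two diagonal entries have different moduli, so a matrix commuting with them up to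
  sign is diagonal. For a reversing \<open>h\<close> one side has \<open>a\<close> and
  \<open>d\<close> replaced by their conjugates, which does not change the moduli.\<close>

lemma commute_diag:
  assumes h: "h \<in> hisom" and ad: "a * d = 1" "cmod a \<noteq> 1"
    and comm: "\<And>v. v \<in> H3 \<Longrightarrow> h (mob (a, 0, 0, d) v) = mob (a, 0, 0, d) (h v)"
  obtains m where "m > 0" "\<And>v. v \<in> H3 \<Longrightarrow> snd (h v) = m * snd v \<and> cmod (fst (h v)) = m * cmod (fst v)"
proof -
  let ?T = "(a, 0, 0, d) :: mat" and ?T' = "(cnj a, 0, 0, cnj d) :: mat"
  have T: "?T \<in> SL2" "?T' \<in> SL2" using ad(1) by (auto simp: SL2_def simp flip: complex_cnj_mult)
  obtain M where M: "M \<in> SL2" "h = mob M \<or> h = mob M \<circ> hconj" using h by (auto simp: hisom_def)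
  obtain x y z w where M': "M = (x, y, z, w)" by (cases M)
  have det: "x * w - y * z = 1" using M(1) by (simp add: M' SL2_def)
  have yz: "y = 0 \<and> z = 0" if "mmul M (a', 0, 0, d') = mmul ?T M \<or> mmul M (a', 0, 0, d') = mneg (mmul ?T M)"
    "cmod a' = cmod a" "cmod d' = cmod d" for a' d'
  proof -
    have "y * d' = a * y \<or> y * d' = - (a * y)" "z * a' = d * z \<or> z * a' = - (d * z)" using that(1) by (auto simp: M')
    then have "cmod (y * d') = cmod (a * y)" "cmod (z * a') = cmod (d * z)" by (metis norm_minus_cancel)+
    then have "cmod y * cmod d = cmod a * cmod y" "cmod z * cmod a = cmod d * cmod z" using that by (simp_all add: norm_mult)
    moreover have "cmod a \<noteq> cmod d"
    proof
      assume "cmod a = cmod d"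
      moreover have "cmod a * cmod d = 1" using ad(1) by (metis norm_mult norm_one)
      ultimately have "cmod a * cmod a = 1" by simp
      then have "cmod a = 1" using square_eq_1_iff[of "cmod a"] norm_ge_zero[of a] by linarith
      then show False using ad(2) by simp
    qed
    ultimately show ?thesis by auto
  qed
  have "y = 0 \<and> z = 0"
  using M(2)
  proof
    assume hM: "h = mob M"
    have "mob (mmul M ?T) v = mob (mmul ?T M) v" if v: "v \<in> H3" for v
      using comm[OF v] M(1) T hM by (simp add: mob_mob del: mmul.simps)
    then have "mmul M ?T = mmul ?T M \<or> mmul M ?T = mneg (mmul ?T M)"
      using M(1) T by (intro mob_eq_imp SL2_closed) auto
    then show ?thesis by (rule yz) auto
  next
    assume hM: "h = mob M \<circ> hconj"
    have "mob (mmul M ?T') v = mob (mmul ?T M) v" if v: "v \<in> H3" for v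
    proof -
      have "hconj (mob ?T (hconj v)) = mob ?T' v" using hconj_mob[OF T(1), of "hconj v"] by (simp add: mcnj_def)
      then show ?thesis using comm[OF hconj_in_H3[OF v]] M(1) T hM by (simp add: mob_mob del: mmul.simps)
    qed
    then have "mmul M ?T' = mmul ?T M \<or> mmul M ?T' = mneg (mmul ?T M)"
      using M(1) T by (intro mob_eq_imp SL2_closed) auto
    then show ?thesis by (rule yz) auto
  qed
  then have yz0: "y = 0" "z = 0" and xw: "x * w = 1" using det by auto
  have x0: "x \<noteq> 0" using xw by auto
  have mM: "mob M v = (x\<^sup>2 * fst v, (cmod x)\<^sup>2 * snd v)" if "v \<in> H3" for v
    using mob_diag[OF that xw] by (simp add: M' yz0)
  show ?thesis
  proof (rule that[of "(cmod x)\<^sup>2"])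
    show "(cmod x)\<^sup>2 > 0" using x0 by simp
    fix v assume v: "v \<in> H3"
    from M(2) show "snd (h v) = (cmod x)\<^sup>2 * snd v \<and> cmod (fst (h v)) = (cmod x)\<^sup>2 * cmod (fst v)"
    proof
      assume "h = mob M" then show ?thesis using mM[OF v] by (simp add: norm_mult norm_power)
    next
      assume "h = mob M \<circ> hconj"
      then show ?thesis using mM[OF hconj_in_H3[OF v]] v by (simp add: norm_mult norm_power hconj_def)
    qed
  qed
qed

text \<open>The fixed point is the midpoint of (0, 1) and its image; when these lie at heights 1 and
  \<open>s\<close> on the axis, it has height \<open>sqrt s\<close>. Together with freeness this
  excludes involutions from the deck group.\<close>

lemma involution_fixed_point:
  assumes h: "h \<in> hisom" and hh: "\<And>v. h (h v) = v"
  obtains u where "u \<in> H3" "h u = u"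
proof (cases "h (0, 1) = (0, 1)")
  case True show ?thesis by (rule that[OF base_in_H3 True])
next
  case False
  have H1: "h (0, 1) \<in> H3" using h by simp
  obtain A s where A: "A \<in> SL2" "mob A (0, 1) = (0, 1)" "s > 1" "mob A (h (0, 1)) = (0, s)"
    using mob_normal_form[OF base_in_H3 H1] False by metis
  have A': "mcof A \<in> SL2" using A by simp
  define k where "k = mob A \<circ> h \<circ> mob (mcof A)"
  have k: "k \<in> hisom" unfolding k_def using h A by (intro hisom_comp mob_hisom) auto
  have unA: "mob (mcof A) (mob A v) = v" "mob A (mob (mcof A) v) = v" for v using A by (simp_all add: mob_mob)
  have k1: "k (0, 1) = (0, s)" using unA(1)[of "(0, 1)"] A by (simp add: k_def)
  have k2: "k (0, s) = (0, 1)" using unA(1)[of "h (0, 1)"] A hh by (simp add: k_def)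
  define r where "r = sqrt s"
  have r: "r > 0" "r * r = s" using A(3) by (auto simp: r_def)
  have H: "(0, 1) \<in> H3" "(0, s) \<in> H3" "(0, r) \<in> H3" using A(3) r by (auto simp: H3_def)
  obtain z t where zt: "k (0, r) = (z, t)" by (cases "k (0, r)")
  have ztH: "(z, t) \<in> H3" using zt hisom_H3[OF k H(3)] by simp
  then have t: "t > 0" by (simp add: H3_def)
  have "ch (z, t) (0, s) = ch (0, r) (0, 1)" "ch (z, t) (0, 1) = ch (0, r) (0, s)"
    using hisom_ch[OF k H(3) H(1)] hisom_ch[OF k H(3) H(2)] by (simp_all add: zt k1 k2)
  then have e: "((cmod z)\<^sup>2 + t\<^sup>2 + s\<^sup>2) / (2 * t * s) = (r\<^sup>2 + 1) / (2 * r)"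
    "((cmod z)\<^sup>2 + t\<^sup>2 + 1) / (2 * t) = (r\<^sup>2 + s\<^sup>2) / (2 * r * s)"
    by (simp_all add: ch_def)
  have e1: "((cmod z)\<^sup>2 + t\<^sup>2 + s\<^sup>2) * r = (r\<^sup>2 + 1) * t * s"
  proof -
    have "((cmod z)\<^sup>2 + t\<^sup>2 + s\<^sup>2) * (2 * r) = (r\<^sup>2 + 1) * (2 * t * s)"
    proof -
      have n: "2 * t * s \<noteq> 0" "2 * r \<noteq> 0" using t r(1) A(3) by simp_all
      show ?thesis using e(1) unfolding frac_eq_eq[OF n] .
    qed
    then show ?thesis by (simp add: algebra_simps)
  qed
  have e2: "((cmod z)\<^sup>2 + t\<^sup>2 + 1) * r = (1 + s) * t"
  proof -
    have "(r\<^sup>2 + s\<^sup>2) / (2 * r * s) = (1 + s) / (2 * r)" using r A(3) by (simp add: power2_eq_square field_simps)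
    then have "((cmod z)\<^sup>2 + t\<^sup>2 + 1) / (2 * t) = (1 + s) / (2 * r)" using e(2) by simp
    then show ?thesis using t r(1) by (simp add: frac_eq_eq)
  qed
  have "(s\<^sup>2 - 1) * r = (s\<^sup>2 - 1) * t"
  proof -
    have "((cmod z)\<^sup>2 + t\<^sup>2 + s\<^sup>2) * r - ((cmod z)\<^sup>2 + t\<^sup>2 + 1) * r = (s + 1) * t * s - (1 + s) * t"
      using e1 e2 r by (simp add: power2_eq_square)
    then show ?thesis by (simp add: algebra_simps power2_eq_square)
  qed
  moreover have "s\<^sup>2 - 1 \<noteq> 0" using A(3) by (simp add: power2_eq_1_iff)
  ultimately have tr: "t = r" by simp
  then have "((cmod z)\<^sup>2 + t\<^sup>2 + 1) * r = (1 + s) * r" using e2 by simp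
  then have "(cmod z)\<^sup>2 = 0" using r tr by (simp add: power2_eq_square)
  then have "k (0, r) = (0, r)" using zt tr by simp
  then have "mob (mcof A) (k (0, r)) = mob (mcof A) (0, r)" by simp
  then have "h (mob (mcof A) (0, r)) = mob (mcof A) (0, r)" by (simp add: k_def unA)
  then show ?thesis using that[of "mob (mcof A) (0, r)"] A' H mob_in_H3 by blast
qed

section \<open>Connected complements of a slab, a box and a cone\<close>

lemma connected_union_star:
  assumes "connected T" "T \<noteq> {}" "\<And>S. S \<in> \<S> \<Longrightarrow> connected S \<and> S \<inter> T \<noteq> {}"
  shows "connected (T \<union> \<Union>\<S>)"
proof -
  have "T \<union> \<Union>\<S> = \<Union>(insert T ((\<lambda>S. T \<union> S) ` \<S>))" by blast
  moreover have "connected \<dots>"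
  proof (rule connected_Union)
    show "connected S" if "S \<in> insert T ((\<lambda>S. T \<union> S) ` \<S>)" for S
      using that assms by (auto intro!: connected_Un)
    show "\<Inter>(insert T ((\<lambda>S. T \<union> S) ` \<S>)) \<noteq> {}" using assms(2) by blast
  qed
  ultimately show ?thesis by simp
qed

text \<open>The convex regions beside the removed set all reach above height \<open>R\<close>, and
  one of them also reaches the layer below height \<open>1 / R\<close>.\<close>

lemma connected_slab_complement:
  "connected (H3 - {v. \<bar>Im (fst v)\<bar> \<le> R \<and> 1 / R \<le> snd v \<and> snd v \<le> R})" (is "connected ?S")
  "connected (H3 - {v. \<bar>Re (fst v)\<bar> \<le> R \<and> \<bar>Im (fst v)\<bar> \<le> R \<and> 1 / R \<le> snd v \<and> snd v \<le> R})" (is "connected ?S'")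
  if R: "R > 0"
proof -
  define T :: "(complex \<times> real) set" where "T = UNIV \<times> {R<..}"
  define D :: "(complex \<times> real) set" where "D = UNIV \<times> {0<..<1/R}"
  define A where "A = {z. Im z > R} \<times> {0::real<..}"
  define A' where "A' = {z. Im z < - R} \<times> {0::real<..}"
  define B where "B = {z. Re z > R} \<times> {0::real<..}"
  define B' where "B' = {z. Re z < - R} \<times> {0::real<..}"
  note defs = T_def D_def A_def A'_def B_def B'_def
  have con: "connected T" "connected D" "connected A" "connected A'" "connected B" "connected B'"
    unfolding defs by (intro convex_connected convex_Times convex_halfspace_Im_gt convex_halfspace_Im_lt
        convex_halfspace_Re_gt convex_halfspace_Re_lt; simp)+
  have i: "Complex 0 (R + 1) \<in> {z. Im z > R}" "Complex 0 (- R - 1) \<in> {z. Im z < - R}"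
    "Complex (R + 1) 0 \<in> {z. Re z > R}" "Complex (- R - 1) 0 \<in> {z. Re z < - R}" by auto
  have AT: "(Complex 0 (R + 1), R + 1) \<in> A \<inter> T" "(Complex 0 (- R - 1), R + 1) \<in> A' \<inter> T"
    "(Complex (R + 1) 0, R + 1) \<in> B \<inter> T" "(Complex (- R - 1) 0, R + 1) \<in> B' \<inter> T"
    using R i unfolding defs by auto
  have AD: "(Complex 0 (R + 1), 1 / (2 * R)) \<in> A \<inter> D" using R unfolding defs by (auto simp: field_simps)
  have Tne: "T \<noteq> {}" using AT by blast
  have 1: "connected (T \<union> \<Union>{A, A'})" by (rule connected_union_star[OF con(1) Tne]) (use con AT in blast)
  have "connected ((T \<union> \<Union>{A, A'}) \<union> D)" by (rule connected_Un[OF 1 con(2)]) (use AD in blast)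
  moreover have "?S = (T \<union> \<Union>{A, A'}) \<union> D" using R unfolding defs H3_def by (auto simp: abs_le_iff not_le)
  ultimately show "connected ?S" by simp
  have 1: "connected (T \<union> \<Union>{A, A', B, B'})" by (rule connected_union_star[OF con(1) Tne]) (use con AT in blast)
  have "connected ((T \<union> \<Union>{A, A', B, B'}) \<union> D)" by (rule connected_Un[OF 1 con(2)]) (use AD in blast)
  moreover have "?S' = (T \<union> \<Union>{A, A', B, B'}) \<union> D" using R unfolding defs H3_def by (auto simp: abs_le_iff not_le)
  ultimately show "connected ?S'" by simp
qed

text \<open>Measuring heights in units of the distance from the axis turns the complement into the
  product of the punctured plane with an interval.\<close>

lemma connected_cone_complement:
  assumes "R > 0" shows "connected (H3 - {v. cmod (fst v) \<le> R * snd v})"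
proof -
  have "connected ((- {0::complex}) \<times> {0<..<1/R})"
    by (intro connected_Times connected_punctured_universe) auto
  then have "connected ((\<lambda>v. (fst v, snd v * cmod (fst v))) ` ((- {0::complex}) \<times> {0<..<1/R}))"
    by (rule connected_continuous_image[rotated]) (intro continuous_intros)
  moreover have "(\<lambda>v. (fst v, snd v * cmod (fst v))) ` ((- {0::complex}) \<times> {0<..<1/R}) = H3 - {v. cmod (fst v) \<le> R * snd v}"
  proof (intro equalityI subsetI)
    fix v assume "v \<in> (\<lambda>v. (fst v, snd v * cmod (fst v))) ` ((- {0::complex}) \<times> {0<..<1/R})"
    then obtain w where w: "w \<in> (- {0::complex}) \<times> {0<..<1/R}" "v = (fst w, snd w * cmod (fst w))" by blast
    define z s where "z = fst w" and "s = snd w"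
    have v: "v = (z, s * cmod z)" "z \<noteq> 0" "0 < s" "s < 1 / R" using w by (simp_all add: z_def s_def mem_Times_iff)
    have "R * s < 1" using v(4) assms by (simp add: field_simps)
    then have "R * s * cmod z < 1 * cmod z" using v(2) by (intro mult_strict_right_mono) auto
    then show "v \<in> H3 - {v. cmod (fst v) \<le> R * snd v}" using v by (simp add: H3_def mult.assoc)
  next
    fix v assume v: "v \<in> H3 - {v. cmod (fst v) \<le> R * snd v}"
    obtain z t where zt: "v = (z, t)" by (cases v)
    have t: "t > 0" "R * t < cmod z" using v by (auto simp: zt H3_def)
    then have z: "z \<noteq> 0" using assms by (metis mult_pos_pos norm_zero order_less_asym)
    have "t / cmod z < 1 / R" using t z assms by (simp add: field_simps)
    moreover have "v = (\<lambda>v. (fst v, snd v * cmod (fst v))) (z, t / cmod z)" using z zt by simp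
    ultimately show "v \<in> (\<lambda>v. (fst v, snd v * cmod (fst v))) ` ((- {0::complex}) \<times> {0<..<1/R})"
      using t z by (intro image_eqI[of _ _ "(z, t / cmod z)"]) auto
  qed
  ultimately show ?thesis by simp
qed

section \<open>The periphery of a manifold of finite volume\<close>

locale finite_volume_end = torus_end X d p f for X :: "'a::euclidean_space set" and d p f +
  fixes \<mu>
  assumes vol: "hyperbolic_volume_measure X d \<mu>" "emeasure \<mu> X < \<infinity>"
begin

text \<open>If the boundary \<open>Tt\<close> of the lifted end, in suitable coordinates, lay in a set \<open>W\<close> with connected
  complement and relatively compact image, then all of that complement would belong to the end. It
  would contain a box of infinite volume down to height 0 on which \<open>p\<close> is finite-to-one.\<close>

lemma cusp_contradiction:
  assumes J: "J \<in> hisom"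
    and T: "J ` Tt \<subseteq> W"
    and C: "compact C" "C \<subseteq> H3" "\<And>u. u \<in> Et \<Longrightarrow> J u \<in> W \<Longrightarrow> p u \<in> p ` C"
    and con: "connected (H3 - W)"
    and Y: "measure lborel (cbox a b) > 0" "\<epsilon> > 0" "(cbox a b \<times> {0<..<\<epsilon>}) \<inter> W = {}"
    and F: "finite FF" "FF \<subseteq> deck"
      "\<And>i j u. u \<in> cbox a b \<times> {0<..<\<epsilon>} \<Longrightarrow> J (periph i j (hinv J u)) \<in> cbox a b \<times> {0<..<\<epsilon>} \<Longrightarrow> periph i j \<in> FF"
  shows False
proof -
  let ?B = "cbox a b \<times> {0<..<\<epsilon>} :: (complex \<times> real) set"
  have J': "hinv J \<in> hisom" using J by simp
  define Y where "Y = hinv J ` (H3 - W)"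
  have YH: "Y \<subseteq> H3" using J by (auto simp: Y_def)
  have memY: "u \<in> Y \<longleftrightarrow> u \<in> H3 \<and> J u \<notin> W" for u
    unfolding Y_def hisom_mem_image_inv[OF J] using J by simp
  have "connected Y" unfolding Y_def
    by (rule connected_continuous_image[OF continuous_on_subset[OF continuous_on_hisom[OF J']] con]) blast
  moreover have "Y \<inter> Tt = {}" using T memY by blast
  \<comment> \<open>Otherwise the whole end would lie over a compact set, although it runs into the
    knot.\<close>
  moreover have "Y \<inter> Et \<noteq> {}"
  proof
    assume "Y \<inter> Et = {}"
    then have "J u \<in> W" if "u \<in> Et" for u using that memY Et_H3 by blast
    then have "p ` Et \<subseteq> p ` C" using C(3) by blast
    moreover have "compact (p ` C)" using compact_continuous_image[OF continuous_on_subset[OF continuous_on_p C(2)] C(1)] .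
    moreover have "p ` C \<subseteq> X" using C(2) by auto
    ultimately show False using Et_not_compact_image by blast
  qed
  ultimately have YE: "Y \<subseteq> Et" using Et_absorbs YH by blast
  have BH: "?B \<subseteq> H3" by (auto simp: H3_def)
  have BE: "hinv J u \<in> Et" if "u \<in> ?B" for u
  proof -
    have "u \<in> H3 - W" using that BH Y(3) by blast
    then show ?thesis using YE unfolding Y_def by blast
  qed
  \<comment> \<open>The covering is precomposed with the coordinate change, so that the volume bound
    applies to a box in the coordinates of \<open>W\<close>.\<close>
  interpret J: hyperbolic_covering X d "p \<circ> hinv J"
  proof unfold_locales
    have "liso (hinv (hinv J) ` H3) (p \<circ> hinv J)" using liso_hisom[OF liso_p J'] .
    then show "liso H3 (p \<circ> hinv J)" using hisom_image_H3[OF inv_hisom[OF J']] by simp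
  qed (fact connected_X)
  have fib: "{v \<in> ?B. (p \<circ> hinv J) v = (p \<circ> hinv J) u} \<subseteq> (\<lambda>g. J (g (hinv J u))) ` FF" if u: "u \<in> ?B" for u
  proof
    fix v assume "v \<in> {v \<in> ?B. (p \<circ> hinv J) v = (p \<circ> hinv J) u}"
    then have v: "v \<in> ?B" "p (hinv J v) = p (hinv J u)" by simp_all
    obtain i j where ij: "hinv J v = periph i j (hinv J u)" using Et_fibre[OF BE[OF u] BE[OF v(1)]] v(2) by metis
    have "v = J (hinv J v)" using J by simp
    then have v2: "v = J (periph i j (hinv J u))" using ij by simp
    then have "J (periph i j (hinv J u)) \<in> ?B" using v(1) by simp
    then have "periph i j \<in> FF" by (rule F(3)[OF u])
    then show "v \<in> (\<lambda>g. J (g (hinv J u))) ` FF" using v2 by blast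
  qed
  have "emeasure H3_volume ?B < \<infinity>"
  proof (rule J.volume_finite_to_one[OF vol _ BH, of "card FF"])
    show "?B \<in> sets borel" by (intro borel_Times) auto
    fix u assume u: "u \<in> ?B"
    have "finite ((\<lambda>g. J (g (hinv J u))) ` FF)" using F(1) by simp
    moreover have "card ((\<lambda>g. J (g (hinv J u))) ` FF) \<le> card FF" using F(1) by (rule card_image_le)
    ultimately show "finite {v \<in> ?B. (p \<circ> hinv J) v = (p \<circ> hinv J) u} \<and> card {v \<in> ?B. (p \<circ> hinv J) v = (p \<circ> hinv J) u} \<le> card FF"
      using fib[OF u] by (meson card_mono finite_subset order_trans)
  qed
  then show False using H3_volume_cusp_box[OF Y(1,2)] by simp
qed

text \<open>Multiples with negative \<open>n\<close> reduce to positive ones by starting from the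
  translated point. It is applied to coordinates and to logarithms of heights.\<close>

lemma int_additive:
  fixes F :: "complex \<times> real \<Rightarrow> 'b::ring_1"
  assumes add: "\<And>u. u \<in> H3 \<Longrightarrow> F (periph i j u) = F u + c" and u: "u \<in> H3"
  shows "F (periph (n * i) (n * j) u) = F u + of_int n * c"
proof -
  have H: "periph k l v \<in> H3" if "v \<in> H3" for k l v using periph(1)[of k l] that by simp
  have nat: "F (periph (int m * i) (int m * j) v) = F v + of_nat m * c" if v: "v \<in> H3" for m v
  proof (induction m)
    case 0 then show ?case by (simp add: periph_0)
  next
    case (Suc m)
    have "periph (int (Suc m) * i) (int (Suc m) * j) v = periph i j (periph (int m * i) (int m * j) v)"
      using fun_cong[OF periph_comp[of i j "int m * i" "int m * j"], of v] by (simp add: algebra_simps)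
    then show ?case using add[OF H[OF v]] Suc by (simp add: algebra_simps)
  qed
  show ?thesis
  proof (cases "n \<ge> 0")
    case True
    then have "n = int (nat n)" by simp
    then show ?thesis using nat[OF u, of "nat n"] by (metis of_int_of_nat_eq)
  next
    case False
    define m where "m = nat (- n)"
    have m: "n = - int m" using False by (simp add: m_def)
    let ?w = "periph (n * i) (n * j) u"
    have "periph (int m * i) (int m * j) ?w = u"
      using fun_cong[OF periph_comp[of "int m * i" "int m * j" "n * i" "n * j"], of u]
      by (simp add: m periph_0)
    then show ?thesis using nat[OF H[OF u], of m "n * i" "n * j"] m by (simp add: algebra_simps)
  qed
qed

definition cell :: "(complex \<times> real) set" where
  "cell = Q ` (cbox 0 (Complex (2*pi) (2*pi)) \<times> {1})"

lemma cell: "compact cell" "cell \<subseteq> H3"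
  "u \<in> Tt \<Longrightarrow> \<exists>i j. \<exists>v\<in>cell. u = periph i j v"
proof -
  show "compact cell" unfolding cell_def by (rule compact_Q_cell)
  show "cell \<subseteq> H3" unfolding cell_def using Q(2) by (force simp: halfcyl_def)
  show "\<exists>i j. \<exists>v\<in>cell. u = periph i j v" if "u \<in> Tt"
    using subsetD[OF Tt_fundamental that] unfolding cell_def by blast
qed

lemma periph_hisom [simp]: "periph i j \<in> hisom"
  using periph(1) by simp

lemma compact_H3_box: "compact (cbox a b \<times> {s..t::real})" "s > 0 \<Longrightarrow> cbox a b \<times> {s..t} \<subseteq> H3" for a b :: complex
  by (auto intro!: compact_Times simp: H3_def)

lemma compact_hisom_image: "g \<in> hisom \<Longrightarrow> compact C \<Longrightarrow> C \<subseteq> H3 \<Longrightarrow> compact (g ` C)"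
  using compact_continuous_image[OF continuous_on_subset[OF continuous_on_hisom]] by blast

lemma compact_bounds:
  assumes "compact C" "C \<subseteq> H3"
  obtains R where "R > 1" "\<And>v. v \<in> C \<Longrightarrow> cmod (fst v) \<le> R \<and> 1 / R \<le> snd v \<and> snd v \<le> R"
proof -
  have 1: "compact ((\<lambda>v. cmod (fst v)) ` C)" "compact (snd ` C)" "compact ((\<lambda>v. 1 / snd v) ` C)"
    using assms by (auto intro!: compact_continuous_image continuous_intros simp: H3_def)
  obtain a where a: "\<And>v. v \<in> C \<Longrightarrow> cmod (fst v) \<le> a" using compact_imp_bounded[OF 1(1)] unfolding bounded_iff by force
  obtain b where b: "\<And>v. v \<in> C \<Longrightarrow> \<bar>snd v\<bar> \<le> b" using compact_imp_bounded[OF 1(2)] unfolding bounded_iff by force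
  obtain c where c: "\<And>v. v \<in> C \<Longrightarrow> \<bar>1 / snd v\<bar> \<le> c" using compact_imp_bounded[OF 1(3)] unfolding bounded_iff by force
  define R where "R = max 2 (max a (max b c))"
  show ?thesis
  proof (rule that[of R])
    show "R > 1" by (simp add: R_def)
    fix v assume v: "v \<in> C"
    have "snd v > 0" using v assms(2) by (auto simp: H3_def)
    moreover have "1 / snd v \<le> R" using c[OF v] \<open>snd v > 0\<close> by (auto simp: R_def le_max_iff_disj)
    ultimately have "1 / R \<le> snd v" by (simp add: R_def field_simps)
    then show "cmod (fst v) \<le> R \<and> 1 / R \<le> snd v \<and> snd v \<le> R" using a[OF v] b[OF v] by (auto simp: R_def)
  qed
qed

text \<open>Without peripheral motion \<open>Tt\<close> is contained in the compact
  \<open>cell\<close>, hence in a box with connected complement, and \<open>p\<close> is injective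
  on the lifted end.\<close>

lemma periph_nontrivial: obtains i j where "periph i j \<noteq> id"
proof (rule ccontr)
  assume "\<not> thesis"
  then have triv: "periph i j = id" for i j using that by blast
  obtain R where R: "R > 1" "\<And>v. v \<in> cell \<Longrightarrow> cmod (fst v) \<le> R \<and> 1 / R \<le> snd v \<and> snd v \<le> R"
    using compact_bounds[OF cell(1,2)] by metis
  define W where "W = {v. \<bar>Re (fst v)\<bar> \<le> R \<and> \<bar>Im (fst v)\<bar> \<le> R \<and> 1 / R \<le> snd v \<and> snd v \<le> R}"
  define C where "C = cbox (Complex (- R) (- R)) (Complex R R) \<times> {1/R..R}"
  have hid: "hinv id u = u" for u :: "complex \<times> real" by simp
  show False
  proof (rule cusp_contradiction[of id W C 0 "1 + \<i>" "1 / R" "{id}"])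
    show "id ` Tt \<subseteq> W"
    proof
      fix u assume "u \<in> id ` Tt"
      then obtain v where "v \<in> cell" "u = v" using cell(3)[of u] triv by auto
      then show "u \<in> W" using R(2)[of u] abs_Re_le_cmod[of "fst u"] abs_Im_le_cmod[of "fst u"] by (simp add: W_def)
    qed
    show "compact C" "C \<subseteq> H3" unfolding C_def using compact_H3_box R(1) by auto
    show "p u \<in> p ` C" if "u \<in> Et" "id u \<in> W" for u
    proof (rule imageI)
      show "u \<in> C" using that(2) by (cases u) (auto simp: W_def C_def in_cbox_complex_iff abs_le_iff)
    qed
    show "connected (H3 - W)" unfolding W_def using connected_slab_complement(2) R(1) by simp
    show "measure lborel (cbox 0 (1 + \<i>)) > 0"
      by (intro content_pos_lt) (auto simp: Basis_complex_def)
    show "(cbox 0 (1 + \<i>) \<times> {0<..<1 / R}) \<inter> W = {}" by (auto simp: W_def)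
  qed (use R triv in auto)
qed

end

lemma floor_divide_bounds:
  fixes L x :: real
  assumes "L > 0"
  shows "of_int \<lfloor>x / L\<rfloor> * L \<le> x" "x \<le> (of_int \<lfloor>x / L\<rfloor> + 1) * L"
proof -
  have "of_int \<lfloor>x / L\<rfloor> * L \<le> x / L * L" "x / L * L \<le> (of_int \<lfloor>x / L\<rfloor> + 1) * L"
    using assms by (intro mult_right_mono; linarith)+
  then show "of_int \<lfloor>x / L\<rfloor> * L \<le> x" "x \<le> (of_int \<lfloor>x / L\<rfloor> + 1) * L" using assms by simp_all
qed

lemma hinv_mob: "B \<in> SL2 \<Longrightarrow> hinv (mob B) = mob (mcof B)"
  by (rule inv_unique_comp) (auto simp: fun_eq_iff mob_mob)

lemma hisom_square_mob:
  assumes "h \<in> hisom" obtains A where "A \<in> SL2" "h \<circ> h = mob A"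
proof -
  obtain M where M: "M \<in> SL2" "h = mob M \<or> h = mob M \<circ> hconj" using assms by (auto simp: hisom_def)
  from M(2) show ?thesis
  proof
    assume h: "h = mob M"
    have "h \<circ> h = mob (mmul M M)" unfolding h using M(1) by (intro ext) (simp add: mob_mob)
    then show ?thesis using that[of "mmul M M"] M(1) by simp
  next
    assume h: "h = mob M \<circ> hconj"
    have "h \<circ> h = mob (mmul M (mcnj M))" unfolding h using M(1) by (intro ext) (simp add: mob_mob hconj_mob)
    then show ?thesis using that[of "mmul M (mcnj M)"] M(1) by simp
  qed
qed

context finite_volume_end
begin

lemma periph_H3 [simp]: "periph i j u \<in> H3 \<longleftrightarrow> u \<in> H3"
  by (rule hisom_H3_iff) simp

text \<open>Squares preserve orientation. A nontrivial peripheral element cannot have square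
  \<open>id\<close>, since an involution has a fixed point while the deck group acts freely.\<close>

lemma ex_orientation_preserving:
  obtains k l A where "A \<in> SL2" "periph k l = mob A" "mob A \<noteq> id"
proof -
  obtain i j where ij: "periph i j \<noteq> id" using periph_nontrivial .
  obtain A where A: "A \<in> SL2" "periph i j \<circ> periph i j = mob A" using hisom_square_mob[OF periph_hisom] .
  have "mob A \<noteq> id"
  proof
    assume "mob A = id"
    then have inv: "periph i j (periph i j v) = v" for v using fun_cong[OF A(2), of v] by simp
    obtain u where "u \<in> H3" "periph i j u = u" using involution_fixed_point[OF periph_hisom inv] by metis
    then have "periph i j = id" using deck_free[OF periph(1)] by blast
    with ij show False ..
  qed
  then show ?thesis using that[OF A(1), of "i + i" "j + j"] A(2) periph_comp[of i j i j] by simp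
qed

definition conjg :: "(complex \<times> real \<Rightarrow> complex \<times> real) \<Rightarrow> int \<Rightarrow> int \<Rightarrow> complex \<times> real \<Rightarrow> complex \<times> real" where
  "conjg J i j v = J (periph i j (hinv J v))"

lemma conjg_hisom: "J \<in> hisom \<Longrightarrow> conjg J i j \<in> hisom"
proof -
  assume "J \<in> hisom"
  then have "J \<circ> periph i j \<circ> hinv J \<in> hisom" by (intro hisom_comp inv_hisom) auto
  moreover have "conjg J i j = J \<circ> periph i j \<circ> hinv J" by (simp add: fun_eq_iff conjg_def)
  ultimately show ?thesis by simp
qed

lemma conjg_apply: "J \<in> hisom \<Longrightarrow> conjg J i j (J u) = J (periph i j u)"
  by (simp add: conjg_def)

lemma conjg_conjg: "J \<in> hisom \<Longrightarrow> conjg J i j (conjg J i' j' v) = conjg J (i + i') (j + j') v"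
  using fun_cong[OF periph_comp[of i j i' j'], of "hinv J v"] by (simp add: conjg_def)

text \<open>All peripheral elements commute with the loxodromic one and therefore act as
  similarities preserving its axis. So \<open>Tt\<close> stays in a cone around the axis, and the
  cone is compact modulo the loxodromic element.\<close>

lemma no_loxodromic:
  assumes J: "J \<in> hisom" and ad: "a * a' = 1" "cmod a > 1"
    and dia: "\<And>v. v \<in> H3 \<Longrightarrow> conjg J k l v = mob (a, 0, 0, a') v"
  shows False
proof -
  have T: "(a, 0, 0, a') \<in> SL2" using ad by (simp add: SL2_def)
  have sc: "\<exists>m>0. \<forall>v\<in>H3. snd (conjg J i j v) = m * snd v \<and> cmod (fst (conjg J i j v)) = m * cmod (fst v)" for i j
  proof -
    have comm: "conjg J i j (mob (a, 0, 0, a') v) = mob (a, 0, 0, a') (conjg J i j v)" if v: "v \<in> H3" for v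
    proof -
      have "conjg J i j v \<in> H3" using conjg_hisom[OF J] v by simp
      then show ?thesis using v conjg_conjg[OF J, of i j k l v] conjg_conjg[OF J, of k l i j v] dia by (simp add: add.commute)
    qed
    have "cmod a \<noteq> 1" using ad by simp
    from commute_diag[OF conjg_hisom[OF J] ad(1) this comm] show ?thesis by metis
  qed
  define \<kappa> where "\<kappa> = (cmod a)\<^sup>2"
  have \<kappa>: "\<kappa> > 1" using ad(2) by (simp add: \<kappa>_def power2_eq_square less_1_mult)
  have lk: "ln \<kappa> > 0" using \<kappa> by simp
  obtain R where R: "R > 1" "\<And>v. v \<in> J ` cell \<Longrightarrow> cmod (fst v) \<le> R \<and> 1 / R \<le> snd v \<and> snd v \<le> R"
    using compact_bounds[of "J ` cell"] compact_hisom_image[OF J cell(1,2)] cell(2) J by (metis hisom_H3 image_subset_iff subsetD)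
  \<comment> \<open>On the compact cell the modulus is at most \<open>R\<close> and the height at
    least \<open>1 / R\<close>, so their ratio is at most the square of \<open>R\<close>;
    similarities preserve this ratio.\<close>
  define W where "W = {v::complex \<times> real. cmod (fst v) \<le> R\<^sup>2 * snd v}"
  define C0 where "C0 = cbox (Complex (- (R\<^sup>2 * \<kappa>)) (- (R\<^sup>2 * \<kappa>))) (Complex (R\<^sup>2 * \<kappa>) (R\<^sup>2 * \<kappa>)) \<times> {1..\<kappa>}"
  have C0: "compact C0" "C0 \<subseteq> H3" unfolding C0_def using compact_H3_box by auto
  \<comment> \<open>The points of this box have modulus at least 1 and height below the inverse
    square of \<open>R\<close>, so the box misses the cone.\<close>
  define B where "B = cbox 1 (2 + \<i>) \<times> {0<..<1/R\<^sup>2}"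
  have Bn: "1 \<le> cmod (fst u) \<and> cmod (fst u) \<le> 3 \<and> u \<in> H3" if "u \<in> B" for u
  proof -
    have b: "1 \<le> Re (fst u)" "Re (fst u) \<le> 2" "0 \<le> Im (fst u)" "Im (fst u) \<le> 1" "snd u > 0"
      using that by (auto simp: B_def in_cbox_complex_iff mem_Times_iff)
    then show ?thesis using complex_Re_le_cmod[of "fst u"] cmod_le[of "fst u"] by (simp add: H3_def)
  qed
  \<comment> \<open>Moduli in the box lie between 1 and 3, so an element that maps a point of the
    box into the box scales by a factor between \<open>1/3\<close> and 3. It moves the base point
    within a compact segment of the axis, which leaves finitely many elements.\<close>
  define FF where "FF = {g \<in> deck. g (hinv J (0, 1)) \<in> hinv J ` (cbox 0 0 \<times> {1/3..3})}"
  have K0: "compact (cbox (0::complex) 0 \<times> {1/3..3::real})" "cbox (0::complex) 0 \<times> {1/3..3::real} \<subseteq> H3"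
    by (rule compact_H3_box(1), rule compact_H3_box(2), simp)
  show False
  proof (rule cusp_contradiction[OF J, of W "hinv J ` C0" 1 "2 + \<i>" "1 / R\<^sup>2" FF])
    show "J ` Tt \<subseteq> W"
    proof
      fix x assume "x \<in> J ` Tt"
      then obtain u where u: "u \<in> Tt" "x = J u" by blast
      obtain i j v where v: "v \<in> cell" "u = periph i j v" using cell(3)[OF u(1)] by blast
      obtain m where m: "m > 0" "\<forall>v\<in>H3. snd (conjg J i j v) = m * snd v \<and> cmod (fst (conjg J i j v)) = m * cmod (fst v)"
        using sc by blast
      have Jv: "J v \<in> H3" using v cell(2) J by auto
      have x: "x = conjg J i j (J v)" using u v J by (simp add: conjg_apply)
      have b: "cmod (fst (J v)) \<le> R" "1 / R \<le> snd (J v)" using R(2)[of "J v"] v by auto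
      have "R \<le> R\<^sup>2 * snd (J v)"
      proof -
        have "R\<^sup>2 * (1 / R) \<le> R\<^sup>2 * snd (J v)" using b(2) by (intro mult_left_mono) auto
        then show ?thesis using R(1) by (simp add: power2_eq_square)
      qed
      then have "m * cmod (fst (J v)) \<le> m * (R\<^sup>2 * snd (J v))" using b(1) m(1) by (intro mult_left_mono) auto
      then show "x \<in> W" using m(2) Jv x by (simp add: W_def mult.left_commute)
    qed
    show "compact (hinv J ` C0)" "hinv J ` C0 \<subseteq> H3" using compact_hisom_image[OF inv_hisom[OF J] C0] C0(2) J by auto
    show "p u \<in> p ` hinv J ` C0" if u: "u \<in> Et" "J u \<in> W" for u
    proof -
      have uH: "u \<in> H3" using u Et_H3 by blast
      define t where "t = snd (J u)"
      have "J u \<in> H3" using uH J by simp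
      then have t: "t > 0" by (simp add: t_def H3_def)
      \<comment> \<open>The power of the loxodromic element that brings the height into the
        fundamental interval from 1 to \<open>\<kappa>\<close>.\<close>
      define n where "n = - \<lfloor>ln t / ln \<kappa>\<rfloor>"
      define u' where "u' = periph (n * k) (n * l) u"
      have u'H: "u' \<in> H3" using uH by (simp add: u'_def)
      then have Ju': "J u' \<in> H3" using J by simp
      have "(ln (snd (J (periph (n * k) (n * l) u)))) = ln (snd (J u)) + of_int n * ln \<kappa>"
      proof (rule int_additive[of "\<lambda>u. ln (snd (J u))", OF _ uH])
        fix w assume w: "w \<in> H3"
        have Jw: "J w \<in> H3" using w J by simp
        have "J (periph k l w) = conjg J k l (J w)" using J by (simp add: conjg_apply)
        also have "\<dots> = (a\<^sup>2 * fst (J w), \<kappa> * snd (J w))" using dia[OF Jw] mob_diag[OF Jw ad(1)] by (simp add: \<kappa>_def)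
        finally have "snd (J (periph k l w)) = \<kappa> * snd (J w)" by simp
        moreover have "snd (J w) > 0" using Jw by (simp add: H3_def)
        ultimately show "ln (snd (J (periph k l w))) = ln (snd (J w)) + ln \<kappa>" using \<kappa> by (simp add: ln_mult)
      qed
      then have lu: "ln (snd (J u')) = ln t + of_int n * ln \<kappa>" by (simp add: u'_def t_def)
      have s0: "snd (J u') > 0" using Ju' by (simp add: H3_def)
      note floor_divide_bounds[OF lk, of "ln t"]
      then have "0 \<le> ln (snd (J u'))" "ln (snd (J u')) \<le> ln \<kappa>" unfolding lu n_def by (simp_all add: algebra_simps)
      then have s: "1 \<le> snd (J u')" "snd (J u') \<le> \<kappa>" using s0 \<kappa> by (simp_all add: ln_ge_zero_iff ln_le_cancel_iff)
      obtain m where m: "m > 0" "\<forall>v\<in>H3. snd (conjg J (n*k) (n*l) v) = m * snd v \<and> cmod (fst (conjg J (n*k) (n*l) v)) = m * cmod (fst v)"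
        using sc by blast
      have "J u' = conjg J (n*k) (n*l) (J u)" using J by (simp add: conjg_apply u'_def)
      then have "cmod (fst (J u')) = m * cmod (fst (J u))" "snd (J u') = m * snd (J u)" using m(2) uH J by auto
      moreover have "m * cmod (fst (J u)) \<le> m * (R\<^sup>2 * snd (J u))" using u(2) m(1) by (intro mult_left_mono) (auto simp: W_def)
      ultimately have "cmod (fst (J u')) \<le> R\<^sup>2 * snd (J u')" by (simp add: mult.left_commute)
      also have "\<dots> \<le> R\<^sup>2 * \<kappa>" using s by (intro mult_left_mono) auto
      finally have c: "cmod (fst (J u')) \<le> R\<^sup>2 * \<kappa>" .
      have "J u' \<in> C0"
        using s c abs_Re_le_cmod[of "fst (J u')"] abs_Im_le_cmod[of "fst (J u')"]
        by (simp add: C0_def mem_Times_iff in_cbox_complex_iff abs_le_iff)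
      then have "u' \<in> hinv J ` C0" unfolding hisom_mem_image_inv[OF J] .
      moreover have "p u' = p u" unfolding u'_def using deck_p[OF periph(1) uH] .
      ultimately show ?thesis by (metis imageI)
    qed
    show "connected (H3 - W)" unfolding W_def using R(1) by (intro connected_cone_complement) simp
    show "measure lborel (cbox 1 (2 + \<i>)) > 0" by (intro content_pos_lt) (auto simp: Basis_complex_def)
    show "0 < 1 / R\<^sup>2" using R(1) by simp
    show "(cbox 1 (2 + \<i>) \<times> {0<..<1 / R\<^sup>2}) \<inter> W = {}"
    proof -
      have "u \<notin> W" if u: "u \<in> B" for u
      proof -
        have "snd u < 1 / R\<^sup>2" using u by (simp add: B_def mem_Times_iff)
        then have "R\<^sup>2 * snd u < 1" using R(1) by (simp add: field_simps)
        then show ?thesis using Bn[OF u] by (simp add: W_def)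
      qed
      then show ?thesis unfolding B_def by blast
    qed
    show "finite FF" unfolding FF_def
      by (rule deck_finite) (use J compact_hisom_image[OF inv_hisom[OF J] K0] K0(2) in auto)
    show "FF \<subseteq> deck" by (auto simp: FF_def)
    fix i j u assume u: "u \<in> cbox 1 (2 + \<i>) \<times> {0<..<1 / R\<^sup>2}" "J (periph i j (hinv J u)) \<in> cbox 1 (2 + \<i>) \<times> {0<..<1 / R\<^sup>2}"
    have uB: "u \<in> B" "conjg J i j u \<in> B" using u by (simp_all only: B_def conjg_def)
    obtain m where m: "m > 0" "\<forall>v\<in>H3. snd (conjg J i j v) = m * snd v \<and> cmod (fst (conjg J i j v)) = m * cmod (fst v)"
      using sc by blast
    have "cmod (fst (conjg J i j u)) = m * cmod (fst u)" using m(2) Bn[OF uB(1)] by blast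
    then have mm: "1 \<le> m * cmod (fst u)" "m * cmod (fst u) \<le> 3" using Bn[OF uB(2)] by simp_all
    have "m * cmod (fst u) \<le> m * 3" "m * 1 \<le> m * cmod (fst u)" using m(1) Bn[OF uB(1)] by (intro mult_left_mono; simp)+
    then have m3: "1/3 \<le> m" "m \<le> 3" using mm by linarith+
    have "conjg J i j (0, 1) = (0, m)" using bspec[OF m(2) base_in_H3] by (simp add: prod_eq_iff)
    then have "J (periph i j (hinv J (0, 1))) \<in> cbox 0 0 \<times> {1/3..3}" using m3 by (simp add: conjg_def)
    then have "periph i j (hinv J (0, 1)) \<in> hinv J ` (cbox 0 0 \<times> {1/3..3})" unfolding hisom_mem_image_inv[OF J] .
    then show "periph i j \<in> FF" using periph(1) by (simp only: FF_def mem_Collect_eq)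
  qed
qed

text \<open>If all peripheral translations were real, imaginary parts would be moved only by
  reversing elements, and in a bounded way. Then \<open>Tt\<close> would lie in a slab that is
  compact modulo the translation by 1 and has connected complement.\<close>

lemma ex_nonreal_translation:
  assumes J: "J \<in> hisom" and par: "\<And>v. v \<in> H3 \<Longrightarrow> conjg J k l v = shift 1 v"
  obtains i j \<beta> where "\<And>v. v \<in> H3 \<Longrightarrow> conjg J i j v = shift \<beta> v" "Im \<beta> \<noteq> 0"
proof (rule ccontr)
  assume "\<not> thesis"
  note nt = this and th = that
  have real: "Im \<beta> = 0" if tr: "\<And>v. v \<in> H3 \<Longrightarrow> conjg J i j v = shift \<beta> v" for i j \<beta>
  proof (rule ccontr)
    assume "Im \<beta> \<noteq> 0"
    have thesis by (rule th[OF tr \<open>Im \<beta> \<noteq> 0\<close>])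
    with nt show False ..
  qed
  have form: "\<exists>\<beta>. (\<forall>v\<in>H3. conjg J i j v = shift \<beta> v) \<or> (\<forall>v\<in>H3. conjg J i j v = shift \<beta> (hconj v))" for i j
  proof -
    have comm: "conjg J i j (shift 1 v) = shift 1 (conjg J i j v)" if v: "v \<in> H3" for v
    proof -
      have "conjg J i j v \<in> H3" using conjg_hisom[OF J] v by simp
      then show ?thesis using v conjg_conjg[OF J, of i j k l v] conjg_conjg[OF J, of k l i j v] par by (simp add: add.commute)
    qed
    from commute_shift[OF conjg_hisom[OF J] comm] show ?thesis by metis
  qed
  \<comment> \<open>Two reversing elements compose to a translation whose imaginary part is the
    difference of theirs; as translations are real, all reversing elements share one imaginary
    part.\<close>
  have "\<exists>c. \<forall>i j \<beta>. (\<forall>v\<in>H3. conjg J i j v = shift \<beta> (hconj v)) \<longrightarrow> Im \<beta> = c"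
  proof (cases "\<exists>i j \<beta>. \<forall>v\<in>H3. conjg J i j v = shift \<beta> (hconj v)")
    case True
    then obtain i j \<beta> where g: "\<And>v. v \<in> H3 \<Longrightarrow> conjg J i j v = shift \<beta> (hconj v)" by blast
    have "Im \<beta>' = Im \<beta>" if g': "\<And>v. v \<in> H3 \<Longrightarrow> conjg J i' j' v = shift \<beta>' (hconj v)" for i' j' \<beta>'
    proof -
      have "conjg J (i' + i) (j' + j) v = shift (\<beta>' + cnj \<beta>) v" if v: "v \<in> H3" for v
      proof -
        have "hconj (shift \<beta> (hconj v)) = shift (cnj \<beta>) v" using v by (simp add: hconj_def shift_def H3_def)
        moreover have "shift \<beta> (hconj v) \<in> H3" using v hconj_in_H3 by simp
        ultimately have "conjg J i' j' (conjg J i j v) = shift \<beta>' (shift (cnj \<beta>) v)" using g[OF v] g' by simp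
        then show ?thesis using conjg_conjg[OF J] by (simp add: shift_shift)
      qed
      then have "Im (\<beta>' + cnj \<beta>) = 0" by (rule real)
      then show ?thesis by simp
    qed
    then show ?thesis by (intro exI[of _ "Im \<beta>"]) blast
  qed blast
  then obtain c where c: "\<And>i j \<beta>. (\<forall>v\<in>H3. conjg J i j v = shift \<beta> (hconj v)) \<Longrightarrow> Im \<beta> = c" by blast
  obtain R0 where R0: "R0 > 1" "\<And>v. v \<in> J ` cell \<Longrightarrow> cmod (fst v) \<le> R0 \<and> 1 / R0 \<le> snd v \<and> snd v \<le> R0"
    using compact_bounds[of "J ` cell"] compact_hisom_image[OF J cell(1,2)] cell(2) J by (metis hisom_H3 image_subset_iff subsetD)
  \<comment> \<open>The summand \<open>\<bar>c\<bar>\<close> makes room for the reversing elements,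
    which send the imaginary part y to c - y.\<close>
  define R where "R = R0 + \<bar>c\<bar>"
  have R: "R > 1" "R0 \<le> R" "1 / R \<le> 1 / R0" using R0(1) by (auto simp: R_def frac_le)
  define W where "W = {v::complex \<times> real. \<bar>Im (fst v)\<bar> \<le> R \<and> 1 / R \<le> snd v \<and> snd v \<le> R}"
  define C0 where "C0 = cbox (Complex 0 (- R)) (Complex 1 R) \<times> {1/R..R}"
  have C0: "compact C0" "C0 \<subseteq> H3" unfolding C0_def using compact_H3_box R(1) by auto
  \<comment> \<open>An element that maps a point of the unit square into the square has an offset
    \<open>\<beta>\<close> bounded by 2 in each coordinate; 4 is generous.\<close>
  define K0 where "K0 = cbox (Complex (-4) (-4)) (Complex 4 4) \<times> {1..1::real}"
  have K0: "compact K0" "K0 \<subseteq> H3" unfolding K0_def by (rule compact_H3_box(1), rule compact_H3_box(2), simp)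
  define FF where "FF = {g \<in> deck. g (hinv J (0, 1)) \<in> hinv J ` K0}"
  show False
  proof (rule cusp_contradiction[OF J, of W "hinv J ` C0" 0 "1 + \<i>" "1 / R" FF])
    show "J ` Tt \<subseteq> W"
    proof
      fix x assume "x \<in> J ` Tt"
      then obtain u where u: "u \<in> Tt" "x = J u" by blast
      obtain i j v where v: "v \<in> cell" "u = periph i j v" using cell(3)[OF u(1)] by blast
      have Jv: "J v \<in> H3" using v cell(2) J by auto
      have x: "x = conjg J i j (J v)" using u v J by (simp add: conjg_apply)
      have b: "cmod (fst (J v)) \<le> R0" "1 / R0 \<le> snd (J v)" "snd (J v) \<le> R0" using R0(2)[of "J v"] v by auto
      have bi: "\<bar>Im (fst (J v))\<bar> \<le> R0" using b(1) abs_Im_le_cmod[of "fst (J v)"] by linarith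
      obtain \<beta> where \<beta>: "(\<forall>v\<in>H3. conjg J i j v = shift \<beta> v) \<or> (\<forall>v\<in>H3. conjg J i j v = shift \<beta> (hconj v))"
        using form by blast
      then show "x \<in> W"
      proof
        assume "\<forall>v\<in>H3. conjg J i j v = shift \<beta> v"
        then have "Im \<beta> = 0" "x = shift \<beta> (J v)" using real[of i j \<beta>] x Jv by auto
        then show ?thesis using b bi R by (simp add: W_def shift_def)
      next
        assume "\<forall>v\<in>H3. conjg J i j v = shift \<beta> (hconj v)"
        then have "Im \<beta> = c" "x = shift \<beta> (hconj (J v))" using c[of i j \<beta>] x Jv by auto
        moreover have "\<bar>c - Im (fst (J v))\<bar> \<le> R" using bi unfolding R_def by linarith
        moreover have "snd (J v) \<le> R" "1 / R \<le> snd (J v)" using b R by linarith+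
        ultimately show ?thesis using Jv by (simp add: W_def shift_def hconj_def)
      qed
    qed
    show "compact (hinv J ` C0)" "hinv J ` C0 \<subseteq> H3" using compact_hisom_image[OF inv_hisom[OF J] C0] C0(2) J by auto
    show "p u \<in> p ` hinv J ` C0" if u: "u \<in> Et" "J u \<in> W" for u
    proof -
      have uH: "u \<in> H3" using u Et_H3 by blast
      define n where "n = - \<lfloor>Re (fst (J u))\<rfloor>"
      define u' where "u' = periph (n * k) (n * l) u"
      have st: "J (periph k l w) = shift 1 (J w)" if "w \<in> H3" for w
        using par[of "J w"] that J by (simp add: conjg_apply)
      have "fst (J (periph (n * k) (n * l) u)) = fst (J u) + of_int n * 1"
        by (rule int_additive[of "\<lambda>u. fst (J u)", OF _ uH]) (simp add: st shift_def)
      then have f: "fst (J u') = fst (J u) + of_int n" by (simp add: u'_def)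
      have "snd (J (periph (n * k) (n * l) u)) = snd (J u) + of_int n * 0"
        by (rule int_additive[of "\<lambda>u. snd (J u)", OF _ uH]) (simp add: st shift_def)
      then have s: "snd (J u') = snd (J u)" by (simp add: u'_def)
      have "0 \<le> Re (fst (J u')) \<and> Re (fst (J u')) \<le> 1" unfolding f n_def by simp linarith
      then have "J u' \<in> C0" using u(2) f s
        by (simp add: C0_def W_def mem_Times_iff in_cbox_complex_iff abs_le_iff)
      then have "u' \<in> hinv J ` C0" unfolding hisom_mem_image_inv[OF J] .
      moreover have "p u' = p u" unfolding u'_def using deck_p[OF periph(1) uH] .
      ultimately show ?thesis by (metis imageI)
    qed
    show "connected (H3 - W)" unfolding W_def using R(1) by (intro connected_slab_complement(1)) simp
    show "measure lborel (cbox 0 (1 + \<i>)) > 0" by (intro content_pos_lt) (auto simp: Basis_complex_def)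
    show "0 < 1 / R" using R(1) by simp
    show "(cbox 0 (1 + \<i>) \<times> {0<..<1 / R}) \<inter> W = {}" by (auto simp: W_def)
    show "finite FF" unfolding FF_def
      by (rule deck_finite) (use J compact_hisom_image[OF inv_hisom[OF J] K0] K0(2) in auto)
    show "FF \<subseteq> deck" by (auto simp: FF_def)
    fix i j u assume u: "u \<in> cbox 0 (1 + \<i>) \<times> {0<..<1 / R}" "J (periph i j (hinv J u)) \<in> cbox 0 (1 + \<i>) \<times> {0<..<1 / R}"
    have uH: "u \<in> H3" using u(1) by (auto simp: H3_def)
    have r1: "0 \<le> Re (fst u)" "Re (fst u) \<le> 1" "0 \<le> Im (fst u)" "Im (fst u) \<le> 1"
      using u(1) by (auto simp: mem_Times_iff in_cbox_complex_iff)
    have r2: "0 \<le> Re (fst (conjg J i j u))" "Re (fst (conjg J i j u)) \<le> 1" "0 \<le> Im (fst (conjg J i j u))" "Im (fst (conjg J i j u)) \<le> 1"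
      using u(2) by (auto simp: mem_Times_iff in_cbox_complex_iff conjg_def)
    obtain \<beta> where \<beta>: "(\<forall>v\<in>H3. conjg J i j v = shift \<beta> v) \<or> (\<forall>v\<in>H3. conjg J i j v = shift \<beta> (hconj v))"
      using form by blast
    then have "conjg J i j (0, 1) = (\<beta>, 1)" by (auto simp: shift_def hconj_def)
    moreover have "(\<beta>, 1) \<in> K0"
      using \<beta>
    proof
      assume "\<forall>v\<in>H3. conjg J i j v = shift \<beta> v"
      then have "fst (conjg J i j u) = fst u + \<beta>" using uH by (simp add: shift_def)
      then show ?thesis using r1 r2 by (simp add: K0_def in_cbox_complex_iff)
    next
      assume "\<forall>v\<in>H3. conjg J i j v = shift \<beta> (hconj v)"
      then have "fst (conjg J i j u) = cnj (fst u) + \<beta>" using uH by (simp add: shift_def hconj_def)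
      then show ?thesis using r1 r2 by (simp add: K0_def in_cbox_complex_iff)
    qed
    ultimately have "J (periph i j (hinv J (0, 1))) \<in> K0" by (simp add: conjg_def)
    then have "periph i j (hinv J (0, 1)) \<in> hinv J ` K0" unfolding hisom_mem_image_inv[OF J] .
    then show "periph i j \<in> FF" using periph(1) by (simp only: FF_def mem_Collect_eq)
  qed
qed

text \<open>A diagonal element would be loxodromic or fix a point, so a parabolic one exists. A
  nonreal translation then excludes reversing elements. Meridian and longitude are independent over
  the reals because all peripheral translations are integral combinations of theirs.\<close>

theorem peripheral_translations:
  obtains J b c where "J \<in> hisom" "\<And>v. v \<in> H3 \<Longrightarrow> conjg J 0 1 v = shift b v" "\<And>v. v \<in> H3 \<Longrightarrow> conjg J 1 0 v = shift c v"
    "b \<noteq> 0" "Im (c / b) \<noteq> 0"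
proof -
  obtain k l A where A: "A \<in> SL2" "periph k l = mob A" "mob A \<noteq> id" using ex_orientation_preserving .
  have cj: "conjg (mob B) k l v = mob B (mob A (mob (mcof B) v))" if "B \<in> SL2" for B v
    using that by (simp add: conjg_def hinv_mob A)
  from A(1,3) show ?thesis
  proof (cases rule: mob_conj_normal)
    case (dia B a a')
    have J: "mob B \<in> hisom" using dia by simp
    have ad: "cmod a * cmod a' = 1" using dia(2) by (metis norm_mult norm_one)
    consider "cmod a > 1" | "cmod a = 1" | "cmod a < 1" by linarith
    then show ?thesis
    proof cases
      case 1
      then show ?thesis using no_loxodromic[OF J dia(2) 1, of k l] cj[OF dia(1)] dia(3) by simp
    next
      case 2
      have "conjg (mob B) k l (0, 1) = (0, 1)"
        unfolding cj[OF dia(1)] dia(3) using mob_diag[OF base_in_H3 dia(2)] 2 by simp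
      then have "mob (mcof B) (mob B (mob A (mob (mcof B) (0, 1)))) = mob (mcof B) (0, 1)"
        unfolding cj[OF dia(1)] by simp
      then have "periph k l (mob (mcof B) (0, 1)) = mob (mcof B) (0, 1)"
        using dia(1) A(1) by (simp add: A(2) mob_mob mmul_assoc[symmetric])
      then have "periph k l = id" using dia(1) by (intro deck_free[OF periph(1)]) (auto simp: mob_in_H3)
      then show ?thesis using A by simp
    next
      case 3
      have d1: "cmod a' > 1"
      proof (rule ccontr)
        assume "\<not> cmod a' > 1"
        then have "cmod a * cmod a' \<le> cmod a * 1" by (intro mult_left_mono) auto
        with ad 3 show False by simp
      qed
      have ad': "a' * a = 1" using dia(2) by (simp add: mult.commute)
      have S: "(a, 0, 0, a') \<in> SL2" "(a', 0, 0, a) \<in> SL2" using dia(2) ad' by (auto simp: SL2_def)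
      have "conjg (mob B) (- k) (- l) v = mob (a', 0, 0, a) v" if v: "v \<in> H3" for v
      proof -
        have vH: "mob (a', 0, 0, a) v \<in> H3" using S v by (simp add: mob_in_H3)
        have e: "mob (a, 0, 0, a') (mob (a', 0, 0, a) v) = v"
          using S dia(2) ad' mob_mone by (simp add: mob_mob mone_def)
        have "conjg (mob B) (- k) (- l) v = conjg (mob B) (- k) (- l) (conjg (mob B) k l (mob (a', 0, 0, a) v))"
          unfolding cj[OF dia(1)] dia(3) e ..
        also have "\<dots> = conjg (mob B) 0 0 (mob (a', 0, 0, a) v)" using conjg_conjg[OF J] by simp
        also have "\<dots> = mob (a', 0, 0, a) v" using J by (simp add: conjg_def periph_0)
        finally show ?thesis .
      qed
      then show ?thesis using no_loxodromic[OF J ad' d1] by blast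
    qed
  next
    case (par B)
    have J: "mob B \<in> hisom" using par by simp
    let ?J = "mob B"
    have pk: "conjg ?J k l v = shift 1 v" if "v \<in> H3" for v using par(2)[OF that] cj[OF par(1)] by simp
    obtain i0 j0 \<beta>0 where b0: "\<And>v. v \<in> H3 \<Longrightarrow> conjg ?J i0 j0 v = shift \<beta>0 v" "Im \<beta>0 \<noteq> 0"
      using ex_nonreal_translation[OF J pk] by metis
    have tr: "\<exists>\<beta>. \<forall>v\<in>H3. conjg ?J i j v = shift \<beta> v" for i j
    proof -
      have comm: "conjg ?J i j (shift b v) = shift b (conjg ?J i j v)"
        if v: "v \<in> H3" and b: "\<And>v. v \<in> H3 \<Longrightarrow> conjg ?J k' l' v = shift b v" for v k' l' b
      proof -
        have "conjg ?J i j v \<in> H3" using conjg_hisom[OF J] v by simp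
        then show ?thesis using v conjg_conjg[OF J, of i j k' l' v] conjg_conjg[OF J, of k' l' i j v] b by (simp add: add.commute)
      qed
      obtain \<beta> where \<beta>: "(\<forall>v\<in>H3. conjg ?J i j v = shift \<beta> v) \<or> (\<forall>v\<in>H3. conjg ?J i j v = shift \<beta> (hconj v))"
        using commute_shift[OF conjg_hisom[OF J] comm[OF _ pk]] by metis
      \<comment> \<open>A reversing element of this form commutes only with real
        translations.\<close>
      moreover have False if g: "\<forall>v\<in>H3. conjg ?J i j v = shift \<beta> (hconj v)"
      proof -
        have "conjg ?J i j (shift \<beta>0 (0, 1)) = shift \<beta>0 (conjg ?J i j (0, 1))" using comm[OF base_in_H3 b0(1)] .
        then have "cnj \<beta>0 + \<beta> = \<beta> + \<beta>0" using g by (simp add: shift_def hconj_def H3_def)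
        then have "cnj \<beta>0 = \<beta>0" by simp
        then show False using b0(2) by (simp add: complex_eq_iff)
      qed
      ultimately show ?thesis by blast
    qed
    obtain b where b: "\<forall>v\<in>H3. conjg ?J 0 1 v = shift b v" using tr by blast
    obtain c where c: "\<forall>v\<in>H3. conjg ?J 1 0 v = shift c v" using tr by blast
    have ij: "fst (conjg ?J i j (0, 1)) = of_int i * c + of_int j * b" for i j
    proof -
      define u where "u = hinv ?J (0, 1)"
      have uH: "u \<in> H3" unfolding u_def using J by simp
      have u0: "fst (?J u) = 0" unfolding u_def using J by simp
      have s: "?J (periph 0 1 w) = shift b (?J w)" "?J (periph 1 0 w) = shift c (?J w)" if "w \<in> H3" for w
        using b c that J by (auto simp: conjg_apply[symmetric] mob_in_H3[OF par(1)])
      have 1: "fst (?J (periph (i * 1) (i * 0) w)) = fst (?J w) + of_int i * c" if "w \<in> H3" for w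
        by (rule int_additive[of "\<lambda>u. fst (?J u)", OF _ that]) (simp add: s shift_def)
      have 2: "fst (?J (periph (j * 0) (j * 1) w)) = fst (?J w) + of_int j * b" if "w \<in> H3" for w
        by (rule int_additive[of "\<lambda>u. fst (?J u)", OF _ that]) (simp add: s shift_def)
      have "conjg ?J i j (0, 1) = ?J (periph i 0 (periph 0 j u))"
        using fun_cong[OF periph_comp[of i 0 0 j], of u] by (simp add: conjg_def u_def)
      then show ?thesis using 1[of "periph 0 j u"] 2[OF uH] uH u0 by simp
    qed
    have e1: "of_int k * c + of_int l * b = 1" using pk[OF base_in_H3] ij[of k l] by (simp add: shift_def)
    have e2: "of_int i0 * c + of_int j0 * b = \<beta>0" using b0(1)[OF base_in_H3] ij[of i0 j0] by (simp add: shift_def)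
    \<comment> \<open>The translations 1 and \<open>\<beta>0\<close> are not real multiples of one
      number. This excludes both \<open>b = 0\<close> and a real quotient
      \<open>c / b\<close>.\<close>
    have notreal: False if "1 = of_real r * x" "\<beta>0 = of_real r' * x" for r r' :: real and x :: complex
    proof -
      have "r \<noteq> 0" using that(1) by auto
      then have "x = of_real (1 / r)" using that(1) by (simp add: field_simps)
      then have "\<beta>0 = of_real (r' / r)" using that(2) by simp
      then show False using b0(2) by simp
    qed
    have bn: "b \<noteq> 0"
    proof
      assume "b = 0"
      then show False using e1 e2 notreal[of "of_int k" c "of_int i0"] by simp
    qed
    have "Im (c / b) \<noteq> 0"
    proof
      assume "Im (c / b) = 0"
      then have "c / b = of_real (Re (c / b))" by (simp add: complex_eq_iff)
      then have cb: "c = of_real (Re (c / b)) * b" using bn by (simp add: field_simps)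
      define r where "r = Re (c / b)"
      have "1 = of_real (of_int k * r + of_int l) * b" "\<beta>0 = of_real (of_int i0 * r + of_int j0) * b"
        using e1 e2 cb by (simp_all add: r_def[symmetric] algebra_simps)
      then show False by (rule notreal)
    qed
    then show ?thesis using that[OF J _ _ bn, of c] b c by blast
  qed
qed

end

section \<open>Traces of Nielsen equivalent pairs\<close>

text \<open>For \<open>A = (1, 1; 0, 1)\<close> and \<open>B\<close> with lower left entry \<open>c\<close> and trace \<open>y\<close>, the traces of \<open>A\<close>, \<open>A\<^sup>k B\<close> and
  \<open>A\<^sup>k\<^sup>+\<^sup>1 B\<close> are \<open>2\<close>, \<open>y + k c\<close> and \<open>y + (k + 1) c\<close>; \<open>mbase y c e u u'\<close> describes these triples up to sign.
  Nielsen moves replace an entry \<open>d\<close> of a trace triple \<open>(a, b, d)\<close> by \<open>a b - d\<close>. Away from the base line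
  the moves form a tree along which the largest entry grows; \<open>markov_up\<close> collects the triples above the
  base, with the largest entry last.\<close>

definition mbase :: "complex \<Rightarrow> complex \<Rightarrow> complex \<Rightarrow> complex \<Rightarrow> complex \<Rightarrow> bool" where
  "mbase y c e u u' \<longleftrightarrow> (\<exists>\<delta>\<in>{1,-1}. \<exists>\<epsilon>\<in>{1,-1}. \<exists>s\<in>{1,-1}. \<exists>k::int.
    e = 2 * \<delta> \<and> u = \<epsilon> * (y + of_int k * c) \<and> u' = \<delta> * \<epsilon> * (y + (of_int k + s) * c))"

inductive markov_up :: "complex \<Rightarrow> complex \<Rightarrow> complex \<Rightarrow> complex \<Rightarrow> complex \<Rightarrow> bool" for y c where
  start: "mbase y c e u u' \<Longrightarrow> markov_up y c u u' (u * u' - e)"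
| step: "markov_up y c a b d \<Longrightarrow> markov_up y c a d (a * d - b)"
| swap: "markov_up y c a b d \<Longrightarrow> markov_up y c b a d"

lemma mbaseI:
  assumes "\<delta> = 1 \<or> \<delta> = -1" "\<epsilon> = 1 \<or> \<epsilon> = -1" "s = 1 \<or> s = -1"
    "e = 2 * \<delta>" "u = \<epsilon> * (y + of_int k * c)" "u' = \<delta> * \<epsilon> * (y + (of_int k + s) * c)"
  shows "mbase y c e u u'"
  unfolding mbase_def using assms by blast

lemma mbaseE:
  assumes "mbase y c e u u'"
  obtains \<delta> \<epsilon> s k where "\<delta> = 1 \<or> \<delta> = -1" "\<epsilon> = 1 \<or> \<epsilon> = -1" "s = 1 \<or> s = -1"
    "e = 2 * \<delta>" "u = \<epsilon> * (y + of_int k * c)" "u' = \<delta> * \<epsilon> * (y + (of_int k + s) * c)"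
  using assms unfolding mbase_def by blast

lemma mbase_swap: assumes "mbase y c e u u'" shows "mbase y c e u' u"
  using assms
proof (cases rule: mbaseE)
  case (1 \<delta> \<epsilon> s k)
  from 1(3) show ?thesis
  proof
    assume "s = 1"
    then show ?thesis using 1 by (intro mbaseI[of \<delta> "\<delta> * \<epsilon>" "-1" _ _ _ "k + 1"]) auto
  next
    assume "s = -1"
    then show ?thesis using 1 by (intro mbaseI[of \<delta> "\<delta> * \<epsilon>" "1" _ _ _ "k - 1"]) auto
  qed
qed

text \<open>With \<open>e = 2 * \<delta>\<close> the move reflects the neighbouring term of the
  arithmetic progression y + k c in the term at \<open>k\<close>, so it only changes the sign
  \<open>s\<close>.\<close>

lemma mbase_vieta: assumes "mbase y c e u u'" shows "mbase y c e u (e * u - u')"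
  using assms
proof (cases rule: mbaseE)
  case (1 \<delta> \<epsilon> s k)
  then show ?thesis by (intro mbaseI[of \<delta> \<epsilon> "- s" _ _ _ k]) (auto simp: algebra_simps)
qed

lemma mbase_sign:
  assumes "mbase y c e u u'"
  shows "mbase y c (- e) (- u) u'" "mbase y c (- e) u (- u')" "mbase y c e (- u) (- u')"
proof -
  from assms obtain \<delta> \<epsilon> s k where 1: "\<delta> = 1 \<or> \<delta> = -1" "\<epsilon> = 1 \<or> \<epsilon> = -1" "s = 1 \<or> s = -1"
    "e = 2 * \<delta>" "u = \<epsilon> * (y + of_int k * c)" "u' = \<delta> * \<epsilon> * (y + (of_int k + s) * c)"
    by (rule mbaseE)
  show "mbase y c (- e) (- u) u'" using 1 by (intro mbaseI[of "- \<delta>" "- \<epsilon>" s _ _ _ k]) auto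
  show "mbase y c (- e) u (- u')" using 1 by (intro mbaseI[of "- \<delta>" \<epsilon> s _ _ _ k]) auto
  show "mbase y c e (- u) (- u')" using 1 by (intro mbaseI[of \<delta> "- \<epsilon>" s _ _ _ k]) auto
qed

lemma markov_up_sign:
  "markov_up y c a b d \<Longrightarrow> markov_up y c (- a) (- b) d \<and> markov_up y c (- a) b (- d) \<and> markov_up y c a (- b) (- d)"
proof (induction rule: markov_up.induct)
  case (start e u u')
  show ?case
    using markov_up.start[OF mbase_sign(1)[OF start]] markov_up.start[OF mbase_sign(2)[OF start]]
      markov_up.start[OF mbase_sign(3)[OF start]] by simp
next
  case (step a b d)
  then show ?case
    using markov_up.step[of y c "- a" b "- d"] markov_up.step[of y c "- a" "- b" d] markov_up.step[of y c a "- b" "- d"]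
    by simp
next
  case (swap a b d)
  then show ?case using markov_up.swap by blast
qed

text \<open>The last entry is the distinguished one: the largest above the base line, and the entry
  of modulus 2 on it.\<close>

definition mtop :: "complex \<Rightarrow> complex \<Rightarrow> complex \<Rightarrow> complex \<Rightarrow> complex \<Rightarrow> bool" where
  "mtop y c a b d \<longleftrightarrow> markov_up y c a b d \<or> mbase y c d a b"

definition markov :: "complex \<Rightarrow> complex \<Rightarrow> complex \<Rightarrow> complex \<Rightarrow> complex \<Rightarrow> bool" where
  "markov y c a b d \<longleftrightarrow> mtop y c a b d \<or> mtop y c a d b \<or> mtop y c b d a"

section \<open>Closure of the triples under Markov moves, and recovery of the base line\<close>

lemma mtop_swap: "mtop y c a b d \<Longrightarrow> mtop y c b a d"
  unfolding mtop_def using mbase_swap markov_up.swap by blast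

lemma markov_swap12: "markov y c a b d \<Longrightarrow> markov y c b a d"
  and markov_swap23: "markov y c a b d \<Longrightarrow> markov y c a d b"
  unfolding markov_def using mtop_swap by blast+

text \<open>Replacing the largest entry undoes the step that created it, so this move leads down the
  tree.\<close>

lemma markov_up_vieta: "markov_up y c a b d \<Longrightarrow> markov y c a b (a * b - d)"
proof (induction rule: markov_up.induct)
  case (start e u u')
  then show ?case by (simp add: markov_def mtop_def)
next
  case (step a b d)
  then show ?case by (simp add: markov_def mtop_def)
next
  case (swap a b d)
  then show ?case using markov_swap12[of y c a b "a * b - d"] by (simp add: mult.commute)
qed

lemma markov_vieta:
  assumes "markov y c a b d" shows "markov y c a b (a * b - d)"
proof -
  consider "markov_up y c a b d" | "mbase y c d a b" | "markov_up y c a d b" | "mbase y c b a d"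
    | "markov_up y c b d a" | "mbase y c a b d"
    using assms unfolding markov_def mtop_def by blast
  then show ?thesis
  proof cases
    case 1 then show ?thesis by (rule markov_up_vieta)
  next
    case 2 then show ?thesis using markov_up.start by (simp add: markov_def mtop_def)
  next
    case 3 then show ?thesis using markov_up.step by (simp add: markov_def mtop_def)
  next
    case 4 then show ?thesis using mbase_vieta[OF 4] by (simp add: markov_def mtop_def mult.commute)
  next
    case 5 then show ?thesis using markov_up.swap[OF markov_up.step[OF 5]] by (simp add: markov_def mtop_def mult.commute)
  next
    case 6 then show ?thesis using mbase_vieta[OF 6] by (simp add: markov_def mtop_def)
  qed
qed

lemma mtop_sign:
  assumes "mtop y c a b d"
  shows "mtop y c (- a) (- b) d" "mtop y c (- a) b (- d)" "mtop y c a (- b) (- d)"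
  using assms markov_up_sign mbase_sign unfolding mtop_def by blast+

lemma markov_sign:
  assumes "markov y c a b d" shows "markov y c (- a) (- b) d" "markov y c (- a) b (- d)" "markov y c a (- b) (- d)"
  using assms mtop_sign unfolding markov_def by blast+

text \<open>Entries of modulus at least 4 outweigh the subtracted term: on leaving the base the new
  entry has modulus at least |u| |u'| - 2, and later at least 4 |d| - |b|, which exceeds
  |d|.\<close>

lemma markov_up_large:
  assumes large: "\<And>k::int. cmod (y + of_int k * c) \<ge> 4"
  shows "markov_up y c a b d \<Longrightarrow> 4 \<le> cmod a \<and> 4 \<le> cmod b \<and> cmod a < cmod d \<and> cmod b < cmod d"
proof (induction rule: markov_up.induct)
  case (start e u u')
  then obtain \<delta> \<epsilon> s k where 1: "\<delta> = 1 \<or> \<delta> = -1" "\<epsilon> = 1 \<or> \<epsilon> = -1" "s = 1 \<or> s = -1"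
    "e = 2 * \<delta>" "u = \<epsilon> * (y + of_int k * c)" "u' = \<delta> * \<epsilon> * (y + (of_int k + s) * c)"
    by (rule mbaseE)
  obtain k' :: int where k': "of_int k + s = of_int k'"
    using 1(3) by (metis diff_conv_add_uminus of_int_1 of_int_add of_int_diff)
  have u: "cmod u \<ge> 4" using 1(2) large[of k] by (auto simp: 1(5) norm_mult)
  have u': "cmod u' \<ge> 4" using 1(1,2) large[of k'] unfolding 1(6) k' by (auto simp: norm_mult)
  have e: "cmod e = 2" using 1(1) by (auto simp: 1(4))
  have "cmod (u * u') \<le> cmod (u * u' - e) + cmod e" using norm_triangle_sub by (metis add.commute)
  then have d: "cmod u * cmod u' - 2 \<le> cmod (u * u' - e)" using e by (simp add: norm_mult)
  have "4 * cmod u' \<le> cmod u * cmod u'" "cmod u * 4 \<le> cmod u * cmod u'"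
    using u u' by (intro mult_right_mono mult_left_mono; simp)+
  then show ?case using d u u' by simp
next
  case (step a b d)
  have "cmod (a * d) \<le> cmod (a * d - b) + cmod b" using norm_triangle_sub by (metis add.commute)
  moreover have "4 * cmod d \<le> cmod a * cmod d" using step by (intro mult_right_mono) auto
  ultimately show ?case using step by (simp add: norm_mult)
qed auto

text \<open>All entries of a triple above the base have modulus at least 4, so the entry 2 puts the
  triple on the base line. The bounds on \<open>v\<close> and \<open>v + c\<close> make this 2 the
  distinguished entry.\<close>

lemma markov_root:
  assumes large: "\<And>k::int. cmod (y + of_int k * c) \<ge> 4"
    and v: "cmod v \<ge> 4" "cmod (v + c) \<ge> 4" and m: "markov y c 2 v (v + c)"
  obtains \<epsilon> and k :: int where "\<epsilon> = 1 \<or> \<epsilon> = -1" "v = \<epsilon> * (y + of_int k * c)"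
proof -
  have nb: "\<not> mbase y c e u u'" if "cmod e \<ge> 4" for e u u'
  proof
    assume "mbase y c e u u'"
    then have "cmod e = 2" by (elim mbaseE) auto
    then show False using that by simp
  qed
  have nu: "\<not> markov_up y c 2 b d" "\<not> markov_up y c b d 2" for b d
    using markov_up_large[OF large, of 2 b d] markov_up_large[OF large, of b d 2] by auto
  have "mbase y c 2 v (v + c)" using m nb[OF v(1)] nb[OF v(2)] nu unfolding markov_def mtop_def by blast
  then show ?thesis using that by (elim mbaseE) blast
qed

text \<open>Consequences of the Cayley-Hamilton relation A + A^-1 = tr A for determinant 1.\<close>

lemma mtr_identities:
  assumes "mdet A = 1" "mdet B = 1"
  shows "mtr (mmul (mcof A) B) = mtr A * mtr B - mtr (mmul A B)"
    "mtr (mmul A (mcof B)) = mtr A * mtr B - mtr (mmul A B)"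
    "mtr (mmul (mmul A B) B) = mtr (mmul A B) * mtr B - mtr A"
    "mtr (mmul A (mmul B A)) = mtr A * mtr (mmul B A) - mtr B"
    "mtr (mcof A) = mtr A" "mtr (mmul B A) = mtr (mmul A B)"
proof -
  obtain a b c d where A: "A = (a, b, c, d)" by (cases A)
  obtain x y z w where B: "B = (x, y, z, w)" by (cases B)
  have d: "a * d - b * c = 1" "x * w - y * z = 1" using assms by (simp_all add: A B)
  show "mtr (mmul (mmul A B) B) = mtr (mmul A B) * mtr B - mtr A"
    unfolding A B mmul.simps mtr.simps using d by algebra
  show "mtr (mmul A (mmul B A)) = mtr A * mtr (mmul B A) - mtr B"
    unfolding A B mmul.simps mtr.simps using d by algebra
qed (cases A; cases B; simp add: algebra_simps)+

text \<open>A relation instead of a homomorphism: an isometry determines its matrix only up to sign,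
  and no consistent choice of signs is made.\<close>

locale trace_representation = group G for G (structure) +
  fixes rep :: "'a \<Rightarrow> mat \<Rightarrow> bool"
  assumes rep_SL2: "rep g A \<Longrightarrow> A \<in> SL2"
    and rep_mult: "\<lbrakk>g \<in> carrier G; h \<in> carrier G; rep g A; rep h B\<rbrakk> \<Longrightarrow> rep (g \<otimes> h) (mmul A B)"
    and rep_inv: "\<lbrakk>g \<in> carrier G; rep g A\<rbrakk> \<Longrightarrow> rep (inv g) (mcof A)"
    and rep_unique: "\<lbrakk>rep g A; rep g B\<rbrakk> \<Longrightarrow> B = A \<or> B = mneg A"
begin

definition markov_pair :: "complex \<Rightarrow> complex \<Rightarrow> 'a list \<Rightarrow> bool" where
  "markov_pair y c g \<longleftrightarrow> (\<exists>x z A B. g = [x, z] \<and> x \<in> carrier G \<and> z \<in> carrier G \<and> rep x A \<and> rep z B \<and>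
    markov y c (mtr A) (mtr B) (mtr (mmul A B)))"

text \<open>By the trace identities, inverting an entry, or multiplying it by the other entry or its
  inverse, changes the triple by one Markov move up to order.\<close>

lemma markov_pair_elementary:
  assumes "elementarily_equivalent G g h" "markov_pair y c g" shows "markov_pair y c h"
proof -
  obtain x z A B where g: "g = [x, z]" "x \<in> carrier G" "z \<in> carrier G" "rep x A" "rep z B"
    and m: "markov y c (mtr A) (mtr B) (mtr (mmul A B))"
    using assms(2) by (auto simp: markov_pair_def)
  have AB: "mdet A = 1" "mdet B = 1" using rep_SL2 g by (auto simp: SL2_def)
  note id = mtr_identities[OF AB]
  let ?X = "mtr A" and ?Y = "mtr B" and ?Z = "mtr (mmul A B)"
  have I: "markov_pair y c [x', z']" if "x' \<in> carrier G" "z' \<in> carrier G" "rep x' A'" "rep z' B'"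
    "markov y c (mtr A') (mtr B') (mtr (mmul A' B'))" for x' z' A' B'
    unfolding markov_pair_def using that by blast
  have v: "markov y c ?X ?Y (?X * ?Y - ?Z)" by (rule markov_vieta[OF m])
  from assms(1) show ?thesis
  proof cases
    case (perm \<sigma>)
    have p: "\<sigma> permutes {..<2}" using perm(2) g(1) by (simp add: numeral_2_eq_2)
    have s: "\<sigma> 0 < 2" "\<sigma> (Suc 0) < 2" "\<sigma> 0 \<noteq> \<sigma> (Suc 0)"
      using permutes_in_image[OF p, of 0] permutes_in_image[OF p, of "Suc 0"]
        inj_eq[OF permutes_inj[OF p], of 0 "Suc 0"] by simp_all
    have "h = [g ! \<sigma> 0, g ! \<sigma> (Suc 0)]" using perm(1) g(1) by (simp add: permute_list_def upt_rec)
    then have "h = [x, z] \<or> h = [z, x]" using s g(1) by (auto simp: less_2_cases_iff)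
    then show ?thesis
    proof
      assume "h = [z, x]"
      moreover have "markov_pair y c [z, x]"
        by (rule I[OF g(3,2,5,4)]) (use markov_swap12[OF m] id(6) in simp)
      ultimately show ?thesis by simp
    qed (use assms(2) g in simp)
  next
    case (inverse i)
    then have "i = 0 \<or> i = Suc 0" using g(1) by (auto simp: less_2_cases_iff)
    then show ?thesis
    proof
      assume "i = 0"
      moreover have "markov_pair y c [inv x, z]"
        by (rule I[OF _ g(3) rep_inv[OF g(2,4)] g(5)]) (use g v id in simp_all)
      ultimately show ?thesis using inverse(1) g(1) by simp
    next
      assume "i = Suc 0"
      moreover have "markov_pair y c [x, inv z]"
        by (rule I[OF g(2) _ g(4) rep_inv[OF g(3,5)]]) (use g v id mtr_identities(5)[OF AB(2,1)] in simp_all)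
      ultimately show ?thesis using inverse(1) g(1) by simp
    qed
  next
    case (mult i j)
    then have "i = 0 \<and> j = Suc 0 \<or> i = Suc 0 \<and> j = 0" using g(1) by (auto simp: less_2_cases_iff)
    then show ?thesis
    proof
      assume ij: "i = 0 \<and> j = Suc 0"
      have "markov y c ?Z ?Y ?X" using markov_swap12 markov_swap23 m by blast
      then have "markov y c ?Z ?Y (?Z * ?Y - ?X)" by (rule markov_vieta)
      then have "markov_pair y c [x \<otimes> z, z]"
        by (intro I[OF _ g(3) rep_mult[OF g(2,3,4,5)] g(5)]) (use g id in simp_all)
      then show ?thesis using mult(1) g(1) ij by simp
    next
      assume ij: "i = Suc 0 \<and> j = 0"
      have "markov y c ?X ?Z ?Y" using markov_swap12 markov_swap23 m by blast
      then have "markov y c ?X ?Z (?X * ?Z - ?Y)" by (rule markov_vieta)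
      then have "markov_pair y c [x, z \<otimes> x]"
        by (intro I[OF g(2) _ g(4) rep_mult[OF g(3,2,5,4)]]) (use g id in simp_all)
      then show ?thesis using mult(1) g(1) ij by simp
    qed
  next
    case (mult_inverse i j)
    then have "i = 0 \<and> j = Suc 0 \<or> i = Suc 0 \<and> j = 0" using g(1) by (auto simp: less_2_cases_iff)
    then show ?thesis
    proof
      assume ij: "i = 0 \<and> j = Suc 0"
      have B: "mmul (mmul A (mcof B)) B = A" using rep_SL2[OF g(5)] by (simp add: mmul_assoc)
      have "markov y c (?X * ?Y - ?Z) ?Y ?X" using markov_swap12 markov_swap23 v by blast
      then have "markov_pair y c [x \<otimes> inv z, z]"
        by (intro I[OF _ g(3) rep_mult[OF g(2) _ g(4) rep_inv[OF g(3,5)]] g(5)]) (use g id B in simp_all)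
      then show ?thesis using mult_inverse(1) g(1) ij by simp
    next
      assume ij: "i = Suc 0 \<and> j = 0"
      have A: "mtr (mmul A (mmul B (mcof A))) = mtr B"
        using mtr_mmul_commute[of A "mmul B (mcof A)"] rep_SL2[OF g(4)] by (simp add: mmul_assoc)
      have "markov y c ?X (?X * ?Y - ?Z) ?Y" using markov_swap12 markov_swap23 v by blast
      then have "markov_pair y c [x, z \<otimes> inv x]"
        by (intro I[OF g(2) _ g(4) rep_mult[OF g(3) _ g(5) rep_inv[OF g(2,4)]]])
          (use g id A mtr_identities(2)[OF AB(2,1)] in \<open>simp_all add: mult.commute\<close>)
      then show ?thesis using mult_inverse(1) g(1) ij by simp
    qed
  qed
qed

lemma markov_pair_nielsen: "nielsen_equivalent G g h \<Longrightarrow> markov_pair y c g \<Longrightarrow> markov_pair y c h"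
  unfolding nielsen_equivalent_def
  by (induction rule: rtranclp_induct) (auto intro: markov_pair_elementary)

lemma rep_nat_pow:
  assumes "l \<in> carrier G" "rep l (1, \<tau>, 0, 1)" "w \<in> carrier G" "rep w (a, b, c, e)"
  shows "rep (w \<otimes> l [^] (n::nat)) (a, b + of_nat n * a * \<tau>, c, e + of_nat n * c * \<tau>)"
proof (induction n)
  case 0 then show ?case using assms by simp
next
  case (Suc n)
  have "rep (w \<otimes> l [^] n \<otimes> l) (mmul (a, b + of_nat n * a * \<tau>, c, e + of_nat n * c * \<tau>) (1, \<tau>, 0, 1))"
    using assms Suc by (intro rep_mult) auto
  moreover have "w \<otimes> l [^] n \<otimes> l = w \<otimes> l [^] Suc n" using assms by (simp add: m_assoc)
  ultimately show ?case by (simp add: algebra_simps)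
qed

theorem infinite_nielsen_classes:
  assumes mlw: "m \<in> carrier G" "l \<in> carrier G" "w \<in> carrier G" and ml: "m \<otimes> l = l \<otimes> m"
    and gen: "generate G {m, w \<otimes> m \<otimes> inv w} = carrier G"
    and rep: "rep m (1, 1, 0, 1)" "rep l (1, \<tau>, 0, 1)" "rep w (a, b, c, e)" "c \<noteq> 0" "Im \<tau> \<noteq> 0"
  shows "infinite (nielsen_classes_of_generating_pairs G)"
proof -
  define u where "u n = w \<otimes> l [^] (n::nat)" for n
  have u: "u n \<in> carrier G" for n using mlw by (simp add: u_def)
  have conj: "u n \<otimes> m \<otimes> inv (u n) = w \<otimes> m \<otimes> inv w" for n
  proof -
    have "m \<otimes> l [^] n = l [^] n \<otimes> m" using group_commutes_pow[OF ml mlw(1,2)] group_commutes_pow[OF ml[symmetric] mlw(2,1)] by simp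
    then have "u n \<otimes> m = w \<otimes> m \<otimes> l [^] n" using mlw by (simp add: u_def m_assoc)
    then have "u n \<otimes> m \<otimes> inv (u n) = w \<otimes> m \<otimes> (l [^] n \<otimes> inv (u n))" using mlw u by (simp add: m_assoc)
    also have "l [^] n \<otimes> inv (u n) = inv w" using mlw by (simp add: u_def inv_mult_group m_assoc[symmetric])
    finally show ?thesis .
  qed
  define t where "t n = [m, u n]" for n
  have gp: "t n \<in> generating_pairs G" for n
  proof -
    have sub: "{m, u n} \<subseteq> carrier G" using mlw u by simp
    interpret H: subgroup "generate G {m, u n}" G using generate_is_subgroup[OF sub] .
    have i: "m \<in> generate G {m, u n}" "u n \<in> generate G {m, u n}" by (auto intro: generate.incl)
    then have "u n \<otimes> m \<otimes> inv (u n) \<in> generate G {m, u n}" by (intro H.m_closed H.m_inv_closed)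
    then have "{m, w \<otimes> m \<otimes> inv w} \<subseteq> generate G {m, u n}" using i conj by simp
    then have "generate G {m, w \<otimes> m \<otimes> inv w} \<subseteq> generate G {m, u n}"
      by (intro generate_subgroup_incl[OF _ H.subgroup_axioms])
    then have "generate G {m, u n} = carrier G" using gen generate_incl[OF sub] by blast
    then show ?thesis using sub by (auto simp: generating_tuples_def tuples_def t_def)
  qed
  define y where "y n = a + e + of_nat n * c * \<tau>" for n :: nat
  have repu: "rep (u n) (a, b + of_nat n * a * \<tau>, c, e + of_nat n * c * \<tau>)" for n
    unfolding u_def by (rule rep_nat_pow[OF mlw(2) rep(2) mlw(3) rep(3)])
  have tr: "mtr (1, 1, 0, 1) = 2" "mtr (a, b + of_nat n * a * \<tau>, c, e + of_nat n * c * \<tau>) = y n"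
    "mtr (mmul (1, 1, 0, 1) (a, b + of_nat n * a * \<tau>, c, e + of_nat n * c * \<tau>)) = y n + c" for n
    by (simp_all add: y_def)
  \<comment> \<open>After division by \<open>c\<close>, adding integral multiples of
    \<open>c\<close> does not change the imaginary part. Hence
    \<open>\<sigma> + real n * Im \<tau>\<close> is, up to sign, what the Nielsen class remembers of
    \<open>y n\<close>.\<close>
  define \<sigma> where "\<sigma> = Im ((a + e) / c)"
  \<comment> \<open>From \<open>N\<close> on, the term \<open>4 / cmod c\<close> keeps the base line
    above modulus 4. The term \<open>\<bar>\<sigma>\<bar> + 1\<close> makes
    \<open>n * Im \<tau>\<close> dominate \<open>\<sigma>\<close> strictly, so that the values for
    two such indices cannot be opposite.\<close>
  define N where "N = nat \<lceil>(\<bar>\<sigma>\<bar> + 4 / cmod c + 1) / \<bar>Im \<tau>\<bar>\<rceil>"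
  have big: "\<bar>\<sigma>\<bar> + 4 / cmod c + 1 \<le> real n * \<bar>Im \<tau>\<bar>" if "n \<ge> N" for n
  proof -
    have "(\<bar>\<sigma>\<bar> + 4 / cmod c + 1) / \<bar>Im \<tau>\<bar> \<le> real n" using that unfolding N_def by linarith
    then show ?thesis using rep(5) by (simp add: pos_divide_le_eq)
  qed
  have imy: "Im ((y n + z * c) / c) = \<sigma> + real n * Im \<tau> + Im z" for n z
  proof -
    have "(y n + z * c) / c = (a + e) / c + of_nat n * \<tau> + z" using rep(4) by (simp add: y_def field_simps)
    then show ?thesis by (simp add: \<sigma>_def)
  qed
  have large: "cmod (y n + of_int k * c) \<ge> 4" if n: "n \<ge> N" for n and k :: int
  proof -
    have "4 / cmod c \<le> \<bar>\<sigma> + real n * Im \<tau>\<bar>"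
      using big[OF n] abs_mult[of "real n" "Im \<tau>"] by simp
    also have "\<dots> \<le> cmod ((y n + of_int k * c) / c)" using abs_Im_le_cmod[of "(y n + of_int k * c) / c"] unfolding imy by simp
    also have "\<dots> = cmod (y n + of_int k * c) / cmod c" by (simp add: norm_divide)
    finally show ?thesis using rep(4) by (simp add: divide_le_cancel)
  qed
  have inj: "n = n'" if n: "n \<ge> N" "n' \<ge> N" and ne: "nielsen_equivalent G (t n) (t n')" for n n'
  proof -
    have "markov (y n) c 2 (y n) (y n + c)"
      unfolding markov_def mtop_def using mbaseI[of 1 1 1 2 "y n" "y n" 0 c "y n + c"] by simp
    then have "markov_pair (y n) c (t n)" unfolding markov_pair_def t_def
      using mlw(1) u rep(1) repu tr by metis
    then have "markov_pair (y n) c (t n')" using markov_pair_nielsen[OF ne] by blast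
    then obtain A B where AB: "rep m A" "rep (u n') B" and mk: "markov (y n) c (mtr A) (mtr B) (mtr (mmul A B))"
      by (auto simp: markov_pair_def t_def)
    \<comment> \<open>The signs of the two matrices are independent and their product is the sign of
      the third trace; each of the four cases is undone by \<open>markov_sign\<close>.\<close>
    have "A = (1, 1, 0, 1) \<or> A = mneg (1, 1, 0, 1)" using rep_unique[OF rep(1) AB(1)] .
    moreover have "B = (a, b + of_nat n' * a * \<tau>, c, e + of_nat n' * c * \<tau>) \<or> B = mneg (a, b + of_nat n' * a * \<tau>, c, e + of_nat n' * c * \<tau>)"
      using rep_unique[OF repu AB(2)] .
    moreover define Z where "Z = y n' + c"
    ultimately have "mtr A = 2 \<and> mtr B = y n' \<and> mtr (mmul A B) = Z \<or> mtr A = - 2 \<and> mtr B = y n' \<and> mtr (mmul A B) = - Z \<or>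
        mtr A = 2 \<and> mtr B = - y n' \<and> mtr (mmul A B) = - Z \<or> mtr A = - 2 \<and> mtr B = - y n' \<and> mtr (mmul A B) = Z"
      by (elim disjE) (simp_all add: tr mneg_mmul mneg_simps del: mmul.simps mneg.simps mtr.simps)
    then have "markov (y n) c 2 (y n') Z"
    proof (elim disjE conjE)
      assume "mtr A = 2" "mtr B = y n'" "mtr (mmul A B) = Z"
      then show ?thesis using mk by simp
    next
      assume "mtr A = - 2" "mtr B = y n'" "mtr (mmul A B) = - Z"
      then show ?thesis using markov_sign(2)[OF mk] by simp
    next
      assume "mtr A = 2" "mtr B = - y n'" "mtr (mmul A B) = - Z"
      then show ?thesis using markov_sign(3)[OF mk] by simp
    next
      assume "mtr A = - 2" "mtr B = - y n'" "mtr (mmul A B) = Z"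
      then show ?thesis using markov_sign(1)[OF mk] by simp
    qed
    then have "markov (y n) c 2 (y n') (y n' + c)" by (simp add: Z_def)
    then obtain \<epsilon> and k :: int where e: "\<epsilon> = 1 \<or> \<epsilon> = -1" "y n' = \<epsilon> * (y n + of_int k * c)"
      using markov_root[of "y n" c "y n'"] large[OF n(1)] large[OF n(2), of 0] large[OF n(2), of 1] by auto
    have im: "Im (y n' / c) = \<sigma> + real n' * Im \<tau>" "Im ((y n + of_int k * c) / c) = \<sigma> + real n * Im \<tau>"
      using imy[of n' 0] imy[of n "of_int k"] by simp_all
    from e(1) show ?thesis
    proof
      assume "\<epsilon> = 1"
      then have "real n' * Im \<tau> = real n * Im \<tau>" using im e(2) by auto
      then show ?thesis using rep(5) by auto
    next
      assume "\<epsilon> = -1"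
      then have "y n' / c = - ((y n + of_int k * c) / c)" using e(2) by (simp add: minus_divide_left)
      then have "\<sigma> + real n' * Im \<tau> = - (\<sigma> + real n * Im \<tau>)" using im by (metis uminus_complex.simps(2))
      then have s0: "2 * \<sigma> + (real n' + real n) * Im \<tau> = 0" by (simp add: algebra_simps)
      have "\<bar>(real n' + real n) * Im \<tau>\<bar> = real n' * \<bar>Im \<tau>\<bar> + real n * \<bar>Im \<tau>\<bar>"
        unfolding abs_mult by (simp add: distrib_right)
      moreover have "4 / cmod c \<ge> 0" by simp
      ultimately show ?thesis using big[OF n(1)] big[OF n(2)] s0 by linarith
    qed
  qed
  let ?R = "{(g, h). g \<in> tuples G 2 \<and> h \<in> tuples G 2 \<and> nielsen_equivalent G g h}"
  have tup: "t n \<in> tuples G 2" for n using gp[of n] by (simp add: generating_tuples_def)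
  have "inj_on (\<lambda>n. ?R `` {t n}) {N..}"
  proof (rule inj_onI)
    fix n n' assume n: "n \<in> {N..}" "n' \<in> {N..}" "?R `` {t n} = ?R `` {t n'}"
    have "t n' \<in> ?R `` {t n'}" using tup by (simp add: nielsen_equivalent_def)
    then have "nielsen_equivalent G (t n) (t n')" unfolding n(3)[symmetric] by simp
    then show "n = n'" using inj n by simp
  qed
  then have "infinite ((\<lambda>n. ?R `` {t n}) ` {N..})" using infinite_Ici finite_imageD by blast
  moreover have "(\<lambda>n. ?R `` {t n}) ` {N..} \<subseteq> nielsen_classes_of_generating_pairs G"
    unfolding nielsen_classes_of_generating_pairs_def by (intro image_subsetI quotientI gp)
  ultimately show ?thesis by (rule infinite_super[rotated])
qed

end

section \<open>Deck transformations of a two-bridge knot complement\<close>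

context hyperbolic_covering
begin

definition pre :: "'a set \<Rightarrow> (complex \<times> real) set" where "pre T = {u \<in> H3. p u \<in> T}"

lemma pre_iff: "u \<in> pre T \<longleftrightarrow> u \<in> H3 \<and> p u \<in> T" by (simp add: pre_def)

lemma pre_mono: "S \<subseteq> T \<Longrightarrow> pre S \<subseteq> pre T" by (auto simp: pre_def)

lemma lift_convex:
  fixes F :: "'b::real_normed_vector \<Rightarrow> 'a"
  assumes C: "convex C" and F: "continuous_on C F" "\<And>x. x \<in> C \<Longrightarrow> F x \<in> X" and c: "c \<in> C" and u: "u \<in> H3" "p u = F c"
  obtains L where "continuous_on C L" "\<And>x. x \<in> C \<Longrightarrow> L x \<in> H3" "\<And>x. x \<in> C \<Longrightarrow> p (L x) = F x" "L c = u"
proof -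
  have "F \<in> C \<rightarrow> X" using F(2) by blast
  from covering_space_lift_strong[OF covering_space_p u(1) c convex_imp_simply_connected[OF C]
      convex_imp_locally_path_connected[OF C] F(1) this u(2)[symmetric]]
  obtain g where g: "continuous_on C g" "g \<in> C \<rightarrow> H3" "g c = u" "\<And>y. y \<in> C \<Longrightarrow> p (g y) = F y" by blast
  show ?thesis by (rule that[of g]) (use g in blast)+
qed

lemma lift_unique_connected:
  fixes L L' :: "'b::real_normed_vector \<Rightarrow> complex \<times> real"
  assumes C: "connected C" and L: "continuous_on C L" "\<And>x. x \<in> C \<Longrightarrow> L x \<in> H3"
    and L': "continuous_on C L'" "\<And>x. x \<in> C \<Longrightarrow> L' x \<in> H3"
    and eq: "\<And>x. x \<in> C \<Longrightarrow> p (L x) = p (L' x)" and c: "c \<in> C" "L c = L' c" and x: "x \<in> C"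
  shows "L x = L' x"
proof (rule covering_space_lift_unique[OF covering_space_p, of L c L' C "p \<circ> L"])
  show "continuous_on C (p \<circ> L)"
    by (rule continuous_on_compose[OF L(1)], rule continuous_on_subset[OF continuous_on_p]) (use L(2) in blast)
qed (use assms in auto)

lemma path_component_lift:
  fixes L :: "'b::real_normed_vector \<Rightarrow> complex \<times> real"
  assumes R: "convex R" and L: "continuous_on R L" "\<And>x. x \<in> R \<Longrightarrow> L x \<in> pre T" and ab: "a \<in> R" "b \<in> R"
  shows "path_component (pre T) (L a) (L b)"
proof -
  have "path_connected (L ` R)" by (rule path_connected_continuous_image[OF L(1) convex_imp_path_connected[OF R]])
  then have "path_component (L ` R) (L a) (L b)" using ab unfolding path_connected_component by blast
  then show ?thesis by (rule path_component_of_subset[rotated]) (use L(2) in blast)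
qed

lemma path_component_deck:
  assumes g: "g \<in> deck" and pc: "path_component (pre T) u v" shows "path_component (pre T) (g u) (g v)"
proof -
  from pc obtain \<gamma> where \<gamma>: "path \<gamma>" "path_image \<gamma> \<subseteq> pre T" "pathstart \<gamma> = u" "pathfinish \<gamma> = v"
    unfolding path_component_def by blast
  have "path (g \<circ> \<gamma>)"
    by (rule path_continuous_image[OF \<gamma>(1)], rule continuous_on_subset[OF continuous_on_hisom[OF deck_hisom[OF g]]])
      (use \<gamma>(2) in \<open>auto simp: pre_def\<close>)
  moreover have "path_image (g \<circ> \<gamma>) \<subseteq> pre T"
    using \<gamma>(2) deck_p[OF g] deck_hisom[OF g] by (auto simp: path_image_compose pre_def)
  ultimately show ?thesis unfolding path_component_def
    by (intro exI[of _ "g \<circ> \<gamma>"]) (use \<gamma>(3,4) in \<open>simp add: pathstart_compose pathfinish_compose\<close>)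
qed

lemma local_path_component:
  fixes F :: "complex \<times> real \<Rightarrow> 'a"
  assumes K: "compact K" "convex K" and F: "continuous_on K F" "inj_on F K"
    and V: "open V" "\<And>c. c \<in> K \<inter> V \<Longrightarrow> F c \<in> X" and u: "u \<in> H3" "p u = F c0" "c0 \<in> K \<inter> V"
  obtains N where "open N" "u \<in> N" "N \<subseteq> H3"
    "\<And>x. x \<in> N \<Longrightarrow> p x \<in> F ` K \<Longrightarrow> path_component (pre (F ` (K \<inter> V))) u x"
proof -
  obtain r where r: "r > 0" "inj_on p (hball u r)" using p_image_hball[OF u(1)] by metis
  obtain e where e: "e > 0" "ball c0 e \<subseteq> V" using V(1) u(3) open_contains_ball by blast
  define C1 where "C1 = K \<inter> ball c0 e"
  have C1: "convex C1" "c0 \<in> C1" "C1 \<subseteq> K \<inter> V" using K(2) u(3) e by (auto simp: C1_def intro!: convex_Int)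
  have F1: "continuous_on C1 F" by (rule continuous_on_subset[OF F(1)]) (use C1 in blast)
  have FX: "F x \<in> X" if "x \<in> C1" for x using V(2) C1(3) that by blast
  obtain L where L: "continuous_on C1 L" "\<And>x. x \<in> C1 \<Longrightarrow> L x \<in> H3" "\<And>x. x \<in> C1 \<Longrightarrow> p (L x) = F x" "L c0 = u"
    using lift_convex[OF C1(1) F1 FX C1(2) u(1,2)] by blast
  have "\<exists>\<delta>>0. \<forall>x\<in>C1. dist x c0 < \<delta> \<longrightarrow> L x \<in> hball u r"
  proof -
    have "open (hball u r)" "L c0 \<in> hball u r" using open_hball centre_hball u(1) r(1) L(4) by auto
    then obtain \<eta> where \<eta>: "\<eta> > 0" "ball (L c0) \<eta> \<subseteq> hball u r" using open_contains_ball by blast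
    from L(1)[unfolded continuous_on_iff, rule_format, OF C1(2) \<eta>(1)] obtain \<delta> where
      "\<delta> > 0" "\<forall>x\<in>C1. dist x c0 < \<delta> \<longrightarrow> dist (L x) (L c0) < \<eta>" by blast
    moreover have "w \<in> hball u r" if "dist w (L c0) < \<eta>" for w
      using \<eta>(2) that by (metis dist_commute mem_ball subsetD)
    ultimately show ?thesis by blast
  qed
  then obtain \<delta> where \<delta>: "\<delta> > 0" "\<And>x. x \<in> C1 \<Longrightarrow> dist x c0 < \<delta> \<Longrightarrow> L x \<in> hball u r" by blast
  obtain G where G: "homeomorphism K (F ` K) F G" using homeomorphism_compact[OF K(1) F(1) refl F(2)] by blast
  define D where "D = pre (F ` K)"
  have "continuous_on D (\<lambda>x. G (p x))"
    by (rule continuous_on_compose2[OF homeomorphism_cont2[OF G]], rule continuous_on_subset[OF continuous_on_p])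
      (auto simp: D_def pre_def)
  moreover have "u \<in> D" using u by (auto simp: D_def pre_def)
  moreover have "min \<delta> e > 0" using \<delta>(1) e(1) by simp
  ultimately obtain \<eta> where \<eta>: "\<eta> > 0" "\<And>x. x \<in> D \<Longrightarrow> dist x u < \<eta> \<Longrightarrow> dist (G (p x)) (G (p u)) < min \<delta> e"
    unfolding continuous_on_iff by blast
  have Gu: "G (p u) = c0" using u homeomorphism_apply1[OF G] by simp
  show ?thesis
  proof (rule that[of "hball u r \<inter> ball u \<eta>"])
    show "open (hball u r \<inter> ball u \<eta>)" "u \<in> hball u r \<inter> ball u \<eta>" "hball u r \<inter> ball u \<eta> \<subseteq> H3"
      using open_hball[OF u(1)] centre_hball[OF u(1) r(1)] \<eta>(1) hball_H3[of u r] by (simp_all add: open_Int le_infI1)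
    fix x assume x: "x \<in> hball u r \<inter> ball u \<eta>" "p x \<in> F ` K"
    then have xD: "x \<in> D" using hball_H3[of u r] unfolding D_def pre_iff by blast
    define c where "c = G (p x)"
    have c: "c \<in> K" "F c = p x" using x(2) G unfolding c_def homeomorphism_def by auto
    have d: "dist c c0 < \<delta>" "dist c c0 < e" using \<eta>(2)[OF xD] x(1) by (auto simp: c_def Gu dist_commute)
    then have c1: "c \<in> C1" using c(1) by (auto simp: C1_def dist_commute)
    have "L c = x"
      by (rule inj_onD[OF r(2)]) (use L(3)[OF c1] c(2) \<delta>(2)[OF c1 d(1)] x(1) in auto)
    moreover have "path_component (pre (F ` (K \<inter> V))) (L c0) (L c)"
      by (rule path_component_lift[OF C1(1) L(1) _ C1(2) c1]) (use L(2,3) C1(3) in \<open>auto simp: pre_def\<close>)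
    ultimately show "path_component (pre (F ` (K \<inter> V))) u x" using L(4) by simp
  qed
qed

end

abbreviation cylinder :: "(complex \<times> real) set" where "cylinder \<equiv> cball 0 1 \<times> {0..1}"

text \<open>\<open>FT\<close> and \<open>FB\<close> parametrize the two balls of a bridge decomposition, in which the knot is given by the
  vertical strands over \<open>{q1, q2}\<close> and over \<open>P2\<close>. The last assumption says that small loops around a
  strand stay in a part of the tube that does not wind around the longitude.\<close>

locale bridge = torus_end X d p f for X :: "'a::euclidean_space set" and d p f +
  fixes FT FB :: "complex \<times> real \<Rightarrow> 'a" and q1 q2 :: complex and P2 :: "complex set"
  assumes contT: "continuous_on cylinder FT" and injT: "inj_on FT cylinder"
    and contB: "continuous_on cylinder FB" and injB: "inj_on FB cylinder"
    and T_in_X: "\<And>z s. (z, s) \<in> cylinder \<Longrightarrow> FT (z, s) \<in> X \<longleftrightarrow> z \<noteq> q1 \<and> z \<noteq> q2"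
    and B_in_X: "\<And>z s. (z, s) \<in> cylinder \<Longrightarrow> FB (z, s) \<in> X \<longleftrightarrow> z \<notin> P2"
    and q12: "q1 \<noteq> q2" and q_ball: "q1 \<in> ball 0 1" "q2 \<in> ball 0 1"
    and P2: "finite P2" "P2 \<subseteq> ball 0 1"
    and X_cover: "X \<subseteq> FT ` cylinder \<union> FB ` cylinder"
    and T_Int_B: "\<And>z s. (z, s) \<in> cylinder \<Longrightarrow> FB (z, s) \<in> FT ` cylinder \<longleftrightarrow> cmod z = 1 \<or> s = 0 \<or> s = 1"
    and small_meridian: "\<And>q. q \<in> {q1, q2} \<Longrightarrow> \<exists>\<theta> \<epsilon>. cmod \<theta> = 1 \<and> \<epsilon> > 0 \<and>
      (\<forall>z. dist z q < \<epsilon> \<longrightarrow> z \<noteq> q \<longrightarrow> (\<exists>a w. cmod a = 1 \<and> Re (a / \<theta>) > 0 \<and> cmod w \<le> 1 \<and> FT (z, 1/2) = f (a, w)))"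
begin

text \<open>\<open>q + exp \<zeta>\<close> runs through a punctured disc around the strand. The
  longitudinal angle is read off by the principal branch, since \<open>a / \<theta>\<close> stays in
  the right half-plane; so only the meridional angle can change when the disc is circled.\<close>

lemma small_loop_coordinates:
  assumes q: "q \<in> {q1, q2}"
  obtains \<rho> v where "continuous_on {\<zeta>. Re \<zeta> < \<rho>} v" "\<And>\<zeta>. Re \<zeta> < \<rho> \<Longrightarrow> v \<zeta> \<in> halfcyl"
    "\<And>\<zeta>. Re \<zeta> < \<rho> \<Longrightarrow> f (polar (v \<zeta>)) = FT (q + exp \<zeta>, 1/2)"
    "\<And>\<zeta> \<zeta>'. Re \<zeta> < \<rho> \<Longrightarrow> Re \<zeta>' < \<rho> \<Longrightarrow> exp \<zeta> = exp \<zeta>' \<Longrightarrow> \<exists>j. v \<zeta>' = shift (period 0 j) (v \<zeta>)"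
proof -
  obtain \<theta> \<epsilon> where \<theta>: "cmod \<theta> = 1" and \<epsilon>: "\<epsilon> > 0"
    and sm: "\<And>z. dist z q < \<epsilon> \<Longrightarrow> z \<noteq> q \<Longrightarrow> \<exists>a w. cmod a = 1 \<and> Re (a / \<theta>) > 0 \<and> cmod w \<le> 1 \<and> FT (z, 1/2) = f (a, w)"
    using small_meridian[OF q] by blast
  define \<delta> where "\<delta> = min \<epsilon> (min (1 - cmod q) (dist q1 q2))"
  have \<delta>: "\<delta> > 0" "\<delta> \<le> \<epsilon>" "\<delta> \<le> 1 - cmod q" "\<delta> \<le> dist q1 q2" using \<epsilon> q q12 q_ball by (auto simp: \<delta>_def)
  define \<rho> where "\<rho> = ln \<delta>"
  define H where "H = {\<zeta>. Re \<zeta> < \<rho>}"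
  have Hc: "convex H" unfolding H_def by (rule convex_halfspace_Re_lt)
  have small: "cmod (exp \<zeta>) < \<delta>" if "\<zeta> \<in> H" for \<zeta>
    using that \<delta>(1) exp_less_cancel_iff[of "Re \<zeta>" "ln \<delta>"] by (simp add: H_def \<rho>_def)
  have inc: "(q + exp \<zeta>, 1/2) \<in> cylinder" "FT (q + exp \<zeta>, 1/2) \<in> X" if "\<zeta> \<in> H" for \<zeta>
  proof -
    have "cmod (q + exp \<zeta>) \<le> 1" using small[OF that] \<delta>(3) norm_triangle_ineq[of q "exp \<zeta>"] by simp
    then show m: "(q + exp \<zeta>, 1/2) \<in> cylinder" by simp
    have "dist q (q + exp \<zeta>) < dist q1 q2" using small[OF that] \<delta>(4) by (simp add: dist_norm)
    moreover have "q + exp \<zeta> \<noteq> q" by simp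
    ultimately have "q + exp \<zeta> \<noteq> q1" "q + exp \<zeta> \<noteq> q2" using q by (auto simp: dist_commute)
    then show "FT (q + exp \<zeta>, 1/2) \<in> X" using T_in_X[OF m] by simp
  qed
  have cK: "compact (sphere (0::complex) 1 \<times> cball (0::complex) 1)" by (intro compact_Times compact_sphere compact_cball)
  obtain G where G: "homeomorphism (sphere 0 1 \<times> cball 0 1) (f ` (sphere 0 1 \<times> cball 0 1)) f G"
    using homeomorphism_compact[OF cK contf refl injf] by blast
  define m where "m \<zeta> = FT (q + exp \<zeta>, 1/2)" for \<zeta>
  have m: "\<exists>a w. cmod a = 1 \<and> Re (a / \<theta>) > 0 \<and> cmod w \<le> 1 \<and> w \<noteq> 0 \<and> m \<zeta> = f (a, w) \<and> G (m \<zeta>) = (a, w)" if "\<zeta> \<in> H" for \<zeta>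
  proof -
    have "dist (q + exp \<zeta>) q < \<epsilon>" using small[OF that] \<delta>(2) by (simp add: dist_norm)
    moreover have "q + exp \<zeta> \<noteq> q" by simp
    ultimately obtain a w where aw: "cmod a = 1" "Re (a / \<theta>) > 0" "cmod w \<le> 1" "m \<zeta> = f (a, w)"
      using sm[of "q + exp \<zeta>"] unfolding m_def by blast
    have s: "a \<in> sphere 0 1" "w \<in> cball 0 1" using aw by auto
    have "w \<noteq> 0" using f_in_X[OF s] inc(2)[OF that] aw(4) by (simp add: m_def)
    moreover have "G (m \<zeta>) = (a, w)" using aw(4) homeomorphism_apply1[OF G, of "(a, w)"] s by simp
    ultimately show ?thesis using aw by blast
  qed
  have contm: "continuous_on H m"
    unfolding m_def by (rule continuous_on_compose2[OF contT]) (use inc(1) in \<open>auto intro!: continuous_intros\<close>)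
  have contG: "continuous_on H (\<lambda>\<zeta>. G (m \<zeta>))"
  proof (rule continuous_on_compose2[OF homeomorphism_cont2[OF G] contm])
    show "m ` H \<subseteq> f ` (sphere 0 1 \<times> cball 0 1)"
    proof
      fix y assume "y \<in> m ` H"
      then obtain \<zeta> where "\<zeta> \<in> H" "y = m \<zeta>" by blast
      then show "y \<in> f ` (sphere 0 1 \<times> cball 0 1)" using m[of \<zeta>] by force
    qed
  qed
  define a where "a \<zeta> = fst (G (m \<zeta>))" for \<zeta>
  define w where "w \<zeta> = snd (G (m \<zeta>))" for \<zeta>
  have aw: "cmod (a \<zeta>) = 1" "Re (a \<zeta> / \<theta>) > 0" "cmod (w \<zeta>) \<le> 1" "w \<zeta> \<noteq> 0" "m \<zeta> = f (a \<zeta>, w \<zeta>)" if "\<zeta> \<in> H" for \<zeta>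
    using m[OF that] by (auto simp: a_def w_def)
  have conta: "continuous_on H a" "continuous_on H w"
    unfolding a_def w_def using contG by (auto intro: continuous_on_fst continuous_on_snd)
  obtain g where g: "continuous_on H g" "\<And>\<zeta>. \<zeta> \<in> H \<Longrightarrow> w \<zeta> = exp (g \<zeta>)"
    using continuous_logarithm_on_contractible[OF conta(2) convex_imp_contractible[OF Hc]] aw(4) by blast
  define v where "v \<zeta> = (Complex (Arg \<theta> + Im (Ln (a \<zeta> / \<theta>))) (Im (g \<zeta>)), cmod (w \<zeta>))" for \<zeta>
  have \<theta>0: "\<theta> \<noteq> 0" using \<theta> by auto
  have cisA: "cis (Arg \<theta>) = \<theta>" using cis_Arg[OF \<theta>0] \<theta> by (simp add: sgn_div_norm)
  have pv: "polar (v \<zeta>) = (a \<zeta>, w \<zeta>)" if "\<zeta> \<in> H" for \<zeta>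
  proof -
    have n: "a \<zeta> / \<theta> \<noteq> 0" "cmod (a \<zeta> / \<theta>) = 1" using aw(1)[OF that] \<theta> \<theta>0 by (auto simp: norm_divide)
    have "cis (Im (Ln (a \<zeta> / \<theta>))) = a \<zeta> / \<theta>"
      using cis_Arg[OF n(1)] n Arg_eq_Im_Ln[OF n(1)] by (simp add: sgn_div_norm)
    moreover have "of_real (cmod (w \<zeta>)) * cis (Im (g \<zeta>)) = w \<zeta>"
      using g(2)[OF that] by (simp add: exp_eq_polar norm_mult)
    ultimately show ?thesis using cisA \<theta>0 by (simp add: polar_def v_def flip: cis_mult)
  qed
  show ?thesis
  proof (rule that[of \<rho> v])
    have Lnc: "continuous_on H (\<lambda>\<zeta>. Ln (a \<zeta> / \<theta>))"
    proof (rule continuous_on_Ln')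
      show "continuous_on H (\<lambda>\<zeta>. a \<zeta> / \<theta>)" using conta(1) \<theta>0 by (intro continuous_intros) auto
      show "a \<zeta> / \<theta> \<notin> \<real>\<^sub>\<le>\<^sub>0" if "\<zeta> \<in> H" for \<zeta>
        using aw(2)[OF that] unfolding complex_nonpos_Reals_iff by linarith
    qed
    show "continuous_on {\<zeta>. Re \<zeta> < \<rho>} v"
      unfolding v_def H_def[symmetric] Complex_eq
      by (intro continuous_on_Pair continuous_on_add continuous_on_mult continuous_on_of_real continuous_on_Im
          continuous_on_norm continuous_on_const conta g Lnc)
    show "v \<zeta> \<in> halfcyl" if "Re \<zeta> < \<rho>" for \<zeta> using aw[of \<zeta>] that by (simp add: v_def halfcyl_iff H_def)
    show "f (polar (v \<zeta>)) = FT (q + exp \<zeta>, 1/2)" if "Re \<zeta> < \<rho>" for \<zeta>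
      using pv[of \<zeta>] aw(5)[of \<zeta>] that by (simp add: H_def m_def)
    show "\<exists>j. v \<zeta>' = shift (period 0 j) (v \<zeta>)" if h: "Re \<zeta> < \<rho>" "Re \<zeta>' < \<rho>" "exp \<zeta> = exp \<zeta>'" for \<zeta> \<zeta>'
    proof -
      have mm: "m \<zeta> = m \<zeta>'" using h(3) by (simp add: m_def)
      then have "exp (g \<zeta>') = exp (g \<zeta>)" using g(2)[of \<zeta>] g(2)[of \<zeta>'] h by (simp add: w_def H_def)
      then obtain j :: int where "g \<zeta>' = g \<zeta> + of_int (2 * j) * pi * \<i>" unfolding exp_eq by blast
      then have "Im (g \<zeta>') = Im (g \<zeta>) + 2 * pi * of_int j" by simp
      then show ?thesis using mm
        by (intro exI[of _ j]) (simp add: v_def shift_def period_def a_def w_def complex_eq_iff)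
    qed
  qed
qed

lemma path_in_pre:
  assumes F: "homeomorphism cylinder (F ` cylinder) F G" and D: "D \<subseteq> cylinder" and pc: "path_component (pre (F ` D)) u v"
  obtains \<gamma> z s where "continuous_on {0..1} \<gamma>" "\<gamma> 0 = u" "\<gamma> (1::real) = v" "\<And>t. t \<in> {0..1} \<Longrightarrow> \<gamma> t \<in> H3"
    "continuous_on {0..1} z" "continuous_on {0..1} s" "\<And>t. t \<in> {0..1} \<Longrightarrow> (z t, s t) \<in> D"
    "\<And>t. t \<in> {0..1} \<Longrightarrow> p (\<gamma> t) = F (z t, s t)"
proof -
  obtain \<gamma> where \<gamma>: "path \<gamma>" "path_image \<gamma> \<subseteq> pre (F ` D)" "pathstart \<gamma> = u" "pathfinish \<gamma> = v"
    using pc unfolding path_component_def by blast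
  have \<gamma>c: "continuous_on {0..1} \<gamma>" using \<gamma>(1) by (simp add: path_def)
  have \<gamma>D: "\<gamma> t \<in> H3" "p (\<gamma> t) \<in> F ` D" if "t \<in> {0..1}" for t
    using \<gamma>(2) that unfolding path_image_def pre_def by blast+
  define c where "c t = G (p (\<gamma> t))" for t
  have cD: "c t \<in> D" "F (c t) = p (\<gamma> t)" if h: "t \<in> {0..1}" for t
  proof -
    obtain x where x: "x \<in> D" "p (\<gamma> t) = F x" using \<gamma>D(2)[OF h] by blast
    then have "c t = x" using homeomorphism_apply1[OF F, of x] D by (auto simp: c_def)
    then show "c t \<in> D" "F (c t) = p (\<gamma> t)" using x by simp_all
  qed
  have "continuous_on {0..1} (\<lambda>t. p (\<gamma> t))"
    by (rule continuous_on_compose2[OF continuous_on_p \<gamma>c]) (use \<gamma>D(1) in blast)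
  then have cc: "continuous_on {0..1} c"
    unfolding c_def by (rule continuous_on_compose2[OF homeomorphism_cont2[OF F]]) (use \<gamma>D(2) D in blast)
  show ?thesis
    by (rule that[of \<gamma> "\<lambda>t. fst (c t)" "\<lambda>t. snd (c t)"])
      (use \<gamma>c \<gamma>(3,4) \<gamma>D(1) cD cc in \<open>auto simp: pathstart_def pathfinish_def intro: continuous_on_fst continuous_on_snd\<close>)
qed

lemma ex_homeomorphism_T: obtains G where "homeomorphism cylinder (FT ` cylinder) FT G"
  using homeomorphism_compact[OF _ contT refl injT] by (metis compact_Times compact_cball compact_Icc)

lemma ex_homeomorphism_B: obtains G where "homeomorphism cylinder (FB ` cylinder) FB G"
  using homeomorphism_compact[OF _ contB refl injB] by (metis compact_Times compact_cball compact_Icc)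

text \<open>A loop around a single strand can be shrunk towards that strand until it lies in the tube, where it
  becomes a power of the meridian.\<close>

lemma puncture_loops:
  assumes q: "q \<in> {q1, q2}" and L: "convex L" "{q1, q2} \<inter> L = {q}" and b: "b \<in> L" "cmod b \<le> 1" "b \<noteq> q"
    and u0: "u0 \<in> H3" "p u0 = FT (b, 1/2)"
  obtains k where "k \<in> deck"
    "\<And>g. g \<in> deck \<Longrightarrow> path_component (pre (FT ` ((cball 0 1 \<inter> L) \<times> {0..1}))) u0 (g u0) \<Longrightarrow> \<exists>j. g = k \<circ> periph 0 j \<circ> hinv k"
proof -
  obtain \<rho> v where v: "continuous_on {\<zeta>. Re \<zeta> < \<rho>} v" "\<And>\<zeta>. Re \<zeta> < \<rho> \<Longrightarrow> v \<zeta> \<in> halfcyl"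
    "\<And>\<zeta>. Re \<zeta> < \<rho> \<Longrightarrow> f (polar (v \<zeta>)) = FT (q + exp \<zeta>, 1/2)"
    "\<And>\<zeta> \<zeta>'. Re \<zeta> < \<rho> \<Longrightarrow> Re \<zeta>' < \<rho> \<Longrightarrow> exp \<zeta> = exp \<zeta>' \<Longrightarrow> \<exists>j. v \<zeta>' = shift (period 0 j) (v \<zeta>)"
    using small_loop_coordinates[OF q] by metis
  \<comment> \<open>Points of the unit disc are at distance at most 2 from \<open>q\<close>, so
    shrinking by \<open>exp (- R)\<close> brings every loop into the small disc.\<close>
  define R where "R = max 0 (ln 2 - \<rho> + 1)"
  have R: "R \<ge> 0" "ln 2 - R < \<rho>" by (auto simp: R_def)
  have qb: "cmod q < 1" "q \<in> L" using q q_ball L(2) by auto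
  have pt: "(q + exp (\<zeta> - of_real (\<tau> * R)), s) \<in> (cball 0 1 \<inter> L) \<times> {0..1}"
      "FT (q + exp (\<zeta> - of_real (\<tau> * R)), s) \<in> X" "Re \<zeta> - R < \<rho>"
    if h: "q + exp \<zeta> \<in> cball 0 1 \<inter> L" "\<tau> \<in> {0..1}" "s \<in> {0..1}" for \<zeta> \<tau> s
  proof -
    define r where "r = exp (- (\<tau> * R))"
    have r: "r > 0" "r \<le> 1" using R(1) h(2) by (auto simp: r_def)
    have e: "q + exp (\<zeta> - of_real (\<tau> * R)) = (1 - r) *\<^sub>R q + r *\<^sub>R (q + exp \<zeta>)"
      by (simp add: r_def exp_diff exp_minus exp_of_real scaleR_conv_of_real algebra_simps divide_inverse del: of_real_mult)
    have cv: "convex (cball 0 1 \<inter> L)" by (intro convex_Int convex_cball L)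
    have c: "q + exp (\<zeta> - of_real (\<tau> * R)) \<in> cball 0 1 \<inter> L"
      unfolding e by (rule convexD[OF cv]) (use qb h r in auto)
    then show m: "(q + exp (\<zeta> - of_real (\<tau> * R)), s) \<in> (cball 0 1 \<inter> L) \<times> {0..1}" using h by simp
    have "q + exp (\<zeta> - of_real (\<tau> * R)) \<noteq> q" by simp
    then have "q + exp (\<zeta> - of_real (\<tau> * R)) \<notin> {q1, q2}" using c L(2) by blast
    then show "FT (q + exp (\<zeta> - of_real (\<tau> * R)), s) \<in> X" using T_in_X[of _ s] m by simp
    have "exp (Re \<zeta>) = cmod ((q + exp \<zeta>) - q)" by simp
    also have "\<dots> \<le> 2" using norm_triangle_ineq4[of "q + exp \<zeta>" q] qb(1) h(1) by (simp del: add_diff_cancel_left')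
    finally have "Re \<zeta> \<le> ln 2" by (simp add: ln_ge_iff)
    then show "Re \<zeta> - R < \<rho>" using R(2) by simp
  qed
  define \<zeta>0 where "\<zeta>0 = Ln (b - q)"
  have \<zeta>0: "q + exp \<zeta>0 = b" using b(3) by (simp add: \<zeta>0_def)
  have \<zeta>0L: "q + exp \<zeta>0 \<in> cball 0 1 \<inter> L" using b \<zeta>0 by simp
  define E0 where "E0 \<tau> = FT (q + exp (\<zeta>0 - of_real (\<tau> * R)), 1/2)" for \<tau> :: real
  have E0: "continuous_on {0..1} E0" "\<And>\<tau>. \<tau> \<in> {0..1} \<Longrightarrow> E0 \<tau> \<in> X"
  proof -
    show "continuous_on {0..1} E0" unfolding E0_def
      by (rule continuous_on_compose2[OF contT]) (use pt(1)[OF \<zeta>0L, of _ "1/2"] in \<open>auto intro!: continuous_intros\<close>)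
    show "E0 \<tau> \<in> X" if "\<tau> \<in> {0..1}" for \<tau> unfolding E0_def by (rule pt(2)[OF \<zeta>0L that]) simp
  qed
  have "p u0 = E0 0" using u0 \<zeta>0 by (simp add: E0_def)
  from lift_convex[OF convex_real_interval(5) E0 _ u0(1) this]
  obtain l where l: "continuous_on {0..1} l" "\<And>\<tau>. \<tau> \<in> {0..1} \<Longrightarrow> l \<tau> \<in> H3" "\<And>\<tau>. \<tau> \<in> {0..1} \<Longrightarrow> p (l \<tau>) = E0 \<tau>" "l 0 = u0"
    by auto
  have \<zeta>R: "Re (\<zeta>0 - of_real R) < \<rho>" using pt(3)[OF \<zeta>0L, of 1 1] by simp
  define v0 where "v0 = v (\<zeta>0 - of_real R)"
  have v0: "v0 \<in> halfcyl" using v(2)[OF \<zeta>R] by (simp add: v0_def)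
  have "p (Q v0) = p (l 1)" using Q(3)[OF v0] v(3)[OF \<zeta>R] l(3)[of 1] by (simp add: v0_def E0_def)
  then obtain k where k: "k \<in> deck" "k (Q v0) = l 1" using deck_transitive[OF Q(2)[OF v0] l(2)[of 1]] by auto
  show ?thesis
  proof (rule that[OF k(1)])
    fix g assume g: "g \<in> deck" and pc: "path_component (pre (FT ` ((cball 0 1 \<inter> L) \<times> {0..1}))) u0 (g u0)"
    obtain GT where GT: "homeomorphism cylinder (FT ` cylinder) FT GT" using ex_homeomorphism_T .
    obtain \<gamma> z s where \<gamma>: "continuous_on {0..1} \<gamma>" "\<gamma> 0 = u0" "\<gamma> (1::real) = g u0" "\<And>t. t \<in> {0..1} \<Longrightarrow> \<gamma> t \<in> H3"
      and zs: "continuous_on {0..1} z" "continuous_on {0..1} s" "\<And>t. t \<in> {0..1} \<Longrightarrow> (z t, s t) \<in> (cball 0 1 \<inter> L) \<times> {0..1}"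
      and p\<gamma>: "\<And>t. t \<in> {0..1} \<Longrightarrow> p (\<gamma> t) = FT (z t, s t)"
      by (rule path_in_pre[OF GT _ pc]) auto
    have ends: "z t = b \<and> s t = 1/2" if "t = 0 \<or> t = 1" for t
    proof -
      have t: "t \<in> {0..1}" using that by auto
      have "p (\<gamma> t) = p u0" using that \<gamma>(2,3) deck_p[OF g u0(1)] by auto
      then have "FT (z t, s t) = FT (b, 1/2)" using p\<gamma>[OF t] u0(2) by simp
      moreover have "(z t, s t) \<in> cylinder" "(b, 1/2) \<in> cylinder" using zs(3)[OF t] b(2) by auto
      ultimately have "(z t, s t) = (b, 1/2)" using injT by (metis inj_onD)
      then show ?thesis by simp
    qed
    have z01: "z 0 = b" "z 1 = b" "s 0 = 1/2" "s 1 = 1/2" using ends[of 0] ends[of 1] by blast+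
    have zq: "z t - q \<noteq> 0" if "t \<in> {0..1}" for t
    proof -
      have "(z t, s t) \<in> cylinder" using zs(3)[OF that] by blast
      moreover have "FT (z t, s t) \<in> X" using p_in_X[OF \<gamma>(4)[OF that]] unfolding p\<gamma>[OF that] .
      ultimately have "z t \<noteq> q1 \<and> z t \<noteq> q2" using T_in_X by blast
      then show ?thesis using q by fastforce
    qed
    have zqc: "continuous_on {0..1} (\<lambda>t. z t - q)" by (intro continuous_intros zs)
    obtain h where h: "continuous_on {0..1} h" "\<And>t. t \<in> {0..1} \<Longrightarrow> z t - q = exp (h t)"
      using continuous_logarithm_on_contractible[OF zqc convex_imp_contractible[OF convex_real_interval(5)] zq] by blast
    define \<zeta> where "\<zeta> t = h t - h 0 + \<zeta>0" for t
    have \<zeta>c: "continuous_on {0..1} \<zeta>" unfolding \<zeta>_def by (intro continuous_intros h)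
    have \<zeta>00: "\<zeta> 0 = \<zeta>0" by (simp add: \<zeta>_def)
    have "exp (h 0) = exp \<zeta>0" using h(2)[of 0] z01 \<zeta>0 by (simp add: algebra_simps)
    then have e\<zeta>: "q + exp (\<zeta> t) = z t" if "t \<in> {0..1}" for t
      using h(2)[OF that] by (simp add: \<zeta>_def exp_add exp_diff algebra_simps)
    have \<zeta>L: "q + exp (\<zeta> t) \<in> cball 0 1 \<inter> L" if "t \<in> {0..1}" for t using e\<zeta>[OF that] zs(3)[OF that] by simp
    \<comment> \<open>The homotopy shrinks towards the strand and at the same time moves the height
      to \<open>1/2\<close>, the level at which tube coordinates are available.\<close>
    define E where "E x = FT (q + exp (\<zeta> (fst x) - of_real (snd x * R)), (1 - snd x) * s (fst x) + snd x / 2)" for x :: "real \<times> real"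
    have s01: "(1 - \<tau>) * s t + \<tau> / 2 \<in> {0..1}" if "t \<in> {0..1}" "\<tau> \<in> {0..1}" for t \<tau>
    proof -
      have "s t \<in> {0..1}" "(1/2::real) \<in> {0..1}" using zs(3)[OF that(1)] by auto
      from convexD[OF convex_real_interval(5) this, of "1 - \<tau>" \<tau>] show ?thesis using that(2) by (simp add: algebra_simps)
    qed
    define SQ :: "(real \<times> real) set" where "SQ = {0..1} \<times> {0..1}"
    have fs: "fst x \<in> {0..1}" "snd x \<in> {0..1}" if "x \<in> SQ" for x using that by (auto simp: SQ_def)
    have SQ: "convex SQ" by (auto simp: SQ_def intro: convex_Times)
    have c\<zeta>': "continuous_on SQ (\<lambda>x. \<zeta> (fst x))" "continuous_on SQ (\<lambda>x. s (fst x))"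
      by (rule continuous_on_compose2[OF \<zeta>c continuous_on_fst[OF continuous_on_id]], use fs(1) in blast)
         (rule continuous_on_compose2[OF zs(2) continuous_on_fst[OF continuous_on_id]], use fs(1) in blast)
    have Ec: "continuous_on SQ E" unfolding E_def
    proof (rule continuous_on_compose2[OF contT])
      show "continuous_on SQ (\<lambda>x. (q + exp (\<zeta> (fst x) - of_real (snd x * R)), (1 - snd x) * s (fst x) + snd x / 2))"
        by (intro continuous_intros c\<zeta>') simp
      show "(\<lambda>x. (q + exp (\<zeta> (fst x) - of_real (snd x * R)), (1 - snd x) * s (fst x) + snd x / 2)) ` SQ \<subseteq> cylinder"
        using pt(1)[OF \<zeta>L[OF fs(1)] fs(2) s01[OF fs]] by blast
    qed
    have EX: "E x \<in> X" if "x \<in> SQ" for x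
      unfolding E_def using pt(2)[OF \<zeta>L[OF fs(1)] fs(2) s01[OF fs]] that by blast
    have c0: "(0, 0) \<in> SQ" by (simp add: SQ_def)
    have "p u0 = E (0, 0)" by (simp add: E_def u0 \<zeta>0 \<zeta>00 z01)
    from lift_convex[OF SQ Ec EX c0 u0(1) this] obtain \<Lambda> where \<Lambda>: "continuous_on SQ \<Lambda>" "\<And>x. x \<in> SQ \<Longrightarrow> \<Lambda> x \<in> H3"
        "\<And>x. x \<in> SQ \<Longrightarrow> p (\<Lambda> x) = E x" "\<Lambda> (0, 0) = u0" by blast
    have I01: "connected {0..1::real}" by simp
    have \<Lambda>1: "continuous_on {0..1} (\<lambda>t. \<Lambda> (t, \<tau>))" "\<And>t. t \<in> {0..1} \<Longrightarrow> \<Lambda> (t, \<tau>) \<in> H3" if "\<tau> \<in> {0..1}" for \<tau>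
      by (rule continuous_on_compose2[OF \<Lambda>(1)]) (use that \<Lambda>(2) in \<open>auto simp: SQ_def intro!: continuous_intros\<close>)
    have \<Lambda>2: "continuous_on {0..1} (\<lambda>\<tau>. \<Lambda> (t, \<tau>))" "\<And>\<tau>. \<tau> \<in> {0..1} \<Longrightarrow> \<Lambda> (t, \<tau>) \<in> H3" if "t \<in> {0..1}" for t
      by (rule continuous_on_compose2[OF \<Lambda>(1)]) (use that \<Lambda>(2) in \<open>auto simp: SQ_def intro!: continuous_intros\<close>)
    have i0: "(0::real) \<in> {0..1}" "(1::real) \<in> {0..1}" by auto
    \<comment> \<open>The lifted square is identified side by side: the given path at the start of
      the homotopy, then the tracks of its two ends, which are \<open>l\<close> and its translate by
      \<open>g\<close>.\<close>
    have L1: "\<Lambda> (t, 0) = \<gamma> t" if t: "t \<in> {0..1}" for t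
      by (rule lift_unique_connected[OF I01 \<Lambda>1[OF i0(1)] \<gamma>(1,4) _ i0(1) _ t])
        (use \<Lambda>(3,4) p\<gamma> \<gamma>(2) e\<zeta> in \<open>auto simp: SQ_def E_def\<close>)
    have L2: "\<Lambda> (0, \<tau>) = l \<tau>" if t: "\<tau> \<in> {0..1}" for \<tau>
      by (rule lift_unique_connected[OF I01 \<Lambda>2[OF i0(1)] l(1,2) _ i0(1) _ t])
        (use \<Lambda>(3,4) l(3,4) \<zeta>00 in \<open>auto simp: SQ_def E_def E0_def z01 field_simps\<close>)
    have e1: "exp (\<zeta> 1) = exp \<zeta>0" using e\<zeta>[of 1] z01 \<zeta>0 by (metis add_left_cancel i0(2))
    have gl: "continuous_on {0..1} (\<lambda>\<tau>. g (l \<tau>))" "\<And>\<tau>. \<tau> \<in> {0..1} \<Longrightarrow> g (l \<tau>) \<in> H3"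
      by (rule continuous_on_compose2[OF continuous_on_hisom[OF deck_hisom[OF g]] l(1)]) (use l(2) deck_hisom[OF g] in auto)
    have L3: "\<Lambda> (1, \<tau>) = g (l \<tau>)" if t: "\<tau> \<in> {0..1}" for \<tau>
    proof (rule lift_unique_connected[OF I01 \<Lambda>2[OF i0(2)] gl _ i0(1) _ t])
      show "p (\<Lambda> (1, \<tau>)) = p (g (l \<tau>))" if "\<tau> \<in> {0..1}" for \<tau>
        using \<Lambda>(3)[of "(1, \<tau>)"] deck_p[OF g l(2)] l(3)[of \<tau>] that e1
        by (simp add: z01 SQ_def E_def E0_def exp_diff field_simps)
      show "\<Lambda> (1, 0) = g (l 0)" using L1[of 1] \<gamma>(3) l(4) by simp
    qed
    have \<zeta>\<rho>: "Re (\<zeta> t - of_real R) < \<rho>" if "t \<in> {0..1}" for t using pt(3)[OF \<zeta>L[OF that], of 1 1] by simp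
    have vc: "continuous_on {0..1} (\<lambda>t. v (\<zeta> t - of_real R))"
      by (rule continuous_on_compose2[OF v(1)]) (use \<zeta>\<rho> in \<open>auto intro!: continuous_intros \<zeta>c\<close>)
    have Qc: "continuous_on {0..1} (\<lambda>t. Q (v (\<zeta> t - of_real R)))"
      by (rule continuous_on_compose2[OF Q(1) vc]) (use v(2) \<zeta>\<rho> in blast)
    have QH: "Q (v (\<zeta> t - of_real R)) \<in> H3" if "t \<in> {0..1}" for t using Q(2) v(2) \<zeta>\<rho>[OF that] by blast
    have kQ: "continuous_on {0..1} (\<lambda>t. k (Q (v (\<zeta> t - of_real R))))"
        "\<And>t. t \<in> {0..1} \<Longrightarrow> k (Q (v (\<zeta> t - of_real R))) \<in> H3"
      by (rule continuous_on_compose2[OF continuous_on_hisom[OF deck_hisom[OF k(1)]] Qc]) (use QH deck_hisom[OF k(1)] in auto)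
    \<comment> \<open>Along the last side the loop lies in the tube, so its lift is the image under
      \<open>k\<close> of a path in the lifted end; closing up there is a meridional period.\<close>
    have "\<Lambda> (1, 1) = k (Q (v (\<zeta> 1 - of_real R)))"
    proof (rule lift_unique_connected[OF I01 \<Lambda>1[OF i0(2)] kQ _ i0(1) _ i0(2)])
      show "p (\<Lambda> (t, 1)) = p (k (Q (v (\<zeta> t - of_real R))))" if "t \<in> {0..1}" for t
        using \<Lambda>(3)[of "(t, 1)"] deck_p[OF k(1) QH[OF that]] Q(3)[OF v(2)[OF \<zeta>\<rho>[OF that]]] v(3)[OF \<zeta>\<rho>[OF that]] that
        by (simp add: SQ_def E_def)
      show "\<Lambda> (0, 1) = k (Q (v (\<zeta> 0 - of_real R)))" using L2[of 1] k(2) by (simp add: \<zeta>00 v0_def)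
    qed
    moreover obtain j where "v (\<zeta> 1 - of_real R) = shift (period 0 j) v0"
      using v(4)[OF \<zeta>R \<zeta>\<rho>[OF i0(2)]] e1 unfolding v0_def by (auto simp: exp_diff)
    moreover have "\<Lambda> (1, 1) = g (k (Q v0))" using L3[of 1] k(2) by simp
    ultimately have eq: "g (k (Q v0)) = k (periph 0 j (Q v0))" using periph(2)[OF v0] by simp
    have kQ0: "k (Q v0) \<in> H3" using k(2) l(2)[of 1] by simp
    have "g = k \<circ> periph 0 j \<circ> hinv k"
      by (rule deck_eqI[OF g _ kQ0]) (use k(1) periph(1) eq Q(2)[OF v0] in simp_all)
    then show "\<exists>j. g = k \<circ> periph 0 j \<circ> hinv k" ..
  qed
qed

end

text \<open>The upper ball is cut into two overlapping halves by the convex sets \<open>L True\<close> and \<open>L False\<close>, each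
  containing one strand; their intersection is simply connected. To see that the subgroup \<open>S\<close> is the whole
  deck group, the points of hyperbolic space reachable from the orbit \<open>S u0\<close> are shown to be open and
  closed: switching between the halves only costs an element of \<open>S\<close>, and a path in the lower ball can be
  pushed into the boundary of that ball.\<close>

locale bridge_halves = bridge X d p f FT FB q1 q2 P2
  for X :: "'a::euclidean_space set" and d p f FT FB q1 q2 P2 +
  fixes L :: "bool \<Rightarrow> complex set" and b0 :: complex and u0 :: "complex \<times> real" and S :: "(complex \<times> real \<Rightarrow> complex \<times> real) set"
  assumes open_L: "\<And>i. open (L i)" and convex_L: "\<And>i. convex (L i)" and L_cover: "\<And>z. \<exists>i. z \<in> L i"
    and L_disj: "\<And>q. q \<in> {q1, q2} \<Longrightarrow> q \<notin> L True \<or> q \<notin> L False"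
    and b0: "\<And>i. b0 \<in> L i" "cmod b0 \<le> 1" and u0: "u0 \<in> H3" "p u0 = FT (b0, 1/2)"
    and S: "S \<subseteq> deck" "id \<in> S" "\<And>g h. g \<in> S \<Longrightarrow> h \<in> S \<Longrightarrow> g \<circ> h \<in> S" "\<And>g. g \<in> S \<Longrightarrow> hinv g \<in> S"
    and S_loops: "\<And>i g. g \<in> deck \<Longrightarrow> path_component (pre (FT ` ((cball 0 1 \<inter> L i) \<times> {0..1}))) u0 (g u0) \<Longrightarrow> g \<in> S"
begin

definition T :: "bool \<Rightarrow> 'a set" where "T i = FT ` ((cball 0 1 \<inter> L i) \<times> {0..1})"
definition Top :: "'a set" where "Top = FT ` cylinder"
definition Bot :: "'a set" where "Bot = FB ` cylinder"
definition sheet_pt :: "complex \<times> real \<Rightarrow> bool" where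
  "sheet_pt x \<longleftrightarrow> (\<exists>\<gamma>\<in>S. \<exists>i. path_component (pre (T i)) (\<gamma> u0) x)"

lemma deck_S [simp]: "\<gamma> \<in> S \<Longrightarrow> \<gamma> \<in> deck" using S(1) by blast

lemma translate_S:
  assumes "\<gamma> \<in> S" "g \<in> deck" "path_component (pre (T i)) (\<gamma> u0) (g u0)" shows "g \<in> S"
proof -
  have \<gamma>: "\<gamma> \<in> hisom" using assms by simp
  have "path_component (pre (T i)) (hinv \<gamma> (\<gamma> u0)) (hinv \<gamma> (g u0))"
    by (rule path_component_deck[OF _ assms(3)]) (use assms(1) in simp)
  then have "path_component (pre (T i)) u0 ((hinv \<gamma> \<circ> g) u0)" using \<gamma> by simp
  then have "hinv \<gamma> \<circ> g \<in> S" unfolding T_def using S_loops[of "hinv \<gamma> \<circ> g" i] assms by simp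
  then have "\<gamma> \<circ> (hinv \<gamma> \<circ> g) \<in> S" using S(3) assms(1) by blast
  moreover have "\<gamma> \<circ> (hinv \<gamma> \<circ> g) = g" using \<gamma> by (auto simp: fun_eq_iff)
  ultimately show ?thesis by simp
qed

text \<open>The overlap of the two halves is convex and contains no strand, so over it one can move
  from \<open>x\<close> to a lift of the base point. By \<open>translate_S\<close> this lift is in
  the orbit of \<open>S\<close>, and it serves the other half as well.\<close>

lemma sheet_switch:
  assumes \<gamma>: "\<gamma> \<in> S" and pc: "path_component (pre (T i)) (\<gamma> u0) x" and x: "p x \<in> T j"
  shows "\<exists>\<gamma>'\<in>S. path_component (pre (T j)) (\<gamma>' u0) x"
proof (cases "i = j")
  case False
  have xp: "x \<in> pre (T i)" using path_component_mem(2)[OF pc] .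
  then have xH: "x \<in> H3" by (simp add: pre_iff)
  obtain z s where zs: "z \<in> cball 0 1 \<inter> L i" "s \<in> {0..1}" "p x = FT (z, s)" using xp by (auto simp: pre_iff T_def)
  obtain z' s' where zs': "z' \<in> cball 0 1 \<inter> L j" "s' \<in> {0..1}" "p x = FT (z', s')" using x by (auto simp: T_def)
  have "(z, s) = (z', s')" by (rule inj_onD[OF injT]) (use zs zs' in auto)
  then have zL: "z \<in> L i \<inter> L j" using zs zs' by simp
  define C where "C = (cball 0 1 \<inter> (L True \<inter> L False)) \<times> {0..1::real}"
  have C: "convex C" unfolding C_def by (intro convex_Times convex_Int convex_L convex_cball convex_real_interval)
  have LL: "L True \<inter> L False = L i \<inter> L j" using False by (cases i; cases j) auto
  have Cc: "C \<subseteq> cylinder" "C \<subseteq> (cball 0 1 \<inter> L i) \<times> {0..1}" "C \<subseteq> (cball 0 1 \<inter> L j) \<times> {0..1}"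
    unfolding C_def LL by auto
  have FC: "continuous_on C FT" by (rule continuous_on_subset[OF contT Cc(1)])
  have FX: "FT c \<in> X" if "c \<in> C" for c
  proof -
    obtain a t where c: "c = (a, t)" by (cases c)
    have "a \<noteq> q1" "a \<noteq> q2" using that L_disj unfolding c C_def by auto
    then show ?thesis using T_in_X[of a t] that Cc(1) c by blast
  qed
  have zC: "(z, s) \<in> C" and bC: "(b0, 1/2) \<in> C" using zs zL b0 LL by (auto simp: C_def)
  obtain l where l: "continuous_on C l" "\<And>c. c \<in> C \<Longrightarrow> l c \<in> H3" "\<And>c. c \<in> C \<Longrightarrow> p (l c) = FT c" "l (z, s) = x"
    using lift_convex[OF C FC FX zC xH zs(3)] by blast
  have pcl: "path_component (pre (T h)) x (l (b0, 1/2))" if "h = i \<or> h = j" for h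
  proof -
    have "path_component (pre (T h)) (l (z, s)) (l (b0, 1/2))"
      by (rule path_component_lift[OF C l(1) _ zC bC]) (use l(2,3) Cc that in \<open>auto simp: pre_iff T_def\<close>)
    then show ?thesis by (simp add: l(4))
  qed
  have "p u0 = p (l (b0, 1/2))" using u0(2) l(3)[OF bC] by simp
  then obtain g where g: "g \<in> deck" "g u0 = l (b0, 1/2)" using deck_transitive[OF u0(1) l(2)[OF bC]] by blast
  have "path_component (pre (T i)) (\<gamma> u0) (g u0)" using path_component_trans[OF pc pcl[of i]] g(2) by simp
  then have "g \<in> S" using translate_S \<gamma> g(1) by blast
  moreover have "path_component (pre (T j)) (g u0) x" using path_component_sym[OF pcl[of j]] g(2) by simp
  ultimately show ?thesis by blast
qed (use assms in auto)

lemma sheet_path: assumes "path_component (pre (T j)) x y" "sheet_pt x" shows "sheet_pt y"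
proof -
  have "p x \<in> T j" using path_component_mem(1)[OF assms(1)] by (simp add: pre_iff)
  then obtain \<gamma> where "\<gamma> \<in> S" "path_component (pre (T j)) (\<gamma> u0) x" using assms(2) sheet_switch unfolding sheet_pt_def by blast
  then show ?thesis using path_component_trans[OF _ assms(1)] unfolding sheet_pt_def by blast
qed

lemma open_half_pieces: "open ((L j - {q1, q2}) \<times> (UNIV :: real set))"
  by (intro open_Times open_Diff open_L finite_imp_closed) auto

lemma sheet_local:
  assumes x: "x \<in> pre Top"
  obtains N where "open N" "x \<in> N" "\<And>y. y \<in> N \<Longrightarrow> p y \<in> Top \<Longrightarrow> sheet_pt y \<longleftrightarrow> sheet_pt x"
proof -
  obtain z s where zs: "(z, s) \<in> cylinder" "p x = FT (z, s)" using x by (auto simp: pre_iff Top_def)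
  obtain j where j: "z \<in> L j" using L_cover by blast
  have xH: "x \<in> H3" using x by (simp add: pre_iff)
  have zq: "z \<noteq> q1" "z \<noteq> q2" using p_in_X[OF xH] T_in_X[OF zs(1)] zs(2) by auto
  define V where "V = (L j - {q1, q2}) \<times> (UNIV :: real set)"
  have cK: "compact cylinder" "convex cylinder"
    by (auto intro!: compact_Times convex_Times)
  have FV: "FT c \<in> X" if "c \<in> cylinder \<inter> V" for c
  proof -
    obtain a t where c: "c = (a, t)" by (cases c)
    show ?thesis using T_in_X[of a t] that unfolding c V_def by blast
  qed
  have zV: "(z, s) \<in> cylinder \<inter> V" using zs(1) j zq by (simp add: V_def)
  obtain N where N: "open N" "x \<in> N" "\<And>y. y \<in> N \<Longrightarrow> p y \<in> FT ` cylinder \<Longrightarrow> path_component (pre (FT ` (cylinder \<inter> V))) x y"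
    using local_path_component[OF cK contT injT open_half_pieces[of j, folded V_def] FV xH zs(2) zV] by metis
  have sub: "pre (FT ` (cylinder \<inter> V)) \<subseteq> pre (T j)" by (rule pre_mono) (auto simp: T_def V_def)
  show ?thesis
  proof (rule that[OF N(1,2)])
    fix y assume "y \<in> N" "p y \<in> Top"
    then have "path_component (pre (T j)) x y" using N(3) path_component_of_subset[OF sub] by (simp add: Top_def)
    then show "sheet_pt y \<longleftrightarrow> sheet_pt x" using sheet_path path_component_sym by blast
  qed
qed

lemma sheet_path_Top:
  assumes pc: "path_component (pre Top) x y" shows "sheet_pt x \<longleftrightarrow> sheet_pt y"
proof -
  obtain \<gamma> where \<gamma>: "path \<gamma>" "path_image \<gamma> \<subseteq> pre Top" "pathstart \<gamma> = x" "pathfinish \<gamma> = y"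
    using pc unfolding path_component_def by blast
  have "sheet_pt x \<longleftrightarrow> sheet_pt (\<gamma> 1)"
  proof (rule connected_induction_simple[where S = "{0..1::real}" and P = "\<lambda>t. sheet_pt x \<longleftrightarrow> sheet_pt (\<gamma> t)"])
    show "sheet_pt x \<longleftrightarrow> sheet_pt (\<gamma> 0)" using \<gamma>(3) by (simp add: pathstart_def)
    fix t :: real assume t: "t \<in> {0..1}"
    have \<gamma>t: "\<gamma> r \<in> pre Top" if "r \<in> {0..1}" for r using \<gamma>(2) that by (auto simp: path_image_def)
    obtain N where N: "open N" "\<gamma> t \<in> N" "\<And>y. y \<in> N \<Longrightarrow> p y \<in> Top \<Longrightarrow> sheet_pt y \<longleftrightarrow> sheet_pt (\<gamma> t)"
      using sheet_local[OF \<gamma>t[OF t]] by blast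
    have "openin (top_of_set {0..1}) ({0..1} \<inter> \<gamma> -` N)"
      using \<gamma>(1) N(1) by (simp add: path_def continuous_openin_preimage_gen)
    moreover have "t \<in> {0..1} \<inter> \<gamma> -` N" using t N(2) by simp
    moreover have "sheet_pt (\<gamma> r) \<longleftrightarrow> sheet_pt (\<gamma> t)" if "r \<in> {0..1} \<inter> \<gamma> -` N" for r
      using N(3)[of "\<gamma> r"] \<gamma>t[of r] that by (simp add: pre_iff)
    ultimately show "\<exists>T. openin (top_of_set {0..1}) T \<and> t \<in> T \<and>
       (\<forall>a\<in>T. \<forall>b\<in>T. (sheet_pt x \<longleftrightarrow> sheet_pt (\<gamma> a)) \<longrightarrow> (sheet_pt x \<longleftrightarrow> sheet_pt (\<gamma> b)))" by blast
  qed auto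
  then show ?thesis using \<gamma>(4) by (simp add: pathfinish_def)
qed

section \<open>Pushing paths out of the lower ball\<close>

lemma FB_A: "(z, s) \<in> cylinder \<Longrightarrow> cmod z = 1 \<or> s = 0 \<or> s = 1 \<Longrightarrow> FB (z, s) \<in> Top \<inter> Bot"
  using T_Int_B[of z s] by (auto simp: Top_def Bot_def)

text \<open>A vertical motion keeps the horizontal coordinate and therefore never meets a vertical
  strand; this is the benefit of straightening the strands.\<close>

lemma square_B:
  fixes z s :: "real \<Rightarrow> _"
  assumes z: "continuous_on {0..1} z" "\<And>t. t \<in> {0..1} \<Longrightarrow> z t \<in> cball 0 1 - P2"
    and s: "continuous_on {0..1} s" "\<And>t. t \<in> {0..1} \<Longrightarrow> s t \<in> {0..1}"
    and u: "u \<in> H3" "p u = FB (z 0, s 0)"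
  obtains M where "continuous_on ({0..1} \<times> {0..1}) M" "\<And>x. x \<in> {0..1} \<times> {0..1} \<Longrightarrow> M x \<in> H3"
    "\<And>t \<tau>. t \<in> {0..1} \<Longrightarrow> \<tau> \<in> {0..1} \<Longrightarrow> p (M (t, \<tau>)) = FB (z t, (1 - \<tau>) * s t)" "M (0, 0) = u"
proof -
  define SQ :: "(real \<times> real) set" where "SQ = {0..1} \<times> {0..1}"
  have SQ: "convex SQ" by (auto simp: SQ_def intro: convex_Times)
  have fs: "fst x \<in> {0..1}" "snd x \<in> {0..1}" if "x \<in> SQ" for x using that by (auto simp: SQ_def)
  define E where "E x = FB (z (fst x), (1 - snd x) * s (fst x))" for x
  have s01: "(1 - \<tau>) * s t \<in> {0..1}" if "t \<in> {0..1}" "\<tau> \<in> {0..1}" for t \<tau>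
    using s(2)[OF that(1)] that(2) by (auto intro: mult_le_one)
  have m: "(z (fst x), (1 - snd x) * s (fst x)) \<in> cylinder" if "x \<in> SQ" for x
    using z(2)[OF fs(1)[OF that]] s01[OF fs[OF that]] by simp
  have c: "continuous_on SQ (\<lambda>x. z (fst x))" "continuous_on SQ (\<lambda>x. s (fst x))"
    by (rule continuous_on_compose2[OF z(1) continuous_on_fst[OF continuous_on_id]], use fs(1) in blast)
       (rule continuous_on_compose2[OF s(1) continuous_on_fst[OF continuous_on_id]], use fs(1) in blast)
  have Ec: "continuous_on SQ E" unfolding E_def
    by (rule continuous_on_compose2[OF contB]) (use m in \<open>auto intro!: continuous_intros c\<close>)
  have EX: "E x \<in> X" if "x \<in> SQ" for x
    unfolding E_def using B_in_X[OF m[OF that]] z(2)[OF fs(1)[OF that]] by blast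
  have "(0, 0) \<in> SQ" "p u = E (0, 0)" using u by (auto simp: SQ_def E_def)
  from lift_convex[OF SQ Ec EX this(1) u(1) this(2)] obtain M where M: "continuous_on SQ M" "\<And>x. x \<in> SQ \<Longrightarrow> M x \<in> H3"
     "\<And>x. x \<in> SQ \<Longrightarrow> p (M x) = E x" "M (0, 0) = u" by blast
  show ?thesis
    by (rule that[of M]) (use M in \<open>auto simp: SQ_def E_def\<close>)
qed

text \<open>Below the side or on the bottom face the vertical segment stays in the boundary sphere.
  From the top face a detour replaces it: along the top face to the rim, down the side, and back
  along the bottom face. The lifted square shows that the detour ends at the same point.\<close>

lemma vertical_B:
  assumes z: "(z, s) \<in> cylinder" "FB (z, s) \<in> X" "FB (z, s) \<in> Top"
    and l: "continuous_on {0..1} l" "\<And>\<tau>. \<tau> \<in> {0..1} \<Longrightarrow> l \<tau> \<in> H3" "\<And>\<tau>. \<tau> \<in> {0..1} \<Longrightarrow> p (l \<tau>) = FB (z, (1 - \<tau>) * s)"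
  shows "path_component (pre (Top \<inter> Bot)) (l 0) (l 1)"
proof -
  have i01: "(0::real) \<in> {0..1}" "(1::real) \<in> {0..1}" by auto
  have "cmod z = 1 \<or> s = 0 \<or> s = 1" using T_Int_B[OF z(1)] z(3) by (simp add: Top_def)
  then consider "cmod z = 1 \<or> s = 0" | "s = 1" by blast
  then show ?thesis
  proof cases
    case 1
    have "l \<tau> \<in> pre (Top \<inter> Bot)" if "\<tau> \<in> {0..1}" for \<tau>
    proof -
      have "FB (z, (1 - \<tau>) * s) \<in> Top \<inter> Bot" by (rule FB_A) (use 1 that z in \<open>auto intro: mult_le_one\<close>)
      then show ?thesis using l(2,3)[OF that] by (simp only: pre_iff)
    qed
    then show ?thesis by (intro path_component_lift[OF convex_real_interval(5) l(1)]) auto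
  next
    case 2
    have zD: "z \<in> cball 0 1 - P2" using z B_in_X[OF z(1)] by auto
    have "path_connected (cball (0::complex) 1 - P2)"
    proof (rule path_connected_convex_diff_countable)
      show "\<not> collinear (cball (0::complex) 1)" by (simp add: collinear_aff_dim aff_dim_cball)
    qed (simp_all add: countable_finite P2(1))
    moreover have "1 \<in> cball 0 1 - P2" using P2 by auto
    ultimately obtain \<zeta> where \<zeta>: "path \<zeta>" "path_image \<zeta> \<subseteq> cball 0 1 - P2" "pathstart \<zeta> = z" "pathfinish \<zeta> = 1"
      using zD unfolding path_connected_def by blast
    have \<zeta>c: "continuous_on {0..1} \<zeta>" "\<And>t. t \<in> {0..1} \<Longrightarrow> \<zeta> t \<in> cball 0 1 - P2" "\<zeta> 0 = z" "\<zeta> 1 = 1"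
      using \<zeta> unfolding path_def path_image_def pathstart_def pathfinish_def by blast+
    have pl: "p (l 0) = FB (\<zeta> 0, 1)" using l(3)[OF i01(1)] 2 \<zeta>c(3) by simp
    have c1: "continuous_on {0..1} (\<lambda>t::real. 1::real)" by simp
    obtain M where M: "continuous_on ({0..1} \<times> {0..1}) M" "\<And>x. x \<in> {0..1} \<times> {0..1} \<Longrightarrow> M x \<in> H3"
       "\<And>t \<tau>. t \<in> {0..1} \<Longrightarrow> \<tau> \<in> {0..1} \<Longrightarrow> p (M (t, \<tau>)) = FB (\<zeta> t, (1 - \<tau>) * 1)" "M (0, 0) = l 0"
      using square_B[where z = \<zeta> and s = "\<lambda>_. 1", OF \<zeta>c(1,2) c1 _ l(2)[OF i01(1)] pl] i01(2) by blast
    have Ml: "M (0, \<tau>) = l \<tau>" if "\<tau> \<in> {0..1}" for \<tau>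
    proof (rule lift_unique_connected[OF _ _ _ l(1,2) _ i01(1) _ that])
      show "continuous_on {0..1} (\<lambda>\<tau>. M (0, \<tau>))"
        by (rule continuous_on_compose2[OF M(1)]) (auto intro!: continuous_intros)
    qed (use M(2,3,4) l(3) 2 \<zeta>c(3) in auto)
    have A: "M (t, \<tau>) \<in> pre (Top \<inter> Bot)" if "t \<in> {0..1}" "\<tau> \<in> {0..1}" "t = 1 \<or> \<tau> = 0 \<or> \<tau> = 1" for t \<tau>
    proof -
      have "FB (\<zeta> t, (1 - \<tau>) * 1) \<in> Top \<inter> Bot" by (rule FB_A) (use that \<zeta>c in auto)
      then show ?thesis using M(2,3) that(1,2) by (simp add: pre_iff)
    qed
    have 3: "path_component (pre (Top \<inter> Bot)) (M (0, \<tau>)) (M (1, \<tau>))" if "\<tau> = 0 \<or> \<tau> = 1" for \<tau>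
    proof (rule path_component_lift[of "{0..1} \<times> {\<tau>}" M])
      show "continuous_on ({0..1} \<times> {\<tau>}) M" by (rule continuous_on_subset[OF M(1)]) (use that in auto)
    qed (use that A in \<open>auto intro: convex_Times\<close>)
    have 4: "path_component (pre (Top \<inter> Bot)) (M (1, 0)) (M (1, 1))"
    proof (rule path_component_lift[of "{1} \<times> {0..1}" M])
      show "continuous_on ({1} \<times> {0..1}) M" by (rule continuous_on_subset[OF M(1)]) auto
    qed (use A in \<open>auto intro: convex_Times\<close>)
    have "path_component (pre (Top \<inter> Bot)) (M (0, 0)) (M (0, 1))"
      using path_component_trans[OF 3[of 0] path_component_trans[OF 4 path_component_sym[OF 3[of 1]]]] by simp
    then show ?thesis using Ml i01 by simp
  qed
qed

text \<open>The path is pushed down to the bottom face, which belongs to the boundary sphere, and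
  \<open>vertical_B\<close> replaces the vertical tracks of its ends.\<close>

lemma path_B:
  assumes u: "u \<in> pre (Top \<inter> Bot)" "v \<in> pre (Top \<inter> Bot)" and pc: "path_component (pre Bot) u v"
  shows "path_component (pre (Top \<inter> Bot)) u v"
proof -
  have i01: "(0::real) \<in> {0..1}" "(1::real) \<in> {0..1}" by auto
  obtain G where G: "homeomorphism cylinder (FB ` cylinder) FB G" using ex_homeomorphism_B .
  obtain \<gamma> z s where \<gamma>: "continuous_on {0..1} \<gamma>" "\<gamma> 0 = u" "\<gamma> (1::real) = v" "\<And>t. t \<in> {0..1} \<Longrightarrow> \<gamma> t \<in> H3"
    and zs: "continuous_on {0..1} z" "continuous_on {0..1} s" "\<And>t. t \<in> {0..1} \<Longrightarrow> (z t, s t) \<in> cylinder"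
    and p\<gamma>: "\<And>t. t \<in> {0..1} \<Longrightarrow> p (\<gamma> t) = FB (z t, s t)"
    using path_in_pre[OF G order.refl pc[unfolded Bot_def]] by metis
  have zX: "FB (z t, s t) \<in> X" if "t \<in> {0..1}" for t using p_in_X[OF \<gamma>(4)[OF that]] unfolding p\<gamma>[OF that] .
  have zP: "z t \<in> cball 0 1 - P2" if "t \<in> {0..1}" for t using B_in_X[OF zs(3)] zX zs(3) that by blast
  have s01: "s t \<in> {0..1}" if "t \<in> {0..1}" for t using zs(3)[OF that] by blast
  have uH: "u \<in> H3" and pu: "p u = FB (z 0, s 0)" using \<gamma>(2,4) p\<gamma> i01 by auto
  obtain M where M: "continuous_on ({0..1} \<times> {0..1}) M" "\<And>x. x \<in> {0..1} \<times> {0..1} \<Longrightarrow> M x \<in> H3"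
     "\<And>t \<tau>. t \<in> {0..1} \<Longrightarrow> \<tau> \<in> {0..1} \<Longrightarrow> p (M (t, \<tau>)) = FB (z t, (1 - \<tau>) * s t)" "M (0, 0) = u"
    using square_B[OF zs(1) zP zs(2) s01 uH pu] by blast
  have M\<gamma>: "M (t, 0) = \<gamma> t" if "t \<in> {0..1}" for t
  proof (rule lift_unique_connected[OF _ _ _ \<gamma>(1,4) _ i01(1) _ that])
    show "continuous_on {0..1} (\<lambda>t. M (t, 0))"
      by (rule continuous_on_compose2[OF M(1)]) (auto intro!: continuous_intros)
  qed (use M(2,3,4) p\<gamma> \<gamma>(2) in auto)
  have v: "path_component (pre (Top \<inter> Bot)) (M (t, 0)) (M (t, 1))" if t: "t = 0 \<or> t = 1" for t
  proof (rule vertical_B[of "z t" "s t" "\<lambda>\<tau>. M (t, \<tau>)"])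
    have ti: "t \<in> {0..1}" using t by auto
    show "(z t, s t) \<in> cylinder" "FB (z t, s t) \<in> X" using zs(3) zX ti by blast+
    show "FB (z t, s t) \<in> Top" using p\<gamma>[OF ti] \<gamma>(2,3) u t by (auto simp: pre_iff)
    show "continuous_on {0..1} (\<lambda>\<tau>. M (t, \<tau>))"
      by (rule continuous_on_compose2[OF M(1)]) (use ti in \<open>auto intro!: continuous_intros\<close>)
  qed (use M(2,3) t in auto)
  have "path_component (pre (Top \<inter> Bot)) (M (0, 1)) (M (1, 1))"
  proof (rule path_component_lift[of "{0..1} \<times> {1}" M])
    show "continuous_on ({0..1} \<times> {1}) M" by (rule continuous_on_subset[OF M(1)]) auto
    show "M x \<in> pre (Top \<inter> Bot)" if h: "x \<in> {0..1} \<times> {1}" for x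
    proof -
      obtain t where t: "x = (t, 1)" "t \<in> {0..1}" using h by blast
      have "FB (z t, (1 - 1) * s t) \<in> Top \<inter> Bot" by (rule FB_A) (use zs(3)[OF t(2)] in auto)
      then show ?thesis using M(2,3) t by (simp add: pre_iff)
    qed
  qed (auto intro: convex_Times)
  from path_component_trans[OF v[of 0] path_component_trans[OF this path_component_sym[OF v[of 1]]]]
  show ?thesis using M\<gamma>[of 0] M\<gamma>[of 1] \<gamma>(2,3) by simp
qed

definition Bot_pt :: "complex \<times> real \<Rightarrow> bool" where
  "Bot_pt x \<longleftrightarrow> (\<exists>v\<in>pre (Top \<inter> Bot). path_component (pre Bot) x v \<and> sheet_pt v)"

definition sheet_all :: "complex \<times> real \<Rightarrow> bool" where
  "sheet_all x \<longleftrightarrow> p x \<in> Top \<and> sheet_pt x \<or> p x \<in> Bot \<and> Bot_pt x"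

text \<open>The two notions of reachability must agree where the balls meet: a path in the lower
  ball is pushed into the common sphere, which also lies in the upper ball.\<close>

lemma Bot_pt_iff:
  assumes x: "x \<in> pre (Top \<inter> Bot)" shows "Bot_pt x \<longleftrightarrow> sheet_pt x"
proof
  assume "Bot_pt x"
  then obtain v where v: "v \<in> pre (Top \<inter> Bot)" "path_component (pre Bot) x v" "sheet_pt v" unfolding Bot_pt_def by blast
  have "path_component (pre Top) x v"
    by (rule path_component_of_subset[OF _ path_B[OF x v(1,2)]], rule pre_mono) blast
  then show "sheet_pt x" using sheet_path_Top v(3) by blast
next
  assume "sheet_pt x"
  moreover have "path_component (pre Bot) x x" using x by (intro path_component_refl) (simp add: pre_iff)
  ultimately show "Bot_pt x" using x unfolding Bot_pt_def by blast
qed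

lemma sheet_all_Top: assumes "x \<in> H3" "p x \<in> Top" shows "sheet_all x \<longleftrightarrow> sheet_pt x"
  using Bot_pt_iff[of x] assms by (auto simp: sheet_all_def pre_iff)

lemma sheet_all_Bot: assumes "x \<in> H3" "p x \<in> Bot" shows "sheet_all x \<longleftrightarrow> Bot_pt x"
  using Bot_pt_iff[of x] assms by (auto simp: sheet_all_def pre_iff)

lemma avoid_compact:
  assumes C: "compact C" and x: "x \<in> H3" "p x \<notin> C"
  obtains N where "open N" "x \<in> N" "\<And>y. y \<in> N \<Longrightarrow> p y \<notin> C"
proof (rule that[of "H3 \<inter> p -` (- C)"])
  show "open (H3 \<inter> p -` (- C))"
    by (rule continuous_open_preimage[OF continuous_on_p open_H3]) (simp add: compact_imp_closed[OF C] open_Compl)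
qed (use x in auto)

lemma compact_cylinder: "compact cylinder" "convex cylinder"
  by (auto intro!: compact_Times convex_Times)

lemma Top_local:
  assumes x: "x \<in> H3"
  obtains N where "open N" "x \<in> N" "\<And>y. y \<in> N \<Longrightarrow> p y \<in> Top \<Longrightarrow> p x \<in> Top \<and> (sheet_pt y \<longleftrightarrow> sheet_pt x)"
proof (cases "p x \<in> Top")
  case True
  then have "x \<in> pre Top" using x by (simp add: pre_iff)
  then obtain N where "open N" "x \<in> N" "\<And>y. y \<in> N \<Longrightarrow> p y \<in> Top \<Longrightarrow> sheet_pt y \<longleftrightarrow> sheet_pt x"
    using sheet_local by metis
  then show ?thesis using that True by metis
next
  case False
  have "compact Top" unfolding Top_def by (rule compact_continuous_image[OF contT compact_cylinder(1)])
  then obtain N where "open N" "x \<in> N" "\<And>y. y \<in> N \<Longrightarrow> p y \<notin> Top"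
    using avoid_compact x False by metis
  then show ?thesis using that by metis
qed

lemma Bot_local:
  assumes x: "x \<in> H3"
  obtains N where "open N" "x \<in> N" "N \<subseteq> H3" "\<And>y. y \<in> N \<Longrightarrow> p y \<in> Bot \<Longrightarrow> p x \<in> Bot \<and> (Bot_pt y \<longleftrightarrow> Bot_pt x)"
proof (cases "p x \<in> Bot")
  case True
  then obtain z s where zs: "(z, s) \<in> cylinder" "p x = FB (z, s)" by (auto simp: Bot_def)
  define V where "V = (- P2) \<times> (UNIV :: real set)"
  have oV: "open V" unfolding V_def by (intro open_Times open_Compl finite_imp_closed P2(1)) auto
  have FV: "FB c \<in> X" if "c \<in> cylinder \<inter> V" for c
  proof -
    obtain a t where c: "c = (a, t)" by (cases c)
    show ?thesis using B_in_X[of a t] that unfolding c V_def by blast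
  qed
  have zV: "(z, s) \<in> cylinder \<inter> V" using zs B_in_X[OF zs(1)] p_in_X[OF x] by (simp add: V_def)
  obtain N where N: "open N" "x \<in> N" "N \<subseteq> H3"
    "\<And>y. y \<in> N \<Longrightarrow> p y \<in> FB ` cylinder \<Longrightarrow> path_component (pre (FB ` (cylinder \<inter> V))) x y"
    using local_path_component[OF compact_cylinder contB injB oV FV x zs(2) zV] by metis
  have sub: "pre (FB ` (cylinder \<inter> V)) \<subseteq> pre Bot" by (rule pre_mono) (auto simp: Bot_def)
  show ?thesis
  proof (rule that[OF N(1-3)])
    fix y assume "y \<in> N" "p y \<in> Bot"
    then have pc: "path_component (pre Bot) x y" using N(4) path_component_of_subset[OF sub] by (simp add: Bot_def)
    have "path_component (pre Bot) x v \<longleftrightarrow> path_component (pre Bot) y v" for v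
      using pc path_component_trans path_component_sym by metis
    then show "p x \<in> Bot \<and> (Bot_pt y \<longleftrightarrow> Bot_pt x)" using True unfolding Bot_pt_def by simp
  qed
next
  case False
  have "compact Bot" unfolding Bot_def by (rule compact_continuous_image[OF contB compact_cylinder(1)])
  then obtain N where "open N" "x \<in> N" "\<And>y. y \<in> N \<Longrightarrow> p y \<notin> Bot"
    using avoid_compact x False by metis
  then show ?thesis using that[of "N \<inter> H3"] open_H3 x by blast
qed

lemma sheet_all_H3: assumes x: "x \<in> H3" shows "sheet_all x"
proof (rule connected_induction_simple[of H3 u0 x sheet_all])
  show "connected H3" by (rule convex_connected[OF convex_H3])
  have m: "(b0, 1/2) \<in> (cball 0 1 \<inter> L True) \<times> {0..1::real}" using b0 by simp
  then have "u0 \<in> pre (T True)" using u0 by (auto simp: pre_iff T_def)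
  then have "path_component (pre (T True)) (id u0) u0" by (simp add: path_component_refl)
  then have "sheet_pt u0" using S(2) unfolding sheet_pt_def by blast
  moreover have "p u0 \<in> Top" using u0(2) m by (auto simp: Top_def)
  ultimately show "sheet_all u0" unfolding sheet_all_def by blast
  fix a assume a: "a \<in> H3"
  obtain N1 where N1: "open N1" "a \<in> N1" "\<And>y. y \<in> N1 \<Longrightarrow> p y \<in> Top \<Longrightarrow> p a \<in> Top \<and> (sheet_pt y \<longleftrightarrow> sheet_pt a)"
    using Top_local[OF a] by metis
  obtain N2 where N2: "open N2" "a \<in> N2" "N2 \<subseteq> H3" "\<And>y. y \<in> N2 \<Longrightarrow> p y \<in> Bot \<Longrightarrow> p a \<in> Bot \<and> (Bot_pt y \<longleftrightarrow> Bot_pt a)"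
    using Bot_local[OF a] by metis
  have eq: "sheet_all y \<longleftrightarrow> sheet_all a" if y: "y \<in> N1 \<inter> N2" for y
  proof -
    have yH: "y \<in> H3" using y N2(3) by blast
    have "p y \<in> Top \<union> Bot" using X_cover p_in_X[OF yH] unfolding Top_def Bot_def by blast
    then show ?thesis
      using N1(3)[of y] N2(4)[of y] y sheet_all_Top[OF yH] sheet_all_Top[OF a] sheet_all_Bot[OF yH] sheet_all_Bot[OF a] by blast
  qed
  show "\<exists>T. openin (top_of_set H3) T \<and> a \<in> T \<and> (\<forall>x\<in>T. \<forall>y\<in>T. sheet_all x \<longrightarrow> sheet_all y)"
  proof (intro exI conjI)
    show "openin (top_of_set H3) (N1 \<inter> N2)"
      using N1(1) N2(1,3) open_H3 by (metis open_Int openin_open_eq le_infI2)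
  qed (use N1(2) N2(2) eq in blast)+
qed (use u0 x in auto)

lemma deck_subset: "deck \<subseteq> S"
proof
  fix g assume g: "g \<in> deck"
  have gu: "g u0 \<in> H3" using g u0 by simp
  have "p (g u0) \<in> Top" using deck_p[OF g u0(1)] u0(2) b0 by (auto simp: Top_def)
  then have "sheet_pt (g u0)" using sheet_all_H3[OF gu] sheet_all_Top[OF gu] by blast
  then show "g \<in> S" using translate_S g unfolding sheet_pt_def by blast
qed

end

context bridge
begin

text \<open>\<open>Q\<close> singles out one lift of the end, while lifted loops around the two
  strands run into its translates by \<open>k1\<close> and \<open>k2\<close>; hence two conjugates
  of the same meridian.\<close>

lemma deck_generators:
  obtains k1 k2 where "k1 \<in> deck" "k2 \<in> deck"
    "\<And>S. \<lbrakk>S \<subseteq> deck; id \<in> S; \<And>g h. g \<in> S \<Longrightarrow> h \<in> S \<Longrightarrow> g \<circ> h \<in> S; \<And>g. g \<in> S \<Longrightarrow> hinv g \<in> S;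
      k1 \<circ> periph 0 1 \<circ> hinv k1 \<in> S; k2 \<circ> periph 0 1 \<circ> hinv k2 \<in> S\<rbrakk> \<Longrightarrow> deck \<subseteq> S"
proof -
  define b0 where "b0 = (q1 + q2) / 2"
  define n where "n = q1 - q2"
  define r where "r = (cmod n)\<^sup>2"
  have r: "r > 0" using q12 by (simp add: r_def n_def)
  \<comment> \<open>Half-planes bounded by parallels to the perpendicular bisector, overlapping in a
    strip. On the scale of \<open>inner n\<close> the points \<open>q1\<close> and \<open>q2\<close>
    are at \<open>r / 2\<close> from the midpoint, so the margin \<open>r / 4\<close> keeps each in
    only one of them.\<close>
  define L where "L i = (if i then {z. inner n z > inner n b0 - r / 4} else {z. inner n z < inner n b0 + r / 4})" for i
  have nn: "inner n n = r" by (simp add: r_def power2_norm_eq_inner)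
  have "q1 = b0 + n /\<^sub>R 2" "q2 = b0 - n /\<^sub>R 2" by (auto simp: b0_def n_def scaleR_conv_of_real field_simps)
  then have nq: "inner n q1 = inner n b0 + r / 2" "inner n q2 = inner n b0 - r / 2"
    by (simp_all add: inner_add_right inner_diff_right nn)
  have L1: "open (L i)" "convex (L i)" "b0 \<in> L i" for i
    using r unfolding L_def by (auto simp: open_halfspace_gt open_halfspace_lt convex_halfspace_gt convex_halfspace_lt)
  have L2: "\<exists>i. z \<in> L i" for z
  proof -
    have "z \<in> L True \<or> z \<in> L False" using r by (auto simp: L_def)
    then show ?thesis by blast
  qed
  have q1L: "q1 \<in> L True" "q1 \<notin> L False" and q2L: "q2 \<notin> L True" "q2 \<in> L False" using nq r by (auto simp: L_def)
  have "cmod b0 \<le> (cmod q1 + cmod q2) / 2" using norm_triangle_ineq[of q1 q2] by (simp add: b0_def norm_divide)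
  then have b0: "cmod b0 \<le> 1" using q_ball by simp
  have bq: "b0 \<noteq> q1" "b0 \<noteq> q2" using nq r by auto
  have "FT (b0, 1/2) \<in> X" using T_in_X[of b0 "1/2"] b0 bq by simp
  then obtain u0 where u0: "u0 \<in> H3" "p u0 = FT (b0, 1/2)" using p_surj by (metis imageE)
  define C where "C i = FT ` ((cball 0 1 \<inter> L i) \<times> {0..1})" for i
  have I: "{q1, q2} \<inter> L True = {q1}" "{q1, q2} \<inter> L False = {q2}" using q1L q2L by auto
  have qq: "q1 \<in> {q1, q2}" "q2 \<in> {q1, q2}" by auto
  obtain k1 where k1: "k1 \<in> deck"
    "\<And>g. g \<in> deck \<Longrightarrow> path_component (pre (C True)) u0 (g u0) \<Longrightarrow> \<exists>j. g = k1 \<circ> periph 0 j \<circ> hinv k1"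
    using puncture_loops[OF qq(1) L1(2) I(1) L1(3) b0 bq(1) u0] unfolding C_def by metis
  obtain k2 where k2: "k2 \<in> deck"
    "\<And>g. g \<in> deck \<Longrightarrow> path_component (pre (C False)) u0 (g u0) \<Longrightarrow> \<exists>j. g = k2 \<circ> periph 0 j \<circ> hinv k2"
    using puncture_loops[OF qq(2) L1(2) I(2) L1(3) b0 bq(2) u0] unfolding C_def by metis
  show ?thesis
  proof (rule that[OF k1(1) k2(1)])
    fix S assume S: "S \<subseteq> deck" "id \<in> S" "\<And>g h. g \<in> S \<Longrightarrow> h \<in> S \<Longrightarrow> g \<circ> h \<in> S" "\<And>g. g \<in> S \<Longrightarrow> hinv g \<in> S"
      and gen: "k1 \<circ> periph 0 1 \<circ> hinv k1 \<in> S" "k2 \<circ> periph 0 1 \<circ> hinv k2 \<in> S"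
    have pow: "k \<circ> periph 0 j \<circ> hinv k \<in> S" if k: "k \<in> deck" "k \<circ> periph 0 1 \<circ> hinv k \<in> S" for k j
    proof -
      have kh: "k \<in> hisom" using k(1) by simp
      have mult: "(k \<circ> periph 0 i \<circ> hinv k) \<circ> (k \<circ> periph 0 j \<circ> hinv k) = k \<circ> periph 0 (i + j) \<circ> hinv k" for i j
      proof
        fix x
        have "periph 0 i (periph 0 j (hinv k x)) = periph 0 (i + j) (hinv k x)"
          using fun_cong[OF periph_comp[of 0 i 0 j], of "hinv k x"] by simp
        then show "((k \<circ> periph 0 i \<circ> hinv k) \<circ> (k \<circ> periph 0 j \<circ> hinv k)) x = (k \<circ> periph 0 (i + j) \<circ> hinv k) x"
          using kh by simp
      qed
      have h1: "k \<circ> periph 0 (-1) \<circ> hinv k \<in> S"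
      proof -
        have "hinv (k \<circ> periph 0 1 \<circ> hinv k) = k \<circ> periph 0 (-1) \<circ> hinv k"
          by (rule inv_unique_comp) (use mult[of 1 "-1"] mult[of "-1" 1] kh in \<open>auto simp: periph_0 fun_eq_iff\<close>)
        then show ?thesis using S(4)[OF k(2)] by simp
      qed
      show ?thesis
      proof (induction j rule: int_induct[where k = 0])
        case base
        have "k \<circ> periph 0 0 \<circ> hinv k = id" using kh by (auto simp: periph_0 fun_eq_iff)
        then show ?case using S(2) by (simp only:)
      next
        case (step1 i) show ?case using S(3)[OF step1(2) k(2)] unfolding mult .
      next
        case (step2 i) then show ?case using S(3)[OF step2(2) h1] unfolding mult by (simp only: add_uminus_conv_diff)
      qed
    qed
    have loops: "g \<in> S" if "g \<in> deck" "path_component (pre (C i)) u0 (g u0)" for i g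
    proof (cases i)
      case True then show ?thesis using k1(2)[OF that(1)] that(2) pow[OF k1(1) gen(1)] by auto
    next
      case False then show ?thesis using k2(2)[OF that(1)] that(2) pow[OF k2(1) gen(2)] by auto
    qed
    interpret bridge_halves X d p f FT FB q1 q2 P2 L b0 u0 S
      by unfold_locales (use L1 L2 q1L q2L b0 u0 S loops in \<open>auto simp: C_def\<close>)
    show "deck \<subseteq> S" by (rule deck_subset)
  qed
qed

end

section \<open>The fundamental group of the exterior\<close>

context torus_end
begin

definition exterior :: "'a set" where "exterior = X - f ` (sphere 0 1 \<times> ball 0 1)"

lemma exterior_subset: "exterior \<subseteq> X" by (auto simp: exterior_def)

text \<open>The open punctured tube is the image of an open set under the open maps \<open>Q\<close>
  and \<open>p\<close>.\<close>

lemma closedin_exterior: "closedin (top_of_set X) exterior"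
proof -
  define V :: "(complex \<times> real) set" where "V = UNIV \<times> {0<..<1}"
  have V: "open V" "V \<subseteq> UNIV \<times> {0<..<1}" "V \<subseteq> halfcyl" by (auto simp: V_def halfcyl_iff open_Times)
  have "open (Q ` V)" by (rule Q_open_map[OF V(1,2)])
  moreover have "Q ` V \<subseteq> H3" using Q(2) V(3) by blast
  ultimately have o: "openin (top_of_set X) (p ` Q ` V)" by (rule p_open_map)
  have "p ` Q ` V = X \<inter> f ` (sphere 0 1 \<times> ball 0 1)"
  proof (intro equalityI subsetI)
    fix y assume "y \<in> p ` Q ` V"
    then obtain v where v: "v \<in> V" "y = p (Q v)" by blast
    then have "v \<in> halfcyl" using V(3) by blast
    then have y: "y = f (polar v)" "f (polar v) \<in> X" using Q(3)[of v] v(2) f_polar_in_X[of v] by simp_all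
    have "0 < snd v" "snd v < 1" using v(1) unfolding V_def mem_Times_iff by simp_all
    then have "polar v \<in> sphere 0 1 \<times> ball 0 1" unfolding polar_def by (simp add: norm_mult)
    from imageI[OF this, of f] show "y \<in> X \<inter> f ` (sphere 0 1 \<times> ball 0 1)" unfolding y(1) using y(2) by (rule IntI[rotated])
  next
    fix y assume y: "y \<in> X \<inter> f ` (sphere 0 1 \<times> ball 0 1)"
    then obtain a z where az: "y = f (a, z)" "a \<in> sphere 0 1" "z \<in> ball 0 1" by blast
    then have z: "z \<in> cball 0 1" by simp
    have "z \<noteq> 0" using f_in_X[OF az(2) z] y az(1) by simp
    then obtain v where v: "v \<in> halfcyl" "polar v = (a, z)" "snd v = cmod z" using polar_surj[OF az(2) z] by metis
    have "v \<in> V" using v az(3) by (cases v) (auto simp: V_def halfcyl_iff)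
    then show "y \<in> p ` Q ` V" using Q(3)[OF v(1)] v(2) az(1) by (auto simp: image_iff intro!: bexI[of _ v])
  qed
  then have "exterior = X - p ` Q ` V" by (auto simp: exterior_def)
  then show ?thesis using closedin_diff[OF closedin_topspace o] by simp
qed

text \<open>The exterior is a deformation retract of the complement: push the punctured tube radially onto its
  boundary torus.\<close>

lemma ex_push:
  obtains R where "continuous_on (X \<times> {0..1}) R" "\<And>y \<tau>. y \<in> X \<Longrightarrow> \<tau> \<in> {0..1} \<Longrightarrow> R (y, \<tau>) \<in> X"
    "\<And>y. y \<in> X \<Longrightarrow> R (y, 0) = y" "\<And>y. y \<in> X \<Longrightarrow> R (y, 1) \<in> exterior"
    "\<And>y \<tau>. y \<in> exterior \<Longrightarrow> \<tau> \<in> {0..1} \<Longrightarrow> R (y, \<tau> :: real) = y"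
proof -
  define D :: "(complex \<times> complex) set" where "D = sphere 0 1 \<times> cball 0 1"
  have cD: "compact D" unfolding D_def by (intro compact_Times compact_sphere compact_cball)
  obtain G where G: "homeomorphism D (f ` D) f G"
    using homeomorphism_compact[OF cD contf[folded D_def] refl injf[folded D_def]] by blast
  define Y where "Y = X \<inter> f ` D"
  have Yclosed: "closedin (top_of_set X) Y"
    unfolding Y_def using compact_imp_closed[OF compact_continuous_image[OF contf[folded D_def] cD]]
    by (simp add: closedin_closed_Int)
  have cover: "X = exterior \<union> Y" by (auto simp: exterior_def Y_def D_def)
  have GY: "\<exists>a z. y = f (a, z) \<and> G y = (a, z) \<and> cmod a = 1 \<and> cmod z \<le> 1 \<and> z \<noteq> 0" if h: "y \<in> Y" for y
  proof -
    obtain a z where az: "y = f (a, z)" "(a, z) \<in> D" using h unfolding Y_def by auto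
    have az': "a \<in> sphere 0 1" "z \<in> cball 0 1" using az(2) by (auto simp: D_def)
    have "z \<noteq> 0" using f_in_X[OF az'] h az(1) by (simp add: Y_def)
    then show ?thesis using az homeomorphism_apply1[OF G az(2)] az' by auto
  qed
  define r where "r \<tau> z = ((1 - \<tau>) + \<tau> / cmod z) *\<^sub>R z" for \<tau> and z :: complex
  have r: "cmod (r \<tau> z) = (1 - \<tau>) * cmod z + \<tau>" if "z \<noteq> 0" "\<tau> \<in> {0..1}" for \<tau> z
  proof -
    have "(1 - \<tau>) + \<tau> / cmod z \<ge> 0" using that(2) by simp
    then show ?thesis using that(1) by (simp add: r_def field_simps)
  qed
  define R2 where "R2 x = f (fst (G (fst x)), r (snd x) (snd (G (fst x))))" for x
  have R2: "\<exists>a w. R2 (y, \<tau>) = f (a, w) \<and> cmod a = 1 \<and> cmod w \<le> 1 \<and> w \<noteq> 0 \<and> (\<tau> = 1 \<longrightarrow> cmod w = 1)"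
    if h: "y \<in> Y" "\<tau> \<in> {0..1}" for y \<tau>
  proof -
    obtain a z where az: "y = f (a, z)" "G y = (a, z)" "cmod a = 1" "cmod z \<le> 1" "z \<noteq> 0" using GY[OF h(1)] by blast
    have e: "cmod (r \<tau> z) = (1 - \<tau>) * cmod z + \<tau>" by (rule r[OF az(5) h(2)])
    have "(1 - \<tau>) * cmod z \<le> 1 - \<tau>" using h(2) az(4) by (simp add: mult_left_le)
    moreover have "(1 - \<tau>) * cmod z + \<tau> > 0" using h(2) az(5) by (cases "\<tau> = 1") (auto intro: add_pos_nonneg)
    ultimately show ?thesis using az e by (intro exI[of _ a] exI[of _ "r \<tau> z"]) (auto simp: R2_def)
  qed
  have R2X: "R2 (y, \<tau>) \<in> X" if y: "y \<in> Y" "\<tau> \<in> {0..1}" for y \<tau>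
  proof -
    obtain a w where h: "R2 (y, \<tau>) = f (a, w)" "cmod a = 1" "cmod w \<le> 1" "w \<noteq> 0" using R2[OF y] by blast
    then show ?thesis using f_in_X[of a w] by simp
  qed
  have R2ext: "R2 (y, 1) \<in> exterior" if y: "y \<in> Y" for y
  proof -
    obtain a w where h: "R2 (y, 1) = f (a, w)" "cmod a = 1" "cmod w = 1" using R2[OF y, of 1] by auto
    have "f (a, w) \<notin> f ` (sphere 0 1 \<times> ball 0 1)"
    proof
      assume "f (a, w) \<in> f ` (sphere 0 1 \<times> ball 0 1)"
      then obtain a' w' where h': "f (a, w) = f (a', w')" "a' \<in> sphere 0 1" "w' \<in> ball 0 1" by blast
      have "(a, w) = (a', w')" by (rule inj_onD[OF injf h'(1)]) (use h h' in auto)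
      then show False using h h' by simp
    qed
    then show ?thesis using R2X[OF y, of 1] h(1) by (simp add: exterior_def)
  qed
  have R20: "R2 (y, 0) = y" if "y \<in> Y" for y using GY[OF that] by (auto simp: R2_def r_def)
  have R2e: "R2 (y, \<tau>) = y" if h: "y \<in> Y" "y \<in> exterior" for y \<tau>
  proof -
    obtain a z where az: "y = f (a, z)" "G y = (a, z)" "cmod a = 1" "cmod z \<le> 1" "z \<noteq> 0" using GY[OF h(1)] by blast
    have "z \<notin> ball 0 1" using h(2) az by (auto simp: exterior_def)
    then have "cmod z = 1" using az(4) by simp
    then show ?thesis using az by (simp add: R2_def r_def)
  qed
  define I where "I = {0..1::real}"
  have contG: "continuous_on (Y \<times> I) (\<lambda>x. G (fst x))"
    by (rule continuous_on_compose2[OF homeomorphism_cont2[OF G] continuous_on_fst[OF continuous_on_id]]) (auto simp: Y_def)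
  have contR2: "continuous_on (Y \<times> I) R2"
    unfolding R2_def
  proof (rule continuous_on_compose2[OF contf])
    have nz: "cmod (snd (G (fst x))) \<noteq> 0" if "x \<in> Y \<times> I" for x using GY[of "fst x"] that by auto
    show "continuous_on (Y \<times> I) (\<lambda>x. (fst (G (fst x)), r (snd x) (snd (G (fst x)))))"
      unfolding r_def using nz by (intro continuous_intros continuous_on_fst[OF contG] continuous_on_snd[OF contG]) auto
    show "(\<lambda>x. (fst (G (fst x)), r (snd x) (snd (G (fst x))))) ` (Y \<times> I) \<subseteq> sphere 0 1 \<times> cball 0 1"
    proof
      fix t assume "t \<in> (\<lambda>x. (fst (G (fst x)), r (snd x) (snd (G (fst x))))) ` (Y \<times> I)"
      then obtain y \<tau> where y: "y \<in> Y" "\<tau> \<in> {0..1}" "t = (fst (G y), r \<tau> (snd (G y)))" by (auto simp: I_def)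
      obtain a z where az: "G y = (a, z)" "cmod a = 1" "cmod z \<le> 1" "z \<noteq> 0" using GY[OF y(1)] by blast
      have "(1 - \<tau>) * cmod z \<le> 1 - \<tau>" using y(2) az(3) by (simp add: mult_left_le)
      then show "t \<in> sphere 0 1 \<times> cball 0 1" using y az r[OF az(4) y(2)] by simp
    qed
  qed
  define R where "R x = (if fst x \<in> exterior then fst x else R2 x)" for x
  have XI: "X \<times> I = exterior \<times> I \<union> Y \<times> I" using cover by blast
  have "continuous_on (exterior \<times> I \<union> Y \<times> I) (\<lambda>x. if fst x \<in> exterior then fst x else R2 x)"
  proof (rule continuous_on_cases_local)
    show "closedin (top_of_set (exterior \<times> I \<union> Y \<times> I)) (exterior \<times> I)"
      unfolding XI[symmetric] by (rule closedin_Times[OF closedin_exterior]) simp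
    show "closedin (top_of_set (exterior \<times> I \<union> Y \<times> I)) (Y \<times> I)"
      unfolding XI[symmetric] by (rule closedin_Times[OF Yclosed]) simp
    show "continuous_on (exterior \<times> I) fst" by (intro continuous_intros)
  qed (use contR2 R2e in auto)
  then have "continuous_on (X \<times> I) R" unfolding XI R_def .
  then show ?thesis
  proof (rule that[of R, folded I_def])
    show "R (y, \<tau>) \<in> X" if "y \<in> X" "\<tau> \<in> I" for y \<tau>
      using R2X[of y \<tau>] that cover by (auto simp: R_def I_def)
    show "R (y, 0) = y" "R (y, 1) \<in> exterior" if "y \<in> X" for y
      using R20[of y] R2ext[of y] that cover by (auto simp: R_def)
  qed (auto simp: R_def)
qed

section \<open>Monodromy of loops in the exterior\<close>

definition monodromy :: "complex \<times> real \<Rightarrow> (real \<Rightarrow> 'a) \<Rightarrow> (complex \<times> real \<Rightarrow> complex \<times> real) \<Rightarrow> bool" where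
  "monodromy u \<gamma> g \<longleftrightarrow> g \<in> deck \<and> (\<exists>l. path l \<and> path_image l \<subseteq> H3 \<and> l 0 = u \<and> l 1 = g u \<and> (\<forall>t\<in>{0..1}. p (l t) = \<gamma> t))"

lemma monodromy_ex:
  assumes u: "u \<in> H3" and \<gamma>: "\<gamma> \<in> loops X (p u)" shows "\<exists>g. monodromy u \<gamma> g"
proof -
  have c: "continuous_on {0..1} \<gamma>" "\<And>t. t \<in> {0..1} \<Longrightarrow> \<gamma> t \<in> X" "p u = \<gamma> 0" "\<gamma> 1 = p u"
    using \<gamma> by (auto simp: loops_def path_def path_image_def pathstart_def pathfinish_def)
  have i: "(0::real) \<in> {0..1}" "(1::real) \<in> {0..1}" by auto
  obtain l where l: "continuous_on {0..1} l" "\<And>t. t \<in> {0..1} \<Longrightarrow> l t \<in> H3" "\<And>t. t \<in> {0..1} \<Longrightarrow> p (l t) = \<gamma> t" "l 0 = u"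
    using lift_convex[OF convex_real_interval(5) c(1,2) i(1) u c(3)] by blast
  have "p u = p (l 1)" using c l(3)[OF i(2)] by simp
  then obtain g where "g \<in> deck" "g u = l 1" using deck_transitive[OF u l(2)[OF i(2)]] by blast
  then show ?thesis unfolding monodromy_def using l by (intro exI[of _ g]) (auto simp: path_def path_image_def intro!: exI[of _ l])
qed

lemma monodromy_path_unique:
  assumes "path l" "path_image l \<subseteq> H3" "path l'" "path_image l' \<subseteq> H3" "l 0 = l' 0"
    "\<And>t. t \<in> {0..1} \<Longrightarrow> p (l t) = p (l' t)" "t \<in> {0..1}"
  shows "l t = l' t"
  by (rule lift_unique_connected[of "{0..1}" l l' 0]) (use assms in \<open>auto simp: path_def path_image_def\<close>)

lemma monodromy_unique:
  assumes u: "u \<in> H3" and "monodromy u \<gamma> g" "monodromy u \<gamma> g'" shows "g = g'"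
proof -
  obtain l l' where l: "path l" "path_image l \<subseteq> H3" "l 0 = u" "l 1 = g u" "\<forall>t\<in>{0..1}. p (l t) = \<gamma> t"
    and l': "path l'" "path_image l' \<subseteq> H3" "l' 0 = u" "l' 1 = g' u" "\<forall>t\<in>{0..1}. p (l' t) = \<gamma> t"
    using assms(2,3) unfolding monodromy_def by metis
  have "l 1 = l' 1" by (rule monodromy_path_unique[OF l(1,2) l'(1,2)]) (use l l' in auto)
  then show ?thesis using deck_eqI[of g g' u] assms l(4) l'(4) unfolding monodromy_def by simp
qed

lemma monodromy_homotopic:
  assumes u: "u \<in> H3" and h: "homotopic_paths X \<gamma> \<gamma>'" and m: "monodromy u \<gamma> g" "monodromy u \<gamma>' g'" shows "g = g'"
proof -
  obtain l l' where l: "path l" "path_image l \<subseteq> H3" "l 0 = u" "l 1 = g u" "\<forall>t\<in>{0..1}. p (l t) = \<gamma> t"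
    and l': "path l'" "path_image l' \<subseteq> H3" "l' 0 = u" "l' 1 = g' u" "\<forall>t\<in>{0..1}. p (l' t) = \<gamma>' t"
    using m unfolding monodromy_def by metis
  have "l 1 = l' 1"
    using covering_space_monodromy[OF covering_space_p homotopic_paths_imp_path[OF h, THEN conjunct1] homotopic_paths_imp_subset[OF h, THEN conjunct1]
        homotopic_paths_imp_path[OF h, THEN conjunct2] homotopic_paths_imp_subset[OF h, THEN conjunct2] h l(1,2) _ l'(1,2)] l l'
    by (auto simp: pathstart_def pathfinish_def)
  then show ?thesis using deck_eqI[of g g' u] m u l(4) l'(4) unfolding monodromy_def by simp
qed

text \<open>The second loop has to be lifted from \<open>g u\<close>, and its lift there is the
  translate by \<open>g\<close> of its lift from \<open>u\<close>. This gives a homomorphism with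
  the factors in the same order.\<close>

lemma monodromy_join:
  assumes u: "u \<in> H3" and m: "monodromy u \<gamma> g" "monodromy u \<gamma>' g'" shows "monodromy u (\<gamma> +++ \<gamma>') (g \<circ> g')"
proof -
  obtain l l' where l: "path l" "path_image l \<subseteq> H3" "l 0 = u" "l 1 = g u" "\<forall>t\<in>{0..1}. p (l t) = \<gamma> t"
    and l': "path l'" "path_image l' \<subseteq> H3" "l' 0 = u" "l' 1 = g' u" "\<forall>t\<in>{0..1}. p (l' t) = \<gamma>' t"
    using m unfolding monodromy_def by metis
  have g: "g \<in> deck" "g' \<in> deck" using m unfolding monodromy_def by auto
  have l'H: "l' t \<in> H3" if "t \<in> {0..1}" for t using l'(2) that by (auto simp: path_image_def)
  have pg: "path (g \<circ> l')"
    by (rule path_continuous_image[OF l'(1) continuous_on_subset[OF continuous_on_hisom[OF deck_hisom[OF g(1)]] l'(2)]])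
  have ig: "path_image (g \<circ> l') \<subseteq> H3" using l'(2) g by (auto simp: path_image_compose)
  have jn: "pathfinish l = pathstart (g \<circ> l')" using l(4) l'(3) by (simp add: pathfinish_def pathstart_def)
  have "path (l +++ (g \<circ> l'))" using l(1) pg jn by simp
  moreover have "path_image (l +++ (g \<circ> l')) \<subseteq> H3" using l(2) ig by (simp add: path_image_join jn)
  moreover have "p ((l +++ (g \<circ> l')) t) = (\<gamma> +++ \<gamma>') t" if "t \<in> {0..1}" for t
  proof (cases "t \<le> 1/2")
    case True then show ?thesis using l(5) that by (simp add: joinpaths_def)
  next
    case False
    then have "2 * t - 1 \<in> {0..1}" using that by auto
    then show ?thesis using l'(5) l'H deck_p[OF g(1)] False by (simp add: joinpaths_def)
  qed
  ultimately show ?thesis unfolding monodromy_def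
    using g l(3) l'(4) by (intro conjI exI[of _ "l +++ (g \<circ> l')"]) (auto simp: joinpaths_def)
qed

text \<open>Lifts with common ends are homotopic in the convex set \<open>H3\<close>. Projecting and
  pushing the homotopy into the exterior leaves the two loops as they are, since the push fixes the
  exterior.\<close>

lemma monodromy_inj:
  assumes x: "u \<in> H3" "p u \<in> exterior" and \<gamma>: "\<gamma> \<in> loops exterior (p u)" "\<gamma>' \<in> loops exterior (p u)"
    and m: "monodromy u \<gamma> g" "monodromy u \<gamma>' g" shows "homotopic_paths exterior \<gamma> \<gamma>'"
proof -
  obtain l l' where l: "path l" "path_image l \<subseteq> H3" "l 0 = u" "l 1 = g u" "\<forall>t\<in>{0..1}. p (l t) = \<gamma> t"
    and l': "path l'" "path_image l' \<subseteq> H3" "l' 0 = u" "l' 1 = g u" "\<forall>t\<in>{0..1}. p (l' t) = \<gamma>' t"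
    using m unfolding monodromy_def by metis
  obtain R where R: "continuous_on (X \<times> {0..1}) R" "\<And>y \<tau>. y \<in> X \<Longrightarrow> \<tau> \<in> {0..1} \<Longrightarrow> R (y, \<tau>) \<in> X"
    "\<And>y. y \<in> X \<Longrightarrow> R (y, 0) = y" "\<And>y. y \<in> X \<Longrightarrow> R (y, 1) \<in> exterior"
    "\<And>y \<tau>. y \<in> exterior \<Longrightarrow> \<tau> \<in> {0..1} \<Longrightarrow> R (y, \<tau> :: real) = y" using ex_push by metis
  have "simply_connected H3" by (rule convex_imp_simply_connected[OF convex_H3])
  then have hl: "homotopic_paths H3 l l'"
    using l l' unfolding simply_connected_eq_homotopic_paths by (simp add: pathstart_def pathfinish_def)
  define F where "F w = R (p w, 1)" for w
  have "continuous_on H3 F" unfolding F_def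
    by (rule continuous_on_compose2[OF R(1)]) (auto intro!: continuous_intros continuous_on_p)
  moreover have "F \<in> H3 \<rightarrow> exterior" using R(4) by (auto simp: F_def)
  ultimately have h: "homotopic_paths exterior (F \<circ> l) (F \<circ> l')" using hl homotopic_paths_continuous_image by blast
  have e: "\<gamma> t = (F \<circ> l) t" "\<gamma>' t = (F \<circ> l') t" if "t \<in> {0..1}" for t
  proof -
    have "\<gamma> t \<in> exterior" "\<gamma>' t \<in> exterior" using \<gamma> that by (auto simp: loops_def path_image_def)
    then show "\<gamma> t = (F \<circ> l) t" "\<gamma>' t = (F \<circ> l') t" using R(5)[of _ 1] l(5) l'(5) that by (auto simp: F_def)
  qed
  have pp: "path \<gamma>" "path_image \<gamma> \<subseteq> exterior" "path \<gamma>'" "path_image \<gamma>' \<subseteq> exterior" using \<gamma> by (auto simp: loops_def)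
  have "homotopic_paths exterior \<gamma> (F \<circ> l)" by (rule homotopic_paths_eq[OF pp(1,2) e(1)])
  moreover have "homotopic_paths exterior \<gamma>' (F \<circ> l')" by (rule homotopic_paths_eq[OF pp(3,4) e(2)])
  ultimately show ?thesis using h homotopic_paths_sym homotopic_paths_trans by blast
qed

text \<open>The pushing homotopy lifts to \<open>H3\<close>. Its final map carries the segment from
  \<open>u\<close> to \<open>g u\<close> to a path over the exterior with the same ends.\<close>

lemma monodromy_surj:
  assumes x: "u \<in> H3" "p u \<in> exterior" and g: "g \<in> deck"
  obtains \<gamma> where "\<gamma> \<in> loops exterior (p u)" "monodromy u \<gamma> g"
proof -
  obtain R where R: "continuous_on (X \<times> {0..1}) R" "\<And>y \<tau>. y \<in> X \<Longrightarrow> \<tau> \<in> {0..1} \<Longrightarrow> R (y, \<tau>) \<in> X"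
    "\<And>y. y \<in> X \<Longrightarrow> R (y, 0) = y" "\<And>y. y \<in> X \<Longrightarrow> R (y, 1) \<in> exterior"
    "\<And>y \<tau>. y \<in> exterior \<Longrightarrow> \<tau> \<in> {0..1} \<Longrightarrow> R (y, \<tau> :: real) = y" using ex_push by metis
  define C where "C = H3 \<times> {0..1::real}"
  have C: "convex C" unfolding C_def by (intro convex_Times convex_H3) simp
  define F where "F c = R (p (fst c), snd c)" for c
  have Fc: "continuous_on C F" unfolding F_def
    by (rule continuous_on_compose2[OF R(1)])
      (auto simp: C_def intro!: continuous_intros continuous_on_compose2[OF continuous_on_p])
  have FX: "F c \<in> X" if "c \<in> C" for c using R(2) that by (auto simp: C_def F_def)
  have u0: "(u, 0) \<in> C" "p u = F (u, 0)" using x R(3) by (auto simp: C_def F_def)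
  obtain L where L: "continuous_on C L" "\<And>c. c \<in> C \<Longrightarrow> L c \<in> H3" "\<And>c. c \<in> C \<Longrightarrow> p (L c) = F c" "L (u, 0) = u"
    using lift_convex[OF C Fc FX u0(1) x(1) u0(2)] by blast
  have L0: "L (w, 0) = w" if w: "w \<in> H3" for w
  proof (rule lift_unique_connected[of H3 "\<lambda>w. L (w, 0)" "\<lambda>w. w" u])
    show "continuous_on H3 (\<lambda>w. L (w, 0))"
      by (rule continuous_on_compose2[OF L(1)]) (auto simp: C_def intro!: continuous_intros)
    show "p (L (w, 0)) = p w" if "w \<in> H3" for w using L(3)[of "(w, 0)"] R(3) that by (simp add: C_def F_def)
  qed (use x L(2,4) w convex_connected[OF convex_H3] in \<open>auto simp: C_def\<close>)
  \<comment> \<open>Over the exterior the homotopy is constant in time, hence so is its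
    lift.\<close>
  have fixd: "L (w, 1) = w" if w: "w \<in> H3" "p w \<in> exterior" for w
  proof -
    have "L (w, 1) = (\<lambda>_. w) (1::real)"
    proof (rule lift_unique_connected[of "{0..1}" "\<lambda>\<tau>. L (w, \<tau>)" "\<lambda>_. w" 0])
      show "continuous_on {0..1} (\<lambda>\<tau>. L (w, \<tau>))"
        by (rule continuous_on_compose2[OF L(1)]) (use w in \<open>auto simp: C_def intro!: continuous_intros\<close>)
      show "p (L (w, \<tau>)) = p w" if "\<tau> \<in> {0..1}" for \<tau> using L(3)[of "(w, \<tau>)"] R(5) that w by (simp add: C_def F_def)
    qed (use L(2) w L0 in \<open>auto simp: C_def\<close>)
    then show ?thesis by simp
  qed
  have gu: "g u \<in> H3" "p (g u) = p u" using deck_p[OF g] x g by auto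
  define l where "l = linepath u (g u)"
  have l: "path l" "path_image l \<subseteq> H3" "l 0 = u" "l 1 = g u"
    using closed_segment_subset[OF x(1) gu(1) convex_H3] unfolding l_def by (simp_all add: linepath_0' linepath_1')
  have lH: "l t \<in> H3" if "t \<in> {0..1}" for t using l(2) that by (auto simp: path_image_def)
  define l' where "l' t = L (l t, 1)" for t
  have l': "continuous_on {0..1} l'" unfolding l'_def
    by (rule continuous_on_compose2[OF L(1)]) (use l(1) lH in \<open>auto simp: path_def C_def intro!: continuous_intros\<close>)
  have l'H: "l' t \<in> H3" if "t \<in> {0..1}" for t using L(2) lH[OF that] by (simp add: l'_def C_def)
  have e: "l' 0 = u" "l' 1 = g u" using l fixd x gu by (auto simp: l'_def)
  define \<gamma> where "\<gamma> = p \<circ> l'"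
  have "\<gamma> \<in> loops exterior (p u)"
  proof -
    have "path \<gamma>" unfolding path_def \<gamma>_def
      by (rule continuous_on_compose[OF l' continuous_on_subset[OF continuous_on_p]]) (use l'H in blast)
    moreover have "\<gamma> t \<in> exterior" if "t \<in> {0..1}" for t
      using L(3)[of "(l t, 1)"] R(4)[of "p (l t)"] lH[OF that] by (simp add: \<gamma>_def l'_def C_def F_def)
    ultimately show ?thesis using e gu by (auto simp: loops_def path_image_def pathstart_def pathfinish_def \<gamma>_def)
  qed
  moreover have "monodromy u \<gamma> g" unfolding monodromy_def
    using g l' l'H e by (intro conjI exI[of _ l']) (auto simp: path_def path_image_def \<gamma>_def)
  ultimately show ?thesis by (rule that)
qed

end

context torus_end
begin

theorem fundamental_group_deck:
  assumes x: "x \<in> exterior"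
  obtains \<Psi> where "bij_betw \<Psi> (carrier (fundamental_group exterior x)) deck"
    "\<And>A B. A \<in> carrier (fundamental_group exterior x) \<Longrightarrow> B \<in> carrier (fundamental_group exterior x) \<Longrightarrow>
      \<Psi> (mult (fundamental_group exterior x) A B) = \<Psi> A \<circ> \<Psi> B"
proof -
  define G where "G = fundamental_group exterior x"
  have "x \<in> p ` H3" using x exterior_subset p_surj by blast
  then obtain u where u: "u \<in> H3" "p u = x" by blast
  have u': "p u \<in> exterior" using u x by simp
  define cl where "cl \<gamma> = loop_homotopy exterior x `` {\<gamma>}" for \<gamma>
  have carr: "carrier G = cl ` loops exterior x" by (auto simp: G_def fundamental_group_def quotient_def cl_def)
  have loopsX: "\<gamma> \<in> loops X (p u)" if "\<gamma> \<in> loops exterior x" for \<gamma>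
  proof -
    have "path \<gamma>" "path_image \<gamma> \<subseteq> X" "pathstart \<gamma> = x" "pathfinish \<gamma> = x"
      using that exterior_subset by (auto simp: loops_def)
    then show ?thesis by (simp add: loops_def u(2))
  qed
  define \<mu> where "\<mu> \<gamma> = (THE g. monodromy u \<gamma> g)" for \<gamma>
  have \<mu>: "monodromy u \<gamma> (\<mu> \<gamma>)" if l: "\<gamma> \<in> loops exterior x" for \<gamma>
  proof -
    have "\<exists>!g. monodromy u \<gamma> g" using monodromy_ex[OF u(1) loopsX[OF l]] monodromy_unique[OF u(1)] by blast
    then show ?thesis unfolding \<mu>_def by (rule theI')
  qed
  have \<mu>I: "\<mu> \<gamma> = g" if "\<gamma> \<in> loops exterior x" "monodromy u \<gamma> g" for \<gamma> g
    using monodromy_unique[OF u(1) \<mu>[OF that(1)] that(2)] .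
  have \<mu>h: "\<mu> \<gamma> = \<mu> \<gamma>'" if "(\<gamma>, \<gamma>') \<in> loop_homotopy exterior x" for \<gamma> \<gamma>'
  proof -
    have l: "\<gamma> \<in> loops exterior x" "\<gamma>' \<in> loops exterior x" "homotopic_paths exterior \<gamma> \<gamma>'"
      using that by (auto simp: loop_homotopy_def)
    have "homotopic_paths X \<gamma> \<gamma>'" using homotopic_paths_subset[OF l(3) exterior_subset] .
    then show ?thesis using monodromy_homotopic[OF u(1)] \<mu> l by blast
  qed
  define \<Psi> where "\<Psi> A = \<mu> (SOME \<gamma>. \<gamma> \<in> A)" for A
  have \<Psi>: "\<Psi> (cl \<gamma>) = \<mu> \<gamma>" if l: "\<gamma> \<in> loops exterior x" for \<gamma>
  proof -
    have "\<gamma> \<in> cl \<gamma>" using equiv_class_self[OF equiv_loop_homotopy l] by (simp add: cl_def)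
    then have "(SOME \<gamma>'. \<gamma>' \<in> cl \<gamma>) \<in> cl \<gamma>" by (metis someI)
    then show ?thesis using \<mu>h by (simp add: \<Psi>_def cl_def)
  qed
  have join: "\<gamma> +++ \<gamma>' \<in> loops exterior x" if "\<gamma> \<in> loops exterior x" "\<gamma>' \<in> loops exterior x" for \<gamma> \<gamma>'
    using that by (simp add: loops_def path_image_join)
  have "inj_on \<Psi> (carrier G)"
  proof (rule inj_onI)
    fix A B assume A: "A \<in> carrier G" and B: "B \<in> carrier G" and e: "\<Psi> A = \<Psi> B"
    obtain \<gamma> where g: "\<gamma> \<in> loops exterior x" "A = cl \<gamma>" using A unfolding carr by blast
    obtain \<gamma>' where g': "\<gamma>' \<in> loops exterior x" "B = cl \<gamma>'" using B unfolding carr by blast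
    have "\<mu> \<gamma> = \<mu> \<gamma>'" using e g g' by (simp add: \<Psi>)
    then have "homotopic_paths exterior \<gamma> \<gamma>'"
      using monodromy_inj[OF u(1) u', of \<gamma> \<gamma>' "\<mu> \<gamma>"] \<mu>[OF g(1)] \<mu>[OF g'(1)] g(1) g'(1) u(2) by simp
    then show "A = B" using g g' unfolding g(2) g'(2) cl_def
      by (intro equiv_class_eq[OF equiv_loop_homotopy]) (simp add: loop_homotopy_def)
  qed
  moreover have "\<Psi> ` carrier G = deck"
  proof (intro equalityI subsetI)
    fix g assume "g \<in> \<Psi> ` carrier G"
    then obtain \<gamma> where "\<gamma> \<in> loops exterior x" "g = \<mu> \<gamma>" unfolding carr using \<Psi> by auto
    then show "g \<in> deck" using \<mu> by (simp add: monodromy_def)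
  next
    fix g assume "g \<in> deck"
    then obtain \<gamma> where "\<gamma> \<in> loops exterior (p u)" "monodromy u \<gamma> g" using monodromy_surj[OF u(1) u'] by metis
    then have "\<gamma> \<in> loops exterior x" "\<Psi> (cl \<gamma>) = g" using \<Psi> \<mu>I u(2) by auto
    then show "g \<in> \<Psi> ` carrier G" unfolding carr by blast
  qed
  ultimately have b: "bij_betw \<Psi> (carrier G) deck" by (simp add: bij_betw_def)
  have h: "\<Psi> (mult G A B) = \<Psi> A \<circ> \<Psi> B" if A: "A \<in> carrier G" and B: "B \<in> carrier G" for A B
  proof -
    obtain \<gamma> where g: "\<gamma> \<in> loops exterior x" "A = cl \<gamma>" using A unfolding carr by blast
    obtain \<gamma>' where g': "\<gamma>' \<in> loops exterior x" "B = cl \<gamma>'" using B unfolding carr by blast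
    have "mult G A B = cl (\<gamma> +++ \<gamma>')" using fundamental_group_mult[OF g(1) g'(1)] by (simp add: G_def cl_def g g')
    then have "\<Psi> (mult G A B) = \<mu> (\<gamma> +++ \<gamma>')" using \<Psi>[OF join[OF g(1) g'(1)]] by simp
    also have "\<dots> = \<mu> \<gamma> \<circ> \<mu> \<gamma>'"
      by (rule \<mu>I[OF join[OF g(1) g'(1)] monodromy_join[OF u(1) \<mu>[OF g(1)] \<mu>[OF g'(1)]]])
    finally show ?thesis using g g' \<Psi> by simp
  qed
  show ?thesis by (rule that[OF b[unfolded G_def] h[unfolded G_def]])
qed

end

text \<open>Preserving orientation is a normal property: the two reflections hidden in a reversing
  \<open>g\<close> and its inverse cancel around \<open>C\<close>.\<close>

lemma hisom_mob_conj:
  assumes g: "g \<in> hisom" and C: "C \<in> SL2" obtains A where "A \<in> SL2" "g \<circ> mob C \<circ> hinv g = mob A"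
proof -
  obtain B where B: "B \<in> SL2" "g = mob B \<or> g = mob B \<circ> hconj" using g by (auto simp: hisom_def)
  from B(2) show ?thesis
  proof
    assume e: "g = mob B"
    show ?thesis
      by (rule that[of "mmul B (mmul C (mcof B))"]) (use B(1) C in \<open>auto simp: e hinv_mob mob_mob mmul_assoc fun_eq_iff\<close>)
  next
    assume e: "g = mob B \<circ> hconj"
    have i: "hinv g = hconj \<circ> mob (mcof B)"
      by (rule inv_unique_comp) (use B(1) in \<open>auto simp: e mob_mob fun_eq_iff\<close>)
    show ?thesis
      by (rule that[of "mmul B (mcnj (mmul C (mcnj (mcof B))))"]) (use B(1) C in \<open>auto simp: i[unfolded e] e mob_mob hconj_mob mmul_assoc fun_eq_iff\<close>)
  qed
qed

section \<open>Two parabolic generators and the Nielsen classes of the exterior\<close>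

locale bridge_knot_complement = bridge X d p f FT FB q1 q2 P2 + finite_volume_end X d p f \<mu>
  for X :: "'a::euclidean_space set" and d p f FT FB q1 q2 P2 \<mu>
begin

text \<open>Conjugation by the inverse of \<open>k1\<close> makes the first generator the meridian
  itself, so that it commutes with the longitude of the same lifted end.\<close>

lemma deck_two_generators:
  obtains w where "w \<in> deck"
    "\<And>S. \<lbrakk>S \<subseteq> deck; id \<in> S; \<And>g h. g \<in> S \<Longrightarrow> h \<in> S \<Longrightarrow> g \<circ> h \<in> S; \<And>g. g \<in> S \<Longrightarrow> hinv g \<in> S;
      periph 0 1 \<in> S; w \<circ> periph 0 1 \<circ> hinv w \<in> S\<rbrakk> \<Longrightarrow> deck \<subseteq> S"
proof -
  obtain k1 k2 where k: "k1 \<in> deck" "k2 \<in> deck" and gen: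
    "\<And>S. \<lbrakk>S \<subseteq> deck; id \<in> S; \<And>g h. g \<in> S \<Longrightarrow> h \<in> S \<Longrightarrow> g \<circ> h \<in> S; \<And>g. g \<in> S \<Longrightarrow> hinv g \<in> S;
      k1 \<circ> periph 0 1 \<circ> hinv k1 \<in> S; k2 \<circ> periph 0 1 \<circ> hinv k2 \<in> S\<rbrakk> \<Longrightarrow> deck \<subseteq> S"
    using deck_generators by metis
  have kh: "k1 \<in> hisom" "k2 \<in> hisom" using k by simp_all
  show ?thesis
  proof (rule that[of "hinv k1 \<circ> k2"])
    show "hinv k1 \<circ> k2 \<in> deck" using k by simp
    fix S assume S: "S \<subseteq> deck" "id \<in> S" "\<And>g h. g \<in> S \<Longrightarrow> h \<in> S \<Longrightarrow> g \<circ> h \<in> S" "\<And>g. g \<in> S \<Longrightarrow> hinv g \<in> S"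
      and m: "periph 0 1 \<in> S" "(hinv k1 \<circ> k2) \<circ> periph 0 1 \<circ> hinv (hinv k1 \<circ> k2) \<in> S"
    have Sh: "s \<in> hisom" if "s \<in> S" for s using S(1) that deck_hisom by blast
    define S' where "S' = {g \<in> deck. hinv k1 \<circ> g \<circ> k1 \<in> S}"
    have "deck \<subseteq> S'"
    proof (rule gen)
      have "hinv k1 \<circ> id \<circ> k1 = id" using kh by (auto simp: fun_eq_iff)
      then show "id \<in> S'" using S(2) by (simp only: S'_def mem_Collect_eq deck_id simp_thms)
      show "g \<circ> h \<in> S'" if "g \<in> S'" "h \<in> S'" for g h
      proof -
        have "hinv k1 \<circ> (g \<circ> h) \<circ> k1 = (hinv k1 \<circ> g \<circ> k1) \<circ> (hinv k1 \<circ> h \<circ> k1)" using kh by (auto simp: fun_eq_iff)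
        then show ?thesis using that S(3) unfolding S'_def by simp
      qed
      show "hinv g \<in> S'" if "g \<in> S'" for g
      proof -
        have g: "g \<in> deck" "hinv k1 \<circ> g \<circ> k1 \<in> S" using that by (auto simp: S'_def)
        have "hinv (hinv k1 \<circ> g \<circ> k1) = hinv k1 \<circ> hinv g \<circ> k1"
          by (rule inv_unique_comp) (use kh g(1) in \<open>auto simp: fun_eq_iff\<close>)
        then show ?thesis using S(4)[OF g(2)] g(1) by (simp add: S'_def)
      qed
      have "hinv k1 \<circ> (k1 \<circ> periph 0 1 \<circ> hinv k1) \<circ> k1 = periph 0 1" using kh by (auto simp: fun_eq_iff)
      then show "k1 \<circ> periph 0 1 \<circ> hinv k1 \<in> S'" using m(1) k(1) periph(1) unfolding S'_def by simp
      have "hinv (hinv k1 \<circ> k2) = hinv k2 \<circ> k1" by (rule inv_unique_comp) (use kh in \<open>auto simp: fun_eq_iff\<close>)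
      then have "hinv k1 \<circ> (k2 \<circ> periph 0 1 \<circ> hinv k2) \<circ> k1 = (hinv k1 \<circ> k2) \<circ> periph 0 1 \<circ> hinv (hinv k1 \<circ> k2)"
        using kh by (auto simp: fun_eq_iff)
      then show "k2 \<circ> periph 0 1 \<circ> hinv k2 \<in> S'" using m(2) k(2) periph(1) unfolding S'_def by simp
    qed (simp add: S'_def)
    show "deck \<subseteq> S"
    proof
      fix g assume g: "g \<in> deck"
      then have "k1 \<circ> g \<circ> hinv k1 \<in> S'" using k(1) \<open>deck \<subseteq> S'\<close> by auto
      then have "hinv k1 \<circ> (k1 \<circ> g \<circ> hinv k1) \<circ> k1 \<in> S" by (simp add: S'_def)
      moreover have "hinv k1 \<circ> (k1 \<circ> g \<circ> hinv k1) \<circ> k1 = g" using kh by (auto simp: fun_eq_iff)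
      ultimately show "g \<in> S" by (simp only:)
    qed
  qed
qed

lemma normalized_peripheral:
  obtains J \<tau> where "J \<in> hisom" "J \<circ> periph 0 1 \<circ> hinv J = mob (1, 1, 0, 1)" "J \<circ> periph 1 0 \<circ> hinv J = mob (1, \<tau>, 0, 1)" "Im \<tau> \<noteq> 0"
proof -
  obtain J b c where J: "J \<in> hisom" "\<And>v. v \<in> H3 \<Longrightarrow> conjg J 0 1 v = shift b v" "\<And>v. v \<in> H3 \<Longrightarrow> conjg J 1 0 v = shift c v"
    and bc: "b \<noteq> 0" "Im (c / b) \<noteq> 0" using peripheral_translations by metis
  have cj: "J \<circ> periph i j \<circ> hinv J = mob (1, t, 0, 1)" if h: "\<And>v. v \<in> H3 \<Longrightarrow> conjg J i j v = shift t v" for i j t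
  proof
    fix v
    show "(J \<circ> periph i j \<circ> hinv J) v = mob (1, t, 0, 1) v"
    proof (cases "v \<in> H3")
      case True
      then show ?thesis using h[OF True] mob_shift[OF True] by (simp add: conjg_def)
    next
      case False
      have "J \<circ> periph i j \<circ> hinv J \<in> hisom" using J(1) periph(1) by simp
      from hisom_outside[OF this False] show ?thesis using False by (simp add: mob_def)
    qed
  qed
  define x where "x = csqrt (1 / b)"
  have x: "x\<^sup>2 = 1 / b" "x \<noteq> 0" using bc(1) by (auto simp: x_def)
  define D :: mat where "D = (x, 0, 0, 1 / x)"
  have D: "D \<in> SL2" using x(2) by (simp add: D_def SL2_def)
  have J': "hinv (mob D \<circ> J) = hinv J \<circ> mob (mcof D)"
    by (rule inv_unique_comp) (use J(1) D in \<open>auto simp: fun_eq_iff mob_mob\<close>)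
  have step: "(mob D \<circ> J) \<circ> periph i j \<circ> hinv (mob D \<circ> J) = mob (1, t / b, 0, 1)"
    if h: "\<And>v. v \<in> H3 \<Longrightarrow> conjg J i j v = shift t v" for i j t
  proof -
    have "(mob D \<circ> J) \<circ> periph i j \<circ> hinv (mob D \<circ> J) = mob D \<circ> (J \<circ> periph i j \<circ> hinv J) \<circ> mob (mcof D)"
      unfolding J' by (simp add: comp_assoc)
    also have "\<dots> = mob D \<circ> mob (1, t, 0, 1) \<circ> mob (mcof D)"
      by (rule arg_cong[OF cj[OF h], of "\<lambda>x. mob D \<circ> x \<circ> mob (mcof D)"])
    also have "\<dots> = mob (mmul D (mmul (1, t, 0, 1) (mcof D)))" using D by (auto simp: fun_eq_iff mob_mob)
    also have "mmul D (mmul (1, t, 0, 1) (mcof D)) = (1, x\<^sup>2 * t, 0, 1)" using x(2) by (simp add: D_def power2_eq_square)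
    finally have *: "(mob D \<circ> J) \<circ> periph i j \<circ> hinv (mob D \<circ> J) = mob (1, x\<^sup>2 * t, 0, 1)" .
    have "x\<^sup>2 * t = t / b" using x(1) by simp
    with * show ?thesis by (simp only:)
  qed
  show ?thesis
    by (rule that[of "mob D \<circ> J" "c / b"]) (rule step[OF J(2), unfolded divide_self[OF bc(1)]] step[OF J(3)] bc(2) | simp add: J(1) D)+
qed

theorem infinite_nielsen_classes_exterior:
  assumes x: "x \<in> exterior"
  shows "infinite (nielsen_classes_of_generating_pairs (fundamental_group exterior x))"
proof -
  define G where "G = fundamental_group exterior x"
  interpret G: group G unfolding G_def by (rule group_fundamental_group[OF x])
  obtain \<Psi> where \<Psi>: "bij_betw \<Psi> (carrier G) deck" "\<And>A B. A \<in> carrier G \<Longrightarrow> B \<in> carrier G \<Longrightarrow> \<Psi> (A \<otimes>\<^bsub>G\<^esub> B) = \<Psi> A \<circ> \<Psi> B"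
    using fundamental_group_deck[OF x] unfolding G_def by metis
  have \<Psi>d: "\<Psi> A \<in> deck" "\<Psi> A \<in> hisom" if "A \<in> carrier G" for A using bij_betwE[OF \<Psi>(1)] that deck_hisom by blast+
  have \<Psi>1: "\<Psi> \<one>\<^bsub>G\<^esub> = id"
  proof -
    have "\<Psi> \<one>\<^bsub>G\<^esub> \<circ> \<Psi> \<one>\<^bsub>G\<^esub> = \<Psi> \<one>\<^bsub>G\<^esub>" using \<Psi>(2)[of "\<one>\<^bsub>G\<^esub>" "\<one>\<^bsub>G\<^esub>"] by simp
    then have "\<Psi> \<one>\<^bsub>G\<^esub> (\<Psi> \<one>\<^bsub>G\<^esub> v) = \<Psi> \<one>\<^bsub>G\<^esub> v" for v by (metis comp_apply)
    then have "\<Psi> \<one>\<^bsub>G\<^esub> v = v" for v using hisom_inj_iff[OF \<Psi>d(2)[OF G.one_closed]] by blast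
    then show ?thesis by (auto simp: fun_eq_iff)
  qed
  have \<Psi>inv: "\<Psi> (inv\<^bsub>G\<^esub> A) = hinv (\<Psi> A)" if A: "A \<in> carrier G" for A
  proof -
    have "\<Psi> A \<circ> \<Psi> (inv\<^bsub>G\<^esub> A) = id" "\<Psi> (inv\<^bsub>G\<^esub> A) \<circ> \<Psi> A = id"
      using \<Psi>(2)[OF A G.inv_closed[OF A]] \<Psi>(2)[OF G.inv_closed[OF A] A] A \<Psi>1 by simp_all
    then show ?thesis by (rule inv_unique_comp[symmetric])
  qed
  have \<Psi>ex: "\<exists>A\<in>carrier G. \<Psi> A = g" if "g \<in> deck" for g
    using bij_betw_imp_surj_on[OF \<Psi>(1)] that by (metis imageE)
  have \<Psi>inj: "A = B" if "\<Psi> A = \<Psi> B" "A \<in> carrier G" "B \<in> carrier G" for A B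
    using inj_onD[OF bij_betw_imp_inj_on[OF \<Psi>(1)]] that by blast
  obtain w where w: "w \<in> deck" and gen:
    "\<And>S. \<lbrakk>S \<subseteq> deck; id \<in> S; \<And>g h. g \<in> S \<Longrightarrow> h \<in> S \<Longrightarrow> g \<circ> h \<in> S; \<And>g. g \<in> S \<Longrightarrow> hinv g \<in> S;
      periph 0 1 \<in> S; w \<circ> periph 0 1 \<circ> hinv w \<in> S\<rbrakk> \<Longrightarrow> deck \<subseteq> S"
    using deck_two_generators by metis
  obtain J \<tau> where J: "J \<in> hisom" "J \<circ> periph 0 1 \<circ> hinv J = mob (1, 1, 0, 1)" "J \<circ> periph 1 0 \<circ> hinv J = mob (1, \<tau>, 0, 1)"
    and \<tau>: "Im \<tau> \<noteq> 0" using normalized_peripheral by metis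
  define cj where "cj g = J \<circ> g \<circ> hinv J" for g
  have cj_comp: "cj (g \<circ> h) = cj g \<circ> cj h" for g h using J(1) by (auto simp: cj_def fun_eq_iff)
  have cj_inv: "cj (hinv g) = hinv (cj g)" if "g \<in> hisom" for g
    by (rule inv_unique_comp[symmetric]) (use J(1) that in \<open>auto simp: cj_def fun_eq_iff\<close>)
  have cj_id: "cj id = mob (1, 0, 0, 1)" using J(1) by (auto simp: cj_def fun_eq_iff mone_def[symmetric])
  have cj_inj: "g = h" if "cj g = cj h" for g h
  proof
    fix v
    have "J (g (hinv J (J v))) = J (h (hinv J (J v)))" using fun_cong[OF that, of "J v"] by (simp add: cj_def)
    then show "g v = h v" using J(1) by (simp add: hisom_inj_iff)
  qed
  have cj_periph: "cj (periph 0 1) = mob (1, 1, 0, 1)" "cj (periph 1 0) = mob (1, \<tau>, 0, 1)" using J by (simp_all add: cj_def)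
  have cj_w: "cj (w \<circ> periph 0 1 \<circ> hinv w) = cj w \<circ> mob (1, 1, 0, 1) \<circ> hinv (cj w)"
    using w cj_inv[of w] by (simp add: cj_comp cj_periph)
  have wm: "w \<circ> periph 0 1 \<circ> hinv w \<in> deck" using w periph(1) by simp
  have mm: "mob A \<circ> mob B = mob (mmul A B)" if "A \<in> SL2" "B \<in> SL2" for A B using that by (auto simp: fun_eq_iff mob_mob)
  \<comment> \<open>The generators are conjugates of a translation, so orientation is preserved by
    the whole group; only now can traces be assigned to its elements.\<close>
  have or_pres: "\<exists>A\<in>SL2. cj g = mob A" if g: "g \<in> deck" for g
  proof -
    have "deck \<subseteq> {g \<in> deck. \<exists>A\<in>SL2. cj g = mob A}"
    proof (rule gen)
      show "id \<in> {g \<in> deck. \<exists>A\<in>SL2. cj g = mob A}" using cj_id by auto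
      show "g \<circ> h \<in> {g \<in> deck. \<exists>A\<in>SL2. cj g = mob A}"
        if h: "g \<in> {g \<in> deck. \<exists>A\<in>SL2. cj g = mob A}" "h \<in> {g \<in> deck. \<exists>A\<in>SL2. cj g = mob A}" for g h
      proof -
        obtain A B where "g \<in> deck" "h \<in> deck" "A \<in> SL2" "cj g = mob A" "B \<in> SL2" "cj h = mob B" using h by blast
        then show ?thesis using mm[of A B] by (auto simp: cj_comp intro!: bexI[of _ "mmul A B"])
      qed
      show "hinv g \<in> {g \<in> deck. \<exists>A\<in>SL2. cj g = mob A}" if h: "g \<in> {g \<in> deck. \<exists>A\<in>SL2. cj g = mob A}" for g
      proof -
        obtain A where "g \<in> deck" "A \<in> SL2" "cj g = mob A" using h by blast
        then show ?thesis by (auto simp: cj_inv hinv_mob intro!: bexI[of _ "mcof A"])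
      qed
      show "periph 0 1 \<in> {g \<in> deck. \<exists>A\<in>SL2. cj g = mob A}" using periph(1) cj_periph by auto
      have "cj w \<in> hisom" using w J(1) by (simp add: cj_def)
      then obtain A where "A \<in> SL2" "cj w \<circ> mob (1, 1, 0, 1) \<circ> hinv (cj w) = mob A" using hisom_mob_conj shift_SL2 by metis
      then show "w \<circ> periph 0 1 \<circ> hinv w \<in> {g \<in> deck. \<exists>A\<in>SL2. cj g = mob A}" using wm cj_w by auto
    qed blast
    then show ?thesis using g by blast
  qed
  \<comment> \<open>Used twice below, with all complex numbers and then with the integers as
    \<open>T\<close>.\<close>
  have shifts: "\<exists>t\<in>T. cj g = mob (1, t, 0, 1)"
    if g: "g \<in> deck" and T: "0 \<in> T" "1 \<in> T" "\<And>s t. s \<in> T \<Longrightarrow> t \<in> T \<Longrightarrow> s + t \<in> T" "\<And>t. t \<in> T \<Longrightarrow> - t \<in> T"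
      and tw: "\<exists>t\<in>T. cj (w \<circ> periph 0 1 \<circ> hinv w) = mob (1, t, 0, 1)" for g and T :: "complex set"
  proof -
    define S where "S = {g \<in> deck. \<exists>t\<in>T. cj g = mob (1, t, 0, 1)}"
    have "deck \<subseteq> S"
    proof (rule gen)
      show "id \<in> S" using cj_id T(1) by (auto simp: S_def)
      show "g \<circ> h \<in> S" if h: "g \<in> S" "h \<in> S" for g h
      proof -
        obtain s t where "g \<in> deck" "h \<in> deck" "s \<in> T" "cj g = mob (1, s, 0, 1)" "t \<in> T" "cj h = mob (1, t, 0, 1)"
          using h unfolding S_def by blast
        then show ?thesis using mm[of "(1, s, 0, 1)" "(1, t, 0, 1)"] T(3)[of t s] by (auto simp: S_def cj_comp)
      qed
      show "hinv g \<in> S" if h: "g \<in> S" for g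
      proof -
        obtain s where "g \<in> deck" "s \<in> T" "cj g = mob (1, s, 0, 1)" using h unfolding S_def by blast
        then show ?thesis using T(4)[of s] by (auto simp: S_def cj_inv hinv_mob)
      qed
      show "periph 0 1 \<in> S" using periph(1) cj_periph T(2) by (auto simp: S_def)
      show "w \<circ> periph 0 1 \<circ> hinv w \<in> S" using wm tw by (simp only: S_def mem_Collect_eq simp_thms)
    qed (auto simp: S_def)
    then show ?thesis using g unfolding S_def by blast
  qed
  obtain W where W: "W \<in> SL2" "cj w = mob W" using or_pres[OF w] by blast
  obtain a b c e where We: "W = (a, b, c, e)" by (cases W)
  \<comment> \<open>If \<open>w\<close> fixed infinity, both generators would be translations, hence
    so would \<open>w\<close> itself. Then \<open>w\<close> commutes with the meridian, the two
    generators coincide, and all translations are integral, against the nonreal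
    \<open>\<tau>\<close>.\<close>
  have c0: "c \<noteq> 0"
  proof
    assume c: "c = 0"
    have ae: "a * e = 1" using W(1) by (simp add: We SL2_def c)
    have "hinv (cj w) = mob (mcof W)" using W hinv_mob by simp
    then have cw: "cj (w \<circ> periph 0 1 \<circ> hinv w) = mob (mmul W (mmul (1, 1, 0, 1) (mcof W)))"
      unfolding cj_w W(2) using W(1) by (auto simp: fun_eq_iff mob_mob mmul_assoc)
    also have "mmul W (mmul (1, 1, 0, 1) (mcof W)) = (1, a\<^sup>2, 0, 1)"
      using ae by (simp add: We c power2_eq_square algebra_simps)
    finally have t: "cj (w \<circ> periph 0 1 \<circ> hinv w) = mob (1, a\<^sup>2, 0, 1)" .
    obtain t where t1: "cj w = mob (1, t, 0, 1)" using shifts[OF w, of UNIV] t by auto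
    have "W = (1, t, 0, 1) \<or> W = mneg (1, t, 0, 1)" by (rule mob_eq_imp[OF W(1)]) (use W(2) t1 in simp_all)
    then have "a\<^sup>2 = 1" by (auto simp: We)
    then have tw: "\<exists>t\<in>\<int>. cj (w \<circ> periph 0 1 \<circ> hinv w) = mob (1, t, 0, 1)" using t by (intro bexI[of _ 1]) simp_all
    obtain t where t2: "t \<in> \<int>" "cj (periph 1 0) = mob (1, t, 0, 1)" using shifts[OF periph(1) _ _ _ _ tw] by auto
    have "\<tau> = t" using mob_eq_imp[of "(1, \<tau>, 0, 1)" "(1, t, 0, 1)"] t2(2) cj_periph(2) by auto
    then show False using t2(1) \<tau> by (auto elim!: Ints_cases)
  qed
  define rep where "rep A B \<longleftrightarrow> A \<in> carrier G \<and> B \<in> SL2 \<and> cj (\<Psi> A) = mob B" for A B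
  interpret trace_representation G rep
  proof unfold_locales
    show "B \<in> SL2" if "rep A B" for A B using that by (simp add: rep_def)
    show "rep (A \<otimes>\<^bsub>G\<^esub> A') (mmul B B')" if "A \<in> carrier G" "A' \<in> carrier G" "rep A B" "rep A' B'" for A A' B B'
      using that mm by (simp add: rep_def \<Psi>(2) cj_comp)
    show "rep (inv\<^bsub>G\<^esub> A) (mcof B)" if "A \<in> carrier G" "rep A B" for A B
      using that \<Psi>d by (simp add: rep_def \<Psi>inv cj_inv hinv_mob)
    show "B' = B \<or> B' = mneg B" if "rep A B" "rep A B'" for A B B'
      by (rule mob_eq_imp) (use that in \<open>simp_all add: rep_def\<close>)
  qed
  obtain m l v where mlv: "m \<in> carrier G" "\<Psi> m = periph 0 1" "l \<in> carrier G" "\<Psi> l = periph 1 0" "v \<in> carrier G" "\<Psi> v = w"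
    using \<Psi>ex w periph(1) by metis
  have "infinite (nielsen_classes_of_generating_pairs G)"
  proof (rule infinite_nielsen_classes[OF mlv(1,3,5)])
    show "m \<otimes>\<^bsub>G\<^esub> l = l \<otimes>\<^bsub>G\<^esub> m"
    proof (rule \<Psi>inj)
      show "\<Psi> (m \<otimes>\<^bsub>G\<^esub> l) = \<Psi> (l \<otimes>\<^bsub>G\<^esub> m)" using mlv by (simp add: \<Psi>(2) periph_comp)
    qed (use mlv in simp_all)
    define H where "H = generate G {m, v \<otimes>\<^bsub>G\<^esub> m \<otimes>\<^bsub>G\<^esub> inv\<^bsub>G\<^esub> v}"
    have Hs: "{m, v \<otimes>\<^bsub>G\<^esub> m \<otimes>\<^bsub>G\<^esub> inv\<^bsub>G\<^esub> v} \<subseteq> carrier G" using mlv by simp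
    have HG: "H \<subseteq> carrier G" unfolding H_def by (rule G.generate_incl[OF Hs])
    have sub: "subgroup H G" unfolding H_def by (rule G.generate_is_subgroup[OF Hs])
    have "deck \<subseteq> \<Psi> ` H"
    proof (rule gen)
      show "\<Psi> ` H \<subseteq> deck" using HG \<Psi>d by blast
      show "id \<in> \<Psi> ` H" using \<Psi>1 subgroup.one_closed[OF sub] by (metis imageI)
      show "g \<circ> h \<in> \<Psi> ` H" if h: "g \<in> \<Psi> ` H" "h \<in> \<Psi> ` H" for g h
      proof -
        obtain A B where AB: "A \<in> H" "B \<in> H" "g = \<Psi> A" "h = \<Psi> B" using h by blast
        then have "\<Psi> (A \<otimes>\<^bsub>G\<^esub> B) = g \<circ> h" using HG \<Psi>(2) by blast
        then show ?thesis using subgroup.m_closed[OF sub AB(1,2)] by (metis imageI)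
      qed
      show "hinv g \<in> \<Psi> ` H" if h: "g \<in> \<Psi> ` H" for g
      proof -
        obtain A where A: "A \<in> H" "g = \<Psi> A" using h by blast
        then have "\<Psi> (inv\<^bsub>G\<^esub> A) = hinv g" using HG \<Psi>inv by blast
        then show ?thesis using subgroup.m_inv_closed[OF sub A(1)] by (metis imageI)
      qed
      show "periph 0 1 \<in> \<Psi> ` H" unfolding H_def using mlv(2) generate.incl[of m] by (metis imageI insertI1)
      have "\<Psi> (v \<otimes>\<^bsub>G\<^esub> m \<otimes>\<^bsub>G\<^esub> inv\<^bsub>G\<^esub> v) = w \<circ> periph 0 1 \<circ> hinv w" using mlv by (simp add: \<Psi>(2) \<Psi>inv)
      then show "w \<circ> periph 0 1 \<circ> hinv w \<in> \<Psi> ` H" unfolding H_def by (metis generate.incl imageI insertI1 insertI2)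
    qed
    then show "generate G {m, v \<otimes>\<^bsub>G\<^esub> m \<otimes>\<^bsub>G\<^esub> inv\<^bsub>G\<^esub> v} = carrier G"
      unfolding H_def[symmetric] using HG \<Psi>d(1) \<Psi>inj by (intro equalityI subsetI) (blast, metis imageE subsetD)
    show "rep m (1, 1, 0, 1)" "rep l (1, \<tau>, 0, 1)" "rep v (a, b, c, e)"
      using mlv cj_periph W We by (simp_all add: rep_def)
  qed (use c0 \<tau> in simp_all)
  then show ?thesis by (simp add: G_def)
qed

end

section \<open>Knots in the 3-sphere\<close>

text \<open>Near each image point the sphere is viewed without the antipode as a hyperplane of
  dimension 3, where invariance of domain applies.\<close>

lemma openin_S3_image:
  fixes F :: "complex \<times> real \<Rightarrow> real ^ 4"
  assumes U: "open U" and F: "continuous_on U F" "inj_on F U" "F ` U \<subseteq> S3"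
  shows "openin (top_of_set S3) (F ` U)"
  unfolding openin_subopen[of _ "F ` U"]
proof
  fix y assume y: "y \<in> F ` U"
  define b where "b = - y"
  have yS: "y \<in> S3" using y F(3) by blast
  have b: "b \<in> S3" "y \<noteq> b"
  proof -
    show "b \<in> S3" using yS by (simp add: b_def)
    show "y \<noteq> b"
    proof
      assume "y = b"
      then have "y + y = 0" by (simp add: b_def)
      then have "2 *\<^sub>R y = 0" by (simp only: scaleR_2)
      then show False using yS by simp
    qed
  qed
  define c :: "real ^ 4" where "c = axis 1 1"
  have c: "c \<noteq> 0" by (simp add: c_def axis_eq_0_iff)
  define V where "V = {x. c \<bullet> x = 0}"
  have "(S3 - {b}) homeomorphic V" unfolding V_def by (rule homeomorphic_punctured_sphere_hyperplane) (use b c in auto)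
  then obtain k k' where k: "homeomorphism (S3 - {b}) V k k'" unfolding homeomorphic_def by blast
  define U' where "U' = U \<inter> F -` (- {b})"
  have U': "open U'" unfolding U'_def by (rule continuous_open_preimage[OF F(1) U]) auto
  have FU': "F u \<in> S3 - {b}" if "u \<in> U'" for u using that F(3) unfolding U'_def by blast
  have "openin (top_of_set V) ((k \<circ> F) ` U')"
  proof (rule invariance_of_domain_affine_sets[of UNIV])
    show "openin (top_of_set UNIV) U'" using U' by simp
    show "affine V" unfolding V_def by (rule affine_hyperplane)
    show "aff_dim V \<le> aff_dim (UNIV :: (complex \<times> real) set)"
      unfolding V_def using aff_dim_hyperplane[OF c, of 0] by simp
    show "continuous_on U' (k \<circ> F)"
      by (rule continuous_on_compose[OF continuous_on_subset[OF F(1)] continuous_on_subset[OF homeomorphism_cont1[OF k]]])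
        (use FU' in \<open>auto simp: U'_def\<close>)
    show "k \<circ> F \<in> U' \<rightarrow> V" using FU' homeomorphism_image1[OF k] by auto
    show "inj_on (k \<circ> F) U'"
    proof (rule comp_inj_on)
      show "inj_on F U'" by (rule inj_on_subset[OF F(2)]) (auto simp: U'_def)
      show "inj_on k (F ` U')" by (rule inj_on_inverseI[of _ k']) (use FU' homeomorphism_apply1[OF k] in auto)
    qed
  qed simp
  from homeomorphism_imp_open_map[OF homeomorphism_symD[OF k] this]
  have "openin (top_of_set (S3 - {b})) (k' ` (k \<circ> F) ` U')" .
  moreover have "k' ` (k \<circ> F) ` U' = F ` U'"
    unfolding image_comp by (rule image_cong[OF refl]) (use FU' homeomorphism_apply1[OF k] in auto)
  ultimately have o: "openin (top_of_set (S3 - {b})) (F ` U')" by simp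
  have "openin (top_of_set S3) (S3 - {b})" by (simp add: openin_delete)
  then have "openin (top_of_set S3) (F ` U')" using o openin_trans by blast
  moreover have "y \<in> F ` U'" using y b(2) by (auto simp: U'_def)
  moreover have "F ` U' \<subseteq> F ` U" by (auto simp: U'_def)
  ultimately show "\<exists>T. openin (top_of_set S3) T \<and> y \<in> T \<and> T \<subseteq> F ` U" by blast
qed

lemma open_image_S3:
  fixes F :: "real ^ 4 \<Rightarrow> complex \<times> real"
  assumes "openin (top_of_set S3) S" "continuous_on S F" "inj_on F S"
  shows "open (F ` S)"
  using invariance_of_domain_sphere_affine_set[OF assms(2,3), of UNIV 1 0] assms(1) by simp

text \<open>From a point of the equator a great circle arc enters the upper hemisphere at once, so
  no neighbourhood of the point lies below.\<close>

lemma equator_not_interior: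
  assumes W: "openin (top_of_set S3) W" "W \<subseteq> {x. x $ 1 \<le> 0}" and x: "x \<in> W" shows "x $ 1 < 0"
proof (rule ccontr)
  assume "\<not> x $ 1 < 0"
  then have x1: "x $ 1 = 0" using W(2) x by fastforce
  have xS: "norm x = 1" using W(1) x openin_imp_subset by fastforce
  define e :: "real ^ 4" where "e = axis 1 1"
  define \<gamma> where "\<gamma> t = cos t *\<^sub>R x + sin t *\<^sub>R e" for t
  have xe: "x \<bullet> e = 0" "e \<bullet> x = 0" using x1 by (simp_all add: e_def inner_axis inner_axis')
  have "\<gamma> t \<bullet> \<gamma> t = 1" for t
  proof -
    have "x \<bullet> x = 1" "e \<bullet> e = 1" using xS by (simp_all add: e_def norm_eq_1[symmetric] norm_axis_1 del: norm_eq_1)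
    then have "\<gamma> t \<bullet> \<gamma> t = (cos t)\<^sup>2 + (sin t)\<^sup>2"
      by (simp add: \<gamma>_def inner_add_left inner_add_right xe power2_eq_square)
    then show ?thesis by simp
  qed
  then have \<gamma>S: "\<gamma> t \<in> S3" for t by (simp add: norm_eq_1)
  have "\<gamma> 0 = x" by (simp add: \<gamma>_def)
  obtain U where U: "open U" "W = S3 \<inter> U" using W(1) by (auto simp: openin_open)
  have "continuous_on UNIV \<gamma>" unfolding \<gamma>_def by (intro continuous_intros)
  then have "open (\<gamma> -` U)" using U(1) by (simp add: open_vimage)
  moreover have "0 \<in> \<gamma> -` U" using x U(2) \<open>\<gamma> 0 = x\<close> by simp
  ultimately obtain \<delta> where \<delta>: "\<delta> > 0" "ball 0 \<delta> \<subseteq> \<gamma> -` U" using open_contains_ball by blast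
  define t where "t = min (\<delta> / 2) 1"
  have t: "0 < t" "t < pi" "t \<in> ball 0 \<delta>" using \<delta>(1) pi_gt3 by (auto simp: t_def)
  have "\<gamma> t \<in> W" using \<delta>(2) t(3) \<gamma>S U(2) by blast
  then have "\<gamma> t $ 1 \<le> 0" using W(2) by blast
  moreover have "\<gamma> t $ 1 = sin t" using x1 by (simp add: \<gamma>_def e_def axis_def)
  moreover have "sin t > 0" using sin_gt_zero t by blast
  ultimately show False by linarith
qed

text \<open>Invariance of domain in both directions: the interior of the cylinder goes to an open
  part of the closed lower hemisphere, which misses the equator, and the open hemisphere comes back
  to an open part of the cylinder.\<close>

lemma lower_cylinder_boundary:
  fixes F :: "complex \<times> real \<Rightarrow> real ^ 4"
  assumes F: "homeomorphism cylinder (S3 \<inter> {x. x $ 1 \<le> 0}) F G" and zs: "(z, s) \<in> cylinder"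
  shows "F (z, s) $ 1 = 0 \<longleftrightarrow> cmod z = 1 \<or> s = 0 \<or> s = 1"
proof -
  define U :: "(complex \<times> real) set" where "U = ball 0 1 \<times> {0<..<1}"
  have U: "open U" "U \<subseteq> cylinder" unfolding U_def by (auto intro: open_Times)
  have Fim: "F c \<in> S3 \<inter> {x. x $ 1 \<le> 0}" if "c \<in> cylinder" for c using homeomorphism_image1[OF F] that by blast
  have iff: "(z, s) \<in> U \<longleftrightarrow> \<not> (cmod z = 1 \<or> s = 0 \<or> s = 1)" using zs by (auto simp: U_def)
  have "F (z, s) $ 1 < 0" if m: "(z, s) \<in> U"
  proof (rule equator_not_interior[of "F ` U"])
    show "openin (top_of_set S3) (F ` U)"
    proof (rule openin_S3_image[OF U(1)])
      show "continuous_on U F" by (rule continuous_on_subset[OF homeomorphism_cont1[OF F] U(2)])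
      show "inj_on F U" by (rule inj_on_inverseI[of _ G]) (use homeomorphism_apply1[OF F] U(2) in blast)
      show "F ` U \<subseteq> S3" using Fim U(2) by blast
    qed
    show "F ` U \<subseteq> {x. x $ 1 \<le> 0}" using Fim U(2) by blast
  qed (use m in blast)
  moreover have "(z, s) \<in> U" if n: "F (z, s) $ 1 \<noteq> 0"
  proof -
    define S where "S = S3 \<inter> {x. x $ 1 < 0}"
    have "open {x :: real ^ 4. x $ 1 < 0}" by (rule open_halfspace_component_lt_cart)
    then have oS: "openin (top_of_set S3) S" unfolding S_def by blast
    have SB: "S \<subseteq> S3 \<inter> {x. x $ 1 \<le> 0}" by (auto simp: S_def)
    have "open (G ` S)"
    proof (rule open_image_S3[OF oS])
      show "continuous_on S G" by (rule continuous_on_subset[OF homeomorphism_cont2[OF F] SB])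
      show "inj_on G S" by (rule inj_on_inverseI[of _ F]) (use homeomorphism_apply2[OF F] SB in blast)
    qed
    moreover have "G ` S \<subseteq> cylinder" using homeomorphism_image2[OF F] SB by blast
    ultimately have "G ` S \<subseteq> interior cylinder" by (rule interior_maximal[rotated])
    moreover have "interior cylinder = U" by (simp add: U_def interior_Times)
    moreover have "F (z, s) \<in> S" using Fim[OF zs] n by (auto simp: S_def)
    ultimately have "G (F (z, s)) \<in> U" by blast
    then show ?thesis using homeomorphism_apply1[OF F zs] by (simp only:)
  qed
  ultimately have "F (z, s) $ 1 = 0 \<longleftrightarrow> (z, s) \<notin> U" by fastforce
  then show ?thesis using iff by blast
qed

text \<open>The distance is a finite infimum over joining curves, whereas an infimum over no curves
  would be infinite.\<close>

lemma hyperbolic_structure_path_connected: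
  assumes "hyperbolic_structure X d" shows "path_connected X"
  unfolding path_connected_def
proof (intro ballI)
  fix a b assume ab: "a \<in> X" "b \<in> X"
  let ?P = "{p. path p \<and> path_image p \<subseteq> X \<and> pathstart p = a \<and> pathfinish p = b}"
  have "ennreal (d a b) = (INF p \<in> ?P. curve_length d p)" using assms ab unfolding hyperbolic_structure_def by blast
  moreover have "ennreal (d a b) \<noteq> Orderings.top_class.top" by simp
  ultimately have "?P \<noteq> {}" by (metis INF_empty)
  then show "\<exists>g. path g \<and> path_image g \<subseteq> X \<and> pathstart g = a \<and> pathfinish g = b" by blast
qed

text \<open>Restricting the longitudinal angle to less than pi/2 on either side of
  \<open>\<theta>\<close> gives an open cell in the tube, and the cosine of the angle difference is
  positive there.\<close>

lemma knot_tube_neighbourhood: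
  fixes f :: "complex \<times> complex \<Rightarrow> real ^ 4"
  assumes f: "continuous_on (sphere 0 1 \<times> ball 0 2) f" "inj_on f (sphere 0 1 \<times> ball 0 2)" "f ` (sphere 0 1 \<times> ball 0 2) \<subseteq> S3"
    and \<theta>: "cmod \<theta> = 1"
  obtains W where "openin (top_of_set S3) W" "f (\<theta>, 0) \<in> W"
    "\<And>y. y \<in> W \<Longrightarrow> \<exists>a w. cmod a = 1 \<and> Re (a / \<theta>) > 0 \<and> cmod w \<le> 1 \<and> y = f (a, w)"
proof -
  define U :: "(complex \<times> real) set" where "U = ball 0 1 \<times> {-pi/2<..<pi/2}"
  define F where "F x = f (\<theta> * cis (snd x), fst x)" for x :: "complex \<times> real"
  have \<theta>0: "\<theta> \<noteq> 0" using \<theta> by auto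
  have U: "open U" unfolding U_def by (intro open_Times) auto
  have m: "(\<theta> * cis (snd x), fst x) \<in> sphere 0 1 \<times> ball 0 2" if "x \<in> U" for x
    using that \<theta> by (auto simp: U_def norm_mult)
  have o: "openin (top_of_set S3) (F ` U)"
  proof (rule openin_S3_image[OF U])
    show "continuous_on U F" unfolding F_def
      by (rule continuous_on_compose2[OF f(1)]) (use m in \<open>auto intro!: continuous_intros\<close>)
    show "F ` U \<subseteq> S3" using f(3) m by (auto simp: F_def)
    show "inj_on F U"
    proof (rule inj_onI)
      fix x y assume xy: "x \<in> U" "y \<in> U" "F x = F y"
      have "(\<theta> * cis (snd x), fst x) = (\<theta> * cis (snd y), fst y)"
        by (rule inj_onD[OF f(2)]) (use xy m in \<open>simp_all add: F_def\<close>)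
      then have e: "cis (snd x) = cis (snd y)" "fst x = fst y" using \<theta>0 by auto
      then obtain n :: int where n: "snd y = snd x + 2 * pi * of_int n" unfolding cis_eq_iff by blast
      have "\<bar>snd y - snd x\<bar> < pi" using xy(1,2) by (auto simp: U_def)
      then have "\<bar>2 * pi * of_int n\<bar> < pi * 1" using n by simp
      then have "pi * \<bar>2 * of_int n\<bar> < pi * 1" by (simp add: abs_mult)
      then have "\<bar>2 * real_of_int n\<bar> < 1" using pi_gt_zero mult_less_cancel_left_pos by blast
      then have "n = 0" by linarith
      then show "x = y" using n e(2) by (simp add: prod_eq_iff)
    qed
  qed
  show ?thesis
  proof (rule that[OF o])
    have "(0, 0) \<in> U" by (simp add: U_def)
    then show "f (\<theta>, 0) \<in> F ` U" by (rule image_eqI[rotated]) (simp add: F_def)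
    fix y assume "y \<in> F ` U"
    then obtain z t where zt: "(z, t) \<in> U" "y = f (\<theta> * cis t, z)" by (auto simp: F_def)
    have "cos t > 0" using zt(1) by (intro cos_gt_zero_pi) (auto simp: U_def)
    then show "\<exists>a w. cmod a = 1 \<and> Re (a / \<theta>) > 0 \<and> cmod w \<le> 1 \<and> y = f (a, w)"
      using zt \<theta> \<theta>0 by (intro exI[of _ "\<theta> * cis t"] exI[of _ z]) (auto simp: U_def norm_mult)
  qed
qed

theorem theorem0p1:
  fixes K M :: "(real ^ 4) set" and x :: "real ^ 4"
  assumes "hyperbolic_knot K"
    and "bridge_knot 2 K"
    and "knot_exterior K M"
    and "x \<in> M"
  shows "infinite (nielsen_classes_of_generating_pairs (fundamental_group M x))"
proof -
  define X where "X = S3 - K"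
  have KS: "K \<subseteq> S3" using assms(2) by (simp add: bridge_knot_def knot_def)
  obtain d \<mu> where hyp: "hyperbolic_structure X d" and compl: "Metric_space.mcomplete X d"
    and vol: "hyperbolic_volume_measure X d \<mu>" "emeasure \<mu> X < \<infinity>"
    using assms(1) unfolding hyperbolic_knot_def has_complete_finite_volume_hyperbolic_structure_def X_def by blast
  obtain N f g where N: "N \<subseteq> S3" and fg: "homeomorphism (unit_circle \<times> ball (0::complex) 2) N f g"
    and fK: "f ` (unit_circle \<times> {0}) = K" and M: "M = S3 - f ` (unit_circle \<times> ball 0 1)"
    using assms(3) unfolding knot_exterior_def by blast
  obtain h h' where hh: "homeomorphism S3 S3 h h'"
    and tp: "trivial_tangle 2 (S3 \<inter> {x. x $ 1 \<ge> 0}) (h ` K \<inter> {x. x $ 1 \<ge> 0})"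
    and tm: "trivial_tangle 2 (S3 \<inter> {x. x $ 1 \<le> 0}) (h ` K \<inter> {x. x $ 1 \<le> 0})"
    using assms(2) unfolding bridge_knot_def has_bridge_presentation_def by blast
  obtain P f1 g1 where P: "P \<subseteq> ball (0::complex) 1" "card P = 2"
    and fg1: "homeomorphism cylinder (S3 \<inter> {x. x $ 1 \<ge> 0}) f1 g1" and fP: "f1 ` (P \<times> {0..1}) = h ` K \<inter> {x. x $ 1 \<ge> 0}"
    using tp unfolding trivial_tangle_def by blast
  obtain P2 f2 g2 where P2: "P2 \<subseteq> ball (0::complex) 1" "finite P2"
    and fg2: "homeomorphism cylinder (S3 \<inter> {x. x $ 1 \<le> 0}) f2 g2" and fP2: "f2 ` (P2 \<times> {0..1}) = h ` K \<inter> {x. x $ 1 \<le> 0}"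
    using tm unfolding trivial_tangle_def by blast
  obtain q1 q2 where q: "P = {q1, q2}" "q1 \<noteq> q2" using P(2) by (auto simp: card_2_iff)
  interpret Metric_space X d using hyp by (simp add: hyperbolic_structure_def)
  interpret hyperbolic_manifold X d
    by unfold_locales (use hyp compl in \<open>simp_all add: hyperbolic_structure_def\<close>)
  have MX: "M = X - f ` (sphere 0 1 \<times> ball 0 1)" unfolding M X_def fK[symmetric] by auto
  have "x \<in> X" using assms(4) MX by blast
  then obtain p where p: "liso H3 p" using ex_developing_map by metis
  have finj: "inj_on f (sphere 0 1 \<times> ball 0 2)" by (rule inj_on_inverseI[of _ g]) (use homeomorphism_apply1[OF fg] in blast)
  have fS: "f ` (sphere 0 1 \<times> ball 0 2) \<subseteq> S3" using homeomorphism_image1[OF fg] N by simp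
  have sub: "sphere 0 1 \<times> cball 0 1 \<subseteq> sphere (0::complex) 1 \<times> ball (0::complex) 2" by auto
  interpret torus_end X d p f
  proof unfold_locales
    show "liso H3 p" by (rule p)
    show "connected X" by (rule path_connected_imp_connected[OF hyperbolic_structure_path_connected[OF hyp]])
    show "continuous_on (sphere 0 1 \<times> cball 0 1) f" by (rule continuous_on_subset[OF homeomorphism_cont1[OF fg] sub])
    show "inj_on f (sphere 0 1 \<times> cball 0 1)" by (rule inj_on_subset[OF finj sub])
    show "f (a, z) \<in> X \<longleftrightarrow> z \<noteq> 0" if az: "a \<in> sphere 0 1" "z \<in> cball 0 1" for a z
    proof -
      have az': "(a, z) \<in> sphere 0 1 \<times> ball 0 2" using az by auto
      have "f (a, z) \<in> K \<longleftrightarrow> z = 0"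
      proof
        assume "f (a, z) \<in> K"
        then obtain a' where a': "a' \<in> sphere 0 1" "f (a, z) = f (a', 0)" unfolding fK[symmetric] by auto
        have "(a, z) = (a', 0)" by (rule inj_onD[OF finj a'(2) az']) (use a' in auto)
        then show "z = 0" by simp
      next
        assume "z = 0" then show "f (a, z) \<in> K" unfolding fK[symmetric] using az(1) by blast
      qed
      then show ?thesis using fS az' unfolding X_def by blast
    qed
  qed
  define FT where "FT = h' \<circ> f1"
  define FB where "FB = h' \<circ> f2"
  have h'inj: "inj_on h' S3" by (rule inj_on_inverseI[of _ h]) (use homeomorphism_apply2[OF hh] in blast)
  have h'c: "continuous_on S3 h'" and h'S: "y \<in> S3 \<Longrightarrow> h' y \<in> S3" for y
    using homeomorphism_cont2[OF hh] homeomorphism_image2[OF hh] by blast+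
  have h'K: "h' y \<in> K \<longleftrightarrow> y \<in> h ` K" if "y \<in> S3" for y
    using that homeomorphism_apply1[OF hh] homeomorphism_apply2[OF hh] KS by (metis imageE image_eqI subsetD)
  have F: "continuous_on cylinder (h' \<circ> f')" "inj_on (h' \<circ> f') cylinder"
      "\<And>z s. (z, s) \<in> cylinder \<Longrightarrow> (h' \<circ> f') (z, s) \<in> X \<longleftrightarrow> z \<notin> P'"
    if H: "homeomorphism cylinder (S3 \<inter> C) f' g'" "f' ` (P' \<times> {0..1}) = h ` K \<inter> C" "P' \<subseteq> ball 0 1" for f' g' C P'
  proof -
    have im: "f' c \<in> S3" "f' c \<in> C" if "c \<in> cylinder" for c using homeomorphism_image1[OF H(1)] that by blast+
    show "continuous_on cylinder (h' \<circ> f')"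
      by (rule continuous_on_compose[OF homeomorphism_cont1[OF H(1)] continuous_on_subset[OF h'c]]) (use im in blast)
    have f'inj: "inj_on f' cylinder" by (rule inj_on_inverseI[of _ g']) (use homeomorphism_apply1[OF H(1)] in blast)
    show "inj_on (h' \<circ> f') cylinder"
      by (rule comp_inj_on[OF f'inj inj_on_subset[OF h'inj]]) (use im in blast)
    show "(h' \<circ> f') (z, s) \<in> X \<longleftrightarrow> z \<notin> P'" if zs: "(z, s) \<in> cylinder" for z s
    proof -
      have "h' (f' (z, s)) \<in> K \<longleftrightarrow> f' (z, s) \<in> f' ` (P' \<times> {0..1})"
        unfolding H(2) using h'K[OF im(1)[OF zs]] im(2)[OF zs] by blast
      also have "\<dots> \<longleftrightarrow> (z, s) \<in> P' \<times> {0..1}"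
        by (rule inj_on_image_mem_iff[OF f'inj zs]) (use H(3) in auto)
      finally show ?thesis using h'S[OF im(1)[OF zs]] zs by (auto simp: X_def)
    qed
  qed
  note FTf = F[OF fg1 fP P(1), folded FT_def] and FBf = F[OF fg2 fP2 P2(1), folded FB_def]
  have f1im: "f1 ` cylinder = S3 \<inter> {x. x $ 1 \<ge> 0}" and f2im: "f2 ` cylinder = S3 \<inter> {x. x $ 1 \<le> 0}"
    using homeomorphism_image1[OF fg1] homeomorphism_image1[OF fg2] .
  have FTim: "FT ` cylinder = h' ` (S3 \<inter> {x. x $ 1 \<ge> 0})" and FBim: "FB ` cylinder = h' ` (S3 \<inter> {x. x $ 1 \<le> 0})"
    unfolding FT_def FB_def image_comp[symmetric] f1im f2im by blast+
  interpret bridge X d p f FT FB q1 q2 P2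
  proof unfold_locales
    show "continuous_on cylinder FT" "inj_on FT cylinder" "continuous_on cylinder FB" "inj_on FB cylinder"
      by (rule FTf FBf)+
    show "FT (z, s) \<in> X \<longleftrightarrow> z \<noteq> q1 \<and> z \<noteq> q2" if "(z, s) \<in> cylinder" for z s using FTf(3)[OF that] q(1) by simp
    show "FB (z, s) \<in> X \<longleftrightarrow> z \<notin> P2" if "(z, s) \<in> cylinder" for z s by (rule FBf(3)[OF that])
    show "q1 \<noteq> q2" "q1 \<in> ball 0 1" "q2 \<in> ball 0 1" "finite P2" "P2 \<subseteq> ball 0 1" using q P P2 by auto
    show "X \<subseteq> FT ` cylinder \<union> FB ` cylinder"
    proof
      fix y assume "y \<in> X"
      then have y: "y \<in> S3" by (simp add: X_def)
      then have hy: "h y \<in> S3" "h' (h y) = y" using homeomorphism_image1[OF hh] homeomorphism_apply1[OF hh] by blast+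
      have "h y $ 1 \<ge> 0 \<or> h y $ 1 \<le> 0" by linarith
      then show "y \<in> FT ` cylinder \<union> FB ` cylinder" unfolding FTim FBim using hy by (metis (mono_tags, lifting) IntI UnI1 UnI2 image_eqI mem_Collect_eq)
    qed
    show "FB (z, s) \<in> FT ` cylinder \<longleftrightarrow> cmod z = 1 \<or> s = 0 \<or> s = 1" if zs: "(z, s) \<in> cylinder" for z s
    proof -
      have f2: "f2 (z, s) \<in> S3" "f2 (z, s) $ 1 \<le> 0" using f2im zs by blast+
      have "FB (z, s) \<in> FT ` cylinder \<longleftrightarrow> f2 (z, s) \<in> S3 \<inter> {x. x $ 1 \<ge> 0}"
        unfolding FTim FB_def comp_apply by (rule inj_on_image_mem_iff[OF h'inj f2(1)]) blast
      also have "\<dots> \<longleftrightarrow> f2 (z, s) $ 1 = 0" using f2 by auto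
      finally show ?thesis using lower_cylinder_boundary[OF fg2 zs] by simp
    qed
    show "\<exists>\<theta> \<epsilon>. cmod \<theta> = 1 \<and> \<epsilon> > 0 \<and> (\<forall>z. dist z r < \<epsilon> \<longrightarrow> z \<noteq> r \<longrightarrow>
        (\<exists>a w. cmod a = 1 \<and> Re (a / \<theta>) > 0 \<and> cmod w \<le> 1 \<and> FT (z, 1/2) = f (a, w)))" if r: "r \<in> {q1, q2}" for r
    proof -
      \<comment> \<open>The midpoint of the strand is a point of the knot and so of the core of the
        tube. A small disc around it at level \<open>1/2\<close> stays in the cell of the tube near
        the same longitudinal angle.\<close>
      have rb: "cmod r < 1" using r P(1) q(1) by auto
      have rc: "(r, 1/2) \<in> cylinder" using rb by simp
      have "FT (r, 1/2) \<notin> X" using FTf(3)[OF rc] r q(1) by blast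
      moreover have "FT (r, 1/2) \<in> S3" using rc f1im h'S unfolding FT_def comp_apply by blast
      ultimately have "FT (r, 1/2) \<in> f ` (unit_circle \<times> {0})" unfolding fK X_def by blast
      then obtain \<theta> where \<theta>: "cmod \<theta> = 1" "FT (r, 1/2) = f (\<theta>, 0)" by auto
      obtain W where W: "openin (top_of_set S3) W" "f (\<theta>, 0) \<in> W"
        "\<And>y. y \<in> W \<Longrightarrow> \<exists>a w. cmod a = 1 \<and> Re (a / \<theta>) > 0 \<and> cmod w \<le> 1 \<and> y = f (a, w)"
        using knot_tube_neighbourhood[OF homeomorphism_cont1[OF fg] finj fS \<theta>(1)] by metis
      obtain V where V: "open V" "W = S3 \<inter> V" using W(1) by (auto simp: openin_open)
      have "continuous_on (ball 0 1) (\<lambda>z. FT (z, 1/2))"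
        by (rule continuous_on_compose2[OF FTf(1)]) (auto intro!: continuous_intros)
      then have "open (ball 0 1 \<inter> (\<lambda>z. FT (z, 1/2)) -` V)" by (intro continuous_open_preimage V) auto
      moreover have "r \<in> ball 0 1 \<inter> (\<lambda>z. FT (z, 1/2)) -` V" using rb W(2) \<theta>(2) V(2) by simp
      ultimately obtain \<epsilon> where \<epsilon>: "\<epsilon> > 0" "ball r \<epsilon> \<subseteq> ball 0 1 \<inter> (\<lambda>z. FT (z, 1/2)) -` V"
        using open_contains_ball by blast
      have "FT (z, 1/2) \<in> W" if "dist z r < \<epsilon>" for z
      proof -
        have z: "z \<in> ball r \<epsilon>" using that by (simp add: dist_commute)
        then have "(z, 1/2) \<in> cylinder" using \<epsilon>(2) by fastforce
        then have "FT (z, 1/2) \<in> S3" using f1im h'S unfolding FT_def comp_apply by blast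
        then show ?thesis using z \<epsilon>(2) V(2) by blast
      qed
      then show ?thesis using \<theta>(1) \<epsilon>(1) W(3) by blast
    qed
  qed
  interpret bridge_knot_complement X d p f FT FB q1 q2 P2 \<mu>
    by unfold_locales (rule vol)+
  have "M = exterior" by (simp add: MX exterior_def)
  then show ?thesis using infinite_nielsen_classes_exterior assms(4) by simp
qed

end
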